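(* For every Stone system $(X,\varphi)$, the group $\mathsf{T}(\varphi)$ does not contain infinite subgroups with Kazhdan's property $(T)$. The same holds more generally for the larger group $\mathsf{PL}(\varphi)\ge\mathsf{T}(\varphi)$: it does not contain infinite subgroups with Kazhdan's property $(T)$.
   Context: Subgroups are considered as discrete groups. A countable group $G$ has Kazhdan's property $(T)$ if every action of $G$ on a Hilbert space by affine isometries has a fixed point (discrete groups with property $(T)$ are finitely generated, hence countable). A Stone system $(X,\varphi)$ is a non-empty totally disconnected compact Hausdorff space $X$ together with a self-homeomorphism $\varphi$ of $X$. Suspension: $Y^\varphi=(X\times\mathbb R)/\mathbb Z$, the quotient by the $\mathbb Z$-action $n\cdot(x,t)=(\varphi^n(x),t-n)$; $[x,t]$ is the class of $(x,t)$, and the suspension flow is $\Phi^t([x,s])=[x,s+t]$. $\mathsf{H}_0(\varphi)$ is the group of homeomorphisms of $Y^\varphi$ that are isotopic to the identity; equivalently (Boyle–Carlsen–Eilers), the homeomorphisms $g$ of $Y^\varphi$ for which there is a continuous $\tau\colon Y^\varphi\to\mathbb R$ with $g(y)=\Phi^{\tau(y)}(y)$ for all $y$. Charts: for a clopen $C\subset X$ put $\tau_C=\min\{n\ge1:\exists x\in C,\ \varphi^n(x)\in C\}\in\mathbb N\cup\{\infty\}$. For an open interval $J\subset\mathbb R$ of length $|J|<\tau_C$, the map $\pi_{C,J}\colon C\times J\to Y^\varphi$, $(x,t)\mapsto[x,t]$, is injective; it is called a chart and its image is denoted $U_{C\times J}$ (a domain). A dyadic rational is a number $p/2^q$ with $p,q\in\mathbb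 Z$; an interval is dyadic if it is bounded with dyadic rational endpoints; a chart $\pi_{C,J}$ is dyadic if $J$ is. A piecewise linear (PL) homeomorphism between intervals is a homeomorphism that is piecewise affine with finitely many breakpoints; it is dyadic if both intervals are dyadic, the breakpoints are dyadic rationals, and each affine piece has the form $x\mapsto2^mx+b$ with $m\in\mathbb Z$, $b$ a dyadic rational. $\mathsf{PL}(\varphi)$ (resp. $\mathsf{T}(\varphi)$) is the group of all $g\in\mathsf{H}_0(\varphi)$ such that for every $y\in Y^\varphi$ there are a dyadic chart $\pi_{C,J}$ with $y\in U_{C\times J}$ and a PL homeomorphism (resp. a dyadic PL homeomorphism) $f\colon J\to f(J)\subset\mathbb R$ such that $g(U_{C\times J})=U_{C\times f(J)}$ and $\pi_{C,f(J)}^{-1}\circ g\circ\pi_{C,J}$ is the map $(x,t)\mapsto(x,f(t))$. *)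

theory Defs
  imports "HOL-Analysis.Analysis" "HOL-Algebra.Module" "HOL-Algebra.Group_Action"
begin

section \<open>Hilbert spaces and property (T)\<close>

definition real_ring :: "real ring" where
  "real_ring = \<lparr>carrier = UNIV, monoid.mult = (*), one = 1, ring.zero = 0, add = (+)\<rparr>"

lemma cring_real_ring: "cring real_ring"
proof (intro cringI abelian_groupI comm_monoidI)
  show "\<exists>y\<in>carrier real_ring. y \<oplus>\<^bsub>real_ring\<^esub> x = \<zero>\<^bsub>real_ring\<^esub>" for x
    by (auto simp: real_ring_def intro: exI[of _ "- x"])
qed (auto simp: real_ring_def algebra_simps)

definition hnorm :: "('h \<Rightarrow> 'h \<Rightarrow> real) \<Rightarrow> 'h \<Rightarrow> real" where
  "hnorm ip v = sqrt (ip v v)"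

text \<open>Real Hilbert spaces on a carrier set, so that one can quantify over them inside a definition.
  The fields \<^term>\<open>monoid.mult M\<close> and \<^term>\<open>one M\<close> of the module record play no role.\<close>

locale real_hilbert_space = module real_ring M
  for M :: "(real, 'h) module" (structure) and ip :: "'h \<Rightarrow> 'h \<Rightarrow> real" +
  assumes ip_commute: "\<lbrakk>x \<in> carrier M; y \<in> carrier M\<rbrakk> \<Longrightarrow> ip x y = ip y x"
    and ip_add_left: "\<lbrakk>x \<in> carrier M; y \<in> carrier M; z \<in> carrier M\<rbrakk>
          \<Longrightarrow> ip (x \<oplus> y) z = ip x z + ip y z"
    and ip_smult_left: "\<lbrakk>x \<in> carrier M; y \<in> carrier M\<rbrakk> \<Longrightarrow> ip (r \<odot>\<^bsub>M\<^esub> x) y = r * ip x y"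
    and ip_pos: "\<lbrakk>x \<in> carrier M; x \<noteq> \<zero>\<rbrakk> \<Longrightarrow> ip x x > 0"
    and complete:
      "\<lbrakk>\<And>n. \<sigma> n \<in> carrier M;
        \<forall>e>0. \<exists>N. \<forall>m\<ge>N. \<forall>n\<ge>N. hnorm ip (\<sigma> m \<ominus> \<sigma> n) < e\<rbrakk>
          \<Longrightarrow> \<exists>x\<in>carrier M. (\<lambda>n. hnorm ip (\<sigma> n \<ominus> x)) \<longlonglongrightarrow> 0"

definition affine_isometric_action ::
    "('g, 'm) monoid_scheme \<Rightarrow> (real, 'h) module \<Rightarrow> ('h \<Rightarrow> 'h \<Rightarrow> real) \<Rightarrow> ('g \<Rightarrow> 'h \<Rightarrow> 'h) \<Rightarrow> bool" where
  "affine_isometric_action G M ip \<alpha> \<longleftrightarrow>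
     group_action G (carrier M) \<alpha> \<and>
     (\<forall>g\<in>carrier G. \<forall>x\<in>carrier M. \<forall>y\<in>carrier M.
        (\<forall>t. \<alpha> g (((1 - t) \<odot>\<^bsub>M\<^esub> x) \<oplus>\<^bsub>M\<^esub> (t \<odot>\<^bsub>M\<^esub> y)) =
             ((1 - t) \<odot>\<^bsub>M\<^esub> \<alpha> g x) \<oplus>\<^bsub>M\<^esub> (t \<odot>\<^bsub>M\<^esub> \<alpha> g y)) \<and>
        hnorm ip (\<alpha> g x \<ominus>\<^bsub>M\<^esub> \<alpha> g y) = hnorm ip (x \<ominus>\<^bsub>M\<^esub> y))"

text \<open>A definition cannot quantify over types, so the Hilbert spaces range over all those whose
  underlying set is a subset of \<^typ>\<open>nat \<Rightarrow> real\<close>. For countable groups nothing is lost: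
  property (T) in this sense yields fixed points for actions on Hilbert spaces over any type,
  see \<open>property_T_fixed_point\<close> below.\<close>

definition property_T :: "('g, 'm) monoid_scheme \<Rightarrow> bool" where
  "property_T G \<longleftrightarrow> group G \<and> countable (carrier G) \<and>
     (\<forall>(M :: (real, nat \<Rightarrow> real) module) ip \<alpha>.
        real_hilbert_space M ip \<longrightarrow> affine_isometric_action G M ip \<alpha> \<longrightarrow>
        (\<exists>x\<in>carrier M. \<forall>g\<in>carrier G. \<alpha> g x = x))"

context real_hilbert_space
begin

lemma smult_closed': "x \<in> carrier M \<Longrightarrow> r \<odot>\<^bsub>M\<^esub> x \<in> carrier M"
  using smult_closed by (simp add: real_ring_def)

lemma ip_add_right: "\<lbrakk>x \<in> carrier M; y \<in> carrier M; z \<in> carrier M\<rbrakk>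
    \<Longrightarrow> ip z (x \<oplus> y) = ip z x + ip z y"
  by (metis M.add.m_closed ip_add_left ip_commute)

lemma ip_smult_right: "\<lbrakk>x \<in> carrier M; y \<in> carrier M\<rbrakk> \<Longrightarrow> ip y (r \<odot>\<^bsub>M\<^esub> x) = r * ip y x"
  by (metis smult_closed' ip_smult_left ip_commute)

lemma ip_zero_left: "y \<in> carrier M \<Longrightarrow> ip \<zero> y = 0"
  using ip_add_left[of \<zero> \<zero> y] by simp

lemma ip_zero_right: "y \<in> carrier M \<Longrightarrow> ip y \<zero> = 0"
  using ip_add_right[of \<zero> \<zero> y] by simp

lemma ip_minus_left: "\<lbrakk>x \<in> carrier M; y \<in> carrier M; z \<in> carrier M\<rbrakk>
    \<Longrightarrow> ip (x \<ominus> y) z = ip x z - ip y z"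
proof -
  assume a: "x \<in> carrier M" "y \<in> carrier M" "z \<in> carrier M"
  have "ip ((x \<ominus> y) \<oplus> y) z = ip (x \<ominus> y) z + ip y z"
    using a by (intro ip_add_left) auto
  moreover have "(x \<ominus> y) \<oplus> y = x"
    using a by (simp add: M.minus_eq M.add.m_assoc M.l_neg)
  ultimately show ?thesis by simp
qed

lemma ip_minus_right: "\<lbrakk>x \<in> carrier M; y \<in> carrier M; z \<in> carrier M\<rbrakk>
    \<Longrightarrow> ip z (x \<ominus> y) = ip z x - ip z y"
  by (metis M.minus_closed ip_minus_left ip_commute)

lemma ip_nonneg: "x \<in> carrier M \<Longrightarrow> ip x x \<ge> 0"
  by (metis ip_pos ip_zero_left order.refl less_imp_le M.zero_closed)

lemma minus_eq_zero: "\<lbrakk>x \<in> carrier M; y \<in> carrier M; x \<ominus> y = \<zero>\<rbrakk> \<Longrightarrow> x = y"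
  by (metis M.a_comm M.add.inv_closed M.add.inv_inv M.minus_eq M.minus_equality)

lemma cauchy_schwarz: "\<lbrakk>x \<in> carrier M; y \<in> carrier M\<rbrakk> \<Longrightarrow> \<bar>ip x y\<bar> \<le> hnorm ip x * hnorm ip y"
proof -
  assume a: "x \<in> carrier M" "y \<in> carrier M"
  have "(ip x y)\<^sup>2 \<le> ip x x * ip y y"
  proof (cases "y = \<zero>")
    case True
    then show ?thesis using a by (simp add: ip_zero_right)
  next
    case False
    define r where "r = ip x y / ip y y"
    have p: "ip y y > 0" using a False ip_pos by blast
    let ?v = "x \<ominus> (r \<odot>\<^bsub>M\<^esub> y)"
    have "0 \<le> ip ?v ?v" using a by (intro ip_nonneg) (auto simp: smult_closed')
    also have "ip ?v ?v = ip x x - r * ip x y - r * (ip x y - r * ip y y)"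
      using a by (simp add: ip_minus_left ip_minus_right ip_smult_left ip_smult_right
          smult_closed' ip_commute[of y x] algebra_simps)
    also have "\<dots> = ip x x - (ip x y)\<^sup>2 / ip y y"
      using p by (simp add: r_def power2_eq_square)
    finally show ?thesis using p by (simp add: field_simps)
  qed
  then have "sqrt ((ip x y)\<^sup>2) \<le> sqrt (ip x x * ip y y)" by (rule real_sqrt_le_mono)
  then show ?thesis by (simp add: hnorm_def real_sqrt_mult)
qed

lemma isometry_polar:
  assumes iso: "\<And>x y. x \<in> carrier M \<Longrightarrow> y \<in> carrier M \<Longrightarrow> hnorm ip (f x \<ominus> f y) = hnorm ip (x \<ominus> y)"
    and cl: "\<And>x. x \<in> carrier M \<Longrightarrow> f x \<in> carrier M"
    and xz: "x \<in> carrier M" "z \<in> carrier M"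
  shows "ip (f x \<ominus> f \<zero>) (f z \<ominus> f \<zero>) = ip x z"
proof -
  have eq: "ip (f u \<ominus> f v) (f u \<ominus> f v) = ip (u \<ominus> v) (u \<ominus> v)"
    if "u \<in> carrier M" "v \<in> carrier M" for u v
    using iso[OF that] by (simp add: hnorm_def)
  show ?thesis
    using eq[of x z] eq[of x \<zero>] eq[of z \<zero>] xz
    by (simp add: cl ip_minus_left ip_minus_right ip_zero_left ip_zero_right
        ip_commute[of z x] ip_commute[of "f z" "f x"] ip_commute[of "f \<zero>" "f x"]
        ip_commute[of "f \<zero>" "f z"])
qed

end

lemma property_T_fixed_point:
  fixes M :: "(real, 'h) module"
  assumes T: "property_T G" and H: "real_hilbert_space M ip"
    and act: "affine_isometric_action G M ip \<alpha>"
  shows "\<exists>x\<in>carrier M. \<forall>g\<in>carrier G. \<alpha> g x = x"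
proof -
  interpret real_hilbert_space M ip by (rule H)
  interpret A: group_action G "carrier M" \<alpha>
    using act by (simp add: affine_isometric_action_def)
  interpret G: group G using T by (simp add: property_T_def)
  have iso: "hnorm ip (\<alpha> g x \<ominus>\<^bsub>M\<^esub> \<alpha> g y) = hnorm ip (x \<ominus>\<^bsub>M\<^esub> y)"
    if "g \<in> carrier G" "x \<in> carrier M" "y \<in> carrier M" for g x y
    using act that by (simp add: affine_isometric_action_def)
  have aff: "\<alpha> g (((1 - t) \<odot>\<^bsub>M\<^esub> x) \<oplus>\<^bsub>M\<^esub> (t \<odot>\<^bsub>M\<^esub> y)) =
             ((1 - t) \<odot>\<^bsub>M\<^esub> \<alpha> g x) \<oplus>\<^bsub>M\<^esub> (t \<odot>\<^bsub>M\<^esub> \<alpha> g y)"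
    if "g \<in> carrier G" "x \<in> carrier M" "y \<in> carrier M" for g x y t
    using act that by (simp add: affine_isometric_action_def)
  have cl: "\<alpha> g x \<in> carrier M" if "g \<in> carrier G" "x \<in> carrier M" for g x
    using that A.element_image by blast
  have comp: "\<alpha> (g \<otimes>\<^bsub>G\<^esub> h) x = \<alpha> g (\<alpha> h x)"
    if "g \<in> carrier G" "h \<in> carrier G" "x \<in> carrier M" for g h x
    using that A.composition_rule by blast
  have unit: "\<alpha> \<one>\<^bsub>G\<^esub> x = x" if "x \<in> carrier M" for x
    using that A.id_eq_one by (metis restrict_apply')

  define D where "D = (\<lambda>g. \<alpha> g \<zero>\<^bsub>M\<^esub>) ` carrier G"
  define d where "d = from_nat_into D"
  have Dne: "D \<noteq> {}" unfolding D_def using G.one_closed by blast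
  have "countable D" unfolding D_def using T by (simp add: property_T_def)
  then have rd: "range d = D" unfolding d_def using Dne by simp
  have dM: "d n \<in> carrier M" for n
  proof -
    have "d n \<in> D" using rd by blast
    then show ?thesis unfolding D_def using cl by auto
  qed
  define N where "N = {z \<in> carrier M. \<forall>n. ip z (d n) = 0}"
  define K where "K = {x \<in> carrier M. \<forall>z\<in>N. ip z x = 0}"
  have NM: "N \<subseteq> carrier M" and KM: "K \<subseteq> carrier M" unfolding N_def K_def by auto
  have K0: "\<zero>\<^bsub>M\<^esub> \<in> K" unfolding K_def using NM ip_zero_right by auto
  have Kadd: "x \<oplus>\<^bsub>M\<^esub> y \<in> K" if "x \<in> K" "y \<in> K" for x y
    using that NM unfolding K_def by (auto simp: ip_add_right subset_iff)
  have Ksm: "r \<odot>\<^bsub>M\<^esub> x \<in> K" if "x \<in> K" for x r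
    using that NM unfolding K_def by (auto simp: ip_smult_right smult_closed' subset_iff)
  have Kmin: "x \<ominus>\<^bsub>M\<^esub> y \<in> K" if "x \<in> K" "y \<in> K" for x y
    using that NM unfolding K_def by (auto simp: ip_minus_right subset_iff)
  have Kinv: "\<alpha> g x \<in> K" if g: "g \<in> carrier G" and x: "x \<in> K" for g x
  proof -
    have xM: "x \<in> carrier M" using x KM by auto
    have "ip z (\<alpha> g x) = 0" if z: "z \<in> N" for z
    proof -
      have zM: "z \<in> carrier M" using z NM by auto
      define b where "b = \<alpha> g \<zero>\<^bsub>M\<^esub>"
      have bM: "b \<in> carrier M" unfolding b_def using cl g by auto
      have orb: "ip z (\<alpha> h \<zero>\<^bsub>M\<^esub>) = 0" if "h \<in> carrier G" for h
      proof -
        have "\<alpha> h \<zero>\<^bsub>M\<^esub> \<in> range d" using that rd D_def by auto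
        then show ?thesis using z unfolding N_def by auto
      qed
      have zb: "ip z b = 0" unfolding b_def using orb g by simp
      obtain w where w: "w \<in> carrier M" "\<alpha> g w = z \<oplus>\<^bsub>M\<^esub> b"
      proof
        show "\<alpha> (inv\<^bsub>G\<^esub> g) (z \<oplus>\<^bsub>M\<^esub> b) \<in> carrier M" using cl g zM bM by auto
        show "\<alpha> g (\<alpha> (inv\<^bsub>G\<^esub> g) (z \<oplus>\<^bsub>M\<^esub> b)) = z \<oplus>\<^bsub>M\<^esub> b"
          using g zM bM by (simp flip: comp add: unit)
      qed
      have "\<alpha> g w \<ominus>\<^bsub>M\<^esub> b = z"
        using w zM bM by (simp add: M.minus_eq M.add.m_assoc M.r_neg)
      then have key: "ip u w = ip (\<alpha> g u) z" if "u \<in> carrier M" for u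
        using isometry_polar[of "\<alpha> g", OF iso[OF g] cl[OF g], of u w] that w zM bM g zb
        by (simp add: b_def[symmetric] ip_minus_left cl ip_commute[of b z])
      have "w \<in> N" unfolding N_def
      proof (intro CollectI conjI allI w)
        fix n
        obtain h where h: "h \<in> carrier G" "d n = \<alpha> h \<zero>\<^bsub>M\<^esub>" using rd D_def by (auto simp: image_iff)
        have "ip (d n) w = ip (\<alpha> g (d n)) z" using key dM by simp
        also have "\<alpha> g (d n) = \<alpha> (g \<otimes>\<^bsub>G\<^esub> h) \<zero>\<^bsub>M\<^esub>" using comp g h by simp
        also have "ip \<dots> z = 0" using orb[of "g \<otimes>\<^bsub>G\<^esub> h"] g h zM cl ip_commute by simp
        finally show "ip w (d n) = 0" using ip_commute dM w by simp
      qed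
      then have "ip w x = 0" using x unfolding K_def by blast
      then show ?thesis using key[OF xM] ip_commute xM w zM cl[OF g xM] by simp
    qed
    then show ?thesis unfolding K_def using cl g xM by simp
  qed

  define F where "F = (\<lambda>x n. ip x (d n))"
  have Fadd: "F (x \<oplus>\<^bsub>M\<^esub> y) = (\<lambda>n. F x n + F y n)" if "x \<in> K" "y \<in> K" for x y
    using that KM dM by (auto simp: F_def ip_add_left subset_iff)
  have Fsm: "F (r \<odot>\<^bsub>M\<^esub> x) = (\<lambda>n. r * F x n)" if "x \<in> K" for x r
    using that KM dM by (auto simp: F_def ip_smult_left subset_iff)
  have F0: "F \<zero>\<^bsub>M\<^esub> = (\<lambda>n. 0)" using dM by (simp add: F_def ip_zero_left)
  have Fmin: "F (x \<ominus>\<^bsub>M\<^esub> y) = (\<lambda>n. F x n - F y n)" if "x \<in> K" "y \<in> K" for x y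
    using that KM dM by (auto simp: F_def ip_minus_left subset_iff)
  have inj: "inj_on F K"
  proof (rule inj_onI)
    fix x y assume xy: "x \<in> K" "y \<in> K" "F x = F y"
    let ?z = "x \<ominus>\<^bsub>M\<^esub> y"
    have xyM: "x \<in> carrier M" "y \<in> carrier M" using xy KM by auto
    have "?z \<in> N" unfolding N_def using xyM fun_cong[OF xy(3)] dM
      by (simp add: F_def ip_minus_left)
    moreover have "?z \<in> K" using Kmin xy by simp
    ultimately have "ip ?z ?z = 0" unfolding K_def by blast
    then have "?z = \<zero>\<^bsub>M\<^esub>" using ip_pos[of ?z] xyM by force
    then show "x = y" using minus_eq_zero xyM by blast
  qed
  define E where "E = inv_into K F"
  have EF: "E (F x) = x" if "x \<in> K" for x using that inj by (simp add: E_def)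
  have EK: "E a \<in> K" if "a \<in> F ` K" for a using that by (simp add: E_def inv_into_into)
  have FE: "F (E a) = a" if "a \<in> F ` K" for a using that by (simp add: E_def f_inv_into_f)
  define M' :: "(real, nat \<Rightarrow> real) module" where
    "M' = \<lparr>carrier = F ` K, monoid.mult = (\<lambda>a b. a), one = (\<lambda>n. 0), ring.zero = (\<lambda>n. 0),
           add = (\<lambda>a b n. a n + b n), smult = (\<lambda>r a n. r * a n)\<rparr>"
  have cM': "carrier M' = F ` K" by (simp add: M'_def)
  define ip' where "ip' = (\<lambda>a b. ip (E a) (E b))"
  have addF: "F x \<oplus>\<^bsub>M'\<^esub> F y = F (x \<oplus>\<^bsub>M\<^esub> y)" if "x \<in> K" "y \<in> K" for x y
    using that by (simp add: M'_def Fadd)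
  have smF: "r \<odot>\<^bsub>M'\<^esub> F x = F (r \<odot>\<^bsub>M\<^esub> x)" if "x \<in> K" for x r
    using that by (simp add: M'_def Fsm)
  have ag: "abelian_group M'"
  proof (rule abelian_groupI)
    show "\<exists>y\<in>carrier M'. y \<oplus>\<^bsub>M'\<^esub> x = \<zero>\<^bsub>M'\<^esub>" if "x \<in> carrier M'" for x
    proof -
      obtain u where u: "u \<in> K" "x = F u" using \<open>x \<in> carrier M'\<close> cM' by auto
      have "F (\<zero>\<^bsub>M\<^esub> \<ominus>\<^bsub>M\<^esub> u) \<in> carrier M'" using u K0 Kmin cM' by simp
      moreover have "F (\<zero>\<^bsub>M\<^esub> \<ominus>\<^bsub>M\<^esub> u) \<oplus>\<^bsub>M'\<^esub> x = \<zero>\<^bsub>M'\<^esub>"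
        using u K0 by (simp add: Fmin M'_def F0)
      ultimately show ?thesis by blast
    qed
    show "x \<oplus>\<^bsub>M'\<^esub> y \<in> carrier M'" if "x \<in> carrier M'" "y \<in> carrier M'" for x y
      using that Kadd by (auto simp: cM' addF)
    show "\<zero>\<^bsub>M'\<^esub> \<in> carrier M'" using K0 F0 by (simp add: M'_def image_iff) metis
  qed (auto simp: M'_def algebra_simps)
  have mod: "module real_ring M'"
  proof (rule moduleI[OF cring_real_ring ag])
    show "a \<odot>\<^bsub>M'\<^esub> x \<in> carrier M'" if "x \<in> carrier M'" for a x
      using that Ksm by (auto simp: cM' smF)
  qed (auto simp: M'_def real_ring_def algebra_simps)
  interpret M': abelian_group M' by (rule ag)
  have minF: "F x \<ominus>\<^bsub>M'\<^esub> F y = F (x \<ominus>\<^bsub>M\<^esub> y)" if xy: "x \<in> K" "y \<in> K" for x y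
  proof -
    have c: "F x \<in> carrier M'" "F y \<in> carrier M'" "F (x \<ominus>\<^bsub>M\<^esub> y) \<in> carrier M'"
      using xy Kmin cM' by auto
    have "F (x \<ominus>\<^bsub>M\<^esub> y) \<oplus>\<^bsub>M'\<^esub> F y = F x"
      using xy by (simp add: Fmin M'_def)
    then have "F x \<ominus>\<^bsub>M'\<^esub> F y = (F (x \<ominus>\<^bsub>M\<^esub> y) \<oplus>\<^bsub>M'\<^esub> F y) \<ominus>\<^bsub>M'\<^esub> F y" by simp
    also have "\<dots> = F (x \<ominus>\<^bsub>M\<^esub> y)"
      using c by (simp add: M'.minus_eq M'.a_assoc M'.r_neg)
    finally show ?thesis .
  qed
  have hnF: "hnorm ip' (F x) = hnorm ip x" if "x \<in> K" for x
    using that by (simp add: hnorm_def ip'_def EF)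
  have H': "real_hilbert_space M' ip'"
  proof (rule real_hilbert_space.intro[OF mod], unfold_locales)
    show "ip' x y = ip' y x" if "x \<in> carrier M'" "y \<in> carrier M'" for x y
      using that KM by (auto simp: cM' ip'_def EF intro!: ip_commute)
    show "ip' (x \<oplus>\<^bsub>M'\<^esub> y) z = ip' x z + ip' y z"
      if "x \<in> carrier M'" "y \<in> carrier M'" "z \<in> carrier M'" for x y z
      using that KM Kadd by (auto simp: cM' ip'_def addF EF intro!: ip_add_left)
    show "ip' (r \<odot>\<^bsub>M'\<^esub> x) y = r * ip' x y" if "x \<in> carrier M'" "y \<in> carrier M'" for x y r
      using that KM Ksm by (auto simp: cM' ip'_def smF EF intro!: ip_smult_left)
    show "ip' x x > 0" if x: "x \<in> carrier M'" "x \<noteq> \<zero>\<^bsub>M'\<^esub>" for x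
    proof -
      obtain u where u: "u \<in> K" "x = F u" using x cM' by auto
      have "u \<noteq> \<zero>\<^bsub>M\<^esub>" using x u F0 by (auto simp: M'_def)
      then show ?thesis using u KM by (auto simp: ip'_def EF intro!: ip_pos)
    qed
    fix \<sigma> :: "nat \<Rightarrow> nat \<Rightarrow> real"
    assume s: "\<And>n. \<sigma> n \<in> carrier M'"
      and c: "\<forall>e>0. \<exists>N. \<forall>m\<ge>N. \<forall>n\<ge>N. hnorm ip' (\<sigma> m \<ominus>\<^bsub>M'\<^esub> \<sigma> n) < e"
    define \<rho> where "\<rho> n = E (\<sigma> n)" for n
    have rK: "\<rho> n \<in> K" and sr: "\<sigma> n = F (\<rho> n)" for n
      using s[of n] EK FE by (auto simp: \<rho>_def cM')
    have rM: "\<rho> n \<in> carrier M" for n using rK KM by auto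
    have "\<forall>e>0. \<exists>N. \<forall>m\<ge>N. \<forall>n\<ge>N. hnorm ip (\<rho> m \<ominus>\<^bsub>M\<^esub> \<rho> n) < e"
      using c by (simp add: sr minF rK hnF Kmin)
    then obtain x where x: "x \<in> carrier M" "(\<lambda>n. hnorm ip (\<rho> n \<ominus>\<^bsub>M\<^esub> x)) \<longlonglongrightarrow> 0"
      using complete[of \<rho>] rM by blast
    have "ip z x = 0" if z: "z \<in> N" for z
    proof -
      have zM: "z \<in> carrier M" using z NM by auto
      have "\<bar>ip z x\<bar> \<le> hnorm ip z * hnorm ip (\<rho> n \<ominus>\<^bsub>M\<^esub> x)" for n
      proof -
        have "ip z (\<rho> n) = 0" using rK[of n] z unfolding K_def by blast
        then have "\<bar>ip z x\<bar> = \<bar>ip z (\<rho> n \<ominus>\<^bsub>M\<^esub> x)\<bar>"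
          using zM rM x by (simp add: ip_minus_right)
        then show ?thesis using cauchy_schwarz[of z "\<rho> n \<ominus>\<^bsub>M\<^esub> x"] zM rM x by simp
      qed
      moreover have "(\<lambda>n. hnorm ip z * hnorm ip (\<rho> n \<ominus>\<^bsub>M\<^esub> x)) \<longlonglongrightarrow> hnorm ip z * 0"
        by (intro tendsto_mult tendsto_const x)
      ultimately have "\<bar>ip z x\<bar> \<le> hnorm ip z * 0"
        by (meson LIMSEQ_le_const)
      then show ?thesis by simp
    qed
    then have xK: "x \<in> K" unfolding K_def using x by simp
    have "(\<lambda>n. hnorm ip' (\<sigma> n \<ominus>\<^bsub>M'\<^esub> F x)) \<longlonglongrightarrow> 0"
      using x(2) xK by (simp add: sr minF rK hnF Kmin)
    then show "\<exists>x\<in>carrier M'. (\<lambda>n. hnorm ip' (\<sigma> n \<ominus>\<^bsub>M'\<^esub> x)) \<longlonglongrightarrow> 0"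
      using xK cM' by blast
  qed
  define \<alpha>' where "\<alpha>' g = (\<lambda>a\<in>F ` K. F (\<alpha> g (E a)))" for g
  have aF: "\<alpha>' g (F x) = F (\<alpha> g x)" if "x \<in> K" for g x
    using that by (simp add: \<alpha>'_def EF)
  have bij: "\<alpha>' g \<in> Bij (F ` K)" if g: "g \<in> carrier G" for g
  proof -
    have "bij_betw (\<alpha>' g) (F ` K) (F ` K)"
    proof (rule bij_betw_byWitness[where f' = "\<alpha>' (inv\<^bsub>G\<^esub> g)"])
      show "\<forall>a\<in>F ` K. \<alpha>' (inv\<^bsub>G\<^esub> g) (\<alpha>' g a) = a"
      proof
        fix a assume "a \<in> F ` K"
        then obtain x where x: "x \<in> K" "a = F x" by auto
        then have "x \<in> carrier M" using KM by auto
        then show "\<alpha>' (inv\<^bsub>G\<^esub> g) (\<alpha>' g a) = a"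
          using x g by (simp add: aF Kinv flip: comp add: unit)
      qed
      show "\<forall>a\<in>F ` K. \<alpha>' g (\<alpha>' (inv\<^bsub>G\<^esub> g) a) = a"
      proof
        fix a assume "a \<in> F ` K"
        then obtain x where x: "x \<in> K" "a = F x" by auto
        then have "x \<in> carrier M" using KM by auto
        then show "\<alpha>' g (\<alpha>' (inv\<^bsub>G\<^esub> g) a) = a"
          using x g by (simp add: aF Kinv flip: comp add: unit)
      qed
    qed (use g Kinv in \<open>auto simp: aF\<close>)
    then show ?thesis by (simp add: Bij_def \<alpha>'_def)
  qed
  have "group_hom G (BijGroup (F ` K)) \<alpha>'"
  proof (rule group_hom.intro[OF G.group_axioms group_BijGroup], unfold_locales)
    show "\<alpha>' \<in> hom G (BijGroup (F ` K))"
    proof (rule homI)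
      show "\<alpha>' g \<in> carrier (BijGroup (F ` K))" if "g \<in> carrier G" for g
        using bij that by (simp add: BijGroup_def)
      show "\<alpha>' (g \<otimes>\<^bsub>G\<^esub> h) = \<alpha>' g \<otimes>\<^bsub>BijGroup (F ` K)\<^esub> \<alpha>' h"
        if gh: "g \<in> carrier G" "h \<in> carrier G" for g h
      proof -
        have "\<alpha>' (g \<otimes>\<^bsub>G\<^esub> h) = compose (F ` K) (\<alpha>' g) (\<alpha>' h)"
        proof (rule extensionalityI[of _ "F ` K"])
          fix a assume "a \<in> F ` K"
          then obtain x where x: "x \<in> K" "a = F x" by auto
          then have "x \<in> carrier M" using KM by auto
          then show "\<alpha>' (g \<otimes>\<^bsub>G\<^esub> h) a = compose (F ` K) (\<alpha>' g) (\<alpha>' h) a"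
            using x gh by (simp add: aF Kinv compose_def comp)
        qed (auto simp: \<alpha>'_def compose_def)
        then show ?thesis using bij gh by (simp add: BijGroup_def)
      qed
    qed
  qed
  then have ga: "group_action G (carrier M') \<alpha>'" by (simp add: group_action_def cM')
  have "affine_isometric_action G M' ip' \<alpha>'"
    unfolding affine_isometric_action_def
  proof (intro conjI ballI allI ga)
    fix g a b t
    assume g: "g \<in> carrier G" and ab: "a \<in> carrier M'" "b \<in> carrier M'"
    obtain x y where xy: "x \<in> K" "a = F x" "y \<in> K" "b = F y" using ab cM' by auto
    have xyM: "x \<in> carrier M" "y \<in> carrier M" using xy KM by auto
    show "\<alpha>' g (((1 - t) \<odot>\<^bsub>M'\<^esub> a) \<oplus>\<^bsub>M'\<^esub> (t \<odot>\<^bsub>M'\<^esub> b)) =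
          ((1 - t) \<odot>\<^bsub>M'\<^esub> \<alpha>' g a) \<oplus>\<^bsub>M'\<^esub> (t \<odot>\<^bsub>M'\<^esub> \<alpha>' g b)"
      using xy g xyM by (simp add: smF addF aF Ksm Kadd Kinv aff)
    show "hnorm ip' (\<alpha>' g a \<ominus>\<^bsub>M'\<^esub> \<alpha>' g b) = hnorm ip' (a \<ominus>\<^bsub>M'\<^esub> b)"
    proof -
      have "\<alpha>' g a \<ominus>\<^bsub>M'\<^esub> \<alpha>' g b = F (\<alpha> g x \<ominus>\<^bsub>M\<^esub> \<alpha> g y)"
        unfolding xy(2,4) aF[OF xy(1)] aF[OF xy(3)]
        by (rule minF[OF Kinv[OF g xy(1)] Kinv[OF g xy(3)]])
      then have "hnorm ip' (\<alpha>' g a \<ominus>\<^bsub>M'\<^esub> \<alpha>' g b) = hnorm ip (\<alpha> g x \<ominus>\<^bsub>M\<^esub> \<alpha> g y)"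
        by (simp only: hnF[OF Kmin[OF Kinv[OF g xy(1)] Kinv[OF g xy(3)]]])
      also have "\<dots> = hnorm ip (x \<ominus>\<^bsub>M\<^esub> y)" by (rule iso[OF g xyM])
      also have "\<dots> = hnorm ip' (F (x \<ominus>\<^bsub>M\<^esub> y))"
        by (rule hnF[OF Kmin[OF xy(1,3)], symmetric])
      also have "F (x \<ominus>\<^bsub>M\<^esub> y) = a \<ominus>\<^bsub>M'\<^esub> b"
        unfolding xy(2,4) by (rule minF[OF xy(1,3), symmetric])
      finally show ?thesis .
    qed
  qed
  then have "\<exists>a\<in>carrier M'. \<forall>g\<in>carrier G. \<alpha>' g a = a"
    using T H' unfolding property_T_def by (elim conjE allE impE) assumption+
  then obtain a where a: "a \<in> carrier M'" "\<forall>g\<in>carrier G. \<alpha>' g a = a" by blast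
  obtain x where x: "x \<in> K" "a = F x" using a cM' by auto
  have "\<alpha> g x = x" if "g \<in> carrier G" for g
  proof -
    have "F (\<alpha> g x) = F x" using a(2) that aF[OF x(1)] x(2) by metis
    then show ?thesis by (rule inj_onD[OF inj _ Kinv[OF that x(1)] x(1)])
  qed
  then show ?thesis using x KM by blast
qed


section \<open>Stone systems and their suspensions\<close>

definition stone_system :: "'a topology \<Rightarrow> ('a \<Rightarrow> 'a) \<Rightarrow> bool" where
  "stone_system X \<phi> \<longleftrightarrow>
     topspace X \<noteq> {} \<and> compact_space X \<and> Hausdorff_space X \<and>
     (\<forall>S. connectedin X S \<longrightarrow> (\<exists>a. S \<subseteq> {a})) \<and>
     homeomorphic_map X X \<phi>"

definition int_iterate :: "'a topology \<Rightarrow> ('a \<Rightarrow> 'a) \<Rightarrow> int \<Rightarrow> 'a \<Rightarrow> 'a" where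
  "int_iterate X \<phi> n =
     (if n \<ge> 0 then \<phi> ^^ nat n else inv_into (topspace X) \<phi> ^^ nat (- n))"

text \<open>The orbit of \<open>(x, t)\<close> under the action of the integers by \<open>n (x, t) = (\<phi>\<^sup>n x, t - n)\<close>.\<close>

definition susp_class :: "'a topology \<Rightarrow> ('a \<Rightarrow> 'a) \<Rightarrow> 'a \<times> real \<Rightarrow> ('a \<times> real) set" where
  "susp_class X \<phi> = (\<lambda>(x, t). range (\<lambda>n. (int_iterate X \<phi> n x, t - of_int n)))"

definition suspension :: "'a topology \<Rightarrow> ('a \<Rightarrow> 'a) \<Rightarrow> ('a \<times> real) set topology" where
  "suspension X \<phi> = topology (\<lambda>U. U \<subseteq> susp_class X \<phi> ` (topspace X \<times> UNIV) \<and>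
     openin (prod_topology X euclideanreal)
       {p \<in> topspace X \<times> UNIV. susp_class X \<phi> p \<in> U})"

lemma openin_suspension:
  "openin (suspension X \<phi>) U \<longleftrightarrow> U \<subseteq> susp_class X \<phi> ` (topspace X \<times> UNIV) \<and>
     openin (prod_topology X euclideanreal) {p \<in> topspace X \<times> UNIV. susp_class X \<phi> p \<in> U}"
proof -
  let ?P = "prod_topology X euclideanreal" and ?c = "susp_class X \<phi>"
  have "istopology (\<lambda>U. U \<subseteq> ?c ` (topspace X \<times> UNIV) \<and>
     openin ?P {p \<in> topspace X \<times> UNIV. ?c p \<in> U})"
  proof (unfold istopology_def, intro conjI allI impI; (elim conjE)?)
    fix S T
    assume "openin ?P {p \<in> topspace X \<times> UNIV. ?c p \<in> S}"
      "openin ?P {p \<in> topspace X \<times> UNIV. ?c p \<in> T}"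
    from openin_Int[OF this]
    show "openin ?P {p \<in> topspace X \<times> UNIV. ?c p \<in> S \<inter> T}"
      by (rule back_subst) auto
  next
    fix \<K>
    assume "\<forall>K\<in>\<K>. K \<subseteq> ?c ` (topspace X \<times> UNIV) \<and>
      openin ?P {p \<in> topspace X \<times> UNIV. ?c p \<in> K}"
    then have "openin ?P (\<Union>K\<in>\<K>. {p \<in> topspace X \<times> UNIV. ?c p \<in> K})" by blast
    then show "openin ?P {p \<in> topspace X \<times> UNIV. ?c p \<in> \<Union>\<K>}"
      by (rule back_subst) auto
  qed blast+
  then show ?thesis by (simp add: suspension_def)
qed

lemma topspace_suspension: "topspace (suspension X \<phi>) = susp_class X \<phi> ` (topspace X \<times> UNIV)"
    (is "_ = ?Y")
proof
  have eq: "{p \<in> topspace X \<times> UNIV. susp_class X \<phi> p \<in> ?Y} = topspace (prod_topology X euclideanreal)"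
    by auto
  have "openin (suspension X \<phi>) ?Y"
    unfolding openin_suspension eq by (intro conjI subset_refl openin_topspace)
  then show "?Y \<subseteq> topspace (suspension X \<phi>)" by (rule openin_subset)
  have "openin (suspension X \<phi>) (topspace (suspension X \<phi>))" by (rule openin_topspace)
  then show "topspace (suspension X \<phi>) \<subseteq> ?Y" unfolding openin_suspension by (rule conjunct1)
qed

lemma quotient_map_suspension:
  "quotient_map (prod_topology X euclideanreal) (suspension X \<phi>) (susp_class X \<phi>)"
  by (auto simp: quotient_map_def topspace_suspension openin_suspension)


section \<open>Homeomorphisms isotopic to the identity\<close>

text \<open>An isotopy is a homotopy through homeomorphisms. Elements are extensional functions, as in
  \<^const>\<open>BijGroup\<close>, so that maps agreeing on the suspension are equal.\<close>

definition H0 :: "'a topology \<Rightarrow> ('a \<Rightarrow> 'a) \<Rightarrow> (('a \<times> real) set \<Rightarrow> ('a \<times> real) set) set" where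
  "H0 X \<phi> = {g \<in> Bij (topspace (suspension X \<phi>)).
     homotopic_with (homeomorphic_map (suspension X \<phi>) (suspension X \<phi>))
       (suspension X \<phi>) (suspension X \<phi>) id g}"


section \<open>Charts and piecewise linear homeomorphisms\<close>

definition clopenin :: "'a topology \<Rightarrow> 'a set \<Rightarrow> bool" where
  "clopenin X C \<longleftrightarrow> openin X C \<and> closedin X C"

definition return_time :: "('a \<Rightarrow> 'a) \<Rightarrow> 'a set \<Rightarrow> enat" where
  "return_time \<phi> C = (INF n \<in> {n. n \<ge> 1 \<and> (\<exists>x\<in>C. (\<phi> ^^ n) x \<in> C)}. enat n)"

text \<open>The length of the interval is strictly smaller than the return time, so the interval is
  bounded even if the return time is infinite.\<close>

definition is_chart :: "'a topology \<Rightarrow> ('a \<Rightarrow> 'a) \<Rightarrow> 'a set \<Rightarrow> real set \<Rightarrow> bool" where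
  "is_chart X \<phi> C J \<longleftrightarrow> clopenin X C \<and>
     (\<exists>a b. a < b \<and> J = {a<..<b} \<and> ereal (b - a) < ereal_of_enat (return_time \<phi> C))"

definition chart :: "'a topology \<Rightarrow> ('a \<Rightarrow> 'a) \<Rightarrow> 'a set \<Rightarrow> real set \<Rightarrow> 'a \<times> real \<Rightarrow> ('a \<times> real) set" where
  "chart X \<phi> C J = restrict (susp_class X \<phi>) (C \<times> J)"

definition chart_domain :: "'a topology \<Rightarrow> ('a \<Rightarrow> 'a) \<Rightarrow> 'a set \<Rightarrow> real set \<Rightarrow> ('a \<times> real) set set" where
  "chart_domain X \<phi> C J = chart X \<phi> C J ` (C \<times> J)"

definition dyadic_rationals :: "real set" where
  "dyadic_rationals = {of_int p * 2 powi q | p q. True}"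

definition dyadic_interval :: "real set \<Rightarrow> bool" where
  "dyadic_interval J \<longleftrightarrow>
     (\<exists>a\<in>dyadic_rationals. \<exists>b\<in>dyadic_rationals. a < b \<and> J = {a<..<b})"

text \<open>The points of \<open>B\<close> are allowed breakpoints; adding points at which \<open>f\<close> is affine
  does no harm.\<close>

definition PL_homeo :: "real set \<Rightarrow> (real \<Rightarrow> real) \<Rightarrow> bool" where
  "PL_homeo J f \<longleftrightarrow> (\<exists>f'. homeomorphism J (f ` J) f f') \<and>
     (\<exists>B. finite B \<and> B \<subseteq> J \<and>
        (\<forall>K\<in>components (J - B). \<exists>m b. \<forall>x\<in>K. f x = m * x + b))"

definition dyadic_PL_homeo :: "real set \<Rightarrow> (real \<Rightarrow> real) \<Rightarrow> bool" where
  "dyadic_PL_homeo J f \<longleftrightarrow> (\<exists>f'. homeomorphism J (f ` J) f f') \<and>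
     dyadic_interval J \<and> dyadic_interval (f ` J) \<and>
     (\<exists>B. finite B \<and> B \<subseteq> J \<and> B \<subseteq> dyadic_rationals \<and>
        (\<forall>K\<in>components (J - B). \<exists>m::int. \<exists>b\<in>dyadic_rationals. \<forall>x\<in>K. f x = 2 powi m * x + b))"

definition locally_of_form ::
    "(real set \<Rightarrow> (real \<Rightarrow> real) \<Rightarrow> bool) \<Rightarrow> 'a topology \<Rightarrow> ('a \<Rightarrow> 'a) \<Rightarrow>
     (('a \<times> real) set \<Rightarrow> ('a \<times> real) set) \<Rightarrow> bool" where
  "locally_of_form P X \<phi> g \<longleftrightarrow>
     (\<forall>y\<in>topspace (suspension X \<phi>). \<exists>C J f.
        is_chart X \<phi> C J \<and> dyadic_interval J \<and> y \<in> chart_domain X \<phi> C J \<and>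
        P J f \<and> is_chart X \<phi> C (f ` J) \<and>
        g ` chart_domain X \<phi> C J = chart_domain X \<phi> C (f ` J) \<and>
        (\<forall>x\<in>C. \<forall>t\<in>J.
           inv_into (C \<times> f ` J) (chart X \<phi> C (f ` J)) (g (chart X \<phi> C J (x, t))) = (x, f t)))"

text \<open>The groups PL and T of the system, with composition as the operation.\<close>

definition PL_group ::
    "'a topology \<Rightarrow> ('a \<Rightarrow> 'a) \<Rightarrow> (('a \<times> real) set \<Rightarrow> ('a \<times> real) set) monoid" where
  "PL_group X \<phi> = (BijGroup (topspace (suspension X \<phi>)))
     \<lparr>carrier := {g \<in> H0 X \<phi>. locally_of_form PL_homeo X \<phi> g}\<rparr>"

definition T_group ::
    "'a topology \<Rightarrow> ('a \<Rightarrow> 'a) \<Rightarrow> (('a \<times> real) set \<Rightarrow> ('a \<times> real) set) monoid" where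
  "T_group X \<phi> = (BijGroup (topspace (suspension X \<phi>)))
     \<lparr>carrier := {g \<in> H0 X \<phi>. locally_of_form dyadic_PL_homeo X \<phi> g}\<rparr>"

lemma T_group_subset_PL_group: "carrier (T_group X \<phi>) \<subseteq> carrier (PL_group X \<phi>)"
proof -
  have "PL_homeo J f" if "dyadic_PL_homeo J f" for J f
    using that unfolding dyadic_PL_homeo_def PL_homeo_def by metis
  then have "locally_of_form PL_homeo X \<phi> g" if "locally_of_form dyadic_PL_homeo X \<phi> g" for g
    using that unfolding locally_of_form_def by meson
  then show ?thesis by (auto simp: T_group_def PL_group_def)
qed

end

theory Submission
  imports Defs "HOL-Algebra.Generated_Groups"
begin

text \<open>An element of \<open>PL(\<phi>)\<close> lifts to piecewise linear homeomorphisms of the leaves, parametrised by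
  the reals. The jumps of the logarithmic slopes along the leaves form a cocycle; carrying a
  \<open>\<phi>\<close>-invariant measure on \<open>X\<close> over to a transversal with countably many leaf parameters, this
  cocycle is square integrable, so property (T) makes it the coboundary of a square integrable
  function. Its jumps lie in a finitely generated group of reals. Treating integral coordinates
  separately, one may round the function to integers, so on some leaf it is locally
  finitely supported. Its partial sums are then, up to sign, the logarithm of the density of a
  coordinate on that leaf in which the group acts by affine maps.

  A group with property (T) has no nontrivial homomorphisms to the reals, and its homomorphisms
  to the circle have finite image. Hence a subgroup of finite index acts on the leaf by
  translations that are periods of the leaf. This subgroup is finitely generated, so it acts
  trivially near one point of the leaf. Triviality near a point propagates along the
  leaf, since the one-sided slopes at a fixed point are trivial again by property (T), and spreads to
  an open invariant set of leaves. The argument applies to every closed invariant subset of \<open>X\<close>, so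
  by compactness finitely many such subgroups cover \<open>X\<close>. Their intersection is trivial
  and has finite index.\<close>

section \<open>Square integrable functions\<close>

text \<open>The logarithms of the slopes form a cocycle themselves, but on the transversal, which
  has infinite measure, they need not be square integrable; their jumps live on finitely many
  parameters and take finitely many values. The square integrable solution may still have infinitely
  many small nonzero values on a bounded piece of a leaf, so its partial sums need not make sense.
  For an integer-valued cocycle, rounding keeps the equation and removes the small values, which is
  why rational coordinates enter. They rest on finitely many generators, themselves supplied by
  property (T). The equation holds only almost everywhere and hence yields a single leaf at a time;
  spreading to neighbouring leaves needs conditions on finitely many elements, so finite-index
  subgroups are replaced by finite generating sets. Lifts to leaves are determined only up to
  periods, so homomorphisms appear modulo a period, and a period must persist on all nearby leaves
  before a translation by it may count as trivial there.\<close>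

lemma AE_compose_nonincreasing:
  assumes S: "S \<in> measurable M M"
    and le: "\<And>f. f \<in> borel_measurable M \<Longrightarrow> (\<integral>\<^sup>+p. f (S p) \<partial>M) \<le> (\<integral>\<^sup>+p. f p \<partial>M)"
    and P: "AE p in M. P p"
  shows "AE p in M. P (S p)"
proof -
  obtain N where N: "N \<in> null_sets M" "{p \<in> space M. \<not> P p} \<subseteq> N"
    using P by (auto simp: eventually_ae_filter)
  have m: "indicator N \<in> borel_measurable M" using N(1) by auto
  have mg: "(\<lambda>p. indicator N (S p)) \<in> borel_measurable M" by (rule measurable_compose[OF S m])
  have "(\<integral>\<^sup>+p. indicator N (S p) \<partial>M) \<le> (\<integral>\<^sup>+p. indicator N p \<partial>M)" by (rule le[OF m])
  also have "\<dots> = 0" using N(1) by (simp add: nn_integral_indicator null_setsD1 null_setsD2)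
  finally have "(\<integral>\<^sup>+p. indicator N (S p) \<partial>M) = 0" by simp
  then have "AE p in M. (indicator N (S p) :: ennreal) = 0"
    unfolding nn_integral_0_iff_AE[OF mg] .
  then show ?thesis
  proof (rule AE_mp, intro AE_I2 impI)
    fix p assume p: "p \<in> space M" and 0: "(indicator N (S p) :: ennreal) = 0"
    have "S p \<in> space M" using S p by (rule measurable_space)
    moreover have "S p \<notin> N" using 0 by (simp add: indicator_def split: if_splits)
    ultimately show "P (S p)" using N(2) by blast
  qed
qed

text \<open>Chebyshev's inequality for the counting measure.\<close>

lemma finite_large_if_square_summable:
  fixes h :: "'a \<Rightarrow> real"
  assumes fin: "(\<integral>\<^sup>+q. ennreal ((h q)\<^sup>2) \<partial>count_space Q) < \<infinity>" and e: "e > 0"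
  shows "finite {q \<in> Q. e \<le> \<bar>h q\<bar>}"
proof (rule ccontr)
  let ?A = "{q \<in> Q. e \<le> \<bar>h q\<bar>}"
  assume inf: "infinite ?A"
  have "ennreal (e\<^sup>2) * emeasure (count_space Q) ?A = (\<integral>\<^sup>+p. ennreal (e\<^sup>2) * indicator ?A p \<partial>count_space Q)"
    by (simp add: nn_integral_cmult_indicator)
  also have "\<dots> \<le> (\<integral>\<^sup>+p. ennreal ((h p)\<^sup>2) \<partial>count_space Q)"
    using e by (intro nn_integral_mono) (auto simp: indicator_def abs_le_square_iff[symmetric] intro!: ennreal_leI)
  finally show False using inf e fin by (simp add: emeasure_count_space ennreal_mult_top)
qed

lemma nn_integral_count_space_subset_le:
  assumes "A \<subseteq> B"
  shows "(\<integral>\<^sup>+x. f x \<partial>count_space A) \<le> (\<integral>\<^sup>+x. f x \<partial>count_space B)"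
proof -
  have "(\<integral>\<^sup>+x. f x \<partial>count_space C) = (\<integral>\<^sup>+x. f x * indicator C x \<partial>count_space UNIV)" for C
    by (rule nn_integral_count_space_indicator[unfolded NO_MATCH_def, OF TrueI])
  moreover have "(\<integral>\<^sup>+x. f x * indicator A x \<partial>count_space UNIV) \<le> (\<integral>\<^sup>+x. f x * indicator B x \<partial>count_space UNIV)"
    using assms by (intro nn_integral_mono) (auto simp: indicator_def)
  ultimately show ?thesis by simp
qed

lemma AE_imp_ex:
  assumes "emeasure M (space M) \<noteq> 0" "AE x in M. P x"
  shows "\<exists>x\<in>space M. P x"
proof (rule ccontr)
  assume no: "\<not> ?thesis"
  obtain N where N: "N \<in> null_sets M" "{x \<in> space M. \<not> P x} \<subseteq> N"
    using assms(2) unfolding eventually_ae_filter by auto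
  have "space M \<subseteq> N" using N(2) no by blast
  then have "emeasure M (space M) \<le> emeasure M N" using N(1) by (intro emeasure_mono) auto
  then show False using assms(1) null_setsD1[OF N(1)] by simp
qed

definition L2_fun :: "'a measure \<Rightarrow> ('a \<Rightarrow> real) set" where
  "L2_fun M = {f \<in> borel_measurable M. integrable M (\<lambda>x. (f x)\<^sup>2)}"

lemma L2_fun_add:
  assumes "f \<in> L2_fun M" "g \<in> L2_fun M"
  shows "(\<lambda>x. f x + g x) \<in> L2_fun M"
proof -
  have [measurable]: "f \<in> borel_measurable M" "g \<in> borel_measurable M"
    using assms by (auto simp: L2_fun_def)
  have "integrable M (\<lambda>x. (f x + g x)\<^sup>2)"
  proof (rule Bochner_Integration.integrable_bound)
    show "integrable M (\<lambda>x. 2 * (f x)\<^sup>2 + 2 * (g x)\<^sup>2)"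
      using assms by (auto simp: L2_fun_def)
    have "(f x + g x)\<^sup>2 \<le> 2 * (f x)\<^sup>2 + 2 * (g x)\<^sup>2" for x
      using sum_squares_bound[of "f x" "g x"] by (simp add: power2_sum)
    then show "AE x in M. norm ((f x + g x)\<^sup>2) \<le> norm (2 * (f x)\<^sup>2 + 2 * (g x)\<^sup>2)"
      by (simp add: abs_of_nonneg)
  qed measurable
  then show ?thesis by (simp add: L2_fun_def)
qed

lemma L2_fun_scale: "f \<in> L2_fun M \<Longrightarrow> (\<lambda>x. r * f x) \<in> L2_fun M"
  by (auto simp: L2_fun_def power_mult_distrib)

lemma L2_fun_zero: "(\<lambda>_. 0) \<in> L2_fun M"
  by (simp add: L2_fun_def)

lemma L2_fun_diff:
  assumes "f \<in> L2_fun M" "g \<in> L2_fun M"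
  shows "(\<lambda>x. f x - g x) \<in> L2_fun M"
  using L2_fun_add[OF assms(1) L2_fun_scale[OF assms(2), of "-1"]] by simp

lemma L2_fun_mult_integrable:
  assumes "f \<in> L2_fun M" "g \<in> L2_fun M"
  shows "integrable M (\<lambda>x. f x * g x)"
proof (rule Bochner_Integration.integrable_bound)
  show "integrable M (\<lambda>x. (f x)\<^sup>2 + (g x)\<^sup>2)"
    using assms by (auto simp: L2_fun_def)
  have "\<bar>f x * g x\<bar> \<le> (f x)\<^sup>2 + (g x)\<^sup>2" for x
    using sum_squares_bound[of "\<bar>f x\<bar>" "\<bar>g x\<bar>"] by (simp add: abs_mult)
      (metis (no_types, opaque_lifting) abs_ge_zero abs_mult dual_order.trans mult.assoc mult_2 mult_nonneg_nonneg le_add_same_cancel1)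
  then show "AE x in M. norm (f x * g x) \<le> norm ((f x)\<^sup>2 + (g x)\<^sup>2)"
    by (simp add: abs_of_nonneg)
qed (use assms in \<open>auto simp: L2_fun_def\<close>)

lemma L2_fun_nn_integral:
  assumes "f \<in> L2_fun M"
  shows "(\<integral>\<^sup>+x. ennreal ((f x)\<^sup>2) \<partial>M) = ennreal (\<integral>x. (f x)\<^sup>2 \<partial>M)"
  using assms by (intro nn_integral_eq_integral) (auto simp: L2_fun_def)

lemma L2_fun_iff_finite:
  assumes "f \<in> borel_measurable M"
  shows "f \<in> L2_fun M \<longleftrightarrow> (\<integral>\<^sup>+x. ennreal ((f x)\<^sup>2) \<partial>M) < \<infinity>"
  using assms by (auto simp: L2_fun_def integrable_iff_bounded)

text \<open>The bound makes \<open>\<bar>u k\<bar>\<close> at most a constant times the k-th power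
  of \<open>inverse (sqrt 2)\<close>, a geometric majorant. In the completeness proof this turns an
  integrated bound on squares into pointwise summability without Minkowski's inequality.\<close>

lemma summable_if_weighted_square_bounded:
  fixes u :: "nat \<Rightarrow> real"
  assumes "\<And>k. 2 ^ k * (u k)\<^sup>2 \<le> C"
  shows "summable u"
proof (rule summable_comparison_test)
  define q where "q = inverse (sqrt 2)"
  have q: "0 < q" "q < 1" "q\<^sup>2 = 1/2"
    unfolding q_def by (auto simp: field_simps power2_eq_square)
  have "C \<ge> 0" using assms[of 0] by (metis mult_1 order_trans power_0 zero_le_power2)
  have "\<bar>u k\<bar> \<le> sqrt C * q ^ k" for k
  proof (rule power2_le_imp_le)
    have "(u k)\<^sup>2 \<le> C * (1/2) ^ k" using assms[of k] by (simp add: field_simps)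
    also have "\<dots> = (sqrt C * q ^ k)\<^sup>2"
      unfolding power_mult_distrib power_mult[symmetric] mult.commute[of k] unfolding power_mult q
      using \<open>C \<ge> 0\<close> by simp
    finally show "\<bar>u k\<bar>\<^sup>2 \<le> (sqrt C * q ^ k)\<^sup>2" by simp
    show "0 \<le> sqrt C * q ^ k" using \<open>C \<ge> 0\<close> q by simp
  qed
  then show "\<exists>N. \<forall>n\<ge>N. norm (u n) \<le> sqrt C * q ^ n" by auto
  show "summable (\<lambda>n. sqrt C * q ^ n)" using q by (intro summable_mult summable_geometric) auto
qed

lemma ennreal_suminf_bounded:
  fixes v :: "nat \<Rightarrow> real"
  assumes "(\<Sum>k. ennreal (v k)) \<noteq> \<infinity>"
  shows "\<exists>C. \<forall>k. v k \<le> C"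
proof -
  obtain C where C: "C \<ge> 0" "(\<Sum>k. ennreal (v k)) = ennreal C"
    using assms by (cases "\<Sum>k. ennreal (v k)") auto
  have "ennreal (v k) \<le> ennreal C" for k
    using sum_le_suminf[of "\<lambda>k. ennreal (v k)" "{k}"] unfolding C(2) by simp
  then show ?thesis using C(1) by (auto simp: ennreal_le_iff)
qed

text \<open>Riesz-Fischer. Along a subsequence the squared norms of consecutive differences are
  below \<open>(1/4) ^ k\<close>, so even with the weights \<open>2 ^ k\<close> their squares have
  an integrable sum; this gives convergence almost everywhere. Fatou's lemma then carries the Cauchy
  bound over to the limit.\<close>

lemma L2_fun_complete:
  fixes f :: "nat \<Rightarrow> 'a \<Rightarrow> real"
  assumes f: "\<And>n. f n \<in> L2_fun M"
    and cauchy: "\<And>e. e > 0 \<Longrightarrow> \<exists>N. \<forall>m\<ge>N. \<forall>n\<ge>N. (\<integral>x. (f m x - f n x)\<^sup>2 \<partial>M) < e"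
  shows "\<exists>g\<in>L2_fun M. (\<lambda>n. \<integral>x. (f n x - g x)\<^sup>2 \<partial>M) \<longlonglongrightarrow> 0"
proof -
  have fm [measurable]: "f n \<in> borel_measurable M" for n using f by (auto simp: L2_fun_def)
  have nn: "(\<integral>\<^sup>+x. ennreal ((f m x - f n x)\<^sup>2) \<partial>M) = ennreal (\<integral>x. (f m x - f n x)\<^sup>2 \<partial>M)" for m n
    using L2_fun_nn_integral[OF L2_fun_diff[OF f f]] .
  have "\<forall>k. \<exists>N. \<forall>m\<ge>N. \<forall>n\<ge>N. (\<integral>x. (f m x - f n x)\<^sup>2 \<partial>M) < (1/4) ^ k"
    using cauchy by simp
  then obtain N where N: "\<And>k m n. m \<ge> N k \<Longrightarrow> n \<ge> N k \<Longrightarrow> (\<integral>x. (f m x - f n x)\<^sup>2 \<partial>M) < (1/4) ^ k"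
    by metis
  \<comment> \<open>The partial sum dominates each \<open>N k\<close>, and the summand
    \<open>k\<close> makes \<open>r\<close> strictly increasing.\<close>
  define r where "r k = (\<Sum>i\<le>k. N i) + k" for k
  have rN: "N k \<le> r k" "N k \<le> r (Suc k)" for k
  proof -
    have "N k \<le> (\<Sum>i\<le>k. N i)" by (rule member_le_sum) auto
    then show "N k \<le> r k" "N k \<le> r (Suc k)" unfolding r_def by auto
  qed
  have rmono: "strict_mono r" unfolding strict_mono_Suc_iff r_def by simp
  define u where "u k x = f (r (Suc k)) x - f (r k) x" for k x
  have [measurable]: "u k \<in> borel_measurable M" for k unfolding u_def by measurable
  have "(\<integral>\<^sup>+x. (\<Sum>k. ennreal (2 ^ k * (u k x)\<^sup>2)) \<partial>M) = (\<Sum>k. \<integral>\<^sup>+x. ennreal (2 ^ k * (u k x)\<^sup>2) \<partial>M)"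
    by (rule nn_integral_suminf) measurable
  also have "\<dots> \<le> (\<Sum>k. ennreal ((1/2) ^ k))"
  proof (rule suminf_le)
    fix k
    have "(\<integral>\<^sup>+x. ennreal (2 ^ k * (u k x)\<^sup>2) \<partial>M) = ennreal (2 ^ k) * (\<integral>\<^sup>+x. ennreal ((u k x)\<^sup>2) \<partial>M)"
      by (subst nn_integral_cmult[symmetric]) (auto simp: ennreal_mult)
    also have "\<dots> \<le> ennreal (2 ^ k) * ennreal ((1/4) ^ k)"
      unfolding u_def nn using N[OF rN(2) rN(1), of k] by (intro mult_left_mono ennreal_leI) auto
    also have "\<dots> = ennreal ((1/2) ^ k)"
      by (subst ennreal_mult[symmetric]) (auto simp flip: power_mult_distrib)
    finally show "(\<integral>\<^sup>+x. ennreal (2 ^ k * (u k x)\<^sup>2) \<partial>M) \<le> ennreal ((1/2) ^ k)" .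
  qed auto
  also have "\<dots> < \<infinity>"
    by (subst suminf_ennreal_eq[OF _ geometric_sums]) auto
  finally have "AE x in M. (\<Sum>k. ennreal (2 ^ k * (u k x)\<^sup>2)) \<noteq> \<infinity>"
    by (intro nn_integral_PInf_AE) auto
  then have conv: "AE x in M. convergent (\<lambda>k. f (r k) x)"
  proof (rule AE_mp, intro AE_I2 impI)
    fix x assume fin: "(\<Sum>k. ennreal (2 ^ k * (u k x)\<^sup>2)) \<noteq> \<infinity>"
    from ennreal_suminf_bounded[OF this] obtain C where "\<And>k. 2 ^ k * (u k x)\<^sup>2 \<le> C" by blast
    then have "summable (\<lambda>k. u k x)" by (rule summable_if_weighted_square_bounded)
    then have "convergent (\<lambda>k. (\<Sum>i<k. u i x))" by (simp add: summable_iff_convergent)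
    moreover have "(\<Sum>i<k. u i x) = f (r k) x - f (r 0) x" for k
      unfolding u_def by (rule sum_lessThan_telescope)
    ultimately have "convergent (\<lambda>k. f (r k) x - f (r 0) x)" by simp
    then have "convergent (\<lambda>k. (f (r k) x - f (r 0) x) + f (r 0) x)"
      by (intro convergent_add convergent_const)
    then show "convergent (\<lambda>k. f (r k) x)" by simp
  qed
  define g where "g x = lim (\<lambda>k. f (r k) x)" for x
  have gm [measurable]: "g \<in> borel_measurable M" unfolding g_def by measurable
  have bound: "(\<integral>\<^sup>+x. ennreal ((f n x - g x)\<^sup>2) \<partial>M) \<le> ennreal ((1/4) ^ k)" if n: "n \<ge> N k" for n k
  proof -
    have "(\<integral>\<^sup>+x. ennreal ((f n x - g x)\<^sup>2) \<partial>M) = (\<integral>\<^sup>+x. liminf (\<lambda>i. ennreal ((f n x - f (r i) x)\<^sup>2)) \<partial>M)"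
    proof (rule nn_integral_cong_AE, rule AE_mp[OF conv], intro AE_I2 impI)
      fix x assume "convergent (\<lambda>k. f (r k) x)"
      then have "(\<lambda>i. f (r i) x) \<longlonglongrightarrow> g x" unfolding g_def by (simp add: convergent_LIMSEQ_iff)
      then have "(\<lambda>i. ennreal ((f n x - f (r i) x)\<^sup>2)) \<longlonglongrightarrow> ennreal ((f n x - g x)\<^sup>2)"
        by (intro tendsto_intros)
      then show "ennreal ((f n x - g x)\<^sup>2) = liminf (\<lambda>i. ennreal ((f n x - f (r i) x)\<^sup>2))"
        by (rule lim_imp_Liminf[OF sequentially_bot, symmetric])
    qed
    also have "\<dots> \<le> liminf (\<lambda>i. \<integral>\<^sup>+x. ennreal ((f n x - f (r i) x)\<^sup>2) \<partial>M)"
      by (rule nn_integral_liminf) measurable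
    also have "\<dots> \<le> ennreal ((1/4) ^ k)"
    proof (rule Liminf_le, simp, unfold eventually_sequentially, intro exI allI impI)
      fix i assume "k \<le> i"
      then have "N k \<le> r i" using rN(1)[of k] strict_mono_less_eq[OF rmono, of k i] by simp
      then show "(\<integral>\<^sup>+x. ennreal ((f n x - f (r i) x)\<^sup>2) \<partial>M) \<le> ennreal ((1/4) ^ k)"
        unfolding nn using N[OF n] by (intro ennreal_leI less_imp_le)
    qed
    finally show ?thesis .
  qed
  have d: "(\<lambda>x. f n x - g x) \<in> L2_fun M" if "n \<ge> N k" for n k
    by (subst L2_fun_iff_finite) (use bound[OF that] in \<open>auto simp: le_less_trans\<close>)
  have gL: "g \<in> L2_fun M"
    using L2_fun_diff[OF f d[OF order_refl, of 0], of "N 0"] by simp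
  have "(\<lambda>n. \<integral>x. (f n x - g x)\<^sup>2 \<partial>M) \<longlonglongrightarrow> 0"
  proof (rule LIMSEQ_I)
    fix e :: real assume "e > 0"
    then obtain k where k: "(1/4) ^ k < e" by (meson real_arch_pow_inv divide_less_eq_1_pos zero_less_numeral one_less_numeral_iff semiring_norm(76))
    have "(\<integral>x. (f n x - g x)\<^sup>2 \<partial>M) < e" if "n \<ge> N k" for n
      using bound[OF that] k unfolding L2_fun_nn_integral[OF d[OF that]]
      by (simp add: ennreal_le_iff)
    then show "\<exists>no. \<forall>n\<ge>no. norm ((\<integral>x. (f n x - g x)\<^sup>2 \<partial>M) - 0) < e"
      by (intro exI[of _ "N k"]) (auto simp: abs_of_nonneg)
  qed
  then show ?thesis using gL by blast
qed

section \<open>The Hilbert space of square integrable functions modulo null sets\<close>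

definition L2_class :: "'a measure \<Rightarrow> ('a \<Rightarrow> real) \<Rightarrow> ('a \<Rightarrow> real) set" where
  "L2_class M f = {h \<in> borel_measurable M. AE x in M. h x = f x}"

text \<open>Choosing representatives lets the operations be written on classes directly;
  \<open>L2_class_eqI\<close> makes their results independent of the choice.\<close>

definition L2_rep :: "('a \<Rightarrow> real) set \<Rightarrow> 'a \<Rightarrow> real" where
  "L2_rep a = (SOME f. f \<in> a)"

definition L2_module :: "'a measure \<Rightarrow> (real, ('a \<Rightarrow> real) set) module" where
  "L2_module M = \<lparr>carrier = L2_class M ` L2_fun M, monoid.mult = (\<lambda>a b. a), one = L2_class M (\<lambda>_. 0),
     ring.zero = L2_class M (\<lambda>_. 0),
     add = (\<lambda>a b. L2_class M (\<lambda>x. L2_rep a x + L2_rep b x)),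
     smult = (\<lambda>r a. L2_class M (\<lambda>x. r * L2_rep a x))\<rparr>"

definition L2_ip :: "'a measure \<Rightarrow> ('a \<Rightarrow> real) set \<Rightarrow> ('a \<Rightarrow> real) set \<Rightarrow> real" where
  "L2_ip M a b = (\<integral>x. L2_rep a x * L2_rep b x \<partial>M)"

lemma L2_class_eqI:
  assumes "AE x in M. f x = g x"
  shows "L2_class M f = L2_class M g"
proof -
  have "(AE x in M. h x = f x) \<longleftrightarrow> (AE x in M. h x = g x)" for h
  proof
    show "AE x in M. h x = g x" if "AE x in M. h x = f x"
      using that assms by eventually_elim simp
    show "AE x in M. h x = f x" if "AE x in M. h x = g x"
      using that assms by eventually_elim simp
  qed
  then show ?thesis by (simp add: L2_class_def)
qed

lemma L2_rep_class:
  assumes "f \<in> borel_measurable M"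
  shows "L2_rep (L2_class M f) \<in> borel_measurable M" "AE x in M. L2_rep (L2_class M f) x = f x"
proof -
  have "f \<in> L2_class M f" using assms by (simp add: L2_class_def)
  then have "L2_rep (L2_class M f) \<in> L2_class M f" unfolding L2_rep_def by (rule someI[of "\<lambda>h. h \<in> L2_class M f"])
  then show "L2_rep (L2_class M f) \<in> borel_measurable M" "AE x in M. L2_rep (L2_class M f) x = f x"
    by (auto simp: L2_class_def)
qed

lemma L2_class_eqD:
  assumes "L2_class M f = L2_class M g" "f \<in> borel_measurable M"
  shows "AE x in M. f x = g x"
proof -
  have "f \<in> L2_class M f" using assms(2) by (simp add: L2_class_def)
  then have "f \<in> L2_class M g" using assms(1) by (rule back_subst)
  then show ?thesis by (simp add: L2_class_def)
qed

lemma L2_fun_measurable: "f \<in> L2_fun M \<Longrightarrow> f \<in> borel_measurable M"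
  by (simp add: L2_fun_def)

context
  fixes M :: "'a measure"
begin

lemma L2_add_class:
  assumes "f \<in> L2_fun M" "g \<in> L2_fun M"
  shows "L2_class M f \<oplus>\<^bsub>L2_module M\<^esub> L2_class M g = L2_class M (\<lambda>x. f x + g x)"
proof -
  have "AE x in M. L2_rep (L2_class M f) x + L2_rep (L2_class M g) x = f x + g x"
    using L2_rep_class(2)[OF L2_fun_measurable[OF assms(1)]]
      L2_rep_class(2)[OF L2_fun_measurable[OF assms(2)]] by eventually_elim simp
  then show ?thesis by (simp add: L2_module_def L2_class_eqI)
qed

lemma L2_smult_class:
  assumes "f \<in> L2_fun M"
  shows "r \<odot>\<^bsub>L2_module M\<^esub> L2_class M f = L2_class M (\<lambda>x. r * f x)"
proof -
  have "AE x in M. r * L2_rep (L2_class M f) x = r * f x"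
    using L2_rep_class(2)[OF L2_fun_measurable[OF assms(1)]] by eventually_elim simp
  then show ?thesis by (simp add: L2_module_def L2_class_eqI)
qed

lemma L2_ip_class:
  assumes "f \<in> L2_fun M" "g \<in> L2_fun M"
  shows "L2_ip M (L2_class M f) (L2_class M g) = (\<integral>x. f x * g x \<partial>M)"
  unfolding L2_ip_def
proof (rule integral_cong_AE)
  note m = L2_fun_measurable[OF assms(1)] L2_fun_measurable[OF assms(2)]
  note [measurable] = m L2_rep_class(1)[OF m(1)] L2_rep_class(1)[OF m(2)]
  show "AE x in M. L2_rep (L2_class M f) x * L2_rep (L2_class M g) x = f x * g x"
    using L2_rep_class(2)[OF m(1)] L2_rep_class(2)[OF m(2)] by eventually_elim simp
  show "(\<lambda>x. L2_rep (L2_class M f) x * L2_rep (L2_class M g) x) \<in> borel_measurable M"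
    "(\<lambda>x. f x * g x) \<in> borel_measurable M" by measurable
qed

lemma L2_carrier: "carrier (L2_module M) = L2_class M ` L2_fun M"
  by (simp add: L2_module_def)

lemma L2_zero: "\<zero>\<^bsub>L2_module M\<^esub> = L2_class M (\<lambda>_. 0)"
  by (simp add: L2_module_def)

lemma L2_abelian_group: "abelian_group (L2_module M)"
proof (rule abelian_groupI)
  show "\<exists>y\<in>carrier (L2_module M). y \<oplus>\<^bsub>L2_module M\<^esub> a = \<zero>\<^bsub>L2_module M\<^esub>"
    if "a \<in> carrier (L2_module M)" for a
  proof -
    obtain f where f: "f \<in> L2_fun M" "a = L2_class M f" using \<open>a \<in> _\<close> by (auto simp: L2_carrier)
    show ?thesis
      using f L2_fun_scale[OF f(1), of "-1"]
      by (intro bexI[of _ "L2_class M (\<lambda>x. - f x)"]) (auto simp: L2_add_class L2_zero L2_carrier)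
  qed
qed (auto simp: L2_carrier L2_zero L2_add_class L2_fun_add L2_fun_zero add_ac)

lemma L2_module: "module real_ring (L2_module M)"
proof (rule moduleI)
  show "cring real_ring" by (rule cring_real_ring)
  show "abelian_group (L2_module M)" by (rule L2_abelian_group)
qed (auto simp: L2_carrier L2_zero L2_add_class L2_smult_class L2_fun_add L2_fun_scale real_ring_def
      algebra_simps)

lemma L2_minus_class:
  assumes "f \<in> L2_fun M" "g \<in> L2_fun M"
  shows "L2_class M f \<ominus>\<^bsub>L2_module M\<^esub> L2_class M g = L2_class M (\<lambda>x. f x - g x)"
proof -
  interpret abelian_group "L2_module M" by (rule L2_abelian_group)
  have m: "(\<lambda>x. - g x) \<in> L2_fun M" using L2_fun_scale[OF assms(2), of "-1"] by simp
  have "\<ominus>\<^bsub>L2_module M\<^esub> L2_class M g = L2_class M (\<lambda>x. - g x)"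
    by (rule minus_equality) (use m assms in \<open>auto simp: L2_carrier L2_add_class L2_zero\<close>)
  then show ?thesis using assms m by (simp add: a_minus_def L2_add_class)
qed

lemma L2_hnorm_diff:
  assumes "f \<in> L2_fun M" "g \<in> L2_fun M"
  shows "hnorm (L2_ip M) (L2_class M f \<ominus>\<^bsub>L2_module M\<^esub> L2_class M g) = sqrt (\<integral>x. (f x - g x)\<^sup>2 \<partial>M)"
  using L2_fun_diff[OF assms] by (simp add: L2_minus_class[OF assms] hnorm_def L2_ip_class power2_eq_square)

lemma L2_hilbert: "real_hilbert_space (L2_module M) (L2_ip M)"
proof (rule real_hilbert_space.intro[OF L2_module real_hilbert_space_axioms.intro])
  fix a assume a: "a \<in> carrier (L2_module M)" "a \<noteq> \<zero>\<^bsub>L2_module M\<^esub>"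
  from a(1) obtain f where f: "f \<in> L2_fun M" "a = L2_class M f" unfolding L2_carrier by (rule imageE)
  have "(\<integral>x. (f x)\<^sup>2 \<partial>M) \<noteq> 0"
  proof
    assume 0: "(\<integral>x. (f x)\<^sup>2 \<partial>M) = 0"
    have "integrable M (\<lambda>x. (f x)\<^sup>2)" using f(1) by (simp add: L2_fun_def)
    from integral_nonneg_eq_0_iff_AE[OF this] 0 have "AE x in M. (f x)\<^sup>2 = 0" by simp
    then have "AE x in M. f x = 0" by simp
    then have "L2_class M f = L2_class M (\<lambda>_. 0)" by (rule L2_class_eqI)
    then show False using a(2) f(2) by (simp only: L2_zero)
  qed
  moreover have "(\<integral>x. (f x)\<^sup>2 \<partial>M) \<ge> 0" by (rule Bochner_Integration.integral_nonneg) simp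
  ultimately have "(\<integral>x. (f x)\<^sup>2 \<partial>M) > 0" by linarith
  then show "L2_ip M a a > 0" using f by (simp add: L2_ip_class power2_eq_square)
next
  fix \<sigma> :: "nat \<Rightarrow> ('a \<Rightarrow> real) set"
  assume s: "\<And>n. \<sigma> n \<in> carrier (L2_module M)"
    and c: "\<forall>e>0. \<exists>N. \<forall>m\<ge>N. \<forall>n\<ge>N. hnorm (L2_ip M) (\<sigma> m \<ominus>\<^bsub>L2_module M\<^esub> \<sigma> n) < e"
  define f where "f n = (SOME h. h \<in> L2_fun M \<and> \<sigma> n = L2_class M h)" for n
  have f: "f n \<in> L2_fun M" "\<sigma> n = L2_class M (f n)" for n
  proof -
    obtain h where "h \<in> L2_fun M \<and> \<sigma> n = L2_class M h" using s[of n] by (auto simp: L2_carrier)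
    then have "f n \<in> L2_fun M \<and> \<sigma> n = L2_class M (f n)" unfolding f_def by (rule someI[of "\<lambda>h. h \<in> L2_fun M \<and> \<sigma> n = L2_class M h"])
    then show "f n \<in> L2_fun M" "\<sigma> n = L2_class M (f n)" by auto
  qed
  have "\<exists>g\<in>L2_fun M. (\<lambda>n. \<integral>x. (f n x - g x)\<^sup>2 \<partial>M) \<longlonglongrightarrow> 0"
  proof (rule L2_fun_complete[OF f(1)])
    fix e :: real assume "e > 0"
    then obtain N where "\<forall>m\<ge>N. \<forall>n\<ge>N. hnorm (L2_ip M) (\<sigma> m \<ominus>\<^bsub>L2_module M\<^esub> \<sigma> n) < sqrt e"
      using c by (meson real_sqrt_gt_zero)
    then show "\<exists>N. \<forall>m\<ge>N. \<forall>n\<ge>N. (\<integral>x. (f m x - f n x)\<^sup>2 \<partial>M) < e"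
      by (intro exI[of _ N]) (simp add: f(2) L2_hnorm_diff[OF f(1) f(1)])
  qed
  then obtain g where g: "g \<in> L2_fun M" "(\<lambda>n. \<integral>x. (f n x - g x)\<^sup>2 \<partial>M) \<longlonglongrightarrow> 0" by blast
  have "(\<lambda>n. sqrt (\<integral>x. (f n x - g x)\<^sup>2 \<partial>M)) \<longlonglongrightarrow> sqrt 0"
    by (intro tendsto_intros g(2))
  then show "\<exists>x\<in>carrier (L2_module M). (\<lambda>n. hnorm (L2_ip M) (\<sigma> n \<ominus>\<^bsub>L2_module M\<^esub> x)) \<longlonglongrightarrow> 0"
    using g(1) by (intro bexI[of _ "L2_class M g"]) (simp_all add: f(2) L2_hnorm_diff[OF f(1) g(1)] L2_carrier)
next
  show "L2_ip M a c = L2_ip M c a" for a c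
    by (simp add: L2_ip_def mult.commute)
  show "L2_ip M (a \<oplus>\<^bsub>L2_module M\<^esub> a') c = L2_ip M a c + L2_ip M a' c"
    if "a \<in> carrier (L2_module M)" "a' \<in> carrier (L2_module M)" "c \<in> carrier (L2_module M)" for a a' c
    using that by (auto simp: L2_carrier L2_add_class L2_ip_class L2_fun_add L2_fun_mult_integrable distrib_right)
  show "L2_ip M (r \<odot>\<^bsub>L2_module M\<^esub> a) c = r * L2_ip M a c"
    if "a \<in> carrier (L2_module M)" "c \<in> carrier (L2_module M)" for r a c
    using that by (auto simp: L2_carrier L2_smult_class L2_ip_class L2_fun_scale mult.assoc)
qed

end

section \<open>Property (T) and square integrable cocycles\<close>

text \<open>The group acts by isometries on functions, \<open>f\<close> going to \<open>f\<close>
  composed with the inverse of \<open>g\<close> minus the cocycle at that inverse. The cocycle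
  identity says exactly that these affine maps compose correctly, and a fixed point is a function
  with coboundary \<open>b\<close>. In \<open>S_le\<close> an inequality is enough, because the
  inverse of \<open>g\<close> supplies the opposite one.\<close>

lemma property_T_L2_coboundary:
  fixes \<Gamma> :: "('g, 'm) monoid_scheme" and M :: "'a measure" and S :: "'g \<Rightarrow> 'a \<Rightarrow> 'a"
    and b :: "'g \<Rightarrow> 'a \<Rightarrow> real"
  assumes T: "property_T \<Gamma>"
    and S_meas: "\<And>g. g \<in> carrier \<Gamma> \<Longrightarrow> S g \<in> measurable M M"
    and S_mult: "\<And>g h p. g \<in> carrier \<Gamma> \<Longrightarrow> h \<in> carrier \<Gamma> \<Longrightarrow> p \<in> space M \<Longrightarrow>
                   S (g \<otimes>\<^bsub>\<Gamma>\<^esub> h) p = S g (S h p)"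
    and S_one: "\<And>p. p \<in> space M \<Longrightarrow> S \<one>\<^bsub>\<Gamma>\<^esub> p = p"
    and S_le: "\<And>g f. g \<in> carrier \<Gamma> \<Longrightarrow> f \<in> borel_measurable M \<Longrightarrow>
                   (\<integral>\<^sup>+p. f (S g p) \<partial>M) \<le> (\<integral>\<^sup>+p. f p \<partial>M)"
    and b_L2: "\<And>g. g \<in> carrier \<Gamma> \<Longrightarrow> b g \<in> L2_fun M"
    and b_mult: "\<And>g h p. g \<in> carrier \<Gamma> \<Longrightarrow> h \<in> carrier \<Gamma> \<Longrightarrow> p \<in> space M \<Longrightarrow>
                   b (g \<otimes>\<^bsub>\<Gamma>\<^esub> h) p = b h p + b g (S h p)"
  shows "\<exists>\<xi>\<in>L2_fun M. \<forall>g\<in>carrier \<Gamma>. AE p in M. b g p = \<xi> (S g p) - \<xi> p"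
proof -
  interpret \<Gamma>: group \<Gamma> using T by (simp add: property_T_def)
  interpret H: real_hilbert_space "L2_module M" "L2_ip M" by (rule L2_hilbert)
  have Ssp: "S g p \<in> space M" if "g \<in> carrier \<Gamma>" "p \<in> space M" for g p
    using S_meas[OF that(1)] that(2) by (rule measurable_space)
  have S_inv: "S (inv\<^bsub>\<Gamma>\<^esub> g) (S g p) = p" "S g (S (inv\<^bsub>\<Gamma>\<^esub> g) p) = p" if "g \<in> carrier \<Gamma>" "p \<in> space M" for g p
    using S_mult[of "inv\<^bsub>\<Gamma>\<^esub> g" g p] S_mult[of g "inv\<^bsub>\<Gamma>\<^esub> g" p] that S_one by auto
  have S_eq: "(\<integral>\<^sup>+p. f (S g p) \<partial>M) = (\<integral>\<^sup>+p. f p \<partial>M)" if g: "g \<in> carrier \<Gamma>" and f: "f \<in> borel_measurable M"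
    for g and f :: "'a \<Rightarrow> ennreal"
  proof (rule antisym[OF S_le[OF g f]])
    have "(\<integral>\<^sup>+p. f p \<partial>M) = (\<integral>\<^sup>+p. f (S g (S (inv\<^bsub>\<Gamma>\<^esub> g) p)) \<partial>M)"
      using g by (intro nn_integral_cong) (simp add: S_inv)
    also have "\<dots> \<le> (\<integral>\<^sup>+p. f (S g p) \<partial>M)"
      using g f S_meas[OF g] by (intro S_le[of "inv\<^bsub>\<Gamma>\<^esub> g" "\<lambda>p. f (S g p)"]) (auto intro: measurable_compose)
    finally show "(\<integral>\<^sup>+p. f p \<partial>M) \<le> (\<integral>\<^sup>+p. f (S g p) \<partial>M)" .
  qed
  have S_AE: "AE p in M. P (S g p)" if g: "g \<in> carrier \<Gamma>" and P: "AE p in M. P p" for g P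
    by (rule AE_compose_nonincreasing[OF S_meas[OF g] S_le[OF g] P])
  have comp_L2: "(\<lambda>p. f (S g p)) \<in> L2_fun M" "(\<integral>p. (f (S g p))\<^sup>2 \<partial>M) = (\<integral>p. (f p)\<^sup>2 \<partial>M)"
    if g: "g \<in> carrier \<Gamma>" and f: "f \<in> L2_fun M" for g f
  proof -
    have fm: "f \<in> borel_measurable M" using f by (rule L2_fun_measurable)
    then have fm2: "(\<lambda>p. ennreal ((f p)\<^sup>2)) \<in> borel_measurable M" by measurable
    have fgm: "(\<lambda>p. f (S g p)) \<in> borel_measurable M" using measurable_compose[OF S_meas[OF g] fm] .
    have eq: "(\<integral>\<^sup>+p. ennreal ((f (S g p))\<^sup>2) \<partial>M) = (\<integral>\<^sup>+p. ennreal ((f p)\<^sup>2) \<partial>M)"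
      by (rule S_eq[OF g fm2])
    then show *: "(\<lambda>p. f (S g p)) \<in> L2_fun M"
      using L2_fun_iff_finite[OF fgm] L2_fun_iff_finite[OF fm] f by simp
    show "(\<integral>p. (f (S g p))\<^sup>2 \<partial>M) = (\<integral>p. (f p)\<^sup>2 \<partial>M)"
      using eq unfolding L2_fun_nn_integral[OF *] L2_fun_nn_integral[OF f]
      by (simp add: ennreal_inj Bochner_Integration.integral_nonneg)
  qed
  let ?E = "carrier (L2_module M)"
  define \<alpha> where "\<alpha> g = (\<lambda>a\<in>?E. L2_class M (\<lambda>p. L2_rep a (S (inv\<^bsub>\<Gamma>\<^esub> g) p) - b (inv\<^bsub>\<Gamma>\<^esub> g) p))" for g
  have \<alpha>_class: "\<alpha> g (L2_class M f) = L2_class M (\<lambda>p. f (S (inv\<^bsub>\<Gamma>\<^esub> g) p) - b (inv\<^bsub>\<Gamma>\<^esub> g) p)"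
    if g: "g \<in> carrier \<Gamma>" and f: "f \<in> L2_fun M" for g f
  proof -
    have "AE p in M. L2_rep (L2_class M f) (S (inv\<^bsub>\<Gamma>\<^esub> g) p) = f (S (inv\<^bsub>\<Gamma>\<^esub> g) p)"
      using S_AE[OF _ L2_rep_class(2)[OF L2_fun_measurable[OF f]]] g by simp
    then have "L2_class M (\<lambda>p. L2_rep (L2_class M f) (S (inv\<^bsub>\<Gamma>\<^esub> g) p) - b (inv\<^bsub>\<Gamma>\<^esub> g) p) =
        L2_class M (\<lambda>p. f (S (inv\<^bsub>\<Gamma>\<^esub> g) p) - b (inv\<^bsub>\<Gamma>\<^esub> g) p)"
      by (intro L2_class_eqI) auto
    then show ?thesis using f by (simp add: \<alpha>_def L2_carrier)
  qed
  have \<alpha>_L2: "(\<lambda>p. f (S (inv\<^bsub>\<Gamma>\<^esub> g) p) - b (inv\<^bsub>\<Gamma>\<^esub> g) p) \<in> L2_fun M"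
    if "g \<in> carrier \<Gamma>" "f \<in> L2_fun M" for g f
    using that by (intro L2_fun_diff comp_L2 b_L2) auto
  have \<alpha>_cl: "\<alpha> g a \<in> ?E" if "g \<in> carrier \<Gamma>" "a \<in> ?E" for g a
    using that \<alpha>_L2 by (auto simp: L2_carrier \<alpha>_class)
  have \<alpha>_mult: "\<alpha> (g \<otimes>\<^bsub>\<Gamma>\<^esub> h) a = \<alpha> g (\<alpha> h a)" if gh: "g \<in> carrier \<Gamma>" "h \<in> carrier \<Gamma>" and a: "a \<in> ?E" for g h a
  proof -
    obtain f where f: "f \<in> L2_fun M" "a = L2_class M f" using a by (auto simp: L2_carrier)
    have "L2_class M (\<lambda>p. f (S (inv\<^bsub>\<Gamma>\<^esub> (g \<otimes>\<^bsub>\<Gamma>\<^esub> h)) p) - b (inv\<^bsub>\<Gamma>\<^esub> (g \<otimes>\<^bsub>\<Gamma>\<^esub> h)) p) =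
      L2_class M (\<lambda>p. f (S (inv\<^bsub>\<Gamma>\<^esub> h) (S (inv\<^bsub>\<Gamma>\<^esub> g) p)) - b (inv\<^bsub>\<Gamma>\<^esub> h) (S (inv\<^bsub>\<Gamma>\<^esub> g) p) - b (inv\<^bsub>\<Gamma>\<^esub> g) p)"
      using gh by (intro L2_class_eqI AE_I2) (simp add: \<Gamma>.inv_mult_group S_mult b_mult)
    then show ?thesis using gh f \<alpha>_L2[OF gh(2) f(1)] by (simp add: \<alpha>_class)
  qed
  have b_one: "b \<one>\<^bsub>\<Gamma>\<^esub> p = 0" if "p \<in> space M" for p
    using b_mult[of "\<one>\<^bsub>\<Gamma>\<^esub>" "\<one>\<^bsub>\<Gamma>\<^esub>" p] that S_one by simp
  have \<alpha>_one: "\<alpha> \<one>\<^bsub>\<Gamma>\<^esub> a = a" if a: "a \<in> ?E" for a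
  proof -
    obtain f where f: "f \<in> L2_fun M" "a = L2_class M f" using a by (auto simp: L2_carrier)
    have "L2_class M (\<lambda>p. f (S \<one>\<^bsub>\<Gamma>\<^esub> p) - b \<one>\<^bsub>\<Gamma>\<^esub> p) = L2_class M f"
      by (intro L2_class_eqI AE_I2) (simp add: S_one b_one)
    then show ?thesis using f by (simp add: \<alpha>_class)
  qed
  have bij: "\<alpha> g \<in> Bij ?E" if g: "g \<in> carrier \<Gamma>" for g
  proof -
    have "\<alpha> (inv\<^bsub>\<Gamma>\<^esub> g) (\<alpha> g a) = a" "\<alpha> g (\<alpha> (inv\<^bsub>\<Gamma>\<^esub> g) a) = a" if "a \<in> ?E" for a
      using that g by (simp_all flip: \<alpha>_mult add: \<alpha>_one)
    then have "bij_betw (\<alpha> g) ?E ?E"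
      using \<alpha>_cl g by (intro bij_betw_byWitness[of _ "\<alpha> (inv\<^bsub>\<Gamma>\<^esub> g)"]) auto
    then show ?thesis by (simp add: Bij_def \<alpha>_def)
  qed
  have "group_hom \<Gamma> (BijGroup ?E) \<alpha>"
  proof (rule group_hom.intro[OF \<Gamma>.group_axioms group_BijGroup], unfold_locales, rule homI)
    show "\<alpha> g \<in> carrier (BijGroup ?E)" if "g \<in> carrier \<Gamma>" for g
      using bij that by (simp add: BijGroup_def)
    show "\<alpha> (g \<otimes>\<^bsub>\<Gamma>\<^esub> h) = \<alpha> g \<otimes>\<^bsub>BijGroup ?E\<^esub> \<alpha> h"
      if gh: "g \<in> carrier \<Gamma>" "h \<in> carrier \<Gamma>" for g h
    proof -
      have "\<alpha> (g \<otimes>\<^bsub>\<Gamma>\<^esub> h) = compose ?E (\<alpha> g) (\<alpha> h)"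
      proof (rule extensionalityI[of _ ?E])
        show "\<alpha> (g \<otimes>\<^bsub>\<Gamma>\<^esub> h) \<in> extensional ?E" by (simp add: \<alpha>_def)
        show "compose ?E (\<alpha> g) (\<alpha> h) \<in> extensional ?E" by (simp add: compose_def)
        show "\<alpha> (g \<otimes>\<^bsub>\<Gamma>\<^esub> h) a = compose ?E (\<alpha> g) (\<alpha> h) a" if "a \<in> ?E" for a
          using \<alpha>_mult[OF gh that] that by (simp add: compose_eq)
      qed
      then show ?thesis using bij gh by (simp add: BijGroup_def)
    qed
  qed
  then have ga: "group_action \<Gamma> ?E \<alpha>" by (simp add: group_action_def)
  have "affine_isometric_action \<Gamma> (L2_module M) (L2_ip M) \<alpha>"
    unfolding affine_isometric_action_def
  proof (intro conjI ballI allI ga)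
    fix g a a' t assume g: "g \<in> carrier \<Gamma>" and a: "a \<in> ?E" "a' \<in> ?E"
    obtain f where f1: "f \<in> L2_fun M" "a = L2_class M f" using a(1) by (auto simp: L2_carrier)
    obtain f' where f2: "f' \<in> L2_fun M" "a' = L2_class M f'" using a(2) by (auto simp: L2_carrier)
    note f = f1 f2
    note L = \<alpha>_L2[OF g f(1)] \<alpha>_L2[OF g f(3)]
    note Lt = L2_fun_scale[OF f(1), of "1 - t"] L2_fun_scale[OF f(3), of t]
    note Lt' = L2_fun_scale[OF L(1), of "1 - t"] L2_fun_scale[OF L(2), of t]
    have "((1 - t) \<odot>\<^bsub>L2_module M\<^esub> a) \<oplus>\<^bsub>L2_module M\<^esub> (t \<odot>\<^bsub>L2_module M\<^esub> a') =
        L2_class M (\<lambda>x. (1 - t) * f x + t * f' x)"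
      by (simp only: f(2,4) L2_smult_class[OF f(1)] L2_smult_class[OF f(3)] L2_add_class[OF Lt])
    then have 1: "\<alpha> g (((1 - t) \<odot>\<^bsub>L2_module M\<^esub> a) \<oplus>\<^bsub>L2_module M\<^esub> (t \<odot>\<^bsub>L2_module M\<^esub> a')) =
        L2_class M (\<lambda>p. (1 - t) * f (S (inv\<^bsub>\<Gamma>\<^esub> g) p) + t * f' (S (inv\<^bsub>\<Gamma>\<^esub> g) p) - b (inv\<^bsub>\<Gamma>\<^esub> g) p)"
      by (simp only: \<alpha>_class[OF g L2_fun_add[OF Lt]])
    have 2: "((1 - t) \<odot>\<^bsub>L2_module M\<^esub> \<alpha> g a) \<oplus>\<^bsub>L2_module M\<^esub> (t \<odot>\<^bsub>L2_module M\<^esub> \<alpha> g a') =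
        L2_class M (\<lambda>p. (1 - t) * (f (S (inv\<^bsub>\<Gamma>\<^esub> g) p) - b (inv\<^bsub>\<Gamma>\<^esub> g) p) + t * (f' (S (inv\<^bsub>\<Gamma>\<^esub> g) p) - b (inv\<^bsub>\<Gamma>\<^esub> g) p))"
      by (simp only: f(2,4) \<alpha>_class[OF g f(1)] \<alpha>_class[OF g f(3)] L2_smult_class[OF L(1)] L2_smult_class[OF L(2)]
          L2_add_class[OF Lt'])
    show "\<alpha> g (((1 - t) \<odot>\<^bsub>L2_module M\<^esub> a) \<oplus>\<^bsub>L2_module M\<^esub> (t \<odot>\<^bsub>L2_module M\<^esub> a')) =
          ((1 - t) \<odot>\<^bsub>L2_module M\<^esub> \<alpha> g a) \<oplus>\<^bsub>L2_module M\<^esub> (t \<odot>\<^bsub>L2_module M\<^esub> \<alpha> g a')"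
      unfolding 1 2 by (intro L2_class_eqI AE_I2) (simp add: algebra_simps)
    have "hnorm (L2_ip M) (\<alpha> g a \<ominus>\<^bsub>L2_module M\<^esub> \<alpha> g a') =
        sqrt (\<integral>p. (f (S (inv\<^bsub>\<Gamma>\<^esub> g) p) - b (inv\<^bsub>\<Gamma>\<^esub> g) p - (f' (S (inv\<^bsub>\<Gamma>\<^esub> g) p) - b (inv\<^bsub>\<Gamma>\<^esub> g) p))\<^sup>2 \<partial>M)"
      by (simp only: f(2,4) \<alpha>_class[OF g f(1)] \<alpha>_class[OF g f(3)] L2_hnorm_diff[OF L])
    also have "\<dots> = sqrt (\<integral>p. (f p - f' p)\<^sup>2 \<partial>M)"
      using comp_L2(2)[OF \<Gamma>.inv_closed[OF g] L2_fun_diff[OF f(1,3)]] by simp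
    also have "\<dots> = hnorm (L2_ip M) (a \<ominus>\<^bsub>L2_module M\<^esub> a')"
      by (simp only: f(2,4) L2_hnorm_diff[OF f(1,3)])
    finally show "hnorm (L2_ip M) (\<alpha> g a \<ominus>\<^bsub>L2_module M\<^esub> \<alpha> g a') = hnorm (L2_ip M) (a \<ominus>\<^bsub>L2_module M\<^esub> a')" .
  qed
  from property_T_fixed_point[OF T L2_hilbert this]
  obtain a where a: "a \<in> ?E" "\<And>g. g \<in> carrier \<Gamma> \<Longrightarrow> \<alpha> g a = a" by blast
  obtain f where f: "f \<in> L2_fun M" "a = L2_class M f" using a(1) by (auto simp: L2_carrier)
  have "AE p in M. b g p = f (S g p) - f p" if g: "g \<in> carrier \<Gamma>" for g
  proof -
    \<comment> \<open>The fixed-point equation is used for the inverse of \<open>g\<close>, where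
      \<open>S g\<close> and \<open>b g\<close> themselves appear.\<close>
    have "L2_class M f = \<alpha> (inv\<^bsub>\<Gamma>\<^esub> g) (L2_class M f)"
      using a(2)[of "inv\<^bsub>\<Gamma>\<^esub> g"] g f(2) by simp
    also have "\<dots> = L2_class M (\<lambda>p. f (S g p) - b g p)"
      using \<alpha>_class[of "inv\<^bsub>\<Gamma>\<^esub> g" f] g f(1) by simp
    finally have "L2_class M f = L2_class M (\<lambda>p. f (S g p) - b g p)" .
    from L2_class_eqD[OF this L2_fun_measurable[OF f(1)]] show ?thesis by eventually_elim simp
  qed
  then show ?thesis using f(1) by blast
qed

text \<open>The case of counting measure: finite support puts the cocycle into the Hilbert space,
  only the empty set is null, so the equation holds at every point, and a square summable function
  has finitely many values of size at least \<open>e\<close>.\<close>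

lemma property_T_finite_support_coboundary:
  fixes \<Gamma> :: "('g, 'm) monoid_scheme" and \<Omega> :: "'a set" and S :: "'g \<Rightarrow> 'a \<Rightarrow> 'a"
    and b :: "'g \<Rightarrow> 'a \<Rightarrow> real"
  assumes T: "property_T \<Gamma>"
    and S_cl: "\<And>g p. g \<in> carrier \<Gamma> \<Longrightarrow> p \<in> \<Omega> \<Longrightarrow> S g p \<in> \<Omega>"
    and S_mult: "\<And>g h p. g \<in> carrier \<Gamma> \<Longrightarrow> h \<in> carrier \<Gamma> \<Longrightarrow> p \<in> \<Omega> \<Longrightarrow> S (g \<otimes>\<^bsub>\<Gamma>\<^esub> h) p = S g (S h p)"
    and S_one: "\<And>p. p \<in> \<Omega> \<Longrightarrow> S \<one>\<^bsub>\<Gamma>\<^esub> p = p"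
    and b_fin: "\<And>g. g \<in> carrier \<Gamma> \<Longrightarrow> finite {p \<in> \<Omega>. b g p \<noteq> 0}"
    and b_mult: "\<And>g h p. g \<in> carrier \<Gamma> \<Longrightarrow> h \<in> carrier \<Gamma> \<Longrightarrow> p \<in> \<Omega> \<Longrightarrow>
                   b (g \<otimes>\<^bsub>\<Gamma>\<^esub> h) p = b h p + b g (S h p)"
  shows "\<exists>\<xi>. (\<forall>e>0. finite {p \<in> \<Omega>. e \<le> \<bar>\<xi> p\<bar>}) \<and>
     (\<forall>g\<in>carrier \<Gamma>. \<forall>p\<in>\<Omega>. b g p = \<xi> (S g p) - \<xi> p)"
proof -
  interpret \<Gamma>: group \<Gamma> using T by (simp add: property_T_def)
  let ?M = "count_space \<Omega>"
  have bij: "bij_betw (S g) \<Omega> \<Omega>" if g: "g \<in> carrier \<Gamma>" for g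
  proof (rule bij_betw_byWitness[of _ "S (inv\<^bsub>\<Gamma>\<^esub> g)"])
    show "\<forall>p\<in>\<Omega>. S (inv\<^bsub>\<Gamma>\<^esub> g) (S g p) = p" "\<forall>p\<in>\<Omega>. S g (S (inv\<^bsub>\<Gamma>\<^esub> g) p) = p"
      using g by (simp_all flip: S_mult add: S_one)
  qed (use S_cl g in auto)
  have "\<exists>\<xi>\<in>L2_fun ?M. \<forall>g\<in>carrier \<Gamma>. AE p in ?M. b g p = \<xi> (S g p) - \<xi> p"
  proof (rule property_T_L2_coboundary[OF T])
    show "S g \<in> measurable ?M ?M" if "g \<in> carrier \<Gamma>" for g using S_cl that by auto
    show "(\<integral>\<^sup>+p. f (S g p) \<partial>?M) \<le> (\<integral>\<^sup>+p. f p \<partial>?M)" if "g \<in> carrier \<Gamma>" for g and f :: "'a \<Rightarrow> ennreal"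
      using nn_integral_bij_count_space[OF bij[OF that], of f] by simp
    show "b g \<in> L2_fun ?M" if g: "g \<in> carrier \<Gamma>" for g
    proof -
      have "(\<integral>\<^sup>+p. ennreal ((b g p)\<^sup>2) \<partial>?M) = (\<Sum>p | p \<in> \<Omega> \<and> 0 < ennreal ((b g p)\<^sup>2). ennreal ((b g p)\<^sup>2))"
        using b_fin[OF g] by (intro nn_integral_count_space) (auto elim!: rev_finite_subset)
      also have "\<dots> < \<infinity>" by simp
      finally show ?thesis by (simp add: L2_fun_iff_finite)
    qed
  qed (simp_all add: S_mult S_one b_mult)
  then obtain \<xi> where \<xi>: "\<xi> \<in> L2_fun ?M" "\<And>g. g \<in> carrier \<Gamma> \<Longrightarrow> AE p in ?M. b g p = \<xi> (S g p) - \<xi> p"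
    by blast
  have "(\<integral>\<^sup>+p. ennreal ((\<xi> p)\<^sup>2) \<partial>?M) < \<infinity>" using \<xi>(1) by (subst L2_fun_iff_finite[symmetric]) auto
  then have "finite {p \<in> \<Omega>. e \<le> \<bar>\<xi> p\<bar>}" if "e > 0" for e
    using that by (rule finite_large_if_square_summable)
  then show ?thesis using \<xi>(2) by (intro exI[of _ \<xi>]) (auto simp: AE_count_space)
qed

text \<open>A homomorphism to the reals is a cocycle for the trivial action on one point, where
  every coboundary vanishes.\<close>

lemma property_T_hom_real_trivial:
  fixes \<Gamma> :: "('g, 'm) monoid_scheme" and r :: "'g \<Rightarrow> real"
  assumes T: "property_T \<Gamma>"
    and r: "\<And>g h. g \<in> carrier \<Gamma> \<Longrightarrow> h \<in> carrier \<Gamma> \<Longrightarrow> r (g \<otimes>\<^bsub>\<Gamma>\<^esub> h) = r g + r h"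
    and g: "g \<in> carrier \<Gamma>"
  shows "r g = 0"
proof -
  have "\<exists>\<xi>. (\<forall>e>0. finite {p \<in> {()}. e \<le> \<bar>\<xi> p\<bar>}) \<and> (\<forall>g\<in>carrier \<Gamma>. \<forall>p\<in>{()}. r g = \<xi> p - \<xi> p)"
    by (rule property_T_finite_support_coboundary[OF T]) (auto simp: r)
  then show ?thesis using g by auto
qed

lemma (in group) l_coset_subgroup_eq_iff:
  assumes "subgroup H G" "g \<in> carrier G"
  shows "g <# H = H \<longleftrightarrow> g \<in> H"
proof
  assume "g <# H = H"
  moreover have "g \<otimes> \<one> \<in> g <# H" using subgroup.one_closed[OF assms(1)] unfolding l_coset_def by blast
  ultimately show "g \<in> H" using assms(2) by simp
next
  assume "g \<in> H"
  then show "g <# H = H" using assms by (intro coset_join3) auto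
qed

text \<open>Enumerate the group and let \<open>H n\<close> be generated by the first elements. If
  every \<open>H n\<close> is proper, the group acts on the disjoint union of the coset spaces of
  the \<open>H n\<close>, and the indicator \<open>f\<close> of the base cosets has a finitely
  supported coboundary although \<open>f\<close> itself is not square summable. A square summable
  solution would have to vary by 1 on each of the infinitely many levels.\<close>

lemma property_T_finitely_generated:
  fixes \<Gamma> :: "('g, 'm) monoid_scheme"
  assumes T: "property_T \<Gamma>"
  shows "\<exists>E. finite E \<and> E \<subseteq> carrier \<Gamma> \<and> generate \<Gamma> E = carrier \<Gamma>"
proof (rule ccontr)
  assume nofg: "\<nexists>E. finite E \<and> E \<subseteq> carrier \<Gamma> \<and> generate \<Gamma> E = carrier \<Gamma>"
  interpret \<Gamma>: group \<Gamma> using T by (simp add: property_T_def)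
  define e where "e = from_nat_into (carrier \<Gamma>)"
  have e: "range e = carrier \<Gamma>"
    unfolding e_def using T \<Gamma>.carrier_not_empty by (simp add: property_T_def)
  define H where "H n = generate \<Gamma> (e ` {..n})" for n
  have eC: "e ` {..n} \<subseteq> carrier \<Gamma>" for n using e by auto
  have H: "subgroup (H n) \<Gamma>" for n unfolding H_def using eC by (rule \<Gamma>.generate_is_subgroup)
  have HC: "H n \<subseteq> carrier \<Gamma>" for n using H by (rule subgroup.subset)
  have "H n \<noteq> carrier \<Gamma>" for n using nofg eC unfolding H_def by blast
  then have "\<exists>a. a \<in> carrier \<Gamma> \<and> a \<notin> H n" for n using HC by blast
  then obtain a where a: "\<And>n. a n \<in> carrier \<Gamma>" "\<And>n. a n \<notin> H n" by metis
  have e_in: "e n \<in> H m" if "n \<le> m" for n m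
    unfolding H_def using that by (intro generate.incl) auto
  define \<Omega> where "\<Omega> = {(n, h <#\<^bsub>\<Gamma>\<^esub> H n) | n h. h \<in> carrier \<Gamma>}"
  define S where "S g p = (fst p, g <#\<^bsub>\<Gamma>\<^esub> snd p)" for g and p :: "nat \<times> 'g set"
  define f :: "nat \<times> 'g set \<Rightarrow> real" where "f p = (if snd p = H (fst p) then 1 else 0)" for p
  have sub: "snd p \<subseteq> carrier \<Gamma>" if "p \<in> \<Omega>" for p
  proof -
    obtain n h where "p = (n, h <#\<^bsub>\<Gamma>\<^esub> H n)" "h \<in> carrier \<Gamma>" using \<open>p \<in> \<Omega>\<close> unfolding \<Omega>_def by blast
    then show ?thesis using \<Gamma>.l_coset_subset_G[OF HC] by simp
  qed
  have S_cl: "S g p \<in> \<Omega>" if g: "g \<in> carrier \<Gamma>" and p: "p \<in> \<Omega>" for g p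
  proof -
    obtain n h where h: "p = (n, h <#\<^bsub>\<Gamma>\<^esub> H n)" "h \<in> carrier \<Gamma>" using p unfolding \<Omega>_def by blast
    have "S g p = (n, (g \<otimes>\<^bsub>\<Gamma>\<^esub> h) <#\<^bsub>\<Gamma>\<^esub> H n)" using h g HC[of n] by (simp add: S_def \<Gamma>.lcos_m_assoc)
    then show ?thesis using h g unfolding \<Omega>_def by blast
  qed
  have S_mult: "S (g \<otimes>\<^bsub>\<Gamma>\<^esub> h) p = S g (S h p)" if "g \<in> carrier \<Gamma>" "h \<in> carrier \<Gamma>" "p \<in> \<Omega>" for g h p
    using that sub by (simp add: S_def \<Gamma>.lcos_m_assoc)
  have S_one: "S \<one>\<^bsub>\<Gamma>\<^esub> p = p" if "p \<in> \<Omega>" for p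
    using sub[OF that] by (simp add: S_def \<Gamma>.lcos_mult_one)
  have "\<exists>\<xi>. (\<forall>e>0. finite {p \<in> \<Omega>. e \<le> \<bar>\<xi> p\<bar>}) \<and> (\<forall>g\<in>carrier \<Gamma>. \<forall>p\<in>\<Omega>. f (S g p) - f p = \<xi> (S g p) - \<xi> p)"
  proof (rule property_T_finite_support_coboundary[OF T S_cl S_mult S_one])
    fix g assume g: "g \<in> carrier \<Gamma>"
    then obtain n where n: "g = e n" using e by auto
    \<comment> \<open>An element \<open>e n\<close> lies in \<open>H m\<close> for every
      \<open>m \<ge> n\<close> and fixes the base coset there. On each lower level \<open>f\<close>
      changes at most at the base coset and at its preimage.\<close>
    have "{p \<in> \<Omega>. f (S g p) - f p \<noteq> 0} \<subseteq> (\<lambda>m. (m, H m)) ` {..<n} \<union> (\<lambda>m. (m, inv\<^bsub>\<Gamma>\<^esub> g <#\<^bsub>\<Gamma>\<^esub> H m)) ` {..<n}"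
    proof clarsimp
      fix m C assume p: "(m, C) \<in> \<Omega>" and ne: "f (S g (m, C)) \<noteq> f (m, C)"
        and 2: "(m, C) \<notin> (\<lambda>m. (m, inv\<^bsub>\<Gamma>\<^esub> g <#\<^bsub>\<Gamma>\<^esub> H m)) ` {..<n}"
      have C: "C \<subseteq> carrier \<Gamma>" using sub[OF p] by simp
      have gC: "C = inv\<^bsub>\<Gamma>\<^esub> g <#\<^bsub>\<Gamma>\<^esub> (g <#\<^bsub>\<Gamma>\<^esub> C)" using C g by (simp add: \<Gamma>.lcos_m_assoc \<Gamma>.lcos_mult_one)
      have "m < n"
      proof (rule ccontr)
        assume "\<not> m < n"
        then have gH: "g \<in> H m" using e_in n by simp
        then have 3: "g <#\<^bsub>\<Gamma>\<^esub> H m = H m" "inv\<^bsub>\<Gamma>\<^esub> g <#\<^bsub>\<Gamma>\<^esub> H m = H m"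
          using g \<Gamma>.l_coset_subgroup_eq_iff[OF H] subgroup.m_inv_closed[OF H] by auto
        have "g <#\<^bsub>\<Gamma>\<^esub> C = H m \<longleftrightarrow> C = H m" using gC 3 by metis
        then show False using ne by (simp add: f_def S_def)
      qed
      moreover have "C = H m \<or> C = inv\<^bsub>\<Gamma>\<^esub> g <#\<^bsub>\<Gamma>\<^esub> H m"
        using ne gC by (auto simp: f_def S_def split: if_splits)
      ultimately show "(m, C) \<in> (\<lambda>m. (m, H m)) ` {..<n}" using 2 by auto
    qed
    then show "finite {p \<in> \<Omega>. f (S g p) - f p \<noteq> 0}" by (rule finite_subset) auto
  qed (auto simp: S_mult)
  then obtain \<xi> where \<xi>: "\<And>d. d > 0 \<Longrightarrow> finite {p \<in> \<Omega>. d \<le> \<bar>\<xi> p\<bar>}"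
    "\<And>g p. g \<in> carrier \<Gamma> \<Longrightarrow> p \<in> \<Omega> \<Longrightarrow> f (S g p) - f p = \<xi> (S g p) - \<xi> p" by blast
  have "\<exists>C. (n, C) \<in> {p \<in> \<Omega>. 1/2 \<le> \<bar>\<xi> p\<bar>}" for n
  proof -
    have "(n, \<one>\<^bsub>\<Gamma>\<^esub> <#\<^bsub>\<Gamma>\<^esub> H n) \<in> \<Omega>" and p2: "(n, a n <#\<^bsub>\<Gamma>\<^esub> H n) \<in> \<Omega>"
      using a(1)[of n] \<Gamma>.one_closed unfolding \<Omega>_def by blast+
    then have p: "(n, H n) \<in> \<Omega>" by (simp only: \<Gamma>.lcos_mult_one[OF HC])
    have "f (n, H n) = 1" "f (n, a n <#\<^bsub>\<Gamma>\<^esub> H n) = 0"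
      using \<Gamma>.l_coset_subgroup_eq_iff[OF H a(1)] a(2) by (simp_all add: f_def)
    then have "\<xi> (n, H n) - \<xi> (n, a n <#\<^bsub>\<Gamma>\<^esub> H n) = 1"
      using \<xi>(2)[OF a(1) p, of n] by (simp add: S_def)
    then have "1/2 \<le> \<bar>\<xi> (n, H n)\<bar> \<or> 1/2 \<le> \<bar>\<xi> (n, a n <#\<^bsub>\<Gamma>\<^esub> H n)\<bar>" by linarith
    then show ?thesis using p p2 by blast
  qed
  then have "n \<in> fst ` {p \<in> \<Omega>. 1/2 \<le> \<bar>\<xi> p\<bar>}" for n by (metis fst_conv imageI)
  then have "UNIV \<subseteq> fst ` {p \<in> \<Omega>. 1/2 \<le> \<bar>\<xi> p\<bar>}" by blast
  moreover have "finite (fst ` {p \<in> \<Omega>. 1/2 \<le> \<bar>\<xi> p\<bar>})" using \<xi>(1)[of "1/2"] by simp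
  ultimately show False using finite_subset by (metis infinite_UNIV_nat)
qed

section \<open>Subgroups of finite index\<close>

definition finite_index :: "('g, 'm) monoid_scheme \<Rightarrow> 'g set \<Rightarrow> bool" where
  "finite_index G N \<longleftrightarrow> subgroup N G \<and>
     (\<exists>R. finite R \<and> R \<subseteq> carrier G \<and> (\<forall>g\<in>carrier G. \<exists>r\<in>R. inv\<^bsub>G\<^esub> r \<otimes>\<^bsub>G\<^esub> g \<in> N))"

context group
begin

lemma finite_indexI:
  assumes "subgroup N G" "finite (\<kappa> ` carrier G)"
    and "\<And>f g. f \<in> carrier G \<Longrightarrow> g \<in> carrier G \<Longrightarrow> \<kappa> f = \<kappa> g \<Longrightarrow> inv f \<otimes> g \<in> N"
  shows "finite_index G N"
proof -
  obtain R where R: "R \<subseteq> carrier G" "finite R" "\<kappa> ` carrier G = \<kappa> ` R"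
    using finite_subset_image[OF assms(2) subset_refl] by blast
  have "\<exists>r\<in>R. inv r \<otimes> g \<in> N" if g: "g \<in> carrier G" for g
  proof -
    obtain r where "r \<in> R" "\<kappa> r = \<kappa> g" using R(3) g by (metis imageE imageI)
    then show ?thesis using R(1) g assms(3) by blast
  qed
  then show ?thesis using assms(1) R unfolding finite_index_def by blast
qed

text \<open>Recording the coset of an element modulo each subgroup maps the group to a finite
  product; the map is injective because the subgroups intersect trivially.\<close>

lemma finite_if_finite_index_Int_trivial:
  assumes "finite I" "\<And>i. i \<in> I \<Longrightarrow> finite_index G (N i)"
    and "\<And>g. g \<in> carrier G \<Longrightarrow> (\<And>i. i \<in> I \<Longrightarrow> g \<in> N i) \<Longrightarrow> g = \<one>"
  shows "finite (carrier G)"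
proof -
  have "\<forall>i\<in>I. \<exists>R. finite R \<and> R \<subseteq> carrier G \<and> (\<forall>g\<in>carrier G. \<exists>r\<in>R. inv r \<otimes> g \<in> N i)"
    using assms(2) by (simp add: finite_index_def)
  then obtain R where R: "\<And>i. i \<in> I \<Longrightarrow> finite (R i)" "\<And>i. i \<in> I \<Longrightarrow> R i \<subseteq> carrier G"
    "\<And>i g. i \<in> I \<Longrightarrow> g \<in> carrier G \<Longrightarrow> \<exists>r\<in>R i. inv r \<otimes> g \<in> N i" by metis
  define \<kappa> where "\<kappa> g = (\<lambda>i\<in>I. SOME r. r \<in> R i \<and> inv r \<otimes> g \<in> N i)" for g
  have \<kappa>: "\<kappa> g i \<in> R i \<and> inv (\<kappa> g i) \<otimes> g \<in> N i" if "g \<in> carrier G" "i \<in> I" for g i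
  proof -
    have "\<exists>r. r \<in> R i \<and> inv r \<otimes> g \<in> N i" using R(3)[OF that(2,1)] by blast
    from someI_ex[OF this] show ?thesis using that(2) by (simp only: \<kappa>_def restrict_apply' if_True)
  qed
  have "\<kappa> g \<in> PiE I R" if "g \<in> carrier G" for g
    using \<kappa>[OF that] by (intro PiE_I) (auto simp: \<kappa>_def)
  then have "\<kappa> ` carrier G \<subseteq> PiE I R" by blast
  then have fin: "finite (\<kappa> ` carrier G)"
    by (rule finite_subset) (intro finite_PiE assms(1) R(1))
  have "inj_on \<kappa> (carrier G)"
  proof (rule inj_onI)
    fix f g assume fg: "f \<in> carrier G" "g \<in> carrier G" "\<kappa> f = \<kappa> g"
    have "inv f \<otimes> g \<in> N i" if i: "i \<in> I" for i
    proof -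
      have Ni: "subgroup (N i) G" using assms(2)[OF i] by (simp add: finite_index_def)
      define r where "r = \<kappa> g i"
      have r: "r \<in> carrier G" "inv r \<otimes> g \<in> N i" "inv r \<otimes> f \<in> N i"
        using \<kappa>[OF fg(2) i] \<kappa>[OF fg(1) i] R(2)[OF i] unfolding r_def fg(3) by blast+
      have "inv (inv r \<otimes> f) \<otimes> (inv r \<otimes> g) \<in> N i"
        using r Ni by (simp add: subgroup.m_closed subgroup.m_inv_closed)
      also have "inv (inv r \<otimes> f) \<otimes> (inv r \<otimes> g) = inv f \<otimes> g"
        using r(1) fg(1,2) by (simp add: inv_mult_group m_assoc) (simp flip: m_assoc)
      finally show ?thesis .
    qed
    then have "inv f \<otimes> g = \<one>" using fg by (intro assms(3)) auto
    then show "f = g" using fg by (metis inv_equality inv_inv inv_closed)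
  qed
  then show ?thesis using fin by (rule finite_imageD[rotated])
qed

text \<open>Schreier's argument: push a letter past a coset representative,
  \<open>s \<otimes> b = a \<otimes> n\<close> with \<open>n\<close> in the subgroup. The finitely
  many elements \<open>n\<close> that can arise generate it.\<close>

lemma finite_index_finitely_generated:
  assumes E: "finite E" "E \<subseteq> carrier G" "generate G E = carrier G" and N: "finite_index G N"
  shows "\<exists>F. finite F \<and> F \<subseteq> N \<and> generate G F = N"
proof -
  obtain R0 where R0: "finite R0" "R0 \<subseteq> carrier G" "\<And>g. g \<in> carrier G \<Longrightarrow> \<exists>r\<in>R0. inv r \<otimes> g \<in> N"
    and Ns: "subgroup N G" using N unfolding finite_index_def by blast
  \<comment> \<open>The unit in \<open>R\<close> is the starting point of the rewriting of words;
    together with the unit in \<open>E'\<close> it also puts those representatives that lie in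
    \<open>N\<close> among the generators.\<close>
  define R where "R = insert \<one> R0"
  define E' where "E' = insert \<one> (E \<union> (\<lambda>x. inv x) ` E)"
  define F where "F = (\<lambda>(a, s, b). inv a \<otimes> (s \<otimes> b)) ` (R \<times> E' \<times> R) \<inter> N"
  have R: "finite R" "R \<subseteq> carrier G" "\<one> \<in> R" using R0 by (auto simp: R_def)
  have E': "finite E'" "E' \<subseteq> carrier G" using E by (auto simp: E'_def)
  have FN: "F \<subseteq> N" by (auto simp: F_def)
  have NC: "N \<subseteq> carrier G" using Ns by (rule subgroup.subset)
  then have FC: "F \<subseteq> carrier G" using FN by blast
  have sub: "generate G F \<subseteq> N" using FN Ns by (rule generate_subgroup_incl)
  have gF: "subgroup (generate G F) G" using FC by (rule generate_is_subgroup)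
  have step: "\<exists>r\<in>R. \<exists>n\<in>generate G F. s \<otimes> g = r \<otimes> n"
    if s: "s \<in> E'" and g: "\<exists>r\<in>R. \<exists>n\<in>generate G F. g = r \<otimes> n" for s g
  proof -
    obtain b n where b: "b \<in> R" "n \<in> generate G F" "g = b \<otimes> n" using g by blast
    have c: "s \<in> carrier G" "b \<in> carrier G" "n \<in> carrier G"
      using s b E' R sub NC by auto
    obtain a where a: "a \<in> R" "inv a \<otimes> (s \<otimes> b) \<in> N"
      using R0(3)[of "s \<otimes> b"] c by (auto simp: R_def)
    have aC: "a \<in> carrier G" using a R by auto
    have "inv a \<otimes> (s \<otimes> b) \<in> F" unfolding F_def using a s b(1)
      by (intro IntI image_eqI[of _ _ "(a, s, b)"]) auto
    from subgroup.m_closed[OF gF generate.incl[OF this] b(2)]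
    have "inv a \<otimes> (s \<otimes> b) \<otimes> n \<in> generate G F" .
    moreover have "s \<otimes> g = a \<otimes> (inv a \<otimes> (s \<otimes> b) \<otimes> n)"
      unfolding b(3) using c aC by (simp flip: m_assoc)
    ultimately show ?thesis using a(1) by blast
  qed
  have rep: "\<exists>r\<in>R. \<exists>n\<in>generate G F. g = r \<otimes> n" if "g \<in> generate G E" for g
  proof -
    have "\<exists>r\<in>R. \<exists>n\<in>generate G F. g \<otimes> x = r \<otimes> n"
      if "g \<in> generate G E" "x \<in> carrier G" "\<exists>r\<in>R. \<exists>n\<in>generate G F. x = r \<otimes> n" for g x
      using that
    proof (induction arbitrary: x)
      case one
      show ?case unfolding l_one[OF one.prems(1)] by (rule one.prems(2))
    next
      case (incl h)
      have "h \<in> E'" using incl.hyps by (simp add: E'_def)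
      from step[OF this incl.prems(2)] show ?case .
    next
      case (inv h)
      have "inv h \<in> E'" using inv.hyps by (simp add: E'_def)
      from step[OF this inv.prems(2)] show ?case .
    next
      case (eng h1 h2)
      have c: "h1 \<in> carrier G" "h2 \<in> carrier G" using eng.hyps E by auto
      have "h2 \<otimes> x \<in> carrier G" using c eng.prems(1) by simp
      from eng.IH(1)[OF this eng.IH(2)[OF eng.prems]] show ?case
        unfolding m_assoc[OF c eng.prems(1)] .
    qed
    from this[OF \<open>g \<in> generate G E\<close> one_closed]
    have "(\<exists>r\<in>R. \<exists>n\<in>generate G F. \<one> = r \<otimes> n) \<Longrightarrow> \<exists>r\<in>R. \<exists>n\<in>generate G F. g \<otimes> \<one> = r \<otimes> n" .
    moreover have "\<exists>r\<in>R. \<exists>n\<in>generate G F. \<one> = r \<otimes> n"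
      using R(3) generate.one[of G F] by (intro bexI[of _ \<one>]) simp_all
    ultimately have "\<exists>r\<in>R. \<exists>n\<in>generate G F. g \<otimes> \<one> = r \<otimes> n" by blast
    moreover have "g \<otimes> \<one> = g" using \<open>g \<in> generate G E\<close> E(3) by (intro r_one) simp
    ultimately show ?thesis by simp
  qed
  have "N \<subseteq> generate G F"
  proof
    fix g assume g: "g \<in> N"
    then have gC: "g \<in> carrier G" using NC by auto
    then obtain r n where rn: "r \<in> R" "n \<in> generate G F" "g = r \<otimes> n" using rep[of g] unfolding E(3) by blast
    have nN: "n \<in> N" using rn sub by auto
    have c: "r \<in> carrier G" "n \<in> carrier G" using rn R nN NC by auto
    have "r = g \<otimes> inv n" using rn c by (simp add: m_assoc)
    then have "r \<in> N" using g nN Ns by (simp add: subgroup.m_closed subgroup.m_inv_closed)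
    moreover have "r = inv \<one> \<otimes> (\<one> \<otimes> r)" using c by simp
    ultimately have "r \<in> F" unfolding F_def using rn R
      by (intro IntI image_eqI[of _ _ "(\<one>, \<one>, r)"]) (auto simp: E'_def)
    from subgroup.m_closed[OF gF generate.incl[OF this] rn(2)]
    show "g \<in> generate G F" using rn(3) by simp
  qed
  moreover have "finite F" unfolding F_def using R E' by auto
  ultimately show ?thesis using sub FN by blast
qed

end

section \<open>Rational-linear functionals on the reals\<close>

interpretation Q_real: vector_space "\<lambda>q x. real_of_rat q * x"
  by unfold_locales (auto simp: algebra_simps of_rat_add of_rat_mult)

text \<open>The coordinate at \<open>a\<close> in a Hamel basis through \<open>w\<close> and
  \<open>a\<close>. It serves to turn a homomorphism to the reals modulo \<open>w\<close> into one
  to the reals without losing its value \<open>a\<close>.\<close>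

lemma rat_linear_functional_separates:
  fixes a w :: real
  assumes a: "\<And>q :: rat. a \<noteq> real_of_rat q * w"
  shows "\<exists>f :: real \<Rightarrow> real. (\<forall>x y. f (x + y) = f x + f y) \<and> (\<forall>k :: int. f (of_int k * w) = 0) \<and> f a \<noteq> 0"
proof -
  have a0: "a \<noteq> 0" using a[of 0] by simp
  \<comment> \<open>For \<open>w = 0\<close> the pair would be dependent, and every functional kills
    \<open>w\<close> anyway.\<close>
  define B where "B = (if w = 0 then {a} else {w, a})"
  have indB: "Q_real.independent B"
  proof (cases "w = 0")
    case True
    then show ?thesis using a0 by (simp add: B_def Q_real.independent_insert)
  next
    case False
    have "Q_real.independent {w}" using False by (simp add: Q_real.independent_insert)
    moreover have "a \<notin> Q_real.span {w}" using a by (auto simp: Q_real.span_singleton)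
    ultimately have "Q_real.independent (insert a {w})" by (simp add: Q_real.independent_insert)
    then show ?thesis using False by (simp add: B_def insert_commute)
  qed
  define E where "E = Q_real.extend_basis B"
  have E: "Q_real.independent E" "B \<subseteq> E" "Q_real.span E = UNIV"
    unfolding E_def using indB
    by (auto simp: Q_real.independent_extend_basis Q_real.span_extend_basis dest: Q_real.extend_basis_superset[THEN subsetD])
  define f where "f x = real_of_rat (Q_real.representation E x a)" for x
  have f_add: "f (x + y) = f x + f y" for x y
    using E by (simp add: f_def Q_real.representation_add of_rat_add)
  have aE: "a \<in> E" using E(2) by (auto simp: B_def split: if_splits)
  have "f a = 1" using E(1) aE by (simp add: f_def Q_real.representation_basis)
  moreover have "f (of_int k * w) = 0" for k :: int
  proof (cases "w = 0")
    case True
    then show ?thesis using f_add[of 0 0] by simp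
  next
    case False
    have wE: "w \<in> E" using E(2) False by (auto simp: B_def)
    have "w \<noteq> a" using a[of 1] by auto
    have "f (of_int k * w) = f (real_of_rat (of_int k) * w)" by simp
    also have "\<dots> = real_of_rat (of_int k * Q_real.representation E w a)"
      unfolding f_def using E by (subst Q_real.representation_scale) auto
    also have "\<dots> = 0" using E(1) wE \<open>w \<noteq> a\<close> by (simp add: Q_real.representation_basis)
    finally show ?thesis .
  qed
  ultimately show ?thesis using f_add by (intro exI[of _ f]) auto
qed

lemma common_denominator:
  assumes "finite (R :: rat set)"
  shows "\<exists>D :: int. D > 0 \<and> (\<forall>q\<in>R. of_int D * q \<in> \<int>)"
  using assms
proof (induction R)
  case empty
  then show ?case by (intro exI[of _ 1]) auto
next
  case (insert q R)
  then obtain D :: int where D: "D > 0" "\<And>q. q \<in> R \<Longrightarrow> of_int D * q \<in> \<int>" by blast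
  obtain a b where q: "quotient_of q = (a, b)" by (cases "quotient_of q")
  have b: "b > 0" "q = of_int a / of_int b" using quotient_of_denom_pos[OF q] quotient_of_div[OF q] by auto
  have "of_int (D * b) * r \<in> \<int>" if "r \<in> insert q R" for r
  proof (cases "r = q")
    case True
    then have "of_int (D * b) * r = of_int (D * a)" using b by simp
    then show ?thesis by (metis Ints_of_int)
  next
    case False
    then have "of_int D * r \<in> \<int>" using that D(2)[of r] by blast
    then have "of_int b * (of_int D * r) \<in> \<int>" by (rule Ints_mult[OF Ints_of_int])
    moreover have "of_int b * (of_int D * r) = of_int (D * b) * r" by simp
    ultimately show ?thesis by metis
  qed
  moreover have "D * b > 0" using D(1) b(1) by simp
  ultimately show ?case by blast
qed

text \<open>Hamel coordinates multiplied by a common denominator of the finitely many coordinates of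
  \<open>V\<close>. The functions \<open>f i\<close> are additive on all reals, so that composing a
  real cocycle with them gives cocycles again.\<close>

lemma integral_coordinates:
  fixes V :: "real set"
  assumes "finite V"
  shows "\<exists>(I :: real set) (f :: real \<Rightarrow> real \<Rightarrow> real) c. finite I \<and>
     (\<forall>i x y. f i (x + y) = f i x + f i y) \<and> (\<forall>v\<in>V. (\<forall>i\<in>I. f i v \<in> \<int>) \<and> v = (\<Sum>i\<in>I. f i v * c i))"
proof -
  define E where "E = Q_real.extend_basis {}"
  have E: "Q_real.independent E" "Q_real.span E = UNIV"
    unfolding E_def by (auto simp: Q_real.independent_extend_basis Q_real.span_extend_basis Q_real.independent_empty)
  define \<rho> where "\<rho> = Q_real.representation E"
  define I where "I = (\<Union>v\<in>V. {i. \<rho> v i \<noteq> 0})"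
  have fin: "finite {i. \<rho> v i \<noteq> 0}" for v
    unfolding \<rho>_def by (rule Q_real.finite_representation)
  have I: "finite I" unfolding I_def using assms fin by blast
  have "finite ((\<lambda>(v, i). \<rho> v i) ` (V \<times> I))" using assms I by blast
  from common_denominator[OF this]
  obtain D :: int where D0: "D > 0" "\<And>q. q \<in> (\<lambda>(v, i). \<rho> v i) ` (V \<times> I) \<Longrightarrow> of_int D * q \<in> \<int>" by blast
  have D: "D > 0" "\<And>v i. v \<in> V \<Longrightarrow> i \<in> I \<Longrightarrow> of_int D * \<rho> v i \<in> \<int>"
    using D0(1) by (simp, intro D0(2)) force
  define f where "f i x = real_of_rat (of_int D * \<rho> x i)" for i x
  have "f i (x + y) = f i x + f i y" for i x y
    using E by (simp add: f_def \<rho>_def Q_real.representation_add of_rat_add distrib_left)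
  moreover have "f i v \<in> \<int>" if "v \<in> V" "i \<in> I" for v i
  proof -
    from D(2)[OF that] obtain k :: int where "of_int D * \<rho> v i = of_int k" by (rule Ints_cases)
    then have "f i v = of_int k" unfolding f_def by (simp only: of_rat_of_int_eq)
    then show ?thesis by simp
  qed
  moreover have "v = (\<Sum>i\<in>I. f i v * (i / of_int D))" if v: "v \<in> V" for v
  proof -
    have "(\<Sum>i\<in>I. f i v * (i / of_int D)) = (\<Sum>i\<in>I. real_of_rat (\<rho> v i) * i)"
      using D(1) by (intro sum.cong) (auto simp: f_def of_rat_mult)
    also have "\<dots> = (\<Sum>i | \<rho> v i \<noteq> 0. real_of_rat (\<rho> v i) * i)"
    proof (rule sum.mono_neutral_right[OF I])
      show "{i. \<rho> v i \<noteq> 0} \<subseteq> I" using v unfolding I_def by blast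
    qed auto
    also have "\<dots> = v" unfolding \<rho>_def using E by (intro Q_real.sum_nonzero_representation_eq) auto
    finally show ?thesis by simp
  qed
  ultimately show ?thesis using I by (intro exI[of _ I] exI[of _ f] exI[of _ "\<lambda>i. i / of_int D"]) auto
qed

text \<open>Induction over words in which inverses are demanded for the generators only, so
  \<open>P\<close> may fail to be visibly stable under inversion.\<close>

lemma (in group) generate_minimal_on:
  assumes "g \<in> generate G E" "E \<subseteq> carrier G"
    and "P \<one>" "\<And>h. h \<in> E \<Longrightarrow> P h" "\<And>h. h \<in> E \<Longrightarrow> P (inv h)"
    and "\<And>g h. g \<in> carrier G \<Longrightarrow> h \<in> carrier G \<Longrightarrow> P g \<Longrightarrow> P h \<Longrightarrow> P (g \<otimes> h)"
  shows "P g"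
  using assms(1)
proof induction
  case (eng h1 h2)
  have "h1 \<in> carrier G" "h2 \<in> carrier G"
    using eng.hyps generate_incl[OF assms(2)] by auto
  then show ?case using eng.IH assms(6) by blast
qed (use assms in auto)

text \<open>Here \<open>r\<close> lifts a homomorphism to the reals modulo \<open>w\<close>. An
  additive functional vanishing at the integer multiples of \<open>w\<close> turns it into a real
  homomorphism, which is zero; hence every \<open>r g\<close> is a rational multiple of
  \<open>w\<close>. Finitely many generators give a common denominator \<open>D\<close>, and the
  image has at most \<open>D\<close> elements. The value \<open>w = 0\<close> is included and means
  an honest real homomorphism.\<close>

lemma property_T_circle_hom_finite_index:
  fixes \<Gamma> :: "('g, 'm) monoid_scheme" and r :: "'g \<Rightarrow> real" and w :: real
  assumes T: "property_T \<Gamma>"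
    and r: "\<And>g h. g \<in> carrier \<Gamma> \<Longrightarrow> h \<in> carrier \<Gamma> \<Longrightarrow> \<exists>k :: int. r (g \<otimes>\<^bsub>\<Gamma>\<^esub> h) = r g + r h + of_int k * w"
  shows "finite_index \<Gamma> {g \<in> carrier \<Gamma>. \<exists>k :: int. r g = of_int k * w}" (is "finite_index \<Gamma> ?N")
proof -
  interpret \<Gamma>: group \<Gamma> using T by (simp add: property_T_def)
  have "\<exists>q. r g = real_of_rat q * w" if g: "g \<in> carrier \<Gamma>" for g
  proof (rule ccontr)
    assume "\<nexists>q. r g = real_of_rat q * w"
    then have "r g \<noteq> real_of_rat q * w" for q by blast
    from rat_linear_functional_separates[OF this] obtain f :: "real \<Rightarrow> real" where
      f: "\<And>x y. f (x + y) = f x + f y" "\<And>k :: int. f (of_int k * w) = 0" "f (r g) \<noteq> 0" by metis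
    have "f (r g) = 0"
    proof (rule property_T_hom_real_trivial[OF T _ g])
      fix g h assume "g \<in> carrier \<Gamma>" "h \<in> carrier \<Gamma>"
      then obtain k :: int where "r (g \<otimes>\<^bsub>\<Gamma>\<^esub> h) = r g + r h + of_int k * w" using r by blast
      then show "f (r (g \<otimes>\<^bsub>\<Gamma>\<^esub> h)) = f (r g) + f (r h)" by (simp add: f(1,2))
    qed
    then show False using f(3) by simp
  qed
  then obtain q where q: "\<And>g. g \<in> carrier \<Gamma> \<Longrightarrow> r g = real_of_rat (q g) * w" by metis
  obtain E where E: "finite E" "E \<subseteq> carrier \<Gamma>" "generate \<Gamma> E = carrier \<Gamma>"
    using property_T_finitely_generated[OF T] by blast
  obtain D :: int where D: "D > 0" "\<And>g. g \<in> E \<Longrightarrow> of_int D * q g \<in> \<int>"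
    using common_denominator[of "q ` E"] E(1) by auto
  obtain k1 :: int where k1: "r \<one>\<^bsub>\<Gamma>\<^esub> = of_int k1 * w"
  proof -
    obtain k :: int where "r (\<one>\<^bsub>\<Gamma>\<^esub> \<otimes>\<^bsub>\<Gamma>\<^esub> \<one>\<^bsub>\<Gamma>\<^esub>) = r \<one>\<^bsub>\<Gamma>\<^esub> + r \<one>\<^bsub>\<Gamma>\<^esub> + of_int k * w"
      using r[OF \<Gamma>.one_closed \<Gamma>.one_closed] by blast
    then have "r \<one>\<^bsub>\<Gamma>\<^esub> = of_int (- k) * w" by simp
    then show ?thesis by (rule that)
  qed
  have inv: "\<exists>k :: int. r (inv\<^bsub>\<Gamma>\<^esub> g) = - r g + of_int k * w" if g: "g \<in> carrier \<Gamma>" for g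
  proof -
    obtain k :: int where "r (g \<otimes>\<^bsub>\<Gamma>\<^esub> inv\<^bsub>\<Gamma>\<^esub> g) = r g + r (inv\<^bsub>\<Gamma>\<^esub> g) + of_int k * w"
      using r[OF g \<Gamma>.inv_closed[OF g]] by blast
    then have "r (inv\<^bsub>\<Gamma>\<^esub> g) = - r g + of_int (k1 - k) * w"
      using k1 g by (simp add: algebra_simps)
    then show ?thesis by blast
  qed
  have "\<exists>m :: int. of_int D * r g = of_int m * w" if g: "g \<in> carrier \<Gamma>" for g
  proof (rule \<Gamma>.generate_minimal_on[of g E])
    show gen: "\<exists>m :: int. of_int D * r h = of_int m * w" if "h \<in> E" for h
    proof -
      from D(2)[OF that] obtain m where "of_int D * q h = of_int m" by (rule Ints_cases)
      then have "real_of_rat (of_int D * q h) = real_of_int m" by simp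
      then have "real_of_int D * real_of_rat (q h) = real_of_int m" by (simp add: of_rat_mult)
      then have "of_int D * r h = of_int m * w" using q[of h] that E(2) by auto
      then show ?thesis by blast
    qed
    show "\<exists>m :: int. of_int D * r (inv\<^bsub>\<Gamma>\<^esub> h) = of_int m * w" if "h \<in> E" for h
    proof -
      obtain m :: int where m: "of_int D * r h = of_int m * w" using gen[OF \<open>h \<in> E\<close>] by blast
      obtain k :: int where k: "r (inv\<^bsub>\<Gamma>\<^esub> h) = - r h + of_int k * w" using inv \<open>h \<in> E\<close> E(2) by blast
      have "of_int D * r (inv\<^bsub>\<Gamma>\<^esub> h) = of_int (D * k - m) * w"
        unfolding k using m by (simp add: algebra_simps)
      then show ?thesis by blast
    qed
    show "\<exists>m :: int. of_int D * r \<one>\<^bsub>\<Gamma>\<^esub> = of_int m * w"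
      by (rule exI[of _ "D * k1"]) (simp add: k1)
    show "\<exists>m :: int. of_int D * r (f \<otimes>\<^bsub>\<Gamma>\<^esub> h) = of_int m * w"
      if fh: "f \<in> carrier \<Gamma>" "h \<in> carrier \<Gamma>" "\<exists>m :: int. of_int D * r f = of_int m * w" "\<exists>m :: int. of_int D * r h = of_int m * w" for f h
    proof -
      obtain m n :: int where m: "of_int D * r f = of_int m * w" "of_int D * r h = of_int n * w" using fh by blast
      obtain k :: int where k: "r (f \<otimes>\<^bsub>\<Gamma>\<^esub> h) = r f + r h + of_int k * w" using r[OF fh(1,2)] by blast
      have "of_int D * r (f \<otimes>\<^bsub>\<Gamma>\<^esub> h) = of_int (m + n + D * k) * w"
        unfolding k using m by (simp add: algebra_simps)
      then show ?thesis by blast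
    qed
  qed (use g E in auto)
  then obtain m :: "'g \<Rightarrow> int" where m: "\<And>g. g \<in> carrier \<Gamma> \<Longrightarrow> of_int D * r g = of_int (m g) * w" by metis
  have mult_in: "\<exists>k :: int. r (inv\<^bsub>\<Gamma>\<^esub> f \<otimes>\<^bsub>\<Gamma>\<^esub> g) = r g - r f + of_int k * w"
    if fg: "f \<in> carrier \<Gamma>" "g \<in> carrier \<Gamma>" for f g
  proof -
    obtain k :: int where k: "r (inv\<^bsub>\<Gamma>\<^esub> f \<otimes>\<^bsub>\<Gamma>\<^esub> g) = r (inv\<^bsub>\<Gamma>\<^esub> f) + r g + of_int k * w"
      using r fg by blast
    obtain l :: int where l: "r (inv\<^bsub>\<Gamma>\<^esub> f) = - r f + of_int l * w" using inv fg by blast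
    have "r (inv\<^bsub>\<Gamma>\<^esub> f \<otimes>\<^bsub>\<Gamma>\<^esub> g) = r g - r f + of_int (k + l) * w"
      unfolding k l by (simp add: algebra_simps)
    then show ?thesis by blast
  qed
  show ?thesis
  proof (rule \<Gamma>.finite_indexI[where \<kappa> = "\<lambda>g. m g mod D"])
    show "finite ((\<lambda>g. m g mod D) ` carrier \<Gamma>)"
      by (rule finite_subset[of _ "{0..<D}"]) (use D(1) in auto)
    show "subgroup ?N \<Gamma>"
    proof (rule \<Gamma>.subgroupI)
      show "?N \<noteq> {}" using k1 by blast
      show "inv\<^bsub>\<Gamma>\<^esub> a \<in> ?N" if aN: "a \<in> ?N" for a
      proof -
        have a: "a \<in> carrier \<Gamma>" using aN by blast
        obtain k :: int where k: "r a = of_int k * w" using aN by blast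
        obtain l :: int where "r (inv\<^bsub>\<Gamma>\<^esub> a) = - r a + of_int l * w" using inv[OF a] by blast
        then have "r (inv\<^bsub>\<Gamma>\<^esub> a) = of_int (l - k) * w" using k by (simp add: algebra_simps)
        then show ?thesis using a by blast
      qed
      show "a \<otimes>\<^bsub>\<Gamma>\<^esub> b \<in> ?N" if abN: "a \<in> ?N" "b \<in> ?N" for a b
      proof -
        have a: "a \<in> carrier \<Gamma>" "b \<in> carrier \<Gamma>" using abN by blast+
        obtain k l :: int where k: "r a = of_int k * w" "r b = of_int l * w" using abN by blast
        obtain j :: int where "r (a \<otimes>\<^bsub>\<Gamma>\<^esub> b) = r a + r b + of_int j * w" using r[OF a] by blast
        then have "r (a \<otimes>\<^bsub>\<Gamma>\<^esub> b) = of_int (k + l + j) * w" using k by (simp add: algebra_simps)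
        then show ?thesis using a by blast
      qed
    qed blast
    show "inv\<^bsub>\<Gamma>\<^esub> f \<otimes>\<^bsub>\<Gamma>\<^esub> g \<in> ?N"
      if fg: "f \<in> carrier \<Gamma>" "g \<in> carrier \<Gamma>" "m f mod D = m g mod D" for f g
    proof -
      have "D dvd m g - m f" using fg(3) by (metis mod_eq_dvd_iff)
      then obtain j where j: "m g - m f = D * j" by blast
      have "of_int D * (r g - r f) = of_int (m g - m f) * w"
        using m fg by (simp add: algebra_simps)
      then have "r g - r f = of_int j * w" using D(1) unfolding j by simp
      moreover obtain k :: int where "r (inv\<^bsub>\<Gamma>\<^esub> f \<otimes>\<^bsub>\<Gamma>\<^esub> g) = r g - r f + of_int k * w"
        using mult_in[OF fg(1,2)] by blast
      ultimately have "r (inv\<^bsub>\<Gamma>\<^esub> f \<otimes>\<^bsub>\<Gamma>\<^esub> g) = of_int (j + k) * w" by (simp add: algebra_simps)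
      then show ?thesis using fg by blast
    qed
  qed
qed

section \<open>Invariant measures\<close>

text \<open>Krylov-Bogoliubov for finitely additive set functions: a cluster point of the orbit
  averages in the compact cube of functions from sets to the unit interval. Working with all subsets
  avoids any topology at this stage.\<close>

lemma invariant_mean:
  fixes f :: "'a \<Rightarrow> 'a" and x0 :: 'a
  shows "\<exists>m :: 'a set \<Rightarrow> real. (\<forall>A. 0 \<le> m A) \<and> (\<forall>A B. A \<inter> B = {} \<longrightarrow> m (A \<union> B) = m A + m B) \<and>
     (\<forall>A. m (f -` A) = m A) \<and> (\<forall>A. (\<forall>i. (f ^^ i) x0 \<in> A) \<longrightarrow> m A = 1)"
proof -
  define a :: "nat \<Rightarrow> 'a set \<Rightarrow> real" where
    "a N A = (\<Sum>i<Suc N. indicator A ((f ^^ i) x0)) / real (Suc N)" for N A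
  have a01: "0 \<le> a N A" "a N A \<le> 1" for N A
  proof -
    have "(\<Sum>i<Suc N. indicator A ((f ^^ i) x0)) \<le> (\<Sum>i<Suc N. (1::real))"
      by (intro sum_mono) (auto simp: indicator_def)
    then show "a N A \<le> 1" by (simp add: a_def)
    show "0 \<le> a N A" by (auto simp: a_def intro!: divide_nonneg_pos sum_nonneg add_nonneg_nonneg)
  qed
  define K :: "('a set \<Rightarrow> real) set" where "K = PiE UNIV (\<lambda>_. {0..1})"
  have "compactin (product_topology (\<lambda>_. euclidean) UNIV) K"
    unfolding K_def compactin_PiE by auto
  then have "compact K" by (simp add: euclidean_product_topology)
  define F where "F = filtermap a sequentially"
  have "F \<noteq> bot" by (simp add: F_def filtermap_bot_iff)
  moreover have "eventually (\<lambda>h. h \<in> K) F"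
    using a01 by (simp add: F_def eventually_filtermap K_def PiE_iff)
  ultimately obtain m where m: "m \<in> K" "inf (nhds m) F \<noteq> bot"
    using \<open>compact K\<close> unfolding compact_filter by blast
  \<comment> \<open>Along this filter the averages converge to \<open>m\<close> on every set, so
    relations between averages that hold eventually pass to \<open>m\<close>.\<close>
  define G where "G = inf (nhds m) F"
  have G: "G \<noteq> bot" using m by (simp add: G_def)
  have lim: "((\<lambda>h. h A) \<longlongrightarrow> m A) G" for A
  proof -
    have "continuous_on UNIV (\<lambda>h :: 'a set \<Rightarrow> real. h A)" by (rule continuous_on_product_coordinates)
    then have "open ((\<lambda>h :: 'a set \<Rightarrow> real. h A) -` U)" if "open U" for U
      using that by (intro open_vimage)
    then have "((\<lambda>h. h A) \<longlongrightarrow> m A) (nhds m)"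
      by (intro topological_tendstoI) (auto simp: eventually_nhds vimage_def)
    then show ?thesis unfolding G_def by (rule tendsto_mono[OF inf_le1])
  qed
  have ev: "eventually P G" if P: "eventually (\<lambda>N. P (a N)) sequentially" for P
  proof -
    have "eventually P F" unfolding F_def eventually_filtermap by (rule P)
    then show ?thesis unfolding G_def by (rule filter_leD[OF inf_le2])
  qed
  have 1: "0 \<le> m A" for A using m(1) by (auto simp: K_def PiE_iff)
  have 2: "m (A \<union> B) = m A + m B" if "A \<inter> B = {}" for A B
  proof (rule tendsto_unique[OF G lim])
    have "indicator (A \<union> B) z = (indicator A z + indicator B z :: real)" for z
      using that by (auto simp: indicator_def)
    then have "a N (A \<union> B) = a N A + a N B" for N
      by (simp only: a_def sum.distrib add_divide_distrib)
    then have "eventually (\<lambda>h. h A + h B = h (A \<union> B)) G" by (intro ev) simp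
    then show "((\<lambda>h. h (A \<union> B)) \<longlongrightarrow> m A + m B) G"
      by (rule Lim_transform_eventually[OF tendsto_add[OF lim lim]])
  qed
  have 3: "m A = 1" if A: "\<forall>i. (f ^^ i) x0 \<in> A" for A
  proof (rule tendsto_unique[OF G lim])
    have "a N A = 1" for N using A by (simp add: a_def)
    then have "eventually (\<lambda>h. 1 = h A) G" by (intro ev) simp
    then show "((\<lambda>h. h A) \<longlongrightarrow> 1) G" by (rule Lim_transform_eventually[OF tendsto_const])
  qed
  have 4: "m (f -` A) = m A" for A
  proof -
    have bound: "\<bar>a N (f -` A) - a N A\<bar> \<le> 1 / real (Suc N)" for N
    proof -
      define s where "s i = (indicator A ((f ^^ i) x0) :: real)" for i
      have "indicator (f -` A) ((f ^^ i) x0) = s (Suc i)" for i by (simp add: s_def indicator_def)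
      then have "a N (f -` A) - a N A = ((\<Sum>i<Suc N. s (Suc i)) - (\<Sum>i<Suc N. s i)) / real (Suc N)"
        by (simp only: a_def s_def diff_divide_distrib)
      \<comment> \<open>Moving the orbit by one step changes only its two end terms.\<close>
      also have "(\<Sum>i<Suc N. s (Suc i)) - (\<Sum>i<Suc N. s i) = s (Suc N) - s 0"
        by (simp only: sum_subtractf[symmetric] sum_lessThan_telescope)
      also have "\<bar>(s (Suc N) - s 0) / real (Suc N)\<bar> \<le> 1 / real (Suc N)"
        unfolding abs_divide by (intro divide_mono) (auto simp: s_def indicator_def)
      finally show ?thesis .
    qed
    have "\<bar>m (f -` A) - m A\<bar> \<le> e" if e: "e > 0" for e
    proof (rule tendsto_upperbound[OF _ _ G])
      show "((\<lambda>h. \<bar>h (f -` A) - h A\<bar>) \<longlongrightarrow> \<bar>m (f -` A) - m A\<bar>) G"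
        by (intro tendsto_rabs tendsto_diff lim)
      have "eventually (\<lambda>N. 1 / real (Suc N) < e) sequentially"
        using order_tendstoD(2)[OF LIMSEQ_inverse_real_of_nat e] by (simp add: inverse_eq_divide)
      then show "eventually (\<lambda>h. \<bar>h (f -` A) - h A\<bar> \<le> e) G"
      proof (intro ev, eventually_elim)
        case (elim N)
        then show ?case using bound[of N] by linarith
      qed
    qed
    then have "\<bar>m (f -` A) - m A\<bar> \<le> 0" using dense_ge[of 0] by blast
    then show ?thesis by simp
  qed
  have "\<forall>A. 0 \<le> m A" "\<forall>A B. A \<inter> B = {} \<longrightarrow> m (A \<union> B) = m A + m B"
    "\<forall>A. m (f -` A) = m A" "\<forall>A. (\<forall>i. (f ^^ i) x0 \<in> A) \<longrightarrow> m A = 1"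
    using 1 2 3 4 by blast+
  then show ?thesis by (intro exI[of _ m] conjI)
qed

locale int_flow =
  fixes X :: "'a topology" and it :: "int \<Rightarrow> 'a \<Rightarrow> 'a"
  assumes compact: "compact_space X"
    and it_cont: "\<And>n. continuous_map X X (it n)"
    and it_0: "\<And>x. x \<in> topspace X \<Longrightarrow> it 0 x = x"
    and it_add: "\<And>m n x. x \<in> topspace X \<Longrightarrow> it (m + n) x = it m (it n x)"
begin

lemma it_closed: "x \<in> topspace X \<Longrightarrow> it n x \<in> topspace X"
  using it_cont[of n] by (auto simp: continuous_map_def)

lemma it_neg [simp]: "x \<in> topspace X \<Longrightarrow> it (- n) (it n x) = x" "x \<in> topspace X \<Longrightarrow> it n (it (- n) x) = x"
  using it_add[of x "-n" n] it_add[of x n "-n"] it_0 by auto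

lemma clopenin_it_vimage:
  assumes "clopenin X C"
  shows "clopenin X {x \<in> topspace X. it n x \<in> C}"
  using assms it_cont[of n] openin_continuous_map_preimage closedin_continuous_map_preimage
  unfolding clopenin_def by blast

definition clopen_sets :: "'a set set" where
  "clopen_sets = {C. clopenin X C}"

lemma clopen_algebra: "Sigma_Algebra.algebra (topspace X) clopen_sets"
  unfolding algebra_iff_Un clopen_sets_def clopenin_def
  by (auto dest: openin_subset)

text \<open>The mean restricted to the clopen algebra is extended by Caratheodory's theorem. The
  sigma-algebra generated by clopen sets is all that is needed, since the functions integrated later
  are built from locally constant ones.\<close>

lemma invariant_measure:
  assumes ne: "topspace X \<noteq> {}"
  shows "\<exists>\<mu>. space \<mu> = topspace X \<and> sets \<mu> = sigma_sets (topspace X) clopen_sets \<and>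
     emeasure \<mu> (space \<mu>) = 1 \<and> (\<forall>n. it n \<in> measurable \<mu> \<mu>) \<and>
     (\<forall>n. \<forall>f\<in>borel_measurable \<mu>. (\<integral>\<^sup>+x. f (it n x) \<partial>\<mu>) = (\<integral>\<^sup>+x. f x \<partial>\<mu>))"
proof -
  interpret A: Sigma_Algebra.algebra "topspace X" clopen_sets by (rule clopen_algebra)
  obtain x0 where x0: "x0 \<in> topspace X" using ne by blast
  obtain m :: "'a set \<Rightarrow> real" where m: "\<And>A. 0 \<le> m A"
    "\<And>A B. A \<inter> B = {} \<Longrightarrow> m (A \<union> B) = m A + m B" "\<And>A. m (it 1 -` A) = m A"
    "\<And>A. (\<And>i. (it 1 ^^ i) x0 \<in> A) \<Longrightarrow> m A = 1"
    using invariant_mean[of "it 1" x0] by metis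
  have orbit: "(it 1 ^^ i) x0 \<in> topspace X" for i
    by (induction i) (auto simp: x0 it_closed)
  have m_top: "m (topspace X) = 1" using orbit by (rule m(4))
  \<comment> \<open>The mean is defined on subsets of the whole type. The orbit stays in
    \<open>X\<close>, so the outside has mass 0 and preimages may be cut down to
    \<open>X\<close>.\<close>
  have m_compl: "m (- topspace X) = 0"
  proof -
    have "m (topspace X \<union> - topspace X) = m (topspace X) + m (- topspace X)" by (rule m(2)) blast
    moreover have "m UNIV = 1" by (rule m(4)) simp
    ultimately show ?thesis using m_top by simp
  qed
  have m_Int: "m (A \<inter> topspace X) = m A" for A
  proof -
    have "(A \<inter> - topspace X) \<union> (- topspace X - A) = - topspace X" by blast
    moreover have "(A \<inter> - topspace X) \<inter> (- topspace X - A) = {}" by blast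
    ultimately have "m (- topspace X) = m (A \<inter> - topspace X) + m (- topspace X - A)"
      using m(2) by metis
    then have 0: "m (A \<inter> - topspace X) = 0"
      using m(1)[of "A \<inter> - topspace X"] m(1)[of "- topspace X - A"] m_compl by linarith
    have "(A \<inter> topspace X) \<union> (A \<inter> - topspace X) = A" by blast
    moreover have "(A \<inter> topspace X) \<inter> (A \<inter> - topspace X) = {}" by blast
    ultimately have "m A = m (A \<inter> topspace X) + m (A \<inter> - topspace X)"
      using m(2) by metis
    then show ?thesis using 0 by simp
  qed
  have m_empty: "m {} = 0" using m(2)[of "{}" "{}"] by simp
  have "\<exists>\<nu>. (\<forall>s\<in>clopen_sets. \<nu> s = ennreal (m s)) \<and> measure_space (topspace X) (sigma_sets (topspace X) clopen_sets) \<nu>"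
  proof (rule A.caratheodory_empty_continuous)
    show "positive clopen_sets (\<lambda>s. ennreal (m s))" by (simp add: positive_def m_empty)
    show "additive clopen_sets (\<lambda>s. ennreal (m s))" unfolding additive_def by (intro ballI impI) (simp only: m(2) ennreal_plus[OF m(1) m(1)])
    fix A :: "nat \<Rightarrow> 'a set" assume A: "range A \<subseteq> clopen_sets" "decseq A" "(\<Inter>i. A i) = {}"
    \<comment> \<open>Continuity at the empty set is automatic: a nested sequence of nonempty closed
      sets in a compact space has a common point.\<close>
    have "\<exists>n. A n = {}"
    proof (rule ccontr)
      assume "\<nexists>n. A n = {}"
      then have "(\<Inter>i. A i) \<noteq> {}"
        using A by (intro compact_space_imp_nest[OF compact]) (auto simp: clopen_sets_def clopenin_def)
      then show False using A(3) by simp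
    qed
    then obtain n where n: "A n = {}" by blast
    have "A k = {}" if "k \<ge> n" for k using decseqD[OF A(2) that] n by simp
    then have "eventually (\<lambda>k. ennreal (m (A k)) = 0) sequentially"
      unfolding eventually_sequentially by (intro exI[of _ n]) (simp add: m_empty)
    then show "(\<lambda>i. ennreal (m (A i))) \<longlonglongrightarrow> 0" by (rule tendsto_eventually)
  qed auto
  then obtain \<nu> where \<nu>: "\<And>s. s \<in> clopen_sets \<Longrightarrow> \<nu> s = ennreal (m s)"
    "measure_space (topspace X) (sigma_sets (topspace X) clopen_sets) \<nu>" by blast
  define \<mu> where "\<mu> = measure_of (topspace X) clopen_sets \<nu>"
  have sub: "clopen_sets \<subseteq> Pow (topspace X)" by (rule A.space_closed)
  have sp: "space \<mu> = topspace X" and st: "sets \<mu> = sigma_sets (topspace X) clopen_sets"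
    unfolding \<mu>_def using sub by (auto simp: space_measure_of sets_measure_of)
  have em: "emeasure \<mu> C = ennreal (m C)" if "C \<in> clopen_sets" for C
  proof -
    have "emeasure \<mu> C = \<nu> C"
      using \<nu>(2) sub that st
      by (intro emeasure_measure_of[OF \<mu>_def sub]) (auto simp: measure_space_def)
    then show ?thesis using \<nu>(1)[OF that] by simp
  qed
  have top: "topspace X \<in> clopen_sets" by (simp add: clopen_sets_def clopenin_def)
  have meas: "it n \<in> measurable \<mu> \<mu>" for n
  proof (rule measurable_sigma_sets[OF st sub])
    show "it n \<in> space \<mu> \<rightarrow> topspace X" using sp it_closed by auto
    fix C assume "C \<in> clopen_sets"
    then have "{x \<in> topspace X. it n x \<in> C} \<in> clopen_sets" using clopenin_it_vimage by (simp add: clopen_sets_def)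
    moreover have "it n -` C \<inter> space \<mu> = {x \<in> topspace X. it n x \<in> C}" using sp by auto
    ultimately show "it n -` C \<inter> space \<mu> \<in> sets \<mu>" using st by auto
  qed
  have deq: "emeasure (distr \<mu> \<mu> (it 1)) C = emeasure \<mu> C" if C: "C \<in> clopen_sets" for C
  proof -
    have v: "it 1 -` C \<inter> topspace X = {x \<in> topspace X. it 1 x \<in> C}" by auto
    have "emeasure (distr \<mu> \<mu> (it 1)) C = emeasure \<mu> (it 1 -` C \<inter> topspace X)"
      using C st meas by (subst emeasure_distr) (auto simp: sp)
    also have "\<dots> = ennreal (m (it 1 -` C \<inter> topspace X))"
      unfolding v using C clopenin_it_vimage by (intro em) (simp add: clopen_sets_def)
    also have "\<dots> = ennreal (m C)" by (simp only: m_Int m(3))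
    finally show ?thesis using em[OF C] by simp
  qed
  have "distr \<mu> \<mu> (it 1) = \<mu>"
  proof (rule measure_eqI_generator_eq[where A = "\<lambda>_. topspace X", OF A.Int_stable sub _ _ st])
    show "sets (distr \<mu> \<mu> (it 1)) = sigma_sets (topspace X) clopen_sets" by (simp add: st)
    show "emeasure (distr \<mu> \<mu> (it 1)) C = emeasure \<mu> C" if "C \<in> clopen_sets" for C
      using that by (rule deq)
    show "range (\<lambda>_. topspace X) \<subseteq> clopen_sets" using top by auto
    show "(\<Union>i::nat. topspace X) = topspace X" by simp
    show "emeasure (distr \<mu> \<mu> (it 1)) (topspace X) \<noteq> \<infinity>" for i :: nat
      unfolding deq[OF top] em[OF top] by simp
  qed
  then have inv1: "(\<integral>\<^sup>+x. f (it 1 x) \<partial>\<mu>) = (\<integral>\<^sup>+x. f x \<partial>\<mu>)" if "f \<in> borel_measurable \<mu>" for f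
    using nn_integral_distr[OF meas, of f 1] that by simp
  have inv_nat: "(\<integral>\<^sup>+x. f (it (int k) x) \<partial>\<mu>) = (\<integral>\<^sup>+x. f x \<partial>\<mu>)" if f: "f \<in> borel_measurable \<mu>" for f k
  proof (induction k)
    case 0
    show ?case by (intro nn_integral_cong) (simp add: sp it_0)
  next
    case (Suc k)
    have "(\<integral>\<^sup>+x. f (it (int (Suc k)) x) \<partial>\<mu>) = (\<integral>\<^sup>+x. f (it (int k) (it 1 x)) \<partial>\<mu>)"
      by (intro nn_integral_cong) (simp add: sp it_add[symmetric] add.commute)
    also have "\<dots> = (\<integral>\<^sup>+x. f (it (int k) x) \<partial>\<mu>)"
      by (rule inv1[of "\<lambda>x. f (it (int k) x)"]) (rule measurable_compose[OF meas f])
    finally show ?case using Suc.IH by simp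
  qed
  have inv: "(\<integral>\<^sup>+x. f (it n x) \<partial>\<mu>) = (\<integral>\<^sup>+x. f x \<partial>\<mu>)" if f: "f \<in> borel_measurable \<mu>" for f n
  proof (cases "n \<ge> 0")
    case True
    then show ?thesis using inv_nat[OF f, of "nat n"] by simp
  next
    case False
    have "(\<integral>\<^sup>+x. f (it n x) \<partial>\<mu>) = (\<integral>\<^sup>+x. f (it n (it (int (nat (- n))) x)) \<partial>\<mu>)"
      by (rule inv_nat[symmetric]) (rule measurable_compose[OF meas f])
    also have "\<dots> = (\<integral>\<^sup>+x. f x \<partial>\<mu>)"
      using False by (intro nn_integral_cong) (simp add: sp)
    finally show ?thesis .
  qed
  have "emeasure \<mu> (space \<mu>) = 1" using em[OF top] by (simp add: sp m_top)
  then show ?thesis using sp st meas inv by blast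
qed

end

section \<open>Leafwise piecewise linear actions\<close>

text \<open>The finite subcover argument in a form that remembers the centre: \<open>P\<close>
  compares a point with the centre of the product neighbourhood containing it, so data at all points
  are read off from finitely many centres.\<close>

lemma compact_cylinder_cover:
  fixes X :: "'a topology" and a b :: real and P :: "'a \<Rightarrow> real \<Rightarrow> 'a \<Rightarrow> real \<Rightarrow> bool"
  assumes "compact_space X"
    and loc: "\<And>x t. x \<in> topspace X \<Longrightarrow>
      \<exists>U e. openin X U \<and> x \<in> U \<and> e > 0 \<and> (\<forall>y\<in>U. \<forall>s. \<bar>s - t\<bar> < e \<longrightarrow> P x t y s)"
  shows "\<exists>F. finite F \<and> F \<subseteq> topspace X \<times> {a..b} \<and>
     (\<forall>y\<in>topspace X. \<forall>s\<in>{a..b}. \<exists>(x, t)\<in>F. P x t y s)"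
proof -
  let ?P = "prod_topology X euclideanreal" and ?K = "topspace X \<times> {a..b}"
  define good where "good p W \<longleftrightarrow> openin ?P W \<and> p \<in> W \<and> (\<forall>q\<in>W. P (fst p) (snd p) (fst q) (snd q))" for p W
  have ex: "\<exists>W. good p W" if p: "p \<in> ?K" for p
  proof -
    obtain U e where U: "openin X U" "fst p \<in> U" "e > 0"
      "\<forall>y\<in>U. \<forall>s. \<bar>s - snd p\<bar> < e \<longrightarrow> P (fst p) (snd p) y s"
      using loc[of "fst p" "snd p"] p by auto
    have "openin ?P (U \<times> ball (snd p) e)" using U(1) by (simp add: openin_prod_Times_iff)
    moreover have "p \<in> U \<times> ball (snd p) e" using U(2,3) by (simp add: mem_Times_iff)
    moreover have "P (fst p) (snd p) (fst q) (snd q)" if q: "q \<in> U \<times> ball (snd p) e" for q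
    proof -
      have "fst q \<in> U" "\<bar>snd q - snd p\<bar> < e"
        using q by (auto simp: mem_Times_iff dist_real_def abs_minus_commute)
      then show ?thesis using U(4) by blast
    qed
    ultimately show ?thesis unfolding good_def by blast
  qed
  define W where "W p = (SOME W. good p W)" for p
  have W: "good p (W p)" if "p \<in> ?K" for p unfolding W_def by (rule someI_ex[OF ex[OF that]])
  have "compactin ?P ?K"
    using assms(1) by (simp add: compactin_Times compact_space_def)
  moreover have "openin ?P V" if "V \<in> W ` ?K" for V
    using that W unfolding good_def by blast
  moreover have "?K \<subseteq> \<Union> (W ` ?K)"
    using W unfolding good_def by blast
  ultimately have "\<exists>\<F>. finite \<F> \<and> \<F> \<subseteq> W ` ?K \<and> ?K \<subseteq> \<Union> \<F>"
    unfolding compactin_def by blast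
  then obtain \<F> where \<F>: "finite \<F>" "\<F> \<subseteq> W ` ?K" "?K \<subseteq> \<Union> \<F>" by blast
  from finite_subset_image[OF \<F>(1,2)]
  obtain F where F: "F \<subseteq> ?K" "finite F" "\<F> = W ` F" by blast
  have "\<exists>(x, t)\<in>F. P x t y s" if y: "y \<in> topspace X" and s: "s \<in> {a..b}" for y s
  proof -
    have "(y, s) \<in> \<Union> (W ` F)" using \<F>(3) y s unfolding F(3) by blast
    then obtain p where p: "p \<in> F" "(y, s) \<in> W p" by blast
    then have "good p (W p)" using W F(1) by blast
    then have "P (fst p) (snd p) y s" using p(2) unfolding good_def by fastforce
    then show ?thesis using p(1) by (intro bexI[of _ p]) (simp add: case_prod_beta)
  qed
  then show ?thesis using F by (intro exI[of _ F]) blast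
qed

lemma locally_constant_real:
  fixes f :: "real \<Rightarrow> 'b"
  assumes "\<And>t. \<exists>e>0. \<forall>s. \<bar>s - t\<bar> < e \<longrightarrow> f s = f t"
  shows "f a = f b"
proof (rule connected_local_const[of UNIV])
  show "\<forall>a\<in>UNIV. eventually (\<lambda>b. f a = f b) (at a within UNIV)"
  proof
    fix t
    obtain e where e: "e > 0" "\<forall>s. \<bar>s - t\<bar> < e \<longrightarrow> f s = f t" using assms by blast
    show "eventually (\<lambda>b. f t = f b) (at t within UNIV)"
      unfolding eventually_at
    proof (intro exI[of _ e] conjI ballI impI e(1))
      fix s assume "s \<noteq> t \<and> dist s t < e"
      then have "\<bar>s - t\<bar> < e" by (simp add: dist_real_def)
      then show "f t = f s" by (rule e(2)[rule_format, symmetric])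
    qed
  qed
qed auto

lemma continuous_on_if_locally_broken_linear:
  fixes f :: "real \<Rightarrow> real"
  assumes "\<And>t. \<exists>e a b. e > 0 \<and> (\<forall>s. \<bar>s - t\<bar> < e \<longrightarrow> f s = f t + (if s \<le> t then a else b) * (s - t))"
  shows "continuous_on UNIV f"
proof -
  have "isCont f t" for t
  proof -
    obtain e a b where e: "e > 0" "\<And>s. \<bar>s - t\<bar> < e \<Longrightarrow> f s = f t + (if s \<le> t then a else b) * (s - t)"
      using assms[of t] by blast
    define c where "c = max \<bar>a\<bar> \<bar>b\<bar>"
    have 1: "eventually (\<lambda>s. norm (f s - f t) \<le> norm (s - t) * c) (at t)"
      unfolding eventually_at
    proof (intro exI[of _ e] conjI ballI impI e(1))
      fix s assume "s \<noteq> t \<and> dist s t < e"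
      then have s: "\<bar>s - t\<bar> < e" by (simp add: dist_real_def)
      define q where "q = (if s \<le> t then a else b)"
      have q: "\<bar>q\<bar> \<le> c" by (auto simp: c_def q_def)
      have "norm (f s - f t) = \<bar>q\<bar> * \<bar>s - t\<bar>"
        using e(2)[OF s, folded q_def] by (simp add: abs_mult)
      also have "\<dots> \<le> norm (s - t) * c" using mult_right_mono[OF q abs_ge_zero[of "s - t"]] by (simp add: mult.commute)
      finally show "norm (f s - f t) \<le> norm (s - t) * c" .
    qed
    have "((\<lambda>s. s - t) \<longlongrightarrow> 0) (at t)" using LIM_zero[OF tendsto_ident_at] .
    from tendsto_0_le[OF this 1] have "((\<lambda>s. f s - f t) \<longlongrightarrow> 0) (at t)" .
    then show ?thesis unfolding isCont_def by (rule LIM_zero_cancel)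
  qed
  then show ?thesis by (simp add: continuous_on_eq_continuous_at)
qed

text \<open>Take the supremum of the points up to which \<open>f\<close> stays above
  \<open>f x\<close>. The left half of the local hypothesis keeps the inequality at the supremum,
  and the right half pushes it beyond, unless \<open>y\<close> has been reached.\<close>

lemma strict_mono_on_real_if_locally:
  fixes f :: "real \<Rightarrow> real"
  assumes "\<And>t. \<exists>e>0. \<forall>s. \<bar>s - t\<bar> < e \<longrightarrow> (s < t \<longrightarrow> f s < f t) \<and> (t < s \<longrightarrow> f t < f s)"
  shows "strict_mono f"
proof (rule strict_monoI)
  fix x y :: real assume xy: "x < y"
  define S where "S = {z \<in> {x<..y}. \<forall>w\<in>{x<..z}. f x < f w}"
  obtain e where e: "e > 0" "\<And>s. \<bar>s - x\<bar> < e \<Longrightarrow> x < s \<Longrightarrow> f x < f s" using assms[of x] by blast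
  define z0 where "z0 = min y (x + e / 2)"
  have z0: "z0 \<in> S" unfolding S_def z0_def using xy e by auto
  have bdd: "bdd_above S" unfolding S_def by (auto intro: bdd_aboveI[of _ y])
  define z where "z = Sup S"
  have zz: "z0 \<le> z" unfolding z_def using z0 bdd by (rule cSup_upper)
  have xz: "x < z" using zz z0 unfolding S_def by auto
  have zy: "z \<le> y" unfolding z_def using z0 by (intro cSup_least) (auto simp: S_def)
  have below: "f x < f w" if xw: "x < w" and wz: "w < z" for w
  proof -
    have "S \<noteq> {}" using z0 by blast
    from less_cSupD[OF this wz[unfolded z_def]] obtain v where v: "v \<in> S" "w < v" by blast
    have "\<forall>w\<in>{x<..v}. f x < f w" using v(1) unfolding S_def by blast
    then show ?thesis using v(2) xw by simp
  qed
  from assms[of z] obtain d where d0: "d > 0"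
    "\<forall>s. \<bar>s - z\<bar> < d \<longrightarrow> (s < z \<longrightarrow> f s < f z) \<and> (z < s \<longrightarrow> f z < f s)" by (elim exE conjE)
  then have d: "d > 0" "\<And>s. \<bar>s - z\<bar> < d \<Longrightarrow> s < z \<Longrightarrow> f s < f z" "\<And>s. \<bar>s - z\<bar> < d \<Longrightarrow> z < s \<Longrightarrow> f z < f s"
    by simp_all
  obtain w where w: "max x (z - d) < w" "w < z" using dense[of "max x (z - d)" z] xz d(1) by auto
  then have w': "x < w" "\<bar>w - z\<bar> < d" by auto
  have "f x < f w" using w'(1) w(2) by (rule below)
  also have "f w < f z" using w'(2) w(2) by (rule d(2))
  finally have fz: "f x < f z" .
  show "f x < f y"
  proof (cases "z = y")
    case False
    then have "z < y" using zy by simp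
    define v where "v = min y (z + d / 2)"
    have "v \<in> S" unfolding S_def
    proof (intro CollectI conjI ballI)
      show "v \<in> {x<..y}" using xz d(1) \<open>z < y\<close> by (auto simp: v_def)
      fix u assume u: "u \<in> {x<..v}"
      consider "u < z" | "u = z" | "u > z" by linarith
      then show "f x < f u"
      proof cases
        case 3
        then have "f z < f u" using u d(1) by (intro d(3)) (auto simp: v_def)
        then show ?thesis using fz by simp
      qed (use below u fz in auto)
    qed
    then have "v \<le> z" unfolding z_def using bdd by (intro cSup_upper)
    then show ?thesis using \<open>z < y\<close> d(1) by (auto simp: v_def min_def split: if_splits)
  qed (use fz in simp)
qed

text \<open>The number \<open>G g x t\<close> is the parameter of the image under \<open>g\<close> of the point with
  parameter \<open>t\<close> on the leaf through \<open>x\<close>. It is determined up to the periods of the leaf,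
  whence the correction \<open>k\<close> in \<open>G_mult\<close>.\<close>

locale PL_leaf_action = int_flow X it + \<Gamma>: group \<Gamma>
  for X :: "'a topology" and it :: "int \<Rightarrow> 'a \<Rightarrow> 'a" and \<Gamma> :: "('g, 'm) monoid_scheme" +
  fixes G :: "'g \<Rightarrow> 'a \<Rightarrow> real \<Rightarrow> real"
  assumes G_local: "\<And>g x t. g \<in> carrier \<Gamma> \<Longrightarrow> x \<in> topspace X \<Longrightarrow>
      \<exists>U e a b. openin X U \<and> x \<in> U \<and> e > 0 \<and> a > 0 \<and> b > 0 \<and>
        (\<forall>y\<in>U. \<forall>s. \<bar>s - t\<bar> < e \<longrightarrow> G g y s = G g x t + (if s \<le> t then a else b) * (s - t))"
    and G_shift: "\<And>g x n t. g \<in> carrier \<Gamma> \<Longrightarrow> x \<in> topspace X \<Longrightarrow>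
      G g (it n x) (t - of_int n) = G g x t - of_int n"
    and G_bounded: "\<And>g. g \<in> carrier \<Gamma> \<Longrightarrow> \<exists>K. \<forall>x\<in>topspace X. \<forall>t. \<bar>G g x t - t\<bar> \<le> K"
    and G_mult: "\<And>g h x. g \<in> carrier \<Gamma> \<Longrightarrow> h \<in> carrier \<Gamma> \<Longrightarrow> x \<in> topspace X \<Longrightarrow>
      \<exists>k U. openin X U \<and> x \<in> U \<and>
        (\<forall>y\<in>U. it k y = y \<and> (\<forall>t. G (g \<otimes>\<^bsub>\<Gamma>\<^esub> h) y t = G g y (G h y t) + of_int k))"
begin

section \<open>One-sided slopes and the break cocycle\<close>

definition has_slopes :: "'g \<Rightarrow> 'a \<Rightarrow> real \<Rightarrow> real \<Rightarrow> real \<Rightarrow> bool" where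
  "has_slopes g x t a b \<longleftrightarrow> a > 0 \<and> b > 0 \<and>
     (\<exists>e>0. \<forall>s. \<bar>s - t\<bar> < e \<longrightarrow> G g x s = G g x t + (if s \<le> t then a else b) * (s - t))"

lemma has_slopes_unique:
  assumes "has_slopes g x t a b" "has_slopes g x t a' b'"
  shows "a = a'" "b = b'"
proof -
  obtain e where e: "e > 0" "\<And>s. \<bar>s - t\<bar> < e \<Longrightarrow> G g x s = G g x t + (if s \<le> t then a else b) * (s - t)"
    using assms(1) unfolding has_slopes_def by blast
  obtain e' where e': "e' > 0" "\<And>s. \<bar>s - t\<bar> < e' \<Longrightarrow> G g x s = G g x t + (if s \<le> t then a' else b') * (s - t)"
    using assms(2) unfolding has_slopes_def by blast
  define d where "d = min e e' / 2"
  have d: "0 < d" "d < e" "d < e'" using e(1) e'(1) by (auto simp: d_def)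
  show "a = a'" using e(2)[of "t - d"] e'(2)[of "t - d"] d by simp
  show "b = b'" using e(2)[of "t + d"] e'(2)[of "t + d"] d by simp
qed

definition lslope :: "'g \<Rightarrow> 'a \<Rightarrow> real \<Rightarrow> real" where
  "lslope g x t = (THE a. \<exists>b. has_slopes g x t a b)"

definition rslope :: "'g \<Rightarrow> 'a \<Rightarrow> real \<Rightarrow> real" where
  "rslope g x t = (THE b. \<exists>a. has_slopes g x t a b)"

lemma slopes_eqI:
  assumes "has_slopes g x t a b"
  shows "lslope g x t = a" "rslope g x t = b"
proof -
  show "lslope g x t = a"
    unfolding lslope_def
  proof (rule the_equality)
    show "\<exists>b. has_slopes g x t a b" using assms by (rule exI)
    show "a' = a" if "\<exists>b. has_slopes g x t a' b" for a'
      using that by (elim exE) (rule has_slopes_unique(1)[OF _ assms])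
  qed
  show "rslope g x t = b"
    unfolding rslope_def
  proof (rule the_equality)
    show "\<exists>a. has_slopes g x t a b" using assms by (rule exI)
    show "b' = b" if "\<exists>a. has_slopes g x t a b'" for b'
      using that by (elim exE) (rule has_slopes_unique(2)[OF _ assms])
  qed
qed

text \<open>Near \<open>(x, t)\<close> the map depends only on the parameter and breaks at most at
  \<open>t\<close>. So on every nearby leaf both slopes agree with the left slope before
  \<open>t\<close> and with the right slope after \<open>t\<close>.\<close>

lemma local_form:
  assumes g: "g \<in> carrier \<Gamma>" and x: "x \<in> topspace X"
  obtains U e where "openin X U" "x \<in> U" "e > 0" "lslope g x t > 0" "rslope g x t > 0"
    "\<And>y s. y \<in> U \<Longrightarrow> \<bar>s - t\<bar> < e \<Longrightarrow>
       G g y s = G g x t + (if s \<le> t then lslope g x t else rslope g x t) * (s - t)"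
    "\<And>y. y \<in> U \<Longrightarrow> lslope g y t = lslope g x t" "\<And>y. y \<in> U \<Longrightarrow> rslope g y t = rslope g x t"
    "\<And>y s. y \<in> U \<Longrightarrow> \<bar>s - t\<bar> < e \<Longrightarrow> s < t \<Longrightarrow> lslope g y s = lslope g x t"
    "\<And>y s. y \<in> U \<Longrightarrow> \<bar>s - t\<bar> < e \<Longrightarrow> s < t \<Longrightarrow> rslope g y s = lslope g x t"
    "\<And>y s. y \<in> U \<Longrightarrow> \<bar>s - t\<bar> < e \<Longrightarrow> t < s \<Longrightarrow> lslope g y s = rslope g x t"
    "\<And>y s. y \<in> U \<Longrightarrow> \<bar>s - t\<bar> < e \<Longrightarrow> t < s \<Longrightarrow> rslope g y s = rslope g x t"
proof -
  obtain U e a b where U: "openin X U" "x \<in> U" "e > 0" "a > 0" "b > 0"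
    and f: "\<And>y s. y \<in> U \<Longrightarrow> \<bar>s - t\<bar> < e \<Longrightarrow> G g y s = G g x t + (if s \<le> t then a else b) * (s - t)"
    using G_local[OF g x, of t] by blast
  have "has_slopes g x t a b" unfolding has_slopes_def using U f by blast
  note ab = slopes_eqI[OF this]
  have f0: "G g y t = G g x t" if "y \<in> U" for y using f[OF that, of t] U(3) by simp
  have 0: "has_slopes g y t a b" if "y \<in> U" for y
    unfolding has_slopes_def f0[OF that] using U f[OF that] by blast
  have 1: "has_slopes g y s a a" if y: "y \<in> U" and s: "\<bar>s - t\<bar> < e" "s < t" for y s
    unfolding has_slopes_def
  proof (intro conjI exI[of _ "min (t - s) (e - (t - s))"] allI impI U)
    show "min (t - s) (e - (t - s)) > 0" using s by auto
    fix r assume r: "\<bar>r - s\<bar> < min (t - s) (e - (t - s))"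
    then have "\<bar>r - t\<bar> < e" "r < t" using s by (auto simp: abs_if split: if_splits)
    then show "G g y r = G g y s + (if r \<le> s then a else a) * (r - s)"
      using f[OF y, of r] f[OF y, of s] s by (simp add: algebra_simps)
  qed
  have 2: "has_slopes g y s b b" if y: "y \<in> U" and s: "\<bar>s - t\<bar> < e" "t < s" for y s
    unfolding has_slopes_def
  proof (intro conjI exI[of _ "min (s - t) (e - (s - t))"] allI impI U)
    show "min (s - t) (e - (s - t)) > 0" using s by auto
    fix r assume r: "\<bar>r - s\<bar> < min (s - t) (e - (s - t))"
    then have "\<bar>r - t\<bar> < e" "t < r" using s by (auto simp: abs_if split: if_splits)
    then show "G g y r = G g y s + (if r \<le> s then b else b) * (r - s)"
      using f[OF y, of r] f[OF y, of s] s by (simp add: algebra_simps)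
  qed
  show ?thesis
  proof (rule that[OF U(1-3)])
    show "lslope g x t > 0" "rslope g x t > 0" using ab U by auto
    show "\<And>y s. y \<in> U \<Longrightarrow> \<bar>s - t\<bar> < e \<Longrightarrow>
       G g y s = G g x t + (if s \<le> t then lslope g x t else rslope g x t) * (s - t)"
      unfolding ab by (rule f)
    show "lslope g y t = lslope g x t" "rslope g y t = rslope g x t" if "y \<in> U" for y
      unfolding ab using slopes_eqI[OF 0[OF that]] by auto
    show "lslope g y s = lslope g x t" "rslope g y s = lslope g x t" if "y \<in> U" "\<bar>s - t\<bar> < e" "s < t" for y s
      unfolding ab using slopes_eqI[OF 1[OF that]] by auto
    show "lslope g y s = rslope g x t" "rslope g y s = rslope g x t" if "y \<in> U" "\<bar>s - t\<bar> < e" "t < s" for y s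
      unfolding ab using slopes_eqI[OF 2[OF that]] by auto
  qed
qed

lemma has_slopes_slopes:
  assumes "g \<in> carrier \<Gamma>" "x \<in> topspace X"
  shows "has_slopes g x t (lslope g x t) (rslope g x t)"
proof -
  obtain U e where "x \<in> U" "e > 0" "lslope g x t > 0" "rslope g x t > 0"
    "\<And>y s. y \<in> U \<Longrightarrow> \<bar>s - t\<bar> < e \<Longrightarrow>
       G g y s = G g x t + (if s \<le> t then lslope g x t else rslope g x t) * (s - t)"
    by (rule local_form[OF assms, of t]) (rule that)
  then show ?thesis unfolding has_slopes_def by blast
qed

lemma slopes_pos:
  assumes "g \<in> carrier \<Gamma>" "x \<in> topspace X"
  shows "lslope g x t > 0" "rslope g x t > 0"
  using has_slopes_slopes[OF assms, of t] by (auto simp: has_slopes_def)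

lemma G_strict_mono:
  assumes "g \<in> carrier \<Gamma>" "x \<in> topspace X"
  shows "strict_mono (G g x)"
proof (rule strict_mono_on_real_if_locally)
  fix t
  obtain e where e: "e > 0" "\<And>s. \<bar>s - t\<bar> < e \<Longrightarrow> G g x s = G g x t + (if s \<le> t then lslope g x t else rslope g x t) * (s - t)"
    using has_slopes_slopes[OF assms, of t] unfolding has_slopes_def by blast
  have "G g x s < G g x t" if "\<bar>s - t\<bar> < e" "s < t" for s
    using e(2)[OF that(1)] that(2) slopes_pos[OF assms, of t] by (simp add: mult_pos_neg)
  moreover have "G g x t < G g x s" if "\<bar>s - t\<bar> < e" "t < s" for s
    using e(2)[OF that(1)] that(2) slopes_pos[OF assms, of t] by simp
  ultimately show "\<exists>e>0. \<forall>s. \<bar>s - t\<bar> < e \<longrightarrow> (s < t \<longrightarrow> G g x s < G g x t) \<and> (t < s \<longrightarrow> G g x t < G g x s)"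
    using e(1) by blast
qed

lemma G_inj: "g \<in> carrier \<Gamma> \<Longrightarrow> x \<in> topspace X \<Longrightarrow> G g x s = G g x t \<Longrightarrow> s = t"
  using G_strict_mono strict_mono_eq by blast

lemma G_continuous:
  assumes "g \<in> carrier \<Gamma>" "x \<in> topspace X"
  shows "continuous_on UNIV (G g x)"
proof (rule continuous_on_if_locally_broken_linear)
  fix t
  show "\<exists>e a b. e > 0 \<and> (\<forall>s. \<bar>s - t\<bar> < e \<longrightarrow> G g x s = G g x t + (if s \<le> t then a else b) * (s - t))"
    using has_slopes_slopes[OF assms, of t] unfolding has_slopes_def by blast
qed

lemma G_surj:
  assumes "g \<in> carrier \<Gamma>" "x \<in> topspace X"
  shows "\<exists>t. G g x t = s"
proof -
  obtain K where K: "\<And>t. \<bar>G g x t - t\<bar> \<le> K" using G_bounded[OF assms(1)] assms(2) by blast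
  have "G g x (s - K) \<le> s" "s \<le> G g x (s + K)" "s - K \<le> s + K"
    using K[of "s - K"] K[of "s + K"] by linarith+
  from IVT'[OF this continuous_on_subset[OF G_continuous[OF assms] subset_UNIV]]
  show ?thesis by blast
qed

text \<open>The chain rule for one-sided derivatives; the integer by which the lift of a product may
  differ does not affect slopes.\<close>

lemma slopes_mult:
  assumes g: "g \<in> carrier \<Gamma>" and h: "h \<in> carrier \<Gamma>" and x: "x \<in> topspace X"
  shows "lslope (g \<otimes>\<^bsub>\<Gamma>\<^esub> h) x t = lslope g x (G h x t) * lslope h x t"
    "rslope (g \<otimes>\<^bsub>\<Gamma>\<^esub> h) x t = rslope g x (G h x t) * rslope h x t"
proof -
  let ?a = "lslope h x t" and ?b = "rslope h x t" and ?a' = "lslope g x (G h x t)" and ?b' = "rslope g x (G h x t)"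
  note pos = slopes_pos[OF h x, of t] slopes_pos[OF g x, of "G h x t"]
  obtain e where e: "e > 0" "\<And>s. \<bar>s - t\<bar> < e \<Longrightarrow> G h x s = G h x t + (if s \<le> t then ?a else ?b) * (s - t)"
    using has_slopes_slopes[OF h x, of t] unfolding has_slopes_def by blast
  obtain d where d: "d > 0" "\<And>s. \<bar>s - G h x t\<bar> < d \<Longrightarrow> G g x s = G g x (G h x t) + (if s \<le> G h x t then ?a' else ?b') * (s - G h x t)"
    using has_slopes_slopes[OF g x, of "G h x t"] unfolding has_slopes_def by blast
  obtain k where k: "\<And>s. G (g \<otimes>\<^bsub>\<Gamma>\<^esub> h) x s = G g x (G h x s) + of_int k"
    using G_mult[OF g h x] by blast
  have "has_slopes (g \<otimes>\<^bsub>\<Gamma>\<^esub> h) x t (?a' * ?a) (?b' * ?b)"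
    unfolding has_slopes_def
  \<comment> \<open>Dividing \<open>d\<close> by the larger slope keeps the image of the interval
    within distance \<open>d\<close> of \<open>G h x t\<close>.\<close>
  proof (intro conjI exI[of _ "min e (d / max ?a ?b)"] allI impI)
    show "0 < ?a' * ?a" "0 < ?b' * ?b" "0 < min e (d / max ?a ?b)" using pos e(1) d(1) by auto
    fix s assume s: "\<bar>s - t\<bar> < min e (d / max ?a ?b)"
    define c where "c = (if s \<le> t then ?a else ?b)"
    have c: "0 < c" "c \<le> max ?a ?b" using pos by (auto simp: c_def)
    have hs: "G h x s = G h x t + c * (s - t)" using e(2)[of s] s by (simp add: c_def)
    have "\<bar>G h x s - G h x t\<bar> = c * \<bar>s - t\<bar>" using hs c by (simp add: abs_mult)
    also have "\<dots> \<le> max ?a ?b * \<bar>s - t\<bar>" using c by (intro mult_right_mono) auto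
    also have "\<dots> < d" using s c by (simp add: field_simps)
    finally have gs: "G g x (G h x s) = G g x (G h x t) + (if G h x s \<le> G h x t then ?a' else ?b') * (G h x s - G h x t)"
      by (rule d(2))
    have "G h x s \<le> G h x t \<longleftrightarrow> s \<le> t" using G_strict_mono[OF h x] by (simp add: strict_mono_less_eq)
    then show "G (g \<otimes>\<^bsub>\<Gamma>\<^esub> h) x s = G (g \<otimes>\<^bsub>\<Gamma>\<^esub> h) x t + (if s \<le> t then ?a' * ?a else ?b' * ?b) * (s - t)"
      unfolding k gs using hs by (simp add: c_def)
  qed
  from slopes_eqI[OF this] show "lslope (g \<otimes>\<^bsub>\<Gamma>\<^esub> h) x t = ?a' * ?a" "rslope (g \<otimes>\<^bsub>\<Gamma>\<^esub> h) x t = ?b' * ?b" .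
qed

lemma slopes_shift:
  assumes g: "g \<in> carrier \<Gamma>" and x: "x \<in> topspace X"
  shows "lslope g (it n x) (t - of_int n) = lslope g x t" "rslope g (it n x) (t - of_int n) = rslope g x t"
proof -
  obtain e where e: "e > 0" "\<And>s. \<bar>s - t\<bar> < e \<Longrightarrow> G g x s = G g x t + (if s \<le> t then lslope g x t else rslope g x t) * (s - t)"
    using has_slopes_slopes[OF assms, of t] unfolding has_slopes_def by blast
  have "has_slopes g (it n x) (t - of_int n) (lslope g x t) (rslope g x t)"
    unfolding has_slopes_def
  proof (intro conjI exI[of _ e] allI impI e(1) slopes_pos[OF assms])
    fix s assume s: "\<bar>s - (t - of_int n)\<bar> < e"
    then have "G g x (s + of_int n) = G g x t + (if s + of_int n \<le> t then lslope g x t else rslope g x t) * (s + of_int n - t)"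
      by (intro e(2)) (simp add: algebra_simps)
    moreover have "G g (it n x) s = G g x (s + of_int n) - of_int n"
      using G_shift[OF g x, of n "s + of_int n"] by simp
    ultimately show "G g (it n x) s = G g (it n x) (t - of_int n) + (if s \<le> t - of_int n then lslope g x t else rslope g x t) * (s - (t - of_int n))"
      using G_shift[OF g x, of n t] by (auto simp: algebra_simps)
  qed
  from slopes_eqI[OF this] show "lslope g (it n x) (t - of_int n) = lslope g x t" "rslope g (it n x) (t - of_int n) = rslope g x t" .
qed

text \<open>The logarithm of the ratio of right to left slope: zero where there is no break, and an
  additive cocycle by the chain rule.\<close>

definition jump :: "'g \<Rightarrow> 'a \<Rightarrow> real \<Rightarrow> real" where
  "jump g x t = ln (rslope g x t) - ln (lslope g x t)"

lemma jump_mult: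
  assumes "g \<in> carrier \<Gamma>" "h \<in> carrier \<Gamma>" "x \<in> topspace X"
  shows "jump (g \<otimes>\<^bsub>\<Gamma>\<^esub> h) x t = jump h x t + jump g x (G h x t)"
  using slopes_pos[OF assms(2,3), of t] slopes_pos[OF assms(1,3), of "G h x t"]
  by (simp add: jump_def slopes_mult[OF assms] ln_mult)

lemma jump_shift:
  assumes "g \<in> carrier \<Gamma>" "x \<in> topspace X"
  shows "jump g (it n x) (t - of_int n) = jump g x t"
  by (simp add: jump_def slopes_shift[OF assms])

lemma shift_01:
  fixes t :: real
  obtains n :: int where "0 \<le> t - of_int n" "t - of_int n < 1"
  by (rule that[of "\<lfloor>t\<rfloor>"]) linarith+

text \<open>In a small product neighbourhood of \<open>(x, t)\<close> breaks occur only at the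
  parameter \<open>t\<close>, and all with the same value. Compactness of \<open>X\<close> times the
  closed unit interval bounds both the parameters and the values; the values at other parameters
  follow by shifting.\<close>

lemma jump_finite:
  assumes g: "g \<in> carrier \<Gamma>"
  shows "finite {t \<in> {0..1}. \<exists>x\<in>topspace X. jump g x t \<noteq> 0}"
    "finite {jump g x t | x t. x \<in> topspace X}"
proof -
  have loc: "\<exists>U e. openin X U \<and> x \<in> U \<and> e > 0 \<and>
      (\<forall>y\<in>U. \<forall>s. \<bar>s - t\<bar> < e \<longrightarrow> jump g y s \<noteq> 0 \<longrightarrow> s = t \<and> jump g y s = jump g x t)"
    if x: "x \<in> topspace X" for x t
  proof -
    obtain U e where U: "openin X U" "x \<in> U" "e > 0"
      and sl: "\<And>y. y \<in> U \<Longrightarrow> lslope g y t = lslope g x t" "\<And>y. y \<in> U \<Longrightarrow> rslope g y t = rslope g x t"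
      "\<And>y s. y \<in> U \<Longrightarrow> \<bar>s - t\<bar> < e \<Longrightarrow> s < t \<Longrightarrow> lslope g y s = lslope g x t"
      "\<And>y s. y \<in> U \<Longrightarrow> \<bar>s - t\<bar> < e \<Longrightarrow> s < t \<Longrightarrow> rslope g y s = lslope g x t"
      "\<And>y s. y \<in> U \<Longrightarrow> \<bar>s - t\<bar> < e \<Longrightarrow> t < s \<Longrightarrow> lslope g y s = rslope g x t"
      "\<And>y s. y \<in> U \<Longrightarrow> \<bar>s - t\<bar> < e \<Longrightarrow> t < s \<Longrightarrow> rslope g y s = rslope g x t"
      by (rule local_form[OF g x, of t]) (rule that)
    have "s = t \<and> jump g y s = jump g x t" if y: "y \<in> U" and s: "\<bar>s - t\<bar> < e" and ne: "jump g y s \<noteq> 0" for y s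
    proof (cases s t rule: linorder_cases)
      case less
      then show ?thesis using ne sl(3)[OF y s] sl(4)[OF y s] by (simp add: jump_def)
    next
      case equal
      then show ?thesis using sl(1)[OF y] sl(2)[OF y] by (simp add: jump_def)
    next
      case greater
      then show ?thesis using ne sl(5)[OF y s] sl(6)[OF y s] by (simp add: jump_def)
    qed
    then show ?thesis using U by blast
  qed
  from compact_cylinder_cover[OF compact loc, of 0 1]
  obtain F where F: "finite F" "F \<subseteq> topspace X \<times> {0..1}"
    and F': "\<forall>y\<in>topspace X. \<forall>s\<in>{0..1}. \<exists>(x, t)\<in>F. jump g y s \<noteq> 0 \<longrightarrow> s = t \<and> jump g y s = jump g x t"
    by blast
  have key: "\<exists>(y, s)\<in>F. t = s \<and> jump g x t = jump g y s" if x: "x \<in> topspace X" and t: "t \<in> {0..1}" and ne: "jump g x t \<noteq> 0" for x t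
    using bspec[OF bspec[OF F' x] t] ne by blast
  have "{t \<in> {0..1}. \<exists>x\<in>topspace X. jump g x t \<noteq> 0} \<subseteq> snd ` F"
  proof clarify
    fix t x assume "t \<in> {0..1::real}" "x \<in> topspace X" "jump g x t \<noteq> 0"
    from key[OF this(2,1,3)] obtain y s where "(y, s) \<in> F" "t = s" by blast
    then show "t \<in> snd ` F" by force
  qed
  then show "finite {t \<in> {0..1}. \<exists>x\<in>topspace X. jump g x t \<noteq> 0}"
    by (rule finite_subset) (use F(1) in simp)
  have "{jump g x t | x t. x \<in> topspace X} \<subseteq> insert 0 ((\<lambda>(y, s). jump g y s) ` F)"
  proof clarify
    fix x t assume x: "x \<in> topspace X" and no: "jump g x t \<notin> (\<lambda>(y, s). jump g y s) ` F"
    obtain n :: int where n: "0 \<le> t - of_int n" "t - of_int n < 1" by (rule shift_01)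
    have "jump g (it n x) (t - of_int n) = 0"
    proof (rule ccontr)
      assume "jump g (it n x) (t - of_int n) \<noteq> 0"
      from key[OF it_closed[OF x] _ this] n
      obtain y s where "(y, s) \<in> F" "jump g (it n x) (t - of_int n) = jump g y s" by auto
      then show False using no jump_shift[OF g x, of n t] by force
    qed
    then show "jump g x t = 0" using jump_shift[OF g x, of n t] by simp
  qed
  then show "finite {jump g x t | x t. x \<in> topspace X}"
    by (rule finite_subset) (use F(1) in simp)
qed

text \<open>For fixed \<open>t\<close> the value is locally constant in the base point, since
  \<open>G_local\<close> uses the value at \<open>x\<close> for all nearby leaves. Together with
  compactness this makes every such function of the base point measurable with finitely many
  values.\<close>

lemma G_level_open:
  assumes g: "g \<in> carrier \<Gamma>"
  shows "openin X {x \<in> topspace X. P (G g x t)}"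
proof (subst openin_subopen, intro ballI)
  fix x assume "x \<in> {x \<in> topspace X. P (G g x t)}"
  then have x: "x \<in> topspace X" "P (G g x t)" by auto
  obtain U e where U: "openin X U" "x \<in> U" "e > 0"
    "\<And>y s. y \<in> U \<Longrightarrow> \<bar>s - t\<bar> < e \<Longrightarrow>
       G g y s = G g x t + (if s \<le> t then lslope g x t else rslope g x t) * (s - t)"
    by (rule local_form[OF g x(1), of t]) (rule that)
  have "U \<subseteq> {x \<in> topspace X. P (G g x t)}"
    using U(3) U(4)[of _ t] x(2) openin_subset[OF U(1)] by auto
  then show "\<exists>T. openin X T \<and> x \<in> T \<and> T \<subseteq> {x \<in> topspace X. P (G g x t)}" using U by blast
qed

lemma G_level_clopen:
  assumes g: "g \<in> carrier \<Gamma>"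
  shows "clopenin X {x \<in> topspace X. P (G g x t)}"
proof -
  have "topspace X - {x \<in> topspace X. P (G g x t)} = {x \<in> topspace X. \<not> P (G g x t)}" by auto
  then show ?thesis using G_level_open[OF g, of P t] G_level_open[OF g, of "\<lambda>r. \<not> P r" t]
    unfolding clopenin_def closedin_def by auto
qed

lemma G_values_finite:
  assumes g: "g \<in> carrier \<Gamma>"
  shows "finite {G g x t | x. x \<in> topspace X}"
proof -
  let ?U = "\<lambda>r. {x \<in> topspace X. G g x t = r}"
  have "compactin X (topspace X)" using compact by (simp add: compact_space_def)
  moreover have "openin X W" if "W \<in> range ?U" for W using that G_level_open[OF g] by auto
  moreover have "topspace X \<subseteq> \<Union> (range ?U)" by blast
  ultimately have "\<exists>\<F>. finite \<F> \<and> \<F> \<subseteq> range ?U \<and> topspace X \<subseteq> \<Union> \<F>"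
    unfolding compactin_def by blast
  then obtain \<F> where \<F>: "finite \<F>" "\<F> \<subseteq> range ?U" "topspace X \<subseteq> \<Union> \<F>" by blast
  from finite_subset_image[OF \<F>(1,2)] obtain R where R: "finite R" "\<F> = ?U ` R" by blast
  have "{G g x t | x. x \<in> topspace X} \<subseteq> R"
  proof clarify
    fix x assume "x \<in> topspace X"
    then have "x \<in> \<Union> (?U ` R)" using \<F>(3) R(2) by blast
    then show "G g x t \<in> R" by blast
  qed
  then show ?thesis using R(1) by (rule finite_subset)
qed

text \<open>A pair \<open>(q, x)\<close> with \<open>0 \<le> q < 1\<close> is the normal form of the point \<open>[x, q]\<close> of the suspension.\<close>

definition leaf_point :: "'a \<Rightarrow> real \<Rightarrow> real \<times> 'a" where
  "leaf_point x t = (frac t, it \<lfloor>t\<rfloor> x)"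

definition leaf_map :: "'g \<Rightarrow> real \<times> 'a \<Rightarrow> real \<times> 'a" where
  "leaf_map g p = leaf_point (snd p) (G g (snd p) (fst p))"

lemma leaf_point_shift:
  assumes "x \<in> topspace X"
  shows "leaf_point (it n x) (t - of_int n) = leaf_point x t"
proof -
  have "frac (t - of_int n) = frac t" by (simp add: frac_def)
  moreover have "it \<lfloor>t - of_int n\<rfloor> (it n x) = it \<lfloor>t\<rfloor> x"
    using it_add[OF assms, of "\<lfloor>t\<rfloor> - n" n] by simp
  ultimately show ?thesis by (simp add: leaf_point_def)
qed

lemma leaf_point_period:
  assumes "x \<in> topspace X" "it k x = x"
  shows "leaf_point x (t + of_int k) = leaf_point x t"
  using leaf_point_shift[OF assms(1), of k "t + of_int k"] assms(2) by simp

lemma leaf_point_01: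
  assumes "x \<in> topspace X" "0 \<le> q" "q < 1"
  shows "leaf_point x q = (q, x)"
proof -
  have "\<lfloor>q\<rfloor> = 0" using assms by linarith
  then show ?thesis using it_0[OF assms(1)] by (simp add: leaf_point_def frac_def)
qed

lemma leaf_point_in: "x \<in> topspace X \<Longrightarrow> leaf_point x t \<in> {0..<1} \<times> topspace X"
  by (simp add: leaf_point_def it_closed frac_ge_0 frac_lt_1)

lemma leaf_map_point:
  assumes "g \<in> carrier \<Gamma>" "x \<in> topspace X"
  shows "leaf_map g (leaf_point x t) = leaf_point x (G g x t)"
proof -
  have "G g (it \<lfloor>t\<rfloor> x) (frac t) = G g x t - of_int \<lfloor>t\<rfloor>"
    using G_shift[OF assms, of "\<lfloor>t\<rfloor>" t] by (simp add: frac_def)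
  then have "leaf_map g (leaf_point x t) = leaf_point (it \<lfloor>t\<rfloor> x) (G g x t - of_int \<lfloor>t\<rfloor>)"
    by (simp add: leaf_map_def leaf_point_def)
  then show ?thesis using leaf_point_shift[OF assms(2)] by simp
qed

lemma leaf_map_mult_point:
  assumes "g \<in> carrier \<Gamma>" "h \<in> carrier \<Gamma>" "x \<in> topspace X"
  shows "leaf_map (g \<otimes>\<^bsub>\<Gamma>\<^esub> h) (leaf_point x t) = leaf_map g (leaf_map h (leaf_point x t))"
proof -
  obtain k where k: "it k x = x" "G (g \<otimes>\<^bsub>\<Gamma>\<^esub> h) x t = G g x (G h x t) + of_int k"
    using G_mult[OF assms] by blast
  show ?thesis
    using assms by (simp add: leaf_map_point k(2) leaf_point_period[OF assms(3) k(1)])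
qed

text \<open>The lift of the unit is idempotent up to a period, and by surjectivity it is itself a
  translation by a period, not necessarily the identity.\<close>

lemma G_one:
  assumes "x \<in> topspace X"
  shows "\<exists>k. it k x = x \<and> (\<forall>t. G \<one>\<^bsub>\<Gamma>\<^esub> x t = t + of_int k)"
proof -
  obtain k where k: "it k x = x" "\<And>t. G (\<one>\<^bsub>\<Gamma>\<^esub> \<otimes>\<^bsub>\<Gamma>\<^esub> \<one>\<^bsub>\<Gamma>\<^esub>) x t = G \<one>\<^bsub>\<Gamma>\<^esub> x (G \<one>\<^bsub>\<Gamma>\<^esub> x t) + of_int k"
    using G_mult[OF \<Gamma>.one_closed \<Gamma>.one_closed assms] assms by blast
  have "G \<one>\<^bsub>\<Gamma>\<^esub> x s = s + of_int (- k)" for s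
  proof -
    obtain t where t: "G \<one>\<^bsub>\<Gamma>\<^esub> x t = s" using G_surj[OF \<Gamma>.one_closed assms] by blast
    have "s = G \<one>\<^bsub>\<Gamma>\<^esub> x s + of_int k" using k(2)[of t] t by simp
    then show ?thesis by simp
  qed
  moreover have "it (- k) x = x" using it_neg(1)[OF assms, of k] k(1) by simp
  ultimately show ?thesis by blast
qed

lemma leaf_map_one_point:
  assumes "x \<in> topspace X"
  shows "leaf_map \<one>\<^bsub>\<Gamma>\<^esub> (leaf_point x t) = leaf_point x t"
proof -
  obtain k where k: "it k x = x" "\<forall>t. G \<one>\<^bsub>\<Gamma>\<^esub> x t = t + of_int k" using G_one[OF assms] by blast
  show ?thesis
    using assms by (simp add: leaf_map_point k(2) leaf_point_period[OF assms k(1)])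
qed

lemma point_eq_leaf_point:
  assumes "p \<in> {0..<1} \<times> topspace X"
  shows "p = leaf_point (snd p) (fst p)"
  using leaf_point_01[of "snd p" "fst p"] assms by (cases p) auto

lemma leaf_map_in:
  assumes "g \<in> carrier \<Gamma>" "p \<in> {0..<1} \<times> topspace X"
  shows "leaf_map g p \<in> {0..<1} \<times> topspace X"
  using leaf_point_in[of "snd p"] assms(2) unfolding leaf_map_def by auto

lemma leaf_map_mult:
  assumes "g \<in> carrier \<Gamma>" "h \<in> carrier \<Gamma>" "p \<in> {0..<1} \<times> topspace X"
  shows "leaf_map (g \<otimes>\<^bsub>\<Gamma>\<^esub> h) p = leaf_map g (leaf_map h p)"
proof -
  have "snd p \<in> topspace X" using assms(3) by auto
  from leaf_map_mult_point[OF assms(1,2) this, of "fst p"] show ?thesis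
    unfolding point_eq_leaf_point[OF assms(3), symmetric] .
qed

lemma leaf_map_one:
  assumes "p \<in> {0..<1} \<times> topspace X"
  shows "leaf_map \<one>\<^bsub>\<Gamma>\<^esub> p = p"
proof -
  have "snd p \<in> topspace X" using assms by auto
  from leaf_map_one_point[OF this, of "fst p"] show ?thesis
    unfolding point_eq_leaf_point[OF assms, symmetric] .
qed

lemma jump_leaf_point:
  assumes "g \<in> carrier \<Gamma>" "x \<in> topspace X"
  shows "jump g (snd (leaf_point x t)) (fst (leaf_point x t)) = jump g x t"
  using jump_shift[OF assms, of "\<lfloor>t\<rfloor>" t] by (simp add: leaf_point_def frac_def)

text \<open>Start from the break parameters and close up under all maps from \<open>q\<close> to the
  fractional part of \<open>G g x q\<close>. Each group element contributes finitely many images of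
  \<open>q\<close>, so the closure under the relation \<open>R\<close> remains countable.\<close>

lemma countable_transversal:
  assumes "countable (carrier \<Gamma>)"
  obtains Q where "countable Q" "Q \<subseteq> {0..<1}"
    "\<And>g x q. g \<in> carrier \<Gamma> \<Longrightarrow> x \<in> topspace X \<Longrightarrow> q \<in> Q \<Longrightarrow> frac (G g x q) \<in> Q"
    "\<And>g x t. g \<in> carrier \<Gamma> \<Longrightarrow> x \<in> topspace X \<Longrightarrow> jump g x t \<noteq> 0 \<Longrightarrow> frac t \<in> Q"
proof -
  define R where "R = {(q, frac (G g x q)) | q g x. g \<in> carrier \<Gamma> \<and> x \<in> topspace X}"
  \<comment> \<open>Compactness gave the closed unit interval; the parameter 1 is dropped because it
    is parameter 0 on the shifted base point.\<close>
  define Q0 where "Q0 = (\<Union>g\<in>carrier \<Gamma>. {t \<in> {0..1}. \<exists>x\<in>topspace X. jump g x t \<noteq> 0} - {1})"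
  define Q where "Q = R\<^sup>* `` Q0"
  have "countable (R `` Y)" if Y: "countable Y" for Y
  proof -
    have "R `` Y \<subseteq> (\<Union>q\<in>Y. \<Union>g\<in>carrier \<Gamma>. frac ` {G g x q | x. x \<in> topspace X})"
      unfolding R_def by blast
    moreover have "countable (\<Union>q\<in>Y. \<Union>g\<in>carrier \<Gamma>. frac ` {G g x q | x. x \<in> topspace X})"
      by (intro countable_UN Y assms countable_image countable_finite G_values_finite)
    ultimately show ?thesis by (rule countable_subset)
  qed
  moreover have "countable Q0"
    unfolding Q0_def by (intro countable_UN assms countable_finite finite_Diff jump_finite(1))
  ultimately have 1: "countable Q" unfolding Q_def by (rule countable_rtrancl)
  have R01: "R `` Y \<subseteq> {0..<1}" for Y unfolding R_def by (auto simp: frac_ge_0 frac_lt_1)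
  have "Q0 \<subseteq> {0..<1}" unfolding Q0_def by auto
  have 2: "Q \<subseteq> {0..<1}"
  proof
    fix q assume "q \<in> Q"
    then obtain q0 where q0: "q0 \<in> Q0" "(q0, q) \<in> R\<^sup>*" unfolding Q_def by blast
    from q0(2) show "q \<in> {0..<1}"
    proof cases
      case base
      then show ?thesis using q0(1) \<open>Q0 \<subseteq> {0..<1}\<close> by blast
    next
      case (step y)
      then show ?thesis using R01[of UNIV] by blast
    qed
  qed
  have 3: "frac (G g x q) \<in> Q" if "g \<in> carrier \<Gamma>" "x \<in> topspace X" "q \<in> Q" for g x q
  proof -
    have "(q, frac (G g x q)) \<in> R" unfolding R_def using that(1,2) by blast
    then show ?thesis using that(3) unfolding Q_def by (meson Image_iff rtrancl.rtrancl_into_rtrancl)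
  qed
  have 4: "frac t \<in> Q" if g: "g \<in> carrier \<Gamma>" and x: "x \<in> topspace X" and ne: "jump g x t \<noteq> 0" for g x t
  proof -
    have "jump g (it \<lfloor>t\<rfloor> x) (frac t) \<noteq> 0" using jump_leaf_point[OF g x, of t] ne by (simp add: leaf_point_def)
    then have "frac t \<in> Q0"
      unfolding Q0_def using g it_closed[OF x, of "\<lfloor>t\<rfloor>"] frac_ge_0[of t] frac_lt_1[of t] by force
    then show ?thesis unfolding Q_def by blast
  qed
  show ?thesis by (rule that[OF 1 2 3 4])
qed

lemma jump_level_open:
  assumes g: "g \<in> carrier \<Gamma>"
  shows "openin X {x \<in> topspace X. P (jump g x t)}"
proof (subst openin_subopen, intro ballI)
  fix x assume "x \<in> {x \<in> topspace X. P (jump g x t)}"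
  then have x: "x \<in> topspace X" "P (jump g x t)" by auto
  obtain U where U: "openin X U" "x \<in> U"
    "\<And>y. y \<in> U \<Longrightarrow> lslope g y t = lslope g x t" "\<And>y. y \<in> U \<Longrightarrow> rslope g y t = rslope g x t"
    by (rule local_form[OF g x(1), of t]) (rule that)
  have "jump g y t = jump g x t" if "y \<in> U" for y using U(3,4)[OF that] by (simp add: jump_def)
  then have "U \<subseteq> {x \<in> topspace X. P (jump g x t)}"
    using x(2) openin_subset[OF U(1)] by auto
  then show "\<exists>T. openin X T \<and> x \<in> T \<and> T \<subseteq> {x \<in> topspace X. P (jump g x t)}" using U by blast
qed

lemma jump_level_clopen:
  assumes g: "g \<in> carrier \<Gamma>"
  shows "clopenin X {x \<in> topspace X. P (jump g x t)}"
proof -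
  have "topspace X - {x \<in> topspace X. P (jump g x t)} = {x \<in> topspace X. \<not> P (jump g x t)}" by auto
  then show ?thesis using jump_level_open[OF g, of P t] jump_level_open[OF g, of "\<lambda>r. \<not> P r" t]
    unfolding clopenin_def closedin_def by auto
qed

section \<open>Measure on the transversal: counting measure on the parameters times an invariant
  measure on the base\<close>

context
  fixes \<mu> :: "'a measure" and Q :: "real set"
  assumes mu_space: "space \<mu> = topspace X"
    and mu_sets: "sets \<mu> = sigma_sets (topspace X) clopen_sets"
    and mu_1: "emeasure \<mu> (space \<mu>) = 1"
    and mu_it: "\<And>n. it n \<in> measurable \<mu> \<mu>"
    and mu_inv: "\<And>n f. f \<in> borel_measurable \<mu> \<Longrightarrow> (\<integral>\<^sup>+x. f (it n x) \<partial>\<mu>) = (\<integral>\<^sup>+x. f x \<partial>\<mu>)"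
    and Q_countable: "countable Q" and Q_01: "Q \<subseteq> {0..<1}"
    and Q_closed: "\<And>g x q. g \<in> carrier \<Gamma> \<Longrightarrow> x \<in> topspace X \<Longrightarrow> q \<in> Q \<Longrightarrow> frac (G g x q) \<in> Q"
begin

abbreviation "transversal \<equiv> count_space Q \<Otimes>\<^sub>M \<mu>"

lemma finite_mu: "finite_measure \<mu>"
  by (rule finite_measureI) (simp add: mu_1)

lemma clopen_in_sets: "clopenin X C \<Longrightarrow> C \<in> sets \<mu>"
  unfolding mu_sets by (rule sigma_sets.Basic) (simp add: clopen_sets_def)

lemma space_transversal: "space transversal = Q \<times> topspace X"
  by (simp add: space_pair_measure mu_space)

lemma leaf_map_transversal:
  assumes "g \<in> carrier \<Gamma>" "p \<in> space transversal"
  shows "leaf_map g p \<in> space transversal"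
  using assms Q_closed[OF assms(1), of "snd p" "fst p"] it_closed[of "snd p"]
  by (auto simp: space_transversal leaf_map_def leaf_point_def)

lemma measurable_finite_levels:
  fixes f :: "'a \<Rightarrow> 'c"
  assumes fin: "finite {f x | x. x \<in> topspace X}"
    and lev: "\<And>r. clopenin X {x \<in> topspace X. f x = r}"
  shows "f \<in> measurable \<mu> (count_space {f x | x. x \<in> topspace X})"
  unfolding measurable_count_space_eq2[OF fin]
proof (intro conjI ballI)
  show "f \<in> space \<mu> \<rightarrow> {f x |x. x \<in> topspace X}" unfolding mu_space by blast
  fix r
  have "f -` {r} \<inter> space \<mu> = {x \<in> topspace X. f x = r}" unfolding mu_space by blast
  then show "f -` {r} \<inter> space \<mu> \<in> sets \<mu>" using clopen_in_sets[OF lev] by simp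
qed

lemma measurable_G_value:
  assumes "g \<in> carrier \<Gamma>"
  shows "(\<lambda>x. G g x t) \<in> measurable \<mu> (count_space {G g x t | x. x \<in> topspace X})"
  by (rule measurable_finite_levels[OF G_values_finite[OF assms] G_level_clopen[OF assms]])

lemma measurable_leaf_map:
  assumes g: "g \<in> carrier \<Gamma>"
  shows "leaf_map g \<in> measurable transversal transversal"
proof (rule measurable_pair_measure_countable1[OF Q_countable])
  fix q assume q: "q \<in> Q"
  note m = measurable_G_value[OF g, of q]
  have 1: "(\<lambda>x. frac (G g x q)) \<in> measurable \<mu> (count_space Q)"
    by (rule measurable_compose[OF m]) (use Q_closed[OF g _ q] in auto)
  have 2: "(\<lambda>x. it \<lfloor>G g x q\<rfloor> x) \<in> measurable \<mu> \<mu>"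
    by (rule measurable_compose_countable'[where f = "\<lambda>r x. it \<lfloor>r\<rfloor> x", OF mu_it m])
      (rule countable_finite[OF G_values_finite[OF g]])
  show "(\<lambda>x. leaf_map g (q, x)) \<in> measurable \<mu> transversal"
    unfolding leaf_map_def leaf_point_def fst_conv snd_conv by (rule measurable_Pair[OF 1 2])
qed

text \<open>Cut the integral according to the integer part \<open>n\<close> of the image parameter;
  there the base point moves by \<open>it n\<close>, which preserves the measure. For a fixed new
  base point \<open>z\<close>, the pairs \<open>(q, n)\<close> correspond to points
  \<open>q - n\<close> of its leaf that land in the unit interval. By injectivity of the lift each
  target parameter in \<open>Q\<close> is hit at most once.\<close>

lemma leaf_map_nonincreasing:
  assumes g: "g \<in> carrier \<Gamma>" and f: "f \<in> borel_measurable transversal"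
  shows "(\<integral>\<^sup>+p. f (leaf_map g p) \<partial>transversal) \<le> (\<integral>\<^sup>+p. f p \<partial>transversal)"
proof -
  interpret finite_measure \<mu> by (rule finite_mu)
  note fS = measurable_compose[OF measurable_leaf_map[OF g] f]
  have fSq: "(\<lambda>x. f (leaf_map g (q, x))) \<in> borel_measurable \<mu>" if "q \<in> Q" for q
    using measurable_compose[OF measurable_Pair1'[of q "count_space Q" \<mu>] fS] that by simp
  \<comment> \<open>The part of the integrand whose image has integer part \<open>n\<close>, so that
    the image has base point \<open>it n x\<close>.\<close>
  define h where "h q n x = f (leaf_map g (q, x)) * indicator {x \<in> topspace X. \<lfloor>G g x q\<rfloor> = n} x" for q n x
  have hm: "h q n \<in> borel_measurable \<mu>" if "q \<in> Q" for q n
    unfolding h_def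
  proof (rule borel_measurable_times_ennreal[OF fSq[OF that]])
    show "indicator {x \<in> topspace X. \<lfloor>G g x q\<rfloor> = n} \<in> borel_measurable \<mu>"
      using clopen_in_sets[OF G_level_clopen[OF g, of "\<lambda>r. \<lfloor>r\<rfloor> = n" q]] by simp
  qed
  have h_sum: "f (leaf_map g (q, x)) = (\<integral>\<^sup>+n. h q n x \<partial>count_space UNIV)" if "x \<in> topspace X" for q x
  proof -
    have "(\<integral>\<^sup>+n. h q n x \<partial>count_space UNIV) =
        (\<integral>\<^sup>+n. f (leaf_map g (q, x)) * indicator {\<lfloor>G g x q\<rfloor>} n \<partial>count_space UNIV)"
      using that by (intro nn_integral_cong) (auto simp: h_def indicator_def)
    then show ?thesis by (simp add: nn_integral_cmult_indicator)
  qed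
  \<comment> \<open>The contribution of the point \<open>s\<close> on the leaf of \<open>z\<close>,
    counted when its image already lies in the fundamental interval of that leaf.\<close>
  define H where "H z s = (if 0 \<le> G g z s \<and> G g z s < 1 then f (G g z s, z) else 0)" for z s
  have hH: "h q n (it (- n) z) = H z (q - of_int n)" if z: "z \<in> topspace X" for q n z
  proof -
    have sh: "G g (it (- n) z) q = G g z (q - of_int n) + of_int n"
      using G_shift[OF g z, of "- n" "q - of_int n"] by simp
    have fl: "\<lfloor>G g (it (- n) z) q\<rfloor> = n \<longleftrightarrow> 0 \<le> G g z (q - of_int n) \<and> G g z (q - of_int n) < 1"
      unfolding sh by (auto simp: floor_eq_iff)
    have "leaf_map g (q, it (- n) z) = (G g z (q - of_int n), z)" if "\<lfloor>G g (it (- n) z) q\<rfloor> = n"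
      using that z sh by (simp add: leaf_map_def leaf_point_def frac_def)
    then show ?thesis using fl it_closed[OF z] by (auto simp: h_def H_def indicator_def)
  qed
  have le: "(\<integral>\<^sup>+q. \<integral>\<^sup>+n. H z (q - of_int n) \<partial>count_space (UNIV :: int set) \<partial>count_space Q) \<le> (\<integral>\<^sup>+q. f (q, z) \<partial>count_space Q)"
    if z: "z \<in> topspace X" for z
  proof -
    let ?I = "{(q, n) \<in> Q \<times> (UNIV :: int set). 0 \<le> G g z (q - of_int n) \<and> G g z (q - of_int n) < 1}"
    let ?\<kappa> = "\<lambda>(q, n). G g z (q - of_int n)"
    interpret Z: sigma_finite_measure "count_space (UNIV :: int set)"
      by (rule sigma_finite_measure_count_space)
    have "(\<integral>\<^sup>+q. \<integral>\<^sup>+n. H z (q - of_int n) \<partial>count_space UNIV \<partial>count_space Q) =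
        (\<integral>\<^sup>+p. H z (fst p - of_int (snd p)) \<partial>(count_space Q \<Otimes>\<^sub>M count_space (UNIV :: int set)))"
      using Z.nn_integral_fst[of "\<lambda>p. H z (fst p - of_int (snd p))" "count_space Q"]
        Q_countable by (simp add: pair_measure_countable)
    also have "\<dots> = (\<integral>\<^sup>+p. H z (fst p - of_int (snd p)) \<partial>count_space (Q \<times> UNIV))"
      using Q_countable by (simp add: pair_measure_countable)
    also have "\<dots> = (\<integral>\<^sup>+p. f (?\<kappa> p, z) \<partial>count_space ?I)"
    proof -
      have "(\<integral>\<^sup>+p. H z (fst p - of_int (snd p)) \<partial>count_space (Q \<times> UNIV)) =
          (\<integral>\<^sup>+p. H z (fst p - of_int (snd p)) \<partial>count_space ?I)"
        by (rule nn_integral_count_space_eq) (auto simp: H_def)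
      also have "\<dots> = (\<integral>\<^sup>+p. f (?\<kappa> p, z) \<partial>count_space ?I)"
        by (rule nn_integral_cong) (auto simp: H_def)
      finally show ?thesis .
    qed
    also have "\<dots> = (\<integral>\<^sup>+q. f (q, z) \<partial>count_space (?\<kappa> ` ?I))"
    proof (rule nn_integral_bij_count_space[where f = "\<lambda>q. f (q, z)"])
      \<comment> \<open>Two numbers in the half-open unit interval with integral difference are
        equal, so \<open>q - n\<close> determines both \<open>q\<close> and
        \<open>n\<close>.\<close>
      have "p = p'" if p: "p \<in> ?I" "p' \<in> ?I" and e: "?\<kappa> p = ?\<kappa> p'" for p p'
      proof -
        obtain q n q' n' where pq: "p = (q, n)" "p' = (q', n')" by (cases p, cases p')
        have "q - of_int n = q' - of_int n'" using G_inj[OF g z] e unfolding pq by auto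
        moreover have "0 \<le> q" "q < 1" "0 \<le> q'" "q' < 1" using p Q_01 unfolding pq by auto
        ultimately have "n = n'" by linarith
        then show ?thesis using \<open>q - of_int n = q' - of_int n'\<close> unfolding pq by simp
      qed
      then have "inj_on ?\<kappa> ?I" unfolding inj_on_def by blast
      then show "bij_betw ?\<kappa> ?I (?\<kappa> ` ?I)" by (rule inj_on_imp_bij_betw)
    qed
    also have "\<dots> \<le> (\<integral>\<^sup>+q. f (q, z) \<partial>count_space Q)"
    proof (rule nn_integral_count_space_subset_le, rule image_subsetI)
      fix p assume p: "p \<in> ?I"
      obtain q n where pq: "p = (q, n)" by (cases p)
      have *: "q \<in> Q" "0 \<le> G g z (q - of_int n)" "G g z (q - of_int n) < 1" using p unfolding pq by auto
      have "G g (it (- n) z) q = G g z (q - of_int n) + of_int n"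
        using G_shift[OF g z, of "- n" "q - of_int n"] by simp
      then have "frac (G g (it (- n) z) q) = G g z (q - of_int n)"
        using *(2,3) by (simp add: frac_unique_iff)
      then show "?\<kappa> p \<in> Q" using Q_closed[OF g it_closed[OF z] *(1), of "- n"] unfolding pq by simp
    qed
    finally show ?thesis .
  qed
  have fq: "(\<lambda>x. f (q, x)) \<in> borel_measurable \<mu>" if "q \<in> Q" for q
    using measurable_compose[OF measurable_Pair1'[of q "count_space Q" \<mu>] f] that by simp
  have Hm: "(\<lambda>z. H z (q - of_int n)) \<in> borel_measurable \<mu>" if q: "q \<in> Q" for q and n :: int
  proof -
    have "(\<lambda>z. h q n (it (- n) z)) \<in> borel_measurable \<mu>" by (rule measurable_compose[OF mu_it hm[OF q]])
    moreover have "h q n (it (- n) z) = H z (q - of_int n)" if "z \<in> space \<mu>" for z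
      using hH that by (simp add: mu_space)
    ultimately show ?thesis by (simp cong: measurable_cong)
  qed
  have inner: "(\<integral>\<^sup>+x. h q n x \<partial>\<mu>) = (\<integral>\<^sup>+z. H z (q - of_int n) \<partial>\<mu>)" if q: "q \<in> Q" for q n
  proof -
    have "(\<integral>\<^sup>+x. h q n x \<partial>\<mu>) = (\<integral>\<^sup>+z. h q n (it (- n) z) \<partial>\<mu>)"
      by (rule mu_inv[OF hm[OF q], symmetric])
    also have "\<dots> = (\<integral>\<^sup>+z. H z (q - of_int n) \<partial>\<mu>)"
      by (rule nn_integral_cong) (simp add: hH mu_space)
    finally show ?thesis .
  qed
  have "(\<integral>\<^sup>+p. f (leaf_map g p) \<partial>transversal) = (\<integral>\<^sup>+q. \<integral>\<^sup>+x. f (leaf_map g (q, x)) \<partial>\<mu> \<partial>count_space Q)"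
    using nn_integral_fst[OF fS] by simp
  also have "\<dots> = (\<integral>\<^sup>+q. \<integral>\<^sup>+x. \<integral>\<^sup>+n. h q n x \<partial>count_space UNIV \<partial>\<mu> \<partial>count_space Q)"
    by (intro nn_integral_cong) (simp add: h_sum mu_space)
  also have "\<dots> = (\<integral>\<^sup>+q. \<integral>\<^sup>+n. \<integral>\<^sup>+x. h q n x \<partial>\<mu> \<partial>count_space UNIV \<partial>count_space Q)"
    by (intro nn_integral_cong nn_integral_count_space_nn_integral) (auto simp: hm)
  also have "\<dots> = (\<integral>\<^sup>+q. \<integral>\<^sup>+n. \<integral>\<^sup>+z. H z (q - of_int n) \<partial>\<mu> \<partial>count_space UNIV \<partial>count_space Q)"
    by (rule nn_integral_cong, rule nn_integral_cong) (simp add: inner)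
  also have "\<dots> = (\<integral>\<^sup>+q. \<integral>\<^sup>+z. \<integral>\<^sup>+n. H z (q - of_int n) \<partial>count_space UNIV \<partial>\<mu> \<partial>count_space Q)"
    by (intro nn_integral_cong nn_integral_count_space_nn_integral[symmetric]) (auto simp: Hm)
  also have "\<dots> = (\<integral>\<^sup>+z. \<integral>\<^sup>+q. \<integral>\<^sup>+n. H z (q - of_int n) \<partial>count_space UNIV \<partial>count_space Q \<partial>\<mu>)"
  proof (rule nn_integral_count_space_nn_integral[symmetric, OF Q_countable])
    fix q assume q: "q \<in> Q"
    interpret Z: sigma_finite_measure "count_space (UNIV :: int set)"
      by (rule sigma_finite_measure_count_space)
    have "(\<lambda>p. H (snd p) (q - of_int (fst p))) \<in> borel_measurable (count_space (UNIV :: int set) \<Otimes>\<^sub>M \<mu>)"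
      by (rule measurable_pair_measure_countable1[OF countableI_type]) (use Hm[OF q] in simp)
    from Z.borel_measurable_nn_integral_fst[OF measurable_pair_swap[OF this]]
    show "(\<lambda>z. \<integral>\<^sup>+n. H z (q - of_int n) \<partial>count_space UNIV) \<in> borel_measurable \<mu>" by simp
  qed
  also have "\<dots> \<le> (\<integral>\<^sup>+z. \<integral>\<^sup>+q. f (q, z) \<partial>count_space Q \<partial>\<mu>)"
    by (rule nn_integral_mono) (rule le, simp add: mu_space)
  also have "\<dots> = (\<integral>\<^sup>+q. \<integral>\<^sup>+z. f (q, z) \<partial>\<mu> \<partial>count_space Q)"
    by (rule nn_integral_count_space_nn_integral[OF Q_countable fq])
  also have "\<dots> = (\<integral>\<^sup>+p. f p \<partial>transversal)" by (rule nn_integral_fst[OF f])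
  finally show ?thesis .
qed

text \<open>Breaks occupy finitely many parameters, each carrying total mass 1, and take finitely
  many values. The function \<open>c\<close> will be one of the rational coordinates.\<close>

lemma jump_L2:
  assumes g: "g \<in> carrier \<Gamma>" and c0: "c 0 = 0"
  shows "(\<lambda>p. c (jump g (snd p) (fst p))) \<in> L2_fun transversal"
proof -
  interpret finite_measure \<mu> by (rule finite_mu)
  let ?V = "{jump g x t | x t. x \<in> topspace X}" and ?J = "{t \<in> {0..1}. \<exists>x\<in>topspace X. jump g x t \<noteq> 0}"
  let ?b = "\<lambda>p. c (jump g (snd p) (fst p))"
  have m: "?b \<in> borel_measurable transversal"
  proof (rule measurable_pair_measure_countable1[OF Q_countable])
    fix q
    have fin: "finite {jump g x q | x. x \<in> topspace X}"
      by (rule finite_subset[OF _ jump_finite(2)[OF g]]) blast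
    have "(\<lambda>x. jump g x q) \<in> measurable \<mu> (count_space {jump g x q | x. x \<in> topspace X})"
      by (rule measurable_finite_levels[OF fin jump_level_clopen[OF g]])
    then have "(\<lambda>x. c (jump g x q)) \<in> borel_measurable \<mu>" by (rule measurable_compose) simp
    then show "(\<lambda>x. c (jump g (snd (q, x)) (fst (q, x)))) \<in> borel_measurable \<mu>" by simp
  qed
  define C where "C = (\<Sum>v\<in>?V. (c v)\<^sup>2)"
  have C: "(c (jump g x q))\<^sup>2 \<le> C" if "x \<in> topspace X" for x q
    unfolding C_def by (rule member_le_sum[OF _ _ jump_finite(2)[OF g]]) (use that in auto)
  have "(\<integral>\<^sup>+p. ennreal ((?b p)\<^sup>2) \<partial>transversal) = (\<integral>\<^sup>+q. \<integral>\<^sup>+x. ennreal ((c (jump g x q))\<^sup>2) \<partial>\<mu> \<partial>count_space Q)"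
    using nn_integral_fst[of "\<lambda>p. ennreal ((?b p)\<^sup>2)" "count_space Q"] m by simp
  also have "\<dots> \<le> (\<integral>\<^sup>+q. ennreal C * indicator ?J q \<partial>count_space Q)"
  proof (rule nn_integral_mono)
    fix q assume "q \<in> space (count_space Q)"
    then have q: "q \<in> {0..1}" using Q_01 by auto
    show "(\<integral>\<^sup>+x. ennreal ((c (jump g x q))\<^sup>2) \<partial>\<mu>) \<le> ennreal C * indicator ?J q"
    proof (cases "q \<in> ?J")
      case True
      have "(\<integral>\<^sup>+x. ennreal ((c (jump g x q))\<^sup>2) \<partial>\<mu>) \<le> (\<integral>\<^sup>+x. ennreal C \<partial>\<mu>)"
        by (intro nn_integral_mono ennreal_leI C) (simp add: mu_space)
      also have "\<dots> = ennreal C" by (simp add: mu_1)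
      finally show ?thesis using True by simp
    next
      case False
      then have "jump g x q = 0" if "x \<in> topspace X" for x using q that by blast
      then have "(\<integral>\<^sup>+x. ennreal ((c (jump g x q))\<^sup>2) \<partial>\<mu>) = (\<integral>\<^sup>+x. 0 \<partial>\<mu>)"
        by (intro nn_integral_cong) (simp add: mu_space c0)
      then show ?thesis by simp
    qed
  qed
  also have "\<dots> \<le> (\<integral>\<^sup>+q. ennreal C * indicator ?J q \<partial>count_space UNIV)"
    by (rule nn_integral_count_space_subset_le) simp
  also have "\<dots> = ennreal C * emeasure (count_space UNIV) ?J" by (simp add: nn_integral_cmult_indicator)
  also have "\<dots> < \<infinity>"
    using jump_finite(1)[OF g] by (simp add: emeasure_count_space_finite ennreal_mult_less_top ennreal_of_nat_eq_real_of_nat)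
  finally show ?thesis by (simp add: L2_fun_iff_finite[OF m])
qed

end

text \<open>Each coordinate of the break cocycle is the coboundary of a square integrable function.
  On a leaf where the equations hold at all transversal points, those functions are rounded to
  integers and recombined with the weights of the coordinates. The result has locally finite support
  and descends to the suspension, hence respects periods.\<close>

theorem leafwise_coboundary:
  assumes T: "property_T \<Gamma>" and ne: "topspace X \<noteq> {}"
  shows "\<exists>x\<in>topspace X. \<exists>\<eta> :: real \<Rightarrow> real. (\<forall>a b. finite {t \<in> {a..b}. \<eta> t \<noteq> 0}) \<and>
     (\<forall>g\<in>carrier \<Gamma>. \<forall>t. jump g x t = \<eta> (G g x t) - \<eta> t) \<and>
     (\<forall>k t. it k x = x \<longrightarrow> \<eta> (t + of_int k) = \<eta> t)"
proof -
  have cG: "countable (carrier \<Gamma>)" using T by (simp add: property_T_def)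
  obtain \<mu> where mu0: "space \<mu> = topspace X \<and> sets \<mu> = sigma_sets (topspace X) clopen_sets \<and>
     emeasure \<mu> (space \<mu>) = 1 \<and> (\<forall>n. it n \<in> measurable \<mu> \<mu>) \<and>
     (\<forall>n. \<forall>f\<in>borel_measurable \<mu>. (\<integral>\<^sup>+x. f (it n x) \<partial>\<mu>) = (\<integral>\<^sup>+x. f x \<partial>\<mu>))"
    using invariant_measure[OF ne] by (rule exE)
  have mu: "space \<mu> = topspace X" "sets \<mu> = sigma_sets (topspace X) clopen_sets" "emeasure \<mu> (space \<mu>) = 1"
    "\<And>n. it n \<in> measurable \<mu> \<mu>"
    "\<And>n f. f \<in> borel_measurable \<mu> \<Longrightarrow> (\<integral>\<^sup>+x. f (it n x) \<partial>\<mu>) = (\<integral>\<^sup>+x. f x \<partial>\<mu>)"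
    using mu0 by blast+
  obtain Q where Q: "countable Q" "Q \<subseteq> {0..<1}"
    "\<And>g x q. g \<in> carrier \<Gamma> \<Longrightarrow> x \<in> topspace X \<Longrightarrow> q \<in> Q \<Longrightarrow> frac (G g x q) \<in> Q"
    and Qj: "\<And>g x t. g \<in> carrier \<Gamma> \<Longrightarrow> x \<in> topspace X \<Longrightarrow> jump g x t \<noteq> 0 \<Longrightarrow> frac t \<in> Q"
    by (rule countable_transversal[OF cG]) (rule that)
  let ?M = "count_space Q \<Otimes>\<^sub>M \<mu>"
  note ctx = mu Q
  interpret finite_measure \<mu> using mu(3) by (intro finite_measureI) simp
  interpret P: pair_sigma_finite "count_space Q" \<mu>
    by (intro pair_sigma_finite.intro sigma_finite_measure_count_space_countable Q(1) sigma_finite_measure_axioms)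
  have spM: "space ?M = Q \<times> topspace X" by (simp add: space_pair_measure mu(1))
  have sp01: "p \<in> {0..<1} \<times> topspace X" if "p \<in> space ?M" for p
    using that Q(2) unfolding spM by auto
  obtain E where E: "finite E" "E \<subseteq> carrier \<Gamma>" "generate \<Gamma> E = carrier \<Gamma>"
    using property_T_finitely_generated[OF T] by blast
  \<comment> \<open>Inverses of the generators are included so that the set \<open>W\<close> of
    admissible jumps has to be stable under addition only.\<close>
  define E' where "E' = E \<union> (\<lambda>g. inv\<^bsub>\<Gamma>\<^esub> g) ` E"
  have E': "finite E'" "E' \<subseteq> carrier \<Gamma>" using E unfolding E'_def by auto
  define V where "V = (\<Union>g\<in>E'. {jump g x t | x t. x \<in> topspace X})"
  have "finite V" unfolding V_def using E' by (intro finite_UN_I jump_finite(2)) auto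
  then have "\<exists>(I :: real set) (c :: real \<Rightarrow> real \<Rightarrow> real) w. finite I \<and>
     (\<forall>i x y. c i (x + y) = c i x + c i y) \<and> (\<forall>v\<in>V. (\<forall>i\<in>I. c i v \<in> \<int>) \<and> v = (\<Sum>i\<in>I. c i v * w i))"
    by (rule integral_coordinates)
  then obtain I :: "real set" and c :: "real \<Rightarrow> real \<Rightarrow> real" and w where I: "finite I"
    and c_add: "\<And>i x y. c i (x + y) = c i x + c i y"
    and cV: "\<forall>v\<in>V. (\<forall>i\<in>I. c i v \<in> \<int>) \<and> v = (\<Sum>i\<in>I. c i v * w i)" by blast
  have c0: "c i 0 = 0" for i using c_add[of i 0 0] by simp
  \<comment> \<open>The reals that have integral coordinates and are recovered from them. Every jump
    of every group element lies here, although integrality was arranged for generators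
    alone.\<close>
  define W where "W = {v. (\<forall>i\<in>I. c i v \<in> \<int>) \<and> v = (\<Sum>i\<in>I. c i v * w i)}"
  have W0: "0 \<in> W" by (simp add: W_def c0)
  have W_add: "u + v \<in> W" if uv: "u \<in> W" "v \<in> W" for u v
  proof -
    have "u = (\<Sum>i\<in>I. c i u * w i)" "v = (\<Sum>i\<in>I. c i v * w i)" using uv unfolding W_def by blast+
    then have "u + v = (\<Sum>i\<in>I. c i u * w i) + (\<Sum>i\<in>I. c i v * w i)" by simp
    also have "\<dots> = (\<Sum>i\<in>I. c i (u + v) * w i)" by (simp add: c_add distrib_right sum.distrib)
    finally have "u + v = (\<Sum>i\<in>I. c i (u + v) * w i)" .
    moreover have "c i (u + v) \<in> \<int>" if "i \<in> I" for i
      using uv that unfolding W_def c_add by (blast intro: Ints_add)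
    ultimately show ?thesis unfolding W_def by blast
  qed
  have jW: "\<forall>x\<in>topspace X. \<forall>t. jump g x t \<in> W" if g: "g \<in> carrier \<Gamma>" for g
  proof (rule \<Gamma>.generate_minimal_on[of g E])
    show "g \<in> generate \<Gamma> E" using g E(3) by simp
    have VW: "V \<subseteq> W" using cV unfolding W_def by blast
    show "\<forall>x\<in>topspace X. \<forall>t. jump h x t \<in> W" if "h \<in> E" for h
      using VW that unfolding V_def E'_def by blast
    show "\<forall>x\<in>topspace X. \<forall>t. jump (inv\<^bsub>\<Gamma>\<^esub> h) x t \<in> W" if "h \<in> E" for h
      using VW that unfolding V_def E'_def by blast
    show "\<forall>x\<in>topspace X. \<forall>t. jump \<one>\<^bsub>\<Gamma>\<^esub> x t \<in> W"
    proof (intro ballI allI)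
      fix x t assume x: "x \<in> topspace X"
      obtain s where s: "G \<one>\<^bsub>\<Gamma>\<^esub> x s = t" using G_surj[OF \<Gamma>.one_closed x] by blast
      have "jump \<one>\<^bsub>\<Gamma>\<^esub> x t = 0" using jump_mult[OF \<Gamma>.one_closed \<Gamma>.one_closed x, of s] s by simp
      then show "jump \<one>\<^bsub>\<Gamma>\<^esub> x t \<in> W" using W0 by simp
    qed
    show "\<forall>x\<in>topspace X. \<forall>t. jump (f \<otimes>\<^bsub>\<Gamma>\<^esub> h) x t \<in> W"
      if fh: "f \<in> carrier \<Gamma>" "h \<in> carrier \<Gamma>" "\<forall>x\<in>topspace X. \<forall>t. jump f x t \<in> W" "\<forall>x\<in>topspace X. \<forall>t. jump h x t \<in> W" for f h
      using fh(3,4) by (intro ballI allI) (simp add: jump_mult[OF fh(1,2)] W_add)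
  qed (rule E(2))
  have ex: "\<exists>\<xi>\<in>L2_fun ?M. \<forall>g\<in>carrier \<Gamma>. AE p in ?M. c i (jump g (snd p) (fst p)) = \<xi> (leaf_map g p) - \<xi> p" for i
  proof (rule property_T_L2_coboundary[OF T])
    show "leaf_map g \<in> measurable ?M ?M" if "g \<in> carrier \<Gamma>" for g
      by (rule measurable_leaf_map[OF ctx that])
    show "leaf_map (g \<otimes>\<^bsub>\<Gamma>\<^esub> h) p = leaf_map g (leaf_map h p)"
      if "g \<in> carrier \<Gamma>" "h \<in> carrier \<Gamma>" "p \<in> space ?M" for g h p
      by (rule leaf_map_mult[OF that(1,2) sp01[OF that(3)]])
    show "leaf_map \<one>\<^bsub>\<Gamma>\<^esub> p = p" if "p \<in> space ?M" for p by (rule leaf_map_one[OF sp01[OF that]])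
    show "(\<integral>\<^sup>+p. f (leaf_map g p) \<partial>?M) \<le> (\<integral>\<^sup>+p. f p \<partial>?M)"
      if "g \<in> carrier \<Gamma>" "f \<in> borel_measurable ?M" for g f
      by (rule leaf_map_nonincreasing[OF ctx that])
    show "(\<lambda>p. c i (jump g (snd p) (fst p))) \<in> L2_fun ?M" if "g \<in> carrier \<Gamma>" for g
      by (rule jump_L2[where c = "c i", OF ctx that c0])
    show "c i (jump (g \<otimes>\<^bsub>\<Gamma>\<^esub> h) (snd p) (fst p)) =
        c i (jump h (snd p) (fst p)) + c i (jump g (snd (leaf_map h p)) (fst (leaf_map h p)))"
      if gh: "g \<in> carrier \<Gamma>" "h \<in> carrier \<Gamma>" and p: "p \<in> space ?M" for g h p
    proof -
      have x: "snd p \<in> topspace X" using p unfolding spM by auto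
      show ?thesis
        unfolding leaf_map_def[of h p] jump_leaf_point[OF gh(1) x] jump_mult[OF gh x] c_add ..
    qed
  qed
  define \<xi> where "\<xi> i = (SOME \<xi>. \<xi> \<in> L2_fun ?M \<and> (\<forall>g\<in>carrier \<Gamma>. AE p in ?M. c i (jump g (snd p) (fst p)) = \<xi> (leaf_map g p) - \<xi> p))" for i
  have \<xi>: "\<xi> i \<in> L2_fun ?M" "\<And>g. g \<in> carrier \<Gamma> \<Longrightarrow> AE p in ?M. c i (jump g (snd p) (fst p)) = \<xi> i (leaf_map g p) - \<xi> i p" for i
    using someI_ex[OF ex[of i, unfolded Bex_def]] unfolding \<xi>_def by blast+
  have "AE p in ?M. \<forall>i\<in>I. \<forall>g\<in>carrier \<Gamma>. c i (jump g (snd p) (fst p)) = \<xi> i (leaf_map g p) - \<xi> i p"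
    using I cG \<xi>(2) by (simp add: AE_ball_countable countable_finite)
  from P.AE_pair[OF this]
  have 1: "\<And>q. q \<in> Q \<Longrightarrow> AE x in \<mu>. \<forall>i\<in>I. \<forall>g\<in>carrier \<Gamma>. c i (jump g x q) = \<xi> i (leaf_map g (q, x)) - \<xi> i (q, x)"
    by (simp add: AE_count_space)
  have 2: "AE x in \<mu>. finite {q \<in> Q. 1/2 \<le> \<bar>\<xi> i (q, x)\<bar>}" for i
  proof -
    have m: "(\<lambda>p. ennreal ((\<xi> i p)\<^sup>2)) \<in> borel_measurable ?M"
      using L2_fun_measurable[OF \<xi>(1)[of i]] by measurable
    have mq: "(\<lambda>x. ennreal ((\<xi> i (q, x))\<^sup>2)) \<in> borel_measurable \<mu>" if "q \<in> Q" for q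
      using measurable_compose[OF measurable_Pair1'[of q "count_space Q" \<mu>] m] that by simp
    have mi: "(\<lambda>x. \<integral>\<^sup>+q. ennreal ((\<xi> i (q, x))\<^sup>2) \<partial>count_space Q) \<in> borel_measurable \<mu>"
      using P.M1.borel_measurable_nn_integral_fst[OF measurable_pair_swap[OF m]] by simp
    have "(\<integral>\<^sup>+x. \<integral>\<^sup>+q. ennreal ((\<xi> i (q, x))\<^sup>2) \<partial>count_space Q \<partial>\<mu>) =
        (\<integral>\<^sup>+q. \<integral>\<^sup>+x. ennreal ((\<xi> i (q, x))\<^sup>2) \<partial>\<mu> \<partial>count_space Q)"
      by (rule nn_integral_count_space_nn_integral[OF Q(1) mq])
    also have "\<dots> = (\<integral>\<^sup>+p. ennreal ((\<xi> i p)\<^sup>2) \<partial>?M)" by (rule nn_integral_fst[OF m])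
    also have "\<dots> < \<infinity>" using \<xi>(1)[of i] L2_fun_iff_finite[OF L2_fun_measurable[OF \<xi>(1)[of i]]] by blast
    finally have "AE x in \<mu>. (\<integral>\<^sup>+q. ennreal ((\<xi> i (q, x))\<^sup>2) \<partial>count_space Q) \<noteq> \<infinity>"
      by (intro nn_integral_PInf_AE mi) simp
    then show ?thesis
    proof eventually_elim
      case (elim x)
      then show ?case by (intro finite_large_if_square_summable) (auto simp: less_top)
    qed
  qed
  define good where "good x \<longleftrightarrow> (\<forall>q\<in>Q. \<forall>i\<in>I. \<forall>g\<in>carrier \<Gamma>. c i (jump g x q) = \<xi> i (leaf_map g (q, x)) - \<xi> i (q, x)) \<and>
      (\<forall>i\<in>I. finite {q \<in> Q. 1/2 \<le> \<bar>\<xi> i (q, x)\<bar>})" for x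
  have "AE x in \<mu>. \<forall>q\<in>Q. \<forall>i\<in>I. \<forall>g\<in>carrier \<Gamma>. c i (jump g x q) = \<xi> i (leaf_map g (q, x)) - \<xi> i (q, x)"
    unfolding AE_ball_countable[OF Q(1)] by (intro ballI 1)
  moreover have "AE x in \<mu>. \<forall>i\<in>I. finite {q \<in> Q. 1/2 \<le> \<bar>\<xi> i (q, x)\<bar>}"
    unfolding AE_ball_countable[OF countable_finite[OF I]] by (intro ballI 2)
  ultimately have "AE x in \<mu>. good x" unfolding good_def by eventually_elim (rule conjI)
  \<comment> \<open>A leaf meets the transversal over all base points \<open>it n x\<close>, so all
    of them must be good at once; countably many conditions cost only a null set.\<close>
  then have "AE x in \<mu>. good (it n x)" for n
    by (rule AE_compose_nonincreasing[OF mu(4), rotated]) (simp add: mu(5))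
  then have "AE x in \<mu>. \<forall>n. good (it n x)" unfolding AE_all_countable by (rule allI)
  from AE_imp_ex[OF _ this] mu(3) obtain x where x: "x \<in> topspace X" and gd: "\<And>n. good (it n x)"
    unfolding mu(1) by auto
  have cob: "c i (jump g (it n x) q) = \<xi> i (leaf_map g (q, it n x)) - \<xi> i (q, it n x)"
    if "q \<in> Q" "i \<in> I" "g \<in> carrier \<Gamma>" for n q i g
    using gd[of n] that unfolding good_def by blast
  have fin: "finite {q \<in> Q. 1/2 \<le> \<bar>\<xi> i (q, it n x)\<bar>}" if "i \<in> I" for n i
    using gd[of n] that unfolding good_def by blast
  \<comment> \<open>The function is expressed through \<open>leaf_point\<close>, so it is
    automatically constant under periods. Rounding kills all values smaller than 1/2, leaving
    finitely many parameters over each base point.\<close>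
  define \<eta> where "\<eta> t = (if frac t \<in> Q then \<Sum>i\<in>I. of_int (round (\<xi> i (leaf_point x t))) * w i else 0)" for t
  have A: "finite {t \<in> {a..b}. \<eta> t \<noteq> 0}" for a b
  proof (rule finite_subset)
    show "{t \<in> {a..b}. \<eta> t \<noteq> 0} \<subseteq>
        (\<Union>n\<in>{\<lfloor>a\<rfloor>..\<lfloor>b\<rfloor>}. \<Union>i\<in>I. (\<lambda>q. q + of_int n) ` {q \<in> Q. 1/2 \<le> \<bar>\<xi> i (q, it n x)\<bar>})"
    proof
      fix t assume "t \<in> {t \<in> {a..b}. \<eta> t \<noteq> 0}"
      then have t: "a \<le> t" "t \<le> b" "\<eta> t \<noteq> 0" by auto
      have fr: "frac t \<in> Q" using t(3) unfolding \<eta>_def by (auto split: if_splits)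
      have "\<exists>i\<in>I. round (\<xi> i (leaf_point x t)) \<noteq> 0"
      proof (rule ccontr)
        assume "\<not> ?thesis"
        then have "\<eta> t = 0" unfolding \<eta>_def by simp
        then show False using t(3) by simp
      qed
      then obtain i where i: "i \<in> I" "round (\<xi> i (leaf_point x t)) \<noteq> 0" by blast
      have "1/2 \<le> \<bar>\<xi> i (leaf_point x t)\<bar>"
      proof (rule ccontr)
        assume "\<not> ?thesis"
        then have "round (\<xi> i (leaf_point x t)) = 0" unfolding round_def by linarith
        then show False using i(2) by simp
      qed
      then have "frac t \<in> {q \<in> Q. 1/2 \<le> \<bar>\<xi> i (q, it \<lfloor>t\<rfloor> x)\<bar>}" using fr by (simp add: leaf_point_def)
      moreover have "t = frac t + of_int \<lfloor>t\<rfloor>" by (simp add: frac_def)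
      moreover have "\<lfloor>t\<rfloor> \<in> {\<lfloor>a\<rfloor>..\<lfloor>b\<rfloor>}" using t by (simp add: floor_mono)
      ultimately show "t \<in> (\<Union>n\<in>{\<lfloor>a\<rfloor>..\<lfloor>b\<rfloor>}. \<Union>i\<in>I. (\<lambda>q. q + of_int n) ` {q \<in> Q. 1/2 \<le> \<bar>\<xi> i (q, it n x)\<bar>})"
        using i(1) by blast
    qed
    show "finite (\<Union>n\<in>{\<lfloor>a\<rfloor>..\<lfloor>b\<rfloor>}. \<Union>i\<in>I. (\<lambda>q. q + of_int n) ` {q \<in> Q. 1/2 \<le> \<bar>\<xi> i (q, it n x)\<bar>})"
      by (intro finite_UN_I finite_imageI fin I) auto
  qed
  have B: "jump g x t = \<eta> (G g x t) - \<eta> t" if g: "g \<in> carrier \<Gamma>" for g t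
  proof (cases "frac t \<in> Q")
    case True
    have lm: "leaf_map g (leaf_point x t) = leaf_point x (G g x t)" by (rule leaf_map_point[OF g x])
    have "leaf_point x t \<in> space ?M" using True it_closed[OF x] by (simp add: spM leaf_point_def)
    from leaf_map_transversal[OF ctx g this] have frG: "frac (G g x t) \<in> Q"
      unfolding lm spM by (simp add: leaf_point_def)
    have jw: "jump g x t \<in> W" using jW[OF g] x by blast
    have rd: "real_of_int (round (\<xi> i (leaf_point x (G g x t)))) - of_int (round (\<xi> i (leaf_point x t))) = c i (jump g x t)"
      if i: "i \<in> I" for i
    proof -
      have "c i (jump g x t) \<in> \<int>" using jw i unfolding W_def by blast
      then obtain k :: int where k: "c i (jump g x t) = of_int k" by (rule Ints_cases)
      have "c i (jump g (it \<lfloor>t\<rfloor> x) (frac t)) = \<xi> i (leaf_map g (frac t, it \<lfloor>t\<rfloor> x)) - \<xi> i (frac t, it \<lfloor>t\<rfloor> x)"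
        by (rule cob[OF True i g])
      then have "\<xi> i (leaf_point x (G g x t)) = \<xi> i (leaf_point x t) + of_int k"
        using jump_leaf_point[OF g x, of t] lm k by (simp add: leaf_point_def)
      \<comment> \<open>Values at a point and at its image differ by an integer, and adding an
        integer commutes with rounding; so the rounded function solves the same equation.\<close>
      then have "\<xi> i (leaf_point x (G g x t)) + 1/2 = (\<xi> i (leaf_point x t) + 1/2) + of_int k" by simp
      then have "round (\<xi> i (leaf_point x (G g x t))) = round (\<xi> i (leaf_point x t)) + k"
        unfolding round_def floor_add_int by (rule arg_cong)
      then show ?thesis using k by simp
    qed
    have "\<eta> (G g x t) - \<eta> t = (\<Sum>i\<in>I. (real_of_int (round (\<xi> i (leaf_point x (G g x t)))) - of_int (round (\<xi> i (leaf_point x t)))) * w i)"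
      using True frG by (simp add: \<eta>_def left_diff_distrib sum_subtractf)
    also have "\<dots> = (\<Sum>i\<in>I. c i (jump g x t) * w i)" by (intro sum.cong refl) (simp only: rd)
    also have "\<dots> = jump g x t" using jw unfolding W_def by simp
    finally show ?thesis ..
  next
    case False
    have "jump g x t = 0" using Qj[OF g x, of t] False by blast
    \<comment> \<open>The inverse of \<open>g\<close> preserves the transversal as well, so a point
      outside it cannot be moved into it.\<close>
    moreover have "frac (G g x t) \<notin> Q"
    proof
      assume *: "frac (G g x t) \<in> Q"
      have ig: "inv\<^bsub>\<Gamma>\<^esub> g \<in> carrier \<Gamma>" using g by simp
      have "leaf_point x (G g x t) \<in> space ?M" using * it_closed[OF x] by (simp add: spM leaf_point_def)
      from leaf_map_transversal[OF ctx ig this]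
      have "leaf_map (inv\<^bsub>\<Gamma>\<^esub> g) (leaf_map g (leaf_point x t)) \<in> space ?M"
        unfolding leaf_map_point[OF g x] .
      then have "leaf_point x t \<in> space ?M"
        unfolding leaf_map_mult_point[OF ig g x, symmetric] \<Gamma>.l_inv[OF g] leaf_map_one_point[OF x] .
      then show False using False by (simp add: spM leaf_point_def)
    qed
    ultimately show ?thesis using False by (simp add: \<eta>_def)
  qed
  have C: "\<eta> (t + of_int k) = \<eta> t" if "it k x = x" for k t
    using leaf_point_period[OF x that, of t] by (simp add: \<eta>_def frac_def)
  show ?thesis
    by (intro bexI[OF _ x] exI[of _ \<eta>] conjI allI ballI impI A B C)
qed

end

section \<open>Affine coordinates on a leaf\<close>

text \<open>A step function continuous from the right, with value \<open>c\<close> on the left of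
  \<open>t\<close>.\<close>

definition step_at :: "(real \<Rightarrow> real) \<Rightarrow> real \<Rightarrow> real \<Rightarrow> real \<Rightarrow> bool" where
  "step_at \<rho> t c e \<longleftrightarrow> e > 0 \<and> (\<forall>s. t \<le> s \<and> s < t + e \<longrightarrow> \<rho> s = \<rho> t) \<and> (\<forall>s. t - e < s \<and> s < t \<longrightarrow> \<rho> s = c)"

lemma step_integral:
  assumes "step_at \<rho> t c e"
  shows "t - e < u \<Longrightarrow> u \<le> t \<Longrightarrow> (\<rho> has_integral c * (t - u)) {u..t}"
    and "t \<le> v \<Longrightarrow> v < t + e \<Longrightarrow> (\<rho> has_integral \<rho> t * (v - t)) {t..v}"
proof -
  assume u: "t - e < u" "u \<le> t"
  have "((\<lambda>_. c) has_integral c * (t - u)) {u..t}"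
    using has_integral_const_real[of c u t] u by (simp add: mult.commute)
  moreover have "\<rho> s = c" if "s \<in> {u..t} - {t}" for s
  proof -
    have "t - e < s \<and> s < t" using that u by auto
    then show ?thesis using assms unfolding step_at_def by blast
  qed
  ultimately show "(\<rho> has_integral c * (t - u)) {u..t}"
    using has_integral_spike_finite[of "{t}" "{u..t}" \<rho> "\<lambda>_. c"] by blast
next
  assume v: "t \<le> v" "v < t + e"
  have "((\<lambda>_. \<rho> t) has_integral \<rho> t * (v - t)) {t..v}"
    using has_integral_const_real[of "\<rho> t" t v] v by (simp add: mult.commute)
  moreover have "\<rho> s = \<rho> t" if "s \<in> {t..v} - {}" for s
  proof -
    have "t \<le> s \<and> s < t + e" using that v by auto
    then show ?thesis using assms unfolding step_at_def by blast
  qed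
  ultimately show "(\<rho> has_integral \<rho> t * (v - t)) {t..v}"
    using has_integral_spike_finite[of "{}" "{t..v}" \<rho> "\<lambda>_. \<rho> t"] by blast
qed

text \<open>Integrability on small intervals around every point suffices. Each of them is cut at
  \<open>t\<close> into two pieces on which the function is constant up to an end point.\<close>

lemma step_integrable:
  assumes "\<And>t. \<exists>c e. step_at \<rho> t c e"
  shows "\<rho> integrable_on {a..b}"
proof -
  have "\<rho> integrable_on cbox a b"
  proof (rule integrable_on_little_subintervals, intro ballI)
    fix t assume "t \<in> cbox a b"
    obtain c e where ce: "step_at \<rho> t c e" using assms by blast
    have e: "e > 0" using ce by (simp add: step_at_def)
    show "\<exists>d>0. \<forall>u v. t \<in> cbox u v \<and> cbox u v \<subseteq> ball t d \<and> cbox u v \<subseteq> cbox a b \<longrightarrow> \<rho> integrable_on cbox u v"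
    proof (intro exI[of _ e] conjI allI impI e)
      fix u v assume *: "t \<in> cbox u v \<and> cbox u v \<subseteq> ball t e \<and> cbox u v \<subseteq> cbox a b"
      then have tuv: "u \<le> t" "t \<le> v" by auto
      then have "u \<in> cbox u v" "v \<in> cbox u v" by auto
      then have "u \<in> ball t e" "v \<in> ball t e" using * by blast+
      then have uv: "t - e < u" "v < t + e" using tuv by (auto simp: dist_real_def)
      have "\<rho> integrable_on {u..t}" "\<rho> integrable_on {t..v}"
        using step_integral(1)[OF ce uv(1) tuv(1)] step_integral(2)[OF ce tuv(2) uv(2)] by blast+
      from Henstock_Kurzweil_Integration.integrable_combine[OF tuv this] show "\<rho> integrable_on cbox u v"
        unfolding box_real .
    qed
  qed
  then show ?thesis by simp
qed

lemma step_antiderivative: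
  fixes \<rho> :: "real \<Rightarrow> real"
  assumes st: "\<And>t. \<exists>c e. step_at \<rho> t c e"
  shows "\<exists>H. \<forall>t c e s. step_at \<rho> t c e \<longrightarrow> \<bar>s - t\<bar> < e \<longrightarrow> H s = H t + (if s \<le> t then c else \<rho> t) * (s - t)"
proof -
  \<comment> \<open>The oriented integral from 0: one of the two intervals is empty or a single
    point.\<close>
  define H where "H t = integral {0..t} \<rho> - integral {t..0} \<rho>" for t
  note int = step_integrable[OF st]
  have diff: "H b = H a + integral {a..b} \<rho>" if ab: "a \<le> b" for a b
  proof -
    have empty: "integral {u..v} \<rho> = 0" if "v \<le> u" for u v :: real
      using that by (cases "v = u") auto
    consider "0 \<le> a" | "b \<le> 0" | "a < 0" "0 < b" by linarith
    then show ?thesis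
    proof cases
      case 1
      then show ?thesis
        using Henstock_Kurzweil_Integration.integral_combine[OF 1 ab int] empty ab by (simp add: H_def)
    next
      case 2
      then show ?thesis
        using Henstock_Kurzweil_Integration.integral_combine[OF ab 2 int] empty ab by (simp add: H_def)
    next
      case 3
      then have "a \<le> 0" "0 \<le> b" by auto
      from Henstock_Kurzweil_Integration.integral_combine[OF this int] show ?thesis using empty 3 by (simp add: H_def)
    qed
  qed
  have "H s = H t + (if s \<le> t then c else \<rho> t) * (s - t)" if ce: "step_at \<rho> t c e" and s: "\<bar>s - t\<bar> < e" for t c e s
  proof (cases "s \<le> t")
    case True
    have "integral {s..t} \<rho> = c * (t - s)"
      using step_integral(1)[OF ce _ True] s by (intro integral_unique) auto
    then show ?thesis using diff[OF True] True by (simp add: algebra_simps)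
  next
    case False
    then have ts: "t \<le> s" by simp
    have "integral {t..s} \<rho> = \<rho> t * (s - t)"
      using step_integral(2)[OF ce ts] s by (intro integral_unique) auto
    then show ?thesis using diff[OF ts] False by simp
  qed
  then show ?thesis by blast
qed

text \<open>The integral of \<open>exp (- \<Xi>)\<close>, where \<open>\<Xi>\<close> sums the values of \<open>\<eta>\<close>, is a coordinate in which
  all maps with break cocycle \<open>\<eta> \<circ> F - \<eta>\<close> are affine.\<close>

lemma affine_coordinate:
  fixes \<eta> :: "real \<Rightarrow> real"
  assumes fin: "\<And>a b. finite {t \<in> {a..b}. \<eta> t \<noteq> 0}"
  shows "\<exists>H :: real \<Rightarrow> real. strict_mono H \<and> continuous_on UNIV H \<and>
    (\<forall>F l r. (\<forall>t. l t > 0 \<and> r t > 0 \<and> ln (r t) - ln (l t) = \<eta> (F t) - \<eta> t \<and>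
        (\<exists>e>0. \<forall>s. \<bar>s - t\<bar> < e \<longrightarrow> F s = F t + (if s \<le> t then l t else r t) * (s - t) \<and>
             (t < s \<longrightarrow> r s = r t) \<and> (s < t \<longrightarrow> r s = l t))) \<longrightarrow>
      (\<exists>\<alpha> \<beta>. \<alpha> > 0 \<and> (\<forall>t. H (F t) = \<alpha> * H t + \<beta>)))"
proof -
  \<comment> \<open>Counting the right end point but not the left one makes the sums
    \<open>\<Xi>\<close> continuous from the right, with the jump \<open>\<eta> t\<close> taking
    place at \<open>t\<close> itself.\<close>
  define S where "S a b = (\<Sum>s | s \<in> {a<..b} \<and> \<eta> s \<noteq> 0. \<eta> s)" for a b
  have finS: "finite {s. s \<in> {a<..b} \<and> \<eta> s \<noteq> 0}" for a b
    by (rule finite_subset[OF _ fin[of a b]]) auto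
  have S_add: "S a c = S a b + S b c" if "a \<le> b" "b \<le> c" for a b c
  proof -
    have "{s. s \<in> {a<..c} \<and> \<eta> s \<noteq> 0} = {s. s \<in> {a<..b} \<and> \<eta> s \<noteq> 0} \<union> {s. s \<in> {b<..c} \<and> \<eta> s \<noteq> 0}"
      using that by auto
    then show ?thesis unfolding S_def using finS by (simp only:) (rule sum.union_disjoint, auto)
  qed
  define \<Xi> where "\<Xi> t = (if 0 \<le> t then S 0 t else - S t 0)" for t
  have Xi_diff: "\<Xi> b = \<Xi> a + S a b" if "a \<le> b" for a b
    using that S_add[of 0 a b] S_add[of a b 0] S_add[of a 0 b] S_add[of 0 0 0] by (auto simp: \<Xi>_def)
  have loc: "\<exists>e>0. (\<forall>s. t \<le> s \<and> s < t + e \<longrightarrow> \<Xi> s = \<Xi> t) \<and> (\<forall>s. t - e < s \<and> s < t \<longrightarrow> \<Xi> s = \<Xi> t - \<eta> t)" for t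
  proof -
    have "finite ({s \<in> {t-1..t+1}. \<eta> s \<noteq> 0} - {t})" using fin by simp
    from finite_set_avoid[OF this, of t] obtain d where d: "d > 0"
      "\<And>s. s \<in> {s \<in> {t-1..t+1}. \<eta> s \<noteq> 0} - {t} \<Longrightarrow> d \<le> dist t s" by auto
    define e where "e = min d 1"
    have e: "e > 0" "e \<le> d" "e \<le> 1" using d(1) by (auto simp: e_def)
    have z: "\<eta> s = 0" if "\<bar>s - t\<bar> < e" "s \<noteq> t" for s
    proof (rule ccontr)
      assume "\<eta> s \<noteq> 0"
      then have "d \<le> dist t s" using that e by (intro d(2)) (auto simp: abs_if split: if_splits)
      then show False using that e by (simp add: dist_real_def abs_minus_commute)
    qed
    have "\<Xi> s = \<Xi> t" if "t \<le> s" "s < t + e" for s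
    proof -
      have "\<eta> w = 0" if "w \<in> {t<..s}" for w
        by (rule z) (use that \<open>s < t + e\<close> in auto)
      then have "{w. w \<in> {t<..s} \<and> \<eta> w \<noteq> 0} = {}" by blast
      then have "S t s = 0" unfolding S_def by (simp only: sum.empty)
      then show ?thesis using Xi_diff[OF that(1)] by simp
    qed
    moreover have "\<Xi> s = \<Xi> t - \<eta> t" if "t - e < s" "s < t" for s
    proof -
      have zz: "\<eta> w = 0" if "s < w" "w < t" for w
        by (rule z) (use that \<open>t - e < s\<close> in auto)
      have "S s t = \<eta> t"
      proof (cases "\<eta> t = 0")
        case True
        have "\<eta> w = 0" if "w \<in> {s<..t}" for w using zz[of w] True that by (cases "w = t") auto
        then have "{w. w \<in> {s<..t} \<and> \<eta> w \<noteq> 0} = {}" by blast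
        then show ?thesis unfolding S_def True by (simp only: sum.empty)
      next
        case False
        have "w = t" if "w \<in> {s<..t}" "\<eta> w \<noteq> 0" for w using zz[of w] that by (cases "w = t") auto
        moreover have "t \<in> {s<..t}" using \<open>s < t\<close> by simp
        ultimately have "{w. w \<in> {s<..t} \<and> \<eta> w \<noteq> 0} = {t}" using False by blast
        then show ?thesis unfolding S_def by simp
      qed
      then show ?thesis using Xi_diff[of s t] that by simp
    qed
    ultimately show ?thesis using e(1) by blast
  qed
  \<comment> \<open>The density of the coordinate. Its value just before \<open>t\<close> is larger
    by the factor \<open>exp (\<eta> t)\<close>, which compensates the ratio of the slopes at a
    break.\<close>
  define \<rho> where "\<rho> t = exp (- \<Xi> t)" for t
  have step: "\<exists>e. step_at \<rho> t (\<rho> t * exp (\<eta> t)) e" for t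
  proof -
    obtain e where e: "e > 0" "\<And>s. t \<le> s \<Longrightarrow> s < t + e \<Longrightarrow> \<Xi> s = \<Xi> t" "\<And>s. t - e < s \<Longrightarrow> s < t \<Longrightarrow> \<Xi> s = \<Xi> t - \<eta> t"
      using loc[of t] by blast
    have "exp (- (\<Xi> t - \<eta> t)) = exp (- \<Xi> t) * exp (\<eta> t)" by (simp add: exp_add[symmetric])
    then have *: "exp (- (\<Xi> t - \<eta> t)) = exp (- \<Xi> t) * exp (\<eta> t)" .
    have "step_at \<rho> t (\<rho> t * exp (\<eta> t)) e"
      unfolding step_at_def \<rho>_def
    proof (intro conjI allI impI e(1); elim conjE)
      show "exp (- \<Xi> s) = exp (- \<Xi> t)" if "t \<le> s" "s < t + e" for s using e(2)[OF that] by simp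
      show "exp (- \<Xi> s) = exp (- \<Xi> t) * exp (\<eta> t)" if "t - e < s" "s < t" for s
        unfolding e(3)[OF that] by (rule *)
    qed
    then show ?thesis by blast
  qed
  then have "\<And>t. \<exists>c e. step_at \<rho> t c e" by blast
  from step_antiderivative[OF this] obtain H where
    H0: "\<forall>t c e s. step_at \<rho> t c e \<longrightarrow> \<bar>s - t\<bar> < e \<longrightarrow> H s = H t + (if s \<le> t then c else \<rho> t) * (s - t)" by blast
  have H: "\<exists>e>0. \<forall>s. \<bar>s - t\<bar> < e \<longrightarrow> H s = H t + (if s \<le> t then \<rho> t * exp (\<eta> t) else \<rho> t) * (s - t)" for t
  proof -
    obtain e where e: "step_at \<rho> t (\<rho> t * exp (\<eta> t)) e" using step by blast
    then have "e > 0" by (simp add: step_at_def)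
    then show ?thesis using H0 e by blast
  qed
  have pos: "\<rho> t > 0" for t by (simp add: \<rho>_def)
  have mono: "strict_mono H"
  proof (rule strict_mono_on_real_if_locally)
    fix t
    obtain e where e: "e > 0" "\<And>s. \<bar>s - t\<bar> < e \<Longrightarrow> H s = H t + (if s \<le> t then \<rho> t * exp (\<eta> t) else \<rho> t) * (s - t)"
      using H[of t] by blast
    have "(s < t \<longrightarrow> H s < H t) \<and> (t < s \<longrightarrow> H t < H s)" if "\<bar>s - t\<bar> < e" for s
      using e(2)[OF that] pos[of t] by (auto simp: mult_pos_neg)
    then show "\<exists>e>0. \<forall>s. \<bar>s - t\<bar> < e \<longrightarrow> (s < t \<longrightarrow> H s < H t) \<and> (t < s \<longrightarrow> H t < H s)"
      using e(1) by blast
  qed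
  have cont: "continuous_on UNIV H"
    by (rule continuous_on_if_locally_broken_linear) (use H in blast)
  have affine: "\<exists>\<alpha> \<beta>. \<alpha> > 0 \<and> (\<forall>t. H (F t) = \<alpha> * H t + \<beta>)"
    if lr: "\<And>t. l t > 0" "\<And>t. r t > 0" and j: "\<And>t. ln (r t) - ln (l t) = \<eta> (F t) - \<eta> t"
      and F: "\<And>t. \<exists>e>0. \<forall>s. \<bar>s - t\<bar> < e \<longrightarrow> F s = F t + (if s \<le> t then l t else r t) * (s - t) \<and>
             (t < s \<longrightarrow> r s = r t) \<and> (s < t \<longrightarrow> r s = l t)" for F l r
  proof -
    \<comment> \<open>The radius is also shrunk so that the image stays within distance
      \<open>d\<close>, inside the region where \<open>\<Xi>\<close> or \<open>H\<close> has its
      simple form around \<open>F t\<close>.\<close>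
    have near: "\<exists>e>0. \<forall>s. \<bar>s - t\<bar> < e \<longrightarrow> F s = F t + (if s \<le> t then l t else r t) * (s - t) \<and>
             (t < s \<longrightarrow> r s = r t) \<and> (s < t \<longrightarrow> r s = l t) \<and> \<bar>F s - F t\<bar> < d" if d: "d > 0" for d t
    proof -
      obtain e where e: "e > 0" "\<forall>s. \<bar>s - t\<bar> < e \<longrightarrow> F s = F t + (if s \<le> t then l t else r t) * (s - t) \<and>
             (t < s \<longrightarrow> r s = r t) \<and> (s < t \<longrightarrow> r s = l t)" using F by blast
      define m where "m = max (l t) (r t)"
      have m: "m > 0" "l t \<le> m" "r t \<le> m" using lr[of t] by (auto simp: m_def)
      have bd: "\<bar>F s - F t\<bar> < d" if s: "\<bar>s - t\<bar> < min e (d / m)" for s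
      proof -
        define q where "q = (if s \<le> t then l t else r t)"
        have q: "0 < q" "q \<le> m" using m lr[of t] by (auto simp: q_def)
        have "\<bar>s - t\<bar> < e" using s by simp
        then have "F s = F t + q * (s - t)" unfolding q_def using e(2) by blast
        then have "\<bar>F s - F t\<bar> = q * \<bar>s - t\<bar>" using q by (simp add: abs_mult)
        also have "\<dots> \<le> m * \<bar>s - t\<bar>" using q by (intro mult_right_mono) auto
        also have "\<dots> < d" using s m by (simp add: field_simps)
        finally show ?thesis .
      qed
      show ?thesis
      proof (intro exI[of _ "min e (d / m)"] conjI)
        show "min e (d / m) > 0" using e(1) d m by simp
        show "\<forall>s. \<bar>s - t\<bar> < min e (d / m) \<longrightarrow> F s = F t + (if s \<le> t then l t else r t) * (s - t) \<and>
             (t < s \<longrightarrow> r s = r t) \<and> (s < t \<longrightarrow> r s = l t) \<and> \<bar>F s - F t\<bar> < d"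
        proof (intro allI impI)
          fix s assume s: "\<bar>s - t\<bar> < min e (d / m)"
          then have "\<bar>s - t\<bar> < e" by simp
          with e(2) bd[OF s] show "F s = F t + (if s \<le> t then l t else r t) * (s - t) \<and>
             (t < s \<longrightarrow> r s = r t) \<and> (s < t \<longrightarrow> r s = l t) \<and> \<bar>F s - F t\<bar> < d" by blast
        qed
      qed
    qed
    \<comment> \<open>The logarithm of the right slope of \<open>F\<close> measured with the density
      \<open>\<rho>\<close> at source and target. Passing to the left of \<open>t\<close> replaces
      the right slope by the left one, and the change is cancelled exactly by the jumps of
      \<open>\<Xi>\<close> at \<open>t\<close> and \<open>F t\<close>.\<close>
    define L where "L t = ln (r t) - \<Xi> (F t) + \<Xi> t" for t
    have Lc: "L s = L t" for s t
    proof (rule locally_constant_real[of L])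
      fix t
      obtain d where d: "d > 0" "\<And>s. t \<le> s \<Longrightarrow> s < t + d \<Longrightarrow> \<Xi> s = \<Xi> t" "\<And>s. t - d < s \<Longrightarrow> s < t \<Longrightarrow> \<Xi> s = \<Xi> t - \<eta> t"
        using loc[of t] by blast
      obtain d' where d': "d' > 0" "\<And>s. F t \<le> s \<Longrightarrow> s < F t + d' \<Longrightarrow> \<Xi> s = \<Xi> (F t)" "\<And>s. F t - d' < s \<Longrightarrow> s < F t \<Longrightarrow> \<Xi> s = \<Xi> (F t) - \<eta> (F t)"
        using loc[of "F t"] by blast
      obtain e where e: "e > 0" "\<forall>s. \<bar>s - t\<bar> < e \<longrightarrow> F s = F t + (if s \<le> t then l t else r t) * (s - t) \<and>
             (t < s \<longrightarrow> r s = r t) \<and> (s < t \<longrightarrow> r s = l t) \<and> \<bar>F s - F t\<bar> < d'" using near[OF d'(1)] by blast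
      have "L s = L t" if s: "\<bar>s - t\<bar> < min e d" for s
      proof (cases s t rule: linorder_cases)
        case less
        have *: "F s = F t + l t * (s - t)" "r s = l t" "\<bar>F s - F t\<bar> < d'" using e(2)[rule_format, of s] s less by auto
        have "F s < F t" using *(1) lr(1)[of t] less by (simp add: mult_pos_neg)
        then have "\<Xi> (F s) = \<Xi> (F t) - \<eta> (F t)" using *(3) by (intro d'(3)) auto
        moreover have "\<Xi> s = \<Xi> t - \<eta> t" using s less by (intro d(3)) auto
        ultimately show ?thesis using *(2) j[of t] by (simp add: L_def)
      next
        case greater
        have *: "F s = F t + r t * (s - t)" "r s = r t" "\<bar>F s - F t\<bar> < d'" using e(2)[rule_format, of s] s greater by auto
        have "F t \<le> F s" using *(1) lr(2)[of t] greater by simp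
        then have "\<Xi> (F s) = \<Xi> (F t)" using *(3) by (intro d'(2)) auto
        moreover have "\<Xi> s = \<Xi> t" using s greater by (intro d(2)) auto
        ultimately show ?thesis using *(2) by (simp add: L_def)
      qed simp
      moreover have "min e d > 0" using e(1) d(1) by simp
      ultimately show "\<exists>e>0. \<forall>s. \<bar>s - t\<bar> < e \<longrightarrow> L s = L t" by blast
    qed
    define \<alpha> where "\<alpha> = exp (L 0)"
    have sl_r: "\<rho> (F t) * r t = \<alpha> * \<rho> t" for t
    proof -
      have "ln (r t) = L 0 + \<Xi> (F t) - \<Xi> t" using Lc[of t 0] L_def[of t] by linarith
      then have "r t = exp (L 0 + \<Xi> (F t) - \<Xi> t)" using exp_ln[OF lr(2)[of t]] by simp
      then show ?thesis by (simp add: \<rho>_def \<alpha>_def exp_add[symmetric])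
    qed
    have sl_l: "(\<rho> (F t) * exp (\<eta> (F t))) * l t = \<alpha> * (\<rho> t * exp (\<eta> t))" for t
    proof -
      have "ln (l t) = ln (r t) - \<eta> (F t) + \<eta> t" using j[of t] by simp
      then have "l t = exp (ln (r t) - \<eta> (F t) + \<eta> t)" using exp_ln[OF lr(1)[of t]] by simp
      also have "\<dots> = r t * exp (\<eta> t) / exp (\<eta> (F t))" using lr(2)[of t] by (simp add: exp_add exp_diff)
      finally have "l t = r t * exp (\<eta> t) / exp (\<eta> (F t))" .
      then have "(\<rho> (F t) * exp (\<eta> (F t))) * l t = (\<rho> (F t) * r t) * exp (\<eta> t)" by simp
      then show ?thesis unfolding sl_r by simp
    qed
    \<comment> \<open>The one-sided slopes of \<open>H\<close> after \<open>F\<close> are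
      \<open>\<alpha>\<close> times those of \<open>H\<close> by \<open>sl_l\<close> and
      \<open>sl_r\<close>, so this difference is locally constant.\<close>
    define K where "K t = H (F t) - \<alpha> * H t" for t
    have Kc: "K s = K t" for s t
    proof (rule locally_constant_real[of K])
      fix t
      obtain d where d: "d > 0" "\<And>s. \<bar>s - t\<bar> < d \<Longrightarrow> H s = H t + (if s \<le> t then \<rho> t * exp (\<eta> t) else \<rho> t) * (s - t)"
        using H[of t] by blast
      obtain d' where d': "d' > 0" "\<And>s. \<bar>s - F t\<bar> < d' \<Longrightarrow> H s = H (F t) + (if s \<le> F t then \<rho> (F t) * exp (\<eta> (F t)) else \<rho> (F t)) * (s - F t)"
        using H[of "F t"] by blast
      obtain e where e: "e > 0" "\<forall>s. \<bar>s - t\<bar> < e \<longrightarrow> F s = F t + (if s \<le> t then l t else r t) * (s - t) \<and>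
             (t < s \<longrightarrow> r s = r t) \<and> (s < t \<longrightarrow> r s = l t) \<and> \<bar>F s - F t\<bar> < d'" using near[OF d'(1)] by blast
      have "K s = K t" if s: "\<bar>s - t\<bar> < min e d" for s
      proof (cases "s \<le> t")
        case True
        have *: "F s - F t = l t * (s - t)" "\<bar>F s - F t\<bar> < d'" using e(2)[rule_format, of s] s True by auto
        have "l t * (s - t) \<le> 0" using lr(1)[of t] True by (simp add: mult_nonneg_nonpos)
        then have "F s \<le> F t" using *(1) by linarith
        then have "H (F s) = H (F t) + (\<rho> (F t) * exp (\<eta> (F t))) * (l t * (s - t))"
          using d'(2)[OF *(2)] unfolding *(1) by simp
        also have "\<dots> = H (F t) + (\<alpha> * (\<rho> t * exp (\<eta> t))) * (s - t)"
          using sl_l[of t] by (simp only: mult.assoc[symmetric])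
        finally have 1: "H (F s) = H (F t) + (\<alpha> * (\<rho> t * exp (\<eta> t))) * (s - t)" .
        have 2: "H s = H t + (\<rho> t * exp (\<eta> t)) * (s - t)" using d(2)[of s] s True by simp
        show ?thesis unfolding K_def 1 2 by (simp add: algebra_simps)
      next
        case False
        have *: "F s - F t = r t * (s - t)" "\<bar>F s - F t\<bar> < d'" using e(2)[rule_format, of s] s False by auto
        have "r t * (s - t) > 0" using lr(2)[of t] False by simp
        then have "\<not> F s \<le> F t" using *(1) by linarith
        then have "H (F s) = H (F t) + \<rho> (F t) * (r t * (s - t))"
          using d'(2)[OF *(2)] unfolding *(1) by simp
        also have "\<dots> = H (F t) + (\<alpha> * \<rho> t) * (s - t)"
          using sl_r[of t] by (simp only: mult.assoc[symmetric])
        finally have 1: "H (F s) = H (F t) + (\<alpha> * \<rho> t) * (s - t)" .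
        have 2: "H s = H t + \<rho> t * (s - t)" using d(2)[of s] s False by simp
        show ?thesis unfolding K_def 1 2 by (simp add: algebra_simps)
      qed
      moreover have "min e d > 0" using e(1) d(1) by simp
      ultimately show "\<exists>e>0. \<forall>s. \<bar>s - t\<bar> < e \<longrightarrow> K s = K t" by blast
    qed
    have "H (F t) = \<alpha> * H t + K 0" for t using Kc[of t 0] by (simp add: K_def)
    then show ?thesis by (intro exI[of _ \<alpha>] exI[of _ "K 0"]) (simp add: \<alpha>_def)
  qed
  show ?thesis
  proof (rule exI[of _ H], intro conjI mono cont allI impI)
    fix F l r
    assume *: "\<forall>t. l t > 0 \<and> r t > 0 \<and> ln (r t) - ln (l t) = \<eta> (F t) - \<eta> t \<and>
        (\<exists>e>0. \<forall>s. \<bar>s - t\<bar> < e \<longrightarrow> F s = F t + (if s \<le> t then l t else r t) * (s - t) \<and>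
             (t < s \<longrightarrow> r s = r t) \<and> (s < t \<longrightarrow> r s = l t))"
    show "\<exists>\<alpha> \<beta>. \<alpha> > 0 \<and> (\<forall>t. H (F t) = \<alpha> * H t + \<beta>)"
      by (rule affine[of l r F]) (use * in blast)+
  qed
qed

lemma int_subgroup_cyclic:
  fixes K :: "int set"
  assumes "0 \<in> K" "\<And>a b. a \<in> K \<Longrightarrow> b \<in> K \<Longrightarrow> a + b \<in> K" "\<And>a. a \<in> K \<Longrightarrow> - a \<in> K"
  shows "\<exists>p\<ge>0. \<forall>k. k \<in> K \<longleftrightarrow> (\<exists>n. k = n * p)"
proof (cases "\<exists>k\<in>K. k > 0")
  case False
  have "k = 0" if "k \<in> K" for k
    using False that assms(3)[OF that] by (metis neg_0_less_iff_less not_less_iff_gr_or_eq)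
  then show ?thesis using assms(1) by (intro exI[of _ 0]) auto
next
  case True
  define P where "P m \<longleftrightarrow> m > 0 \<and> int m \<in> K" for m
  obtain k where k: "k \<in> K" "k > 0" using True by blast
  have "P (nat k)" using k by (simp add: P_def)
  then have PL: "P (Least P)" by (rule LeastI)
  define p where "p = int (Least P)"
  have p: "p \<in> K" "p > 0" using PL by (auto simp: p_def P_def)
  have least: "p \<le> j" if "j \<in> K" "j > 0" for j
  proof -
    have "P (nat j)" using that by (simp add: P_def)
    then have "Least P \<le> nat j" by (rule Least_le)
    then show ?thesis using that by (simp add: p_def)
  qed
  have mult_nat: "int m * p \<in> K" for m
    by (induction m) (use assms(1,2) p(1) in \<open>auto simp: distrib_right\<close>)
  have mult: "n * p \<in> K" for n
  proof (cases "n \<ge> 0")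
    case True then show ?thesis using mult_nat[of "nat n"] by simp
  next
    case False then show ?thesis using assms(3)[OF mult_nat[of "nat (- n)"]] by simp
  qed
  have "\<exists>n. k = n * p" if "k \<in> K" for k
  proof -
    have e: "k mod p = k + (- (k div p)) * p" using div_mult_mod_eq[of k p] by (simp add: algebra_simps)
    then have "k mod p \<in> K" unfolding e by (intro assms(2) that mult)
    moreover have "0 \<le> k mod p" "k mod p < p" using p(2) by auto
    ultimately have "k mod p = 0" using least[of "k mod p"] by linarith
    then show ?thesis using e by (intro exI[of _ "k div p"]) simp
  qed
  then show ?thesis using mult p(2) by (intro exI[of _ p]) auto
qed

section \<open>From affine coordinates to translations of a leaf\<close>

context PL_leaf_action
begin

text \<open>A period shared by all nearby leaves. A period of the leaf of \<open>x\<close> alone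
  would not make translation by it trivial near \<open>x\<close>.\<close>

definition germ_period :: "int \<Rightarrow> 'a \<Rightarrow> bool" where
  "germ_period k x \<longleftrightarrow> (\<exists>U. openin X U \<and> x \<in> U \<and> (\<forall>y\<in>U. it k y = y))"

lemma germ_periodD: "germ_period k x \<Longrightarrow> it k x = x"
  unfolding germ_period_def by blast

lemma germ_period_0: "x \<in> topspace X \<Longrightarrow> germ_period 0 x"
  unfolding germ_period_def by (intro exI[of _ "topspace X"]) (simp add: it_0)

lemma germ_period_add:
  assumes "germ_period k x" "germ_period l x"
  shows "germ_period (k + l) x"
proof -
  obtain U V where U: "openin X U" "x \<in> U" "\<And>y. y \<in> U \<Longrightarrow> it k y = y"
    and V: "openin X V" "x \<in> V" "\<And>y. y \<in> V \<Longrightarrow> it l y = y"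
    using assms unfolding germ_period_def by blast
  have "it (k + l) y = y" if y: "y \<in> U \<inter> V" for y
  proof -
    have "y \<in> topspace X" using y openin_subset[OF U(1)] by blast
    then have "it (k + l) y = it k (it l y)" by (rule it_add)
    then show ?thesis using y U(3)[of y] V(3)[of y] by simp
  qed
  moreover have "openin X (U \<inter> V)" "x \<in> U \<inter> V" using U V by auto
  ultimately show ?thesis unfolding germ_period_def by blast
qed

lemma germ_period_neg:
  assumes "germ_period k x"
  shows "germ_period (- k) x"
proof -
  obtain U where U: "openin X U" "x \<in> U" "\<And>y. y \<in> U \<Longrightarrow> it k y = y"
    using assms unfolding germ_period_def by blast
  have "it (- k) y = y" if y: "y \<in> U" for y
  proof -
    have "y \<in> topspace X" using y openin_subset[OF U(1)] by blast
    from it_neg(1)[OF this, of k] show ?thesis unfolding U(3)[OF y] .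
  qed
  then show ?thesis using U(1,2) unfolding germ_period_def by blast
qed

lemma G_mult_germ:
  assumes "g \<in> carrier \<Gamma>" "h \<in> carrier \<Gamma>" "x \<in> topspace X"
  shows "\<exists>k. germ_period k x \<and> (\<forall>t. G (g \<otimes>\<^bsub>\<Gamma>\<^esub> h) x t = G g x (G h x t) + of_int k)"
  using G_mult[OF assms] unfolding germ_period_def by blast

lemma G_period:
  assumes "g \<in> carrier \<Gamma>" "x \<in> topspace X" "it k x = x"
  shows "G g x (t + of_int k) = G g x t + of_int k"
  using G_shift[OF assms(1,2), of k "t + of_int k"] assms(3) by simp

text \<open>In the coordinate \<open>H\<close> the elements act by affine maps. The plan is to find
  an injective coordinate \<open>D\<close> in which they are translations by \<open>r g\<close> and
  the basic germ period is a translation by \<open>w\<close>; then \<open>r\<close> is a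
  homomorphism modulo \<open>w\<close> and has finite image. Without germ periods, property (T)
  removes the linear parts. With a germ period \<open>p\<close>, every affine map commutes with the
  one belonging to \<open>p\<close>: if that is a translation, the others are translations too, and
  otherwise all share its fixed point \<open>z\<close>, so that the logarithm of the distance from
  \<open>z\<close> is a suitable coordinate.\<close>

lemma leaf_translations_finite_index:
  fixes \<eta> :: "real \<Rightarrow> real"
  assumes T: "property_T \<Gamma>" and x: "x \<in> topspace X"
    and fin: "\<And>a b. finite {t \<in> {a..b}. \<eta> t \<noteq> 0}"
    and cob: "\<And>g t. g \<in> carrier \<Gamma> \<Longrightarrow> jump g x t = \<eta> (G g x t) - \<eta> t"
    and per: "\<And>k t. it k x = x \<Longrightarrow> \<eta> (t + of_int k) = \<eta> t"
  shows "finite_index \<Gamma> {g \<in> carrier \<Gamma>. \<exists>k. germ_period k x \<and> (\<forall>t. G g x t = t + of_int k)}" (is "finite_index \<Gamma> ?N")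
proof -
  obtain H :: "real \<Rightarrow> real" where mono: "strict_mono H" and cont: "continuous_on UNIV H"
    and aff: "\<forall>(F :: real \<Rightarrow> real) l r. (\<forall>t. l t > 0 \<and> r t > 0 \<and> ln (r t) - ln (l t) = \<eta> (F t) - \<eta> t \<and>
        (\<exists>e>0. \<forall>s. \<bar>s - t\<bar> < e \<longrightarrow> F s = F t + (if s \<le> t then l t else r t) * (s - t) \<and>
             (t < s \<longrightarrow> r s = r t) \<and> (s < t \<longrightarrow> r s = l t))) \<longrightarrow>
      (\<exists>\<alpha> \<beta>. \<alpha> > 0 \<and> (\<forall>t. H (F t) = \<alpha> * H t + \<beta>))"
    using affine_coordinate[OF fin] by (elim exE conjE) (rule that)
  have Hinj: "s = t" if "H s = H t" for s t using mono that by (simp add: strict_mono_eq)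
  have ex: "\<exists>\<alpha> \<beta>. \<alpha> > 0 \<and> (\<forall>t. H (G g x t) = \<alpha> * H t + \<beta>)" if g: "g \<in> carrier \<Gamma>" for g
  proof (rule aff[rule_format, of "lslope g x" "rslope g x"])
    fix t
    obtain U e where U: "x \<in> U" "e > 0"
      "\<And>y s. y \<in> U \<Longrightarrow> \<bar>s - t\<bar> < e \<Longrightarrow> G g y s = G g x t + (if s \<le> t then lslope g x t else rslope g x t) * (s - t)"
      "\<And>y s. y \<in> U \<Longrightarrow> \<bar>s - t\<bar> < e \<Longrightarrow> s < t \<Longrightarrow> rslope g y s = lslope g x t"
      "\<And>y s. y \<in> U \<Longrightarrow> \<bar>s - t\<bar> < e \<Longrightarrow> t < s \<Longrightarrow> rslope g y s = rslope g x t"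
      by (rule local_form[OF g x, of t]) (rule that)
    have "\<exists>e>0. \<forall>s. \<bar>s - t\<bar> < e \<longrightarrow> G g x s = G g x t + (if s \<le> t then lslope g x t else rslope g x t) * (s - t) \<and>
             (t < s \<longrightarrow> rslope g x s = rslope g x t) \<and> (s < t \<longrightarrow> rslope g x s = lslope g x t)"
      using U(2) U(3-5)[OF U(1)] by blast
    then show "lslope g x t > 0 \<and> rslope g x t > 0 \<and> ln (rslope g x t) - ln (lslope g x t) = \<eta> (G g x t) - \<eta> t \<and>
        (\<exists>e>0. \<forall>s. \<bar>s - t\<bar> < e \<longrightarrow> G g x s = G g x t + (if s \<le> t then lslope g x t else rslope g x t) * (s - t) \<and>
             (t < s \<longrightarrow> rslope g x s = rslope g x t) \<and> (s < t \<longrightarrow> rslope g x s = lslope g x t))"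
      using slopes_pos[OF g x, of t] cob[OF g, of t] unfolding jump_def by blast
  qed
  define ab where "ab g = (SOME ab. fst ab > 0 \<and> (\<forall>t. H (G g x t) = fst ab * H t + snd ab))" for g
  define \<alpha> \<beta> where "\<alpha> g = fst (ab g)" and "\<beta> g = snd (ab g)" for g
  have \<alpha>HG: "\<alpha> g > 0 \<and> (\<forall>t. H (G g x t) = \<alpha> g * H t + \<beta> g)" if g: "g \<in> carrier \<Gamma>" for g
  proof -
    from ex[OF g] obtain a b where "a > 0" "\<forall>t. H (G g x t) = a * H t + b" by blast
    then have "fst (a, b) > 0 \<and> (\<forall>t. H (G g x t) = fst (a, b) * H t + snd (a, b))" unfolding fst_conv snd_conv by blast
    then show ?thesis unfolding \<alpha>_def \<beta>_def ab_def
      by (rule someI[of "\<lambda>ab. fst ab > 0 \<and> (\<forall>t. H (G g x t) = fst ab * H t + snd ab)"])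
  qed
  have \<alpha>: "\<alpha> g > 0" and HG: "H (G g x t) = \<alpha> g * H t + \<beta> g" if "g \<in> carrier \<Gamma>" for g t
    using \<alpha>HG[OF that] by blast+
  \<comment> \<open>Translation by a period has slopes 1 and preserves \<open>\<eta>\<close>, so it
    meets the conditions for being affine in \<open>H\<close>, like the group elements.\<close>
  have HT: "\<exists>a b. a > 0 \<and> (\<forall>t. H (t + of_int k) = a * H t + b)" if k: "it k x = x" for k
  proof (rule aff[rule_format, of "\<lambda>_. 1" "\<lambda>_. 1"])
    fix t
    show "(0::real) < 1 \<and> (0::real) < 1 \<and> ln 1 - ln 1 = \<eta> (t + of_int k) - \<eta> t \<and>
        (\<exists>e>0. \<forall>s. \<bar>s - t\<bar> < e \<longrightarrow> s + of_int k = t + of_int k + (if s \<le> t then 1 else 1) * (s - t) \<and>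
             (t < s \<longrightarrow> (1::real) = 1) \<and> (s < t \<longrightarrow> (1::real) = 1))"
      using per[OF k, of t] by (intro conjI exI[of _ 1]) auto
  qed
  have "\<exists>p\<ge>0. \<forall>k. k \<in> {k. germ_period k x} \<longleftrightarrow> (\<exists>n. k = n * p)"
    by (rule int_subgroup_cyclic) (auto simp: germ_period_0[OF x] germ_period_add germ_period_neg)
  then obtain p where p: "p \<ge> 0" "\<And>k. germ_period k x \<longleftrightarrow> (\<exists>n. k = n * p)" by auto
  have pp: "germ_period p x" unfolding p(2) by (rule exI[of _ 1]) simp
  have itp: "it p x = x" by (rule germ_periodD[OF pp])
  \<comment> \<open>The common end of the three cases. Products of lifts differ by a germ period,
    hence by a multiple of \<open>p\<close>, so \<open>r\<close> is additive modulo
    \<open>w\<close>; injectivity of \<open>D\<close> translates \<open>r g = n w\<close> back into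
    translation by \<open>n p\<close>.\<close>
  have final: "finite_index \<Gamma> ?N"
    if Dinj: "\<And>s t. D s = D t \<Longrightarrow> s = t" and Dr: "\<And>g t. g \<in> carrier \<Gamma> \<Longrightarrow> D (G g x t) = D t + r g"
      and Dp: "\<And>t. D (t + of_int p) = D t + w" for D r :: "_ \<Rightarrow> real" and w
  proof -
    have Dn: "D (t + of_int (n * p)) = D t + of_int n * w" for n t
    proof (induction n rule: int_induct[where k = 0])
      case base then show ?case by simp
    next
      case (step1 i)
      have "D (t + of_int ((i + 1) * p)) = D ((t + of_int (i * p)) + of_int p)" by (simp add: algebra_simps)
      then show ?case using step1 by (simp only: Dp) (simp add: algebra_simps)
    next
      case (step2 i)
      have "D (t + of_int (i * p)) = D ((t + of_int ((i - 1) * p)) + of_int p)" by (simp add: algebra_simps)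
      then show ?case using step2 by (simp only: Dp) (simp add: algebra_simps)
    qed
    have "finite_index \<Gamma> {g \<in> carrier \<Gamma>. \<exists>k :: int. r g = of_int k * w}"
    proof (rule property_T_circle_hom_finite_index[OF T])
      fix g h assume gh: "g \<in> carrier \<Gamma>" "h \<in> carrier \<Gamma>"
      obtain k where k: "germ_period k x" "\<forall>t. G (g \<otimes>\<^bsub>\<Gamma>\<^esub> h) x t = G g x (G h x t) + of_int k"
        using G_mult_germ[OF gh x] by blast
      obtain n where n: "k = n * p" using k(1) p(2) by blast
      have "D 0 + r (g \<otimes>\<^bsub>\<Gamma>\<^esub> h) = D (G (g \<otimes>\<^bsub>\<Gamma>\<^esub> h) x 0)" using Dr gh by simp
      also have "\<dots> = D (G g x (G h x 0)) + of_int n * w" using k(2) Dn n by simp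
      also have "\<dots> = D 0 + r h + r g + of_int n * w" using Dr gh by simp
      finally show "\<exists>k :: int. r (g \<otimes>\<^bsub>\<Gamma>\<^esub> h) = r g + r h + of_int k * w" by (intro exI[of _ n]) simp
    qed
    moreover have "{g \<in> carrier \<Gamma>. \<exists>k :: int. r g = of_int k * w} = ?N"
    proof (rule Collect_cong, rule conj_cong[OF refl], rule iffI)
      fix g assume g: "g \<in> carrier \<Gamma>" and "\<exists>k :: int. r g = of_int k * w"
      then obtain n :: int where n: "r g = of_int n * w" by blast
      have "G g x t = t + of_int (n * p)" for t
        by (rule Dinj) (simp only: Dr[OF g] Dn n)
      moreover have "germ_period (n * p) x" using p(2) by blast
      ultimately show "\<exists>k. germ_period k x \<and> (\<forall>t. G g x t = t + of_int k)" by blast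
    next
      fix g assume g: "g \<in> carrier \<Gamma>" and "\<exists>k. germ_period k x \<and> (\<forall>t. G g x t = t + of_int k)"
      then obtain k where k: "germ_period k x" "\<forall>t. G g x t = t + of_int k" by blast
      obtain n where n: "k = n * p" using k(1) p(2) by blast
      have "D 0 + r g = D (G g x 0)" by (rule Dr[OF g, symmetric])
      also have "\<dots> = D (0 + of_int (n * p))" using k(2) n by simp
      also have "\<dots> = D 0 + of_int n * w" by (rule Dn)
      finally have "r g = of_int n * w" by simp
      then show "\<exists>k :: int. r g = of_int k * w" by blast
    qed
    ultimately show ?thesis by simp
  qed
  show ?thesis
  proof (cases "p = 0")
    case True
    \<comment> \<open>The only germ period is 0, so the lifts compose exactly and
      \<open>\<alpha>\<close> is a homomorphism to the positive reals.\<close>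
    have comp: "G (g \<otimes>\<^bsub>\<Gamma>\<^esub> h) x t = G g x (G h x t)" if gh: "g \<in> carrier \<Gamma>" "h \<in> carrier \<Gamma>" for g h t
    proof -
      obtain k where k: "germ_period k x" "\<forall>t. G (g \<otimes>\<^bsub>\<Gamma>\<^esub> h) x t = G g x (G h x t) + of_int k"
        using G_mult_germ[OF gh x] by blast
      have "k = 0" using k(1) p(2) True by simp
      then show ?thesis using k(2)[rule_format, of t] by simp
    qed
    have am: "\<alpha> (g \<otimes>\<^bsub>\<Gamma>\<^esub> h) = \<alpha> g * \<alpha> h" if gh: "g \<in> carrier \<Gamma>" "h \<in> carrier \<Gamma>" for g h
    proof -
      have "\<alpha> (g \<otimes>\<^bsub>\<Gamma>\<^esub> h) * H t + \<beta> (g \<otimes>\<^bsub>\<Gamma>\<^esub> h) = \<alpha> g * (\<alpha> h * H t + \<beta> h) + \<beta> g" for t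
        using HG[of "g \<otimes>\<^bsub>\<Gamma>\<^esub> h" t] HG[OF gh(1), of "G h x t"] HG[OF gh(2), of t] gh comp[OF gh, of t] by simp
      from this[of 0] this[of 1]
      have "(\<alpha> (g \<otimes>\<^bsub>\<Gamma>\<^esub> h) - \<alpha> g * \<alpha> h) * (H 1 - H 0) = 0" by (simp add: algebra_simps)
      moreover have "H 1 - H 0 \<noteq> 0" using Hinj[of 1 0] by auto
      ultimately show ?thesis by simp
    qed
    have ln0: "ln (\<alpha> g) = 0" if "g \<in> carrier \<Gamma>" for g
    proof (rule property_T_hom_real_trivial[OF T _ that, of "\<lambda>g. ln (\<alpha> g)"])
      show "ln (\<alpha> (g \<otimes>\<^bsub>\<Gamma>\<^esub> h)) = ln (\<alpha> g) + ln (\<alpha> h)" if gh: "g \<in> carrier \<Gamma>" "h \<in> carrier \<Gamma>" for g h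
        using \<alpha>[OF gh(1)] \<alpha>[OF gh(2)] by (simp add: am[OF gh] ln_mult)
    qed
    have a1: "\<alpha> g = 1" if g: "g \<in> carrier \<Gamma>" for g using ln0[OF g] \<alpha>[OF g] by simp
    show ?thesis
    proof (rule final[of H \<beta> 0])
      show "s = t" if "H s = H t" for s t by (rule Hinj[OF that])
      show "H (G g x t) = H t + \<beta> g" if g: "g \<in> carrier \<Gamma>" for g t by (simp add: HG[OF g] a1[OF g])
      show "H (t + of_int p) = H t + 0" for t by (simp add: True)
    qed
  next
    case False
    then have pos: "p > 0" using p(1) by simp
    obtain a b where a: "a > 0" and HP: "\<And>t. H (t + of_int p) = a * H t + b" using HT[OF itp] by blast
    \<comment> \<open>The lift commutes with translation by the period; comparing constant terms of
      the two affine compositions gives this relation.\<close>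
    have comm: "\<alpha> g * b + \<beta> g = a * \<beta> g + b" if g: "g \<in> carrier \<Gamma>" for g
    proof -
      have "H (G g x (0 + of_int p)) = H (G g x 0 + of_int p)" by (simp only: G_period[OF g x itp])
      then have "\<alpha> g * (a * H 0 + b) + \<beta> g = a * (\<alpha> g * H 0 + \<beta> g) + b" unfolding HP HG[OF g] .
      then show ?thesis by (simp add: algebra_simps)
    qed
    show ?thesis
    proof (cases "a = 1")
      case True
      have "H 0 < H (0 + of_int p)" by (rule strict_monoD[OF mono]) (use pos in simp)
      then have "b > 0" unfolding HP using True by simp
      have a1: "\<alpha> g = 1" if g: "g \<in> carrier \<Gamma>" for g using comm[OF g] True \<open>b > 0\<close> by simp
      show ?thesis
      proof (rule final[of H \<beta> b])
        show "s = t" if "H s = H t" for s t by (rule Hinj[OF that])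
        show "H (G g x t) = H t + \<beta> g" if g: "g \<in> carrier \<Gamma>" for g t by (simp add: HG[OF g] a1[OF g])
        show "H (t + of_int p) = H t + b" for t by (simp add: HP True)
      qed
    next
      case False
      \<comment> \<open>The fixed point of the affine map of the period. It is outside the range of
        \<open>H\<close>, for otherwise the period would fix a point of the leaf.\<close>
      define z where "z = b / (1 - a)"
      have z: "a * z + b = z" using False by (simp add: z_def field_simps)
      have zg: "\<beta> g = z * (1 - \<alpha> g)" if "g \<in> carrier \<Gamma>" for g
      proof -
        have "\<beta> g * (1 - a) = b * (1 - \<alpha> g)" using comm[OF that] by (simp add: algebra_simps)
        then show ?thesis using False by (simp add: z_def field_simps)
      qed
      have ne: "H t \<noteq> z" for t
      proof
        assume "H t = z"
        then have "H (t + of_int p) = H t" unfolding HP using z by simp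
        then show False using Hinj pos by fastforce
      qed
      \<comment> \<open>By the intermediate value theorem \<open>H - z\<close> never changes sign,
        so its absolute value still separates points.\<close>
      have side: "H s < z \<longleftrightarrow> H t < z" for s t
      proof -
        have "\<not> (H u < z \<and> z < H v)" for u v
        proof
          assume uv: "H u < z \<and> z < H v"
          then have "u < v" using strict_mono_less[OF mono, of u v] by simp
          then have "\<exists>w\<ge>u. w \<le> v \<and> H w = z"
            using uv by (intro IVT' continuous_on_subset[OF cont]) auto
          then show False using ne by blast
        qed
        then show ?thesis using ne by (metis linorder_neqE_linordered_idom)
      qed
      define D where "D t = ln \<bar>H t - z\<bar>" for t
      have "s = t" if "D s = D t" for s t
      proof -
        have "\<bar>H s - z\<bar> = \<bar>H t - z\<bar>" using that ne[of s] ne[of t] unfolding D_def by simp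
        then have "H s = H t" using side[of s t] by (simp add: abs_if split: if_splits)
        then show ?thesis by (rule Hinj)
      qed
      moreover have "D (G g x t) = D t + ln (\<alpha> g)" if g: "g \<in> carrier \<Gamma>" for g t
      proof -
        have "H (G g x t) - z = \<alpha> g * (H t - z)" unfolding HG[OF g] zg[OF g] by (simp add: algebra_simps)
        then have "\<bar>H (G g x t) - z\<bar> = \<bar>H t - z\<bar> * \<alpha> g" using \<alpha>[OF g] by (simp add: abs_mult)
        then show ?thesis unfolding D_def using \<alpha>[OF g] ne[of t] by (simp add: ln_mult)
      qed
      moreover have "D (t + of_int p) = D t + ln a" for t
      proof -
        have "H (t + of_int p) - z = a * (H t - z)" unfolding HP using z by (simp add: algebra_simps)
        then have "\<bar>H (t + of_int p) - z\<bar> = \<bar>H t - z\<bar> * a" using a by (simp add: abs_mult)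
        then show ?thesis unfolding D_def using a ne[of t] by (simp add: ln_mult)
      qed
      ultimately show ?thesis by (rule final)
    qed
  qed
qed

lemma slopes_leaf_point:
  assumes "g \<in> carrier \<Gamma>" "x \<in> topspace X"
  shows "lslope g (snd (leaf_point x t)) (fst (leaf_point x t)) = lslope g x t"
    "rslope g (snd (leaf_point x t)) (fst (leaf_point x t)) = rslope g x t"
  using slopes_shift[OF assms, of "\<lfloor>t\<rfloor>" t] by (simp_all add: leaf_point_def frac_def)

text \<open>The logarithms of the one-sided slopes are cocycles; on the finite orbit of a point fixed by a
  subgroup of finite index they are coboundaries, hence vanish on that subgroup.\<close>

lemma slopes_eq_1_if_fixed:
  assumes T: "property_T \<Gamma>" and N: "finite_index \<Gamma> N" and x: "x \<in> topspace X"
    and fixed: "\<And>n. n \<in> N \<Longrightarrow> leaf_map n (leaf_point x t) = leaf_point x t" and n: "n \<in> N"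
  shows "lslope n x t = 1" "rslope n x t = 1"
proof -
  let ?y = "leaf_point x t"
  define \<Omega> where "\<Omega> = (\<lambda>g. leaf_map g ?y) ` carrier \<Gamma>"
  have y01: "?y \<in> {0..<1} \<times> topspace X" by (rule leaf_point_in[OF x])
  have NC: "N \<subseteq> carrier \<Gamma>" using N subgroup.subset unfolding finite_index_def by blast
  have nC: "n \<in> carrier \<Gamma>" using n NC by blast
  obtain R where R: "finite R" "R \<subseteq> carrier \<Gamma>" "\<And>g. g \<in> carrier \<Gamma> \<Longrightarrow> \<exists>r\<in>R. inv\<^bsub>\<Gamma>\<^esub> r \<otimes>\<^bsub>\<Gamma>\<^esub> g \<in> N"
    using N unfolding finite_index_def by blast
  \<comment> \<open>Because \<open>N\<close> fixes the point, the orbit is already the image of the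
    coset representatives and is therefore finite.\<close>
  have "\<Omega> \<subseteq> (\<lambda>g. leaf_map g ?y) ` R"
    unfolding \<Omega>_def
  proof (rule image_subsetI)
    fix g assume g: "g \<in> carrier \<Gamma>"
    then obtain r where r: "r \<in> R" "inv\<^bsub>\<Gamma>\<^esub> r \<otimes>\<^bsub>\<Gamma>\<^esub> g \<in> N" using R(3) by blast
    have rC: "r \<in> carrier \<Gamma>" using r R(2) by blast
    have "r \<otimes>\<^bsub>\<Gamma>\<^esub> (inv\<^bsub>\<Gamma>\<^esub> r \<otimes>\<^bsub>\<Gamma>\<^esub> g) = g" using rC g by (simp add: \<Gamma>.m_assoc[symmetric])
    then have "leaf_map g ?y = leaf_map r (leaf_map (inv\<^bsub>\<Gamma>\<^esub> r \<otimes>\<^bsub>\<Gamma>\<^esub> g) ?y)"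
      using leaf_map_mult_point[OF rC _ x, of "inv\<^bsub>\<Gamma>\<^esub> r \<otimes>\<^bsub>\<Gamma>\<^esub> g" t] rC g by simp
    then show "leaf_map g ?y \<in> (\<lambda>g. leaf_map g ?y) ` R" using fixed[OF r(2)] r(1) by simp
  qed
  then have fin: "finite \<Omega>" using R(1) finite_surj by blast
  have \<Omega>_pt: "\<exists>s. p = leaf_point x s" if "p \<in> \<Omega>" for p
    using that leaf_map_point[OF _ x] unfolding \<Omega>_def by blast
  have \<Omega>01: "p \<in> {0..<1} \<times> topspace X" if "p \<in> \<Omega>" for p
    using leaf_map_in[OF _ y01] that unfolding \<Omega>_def by blast
  have y\<Omega>: "?y \<in> \<Omega>" using leaf_map_one_point[OF x, of t] \<Gamma>.one_closed unfolding \<Omega>_def by (metis imageI)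
  have cl: "leaf_map g p \<in> \<Omega>" if gp: "g \<in> carrier \<Gamma>" "p \<in> \<Omega>" for g p
  proof -
    obtain h where h: "h \<in> carrier \<Gamma>" "p = leaf_map h ?y" using gp unfolding \<Omega>_def by blast
    have "leaf_map g p = leaf_map (g \<otimes>\<^bsub>\<Gamma>\<^esub> h) ?y" unfolding h(2) by (rule leaf_map_mult_point[OF gp(1) h(1) x, symmetric])
    then show ?thesis using gp(1) h(1) unfolding \<Omega>_def by blast
  qed
  have vanish: "c n (snd ?y) (fst ?y) = 0"
    if c: "\<And>g h x t. g \<in> carrier \<Gamma> \<Longrightarrow> h \<in> carrier \<Gamma> \<Longrightarrow> x \<in> topspace X \<Longrightarrow>
        c (g \<otimes>\<^bsub>\<Gamma>\<^esub> h) x t = c h x t + c g (snd (leaf_point x (G h x t))) (fst (leaf_point x (G h x t)))"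
    for c :: "'g \<Rightarrow> 'a \<Rightarrow> real \<Rightarrow> real"
  proof -
    have "\<exists>\<xi>. (\<forall>e>0. finite {p \<in> \<Omega>. e \<le> \<bar>\<xi> p\<bar>}) \<and>
        (\<forall>g\<in>carrier \<Gamma>. \<forall>p\<in>\<Omega>. c g (snd p) (fst p) = \<xi> (leaf_map g p) - \<xi> p)"
    proof (rule property_T_finite_support_coboundary[OF T cl])
      show "leaf_map (g \<otimes>\<^bsub>\<Gamma>\<^esub> h) p = leaf_map g (leaf_map h p)" if "g \<in> carrier \<Gamma>" "h \<in> carrier \<Gamma>" "p \<in> \<Omega>" for g h p
        by (rule leaf_map_mult[OF that(1,2) \<Omega>01[OF that(3)]])
      show "leaf_map \<one>\<^bsub>\<Gamma>\<^esub> p = p" if "p \<in> \<Omega>" for p by (rule leaf_map_one[OF \<Omega>01[OF that]])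
      show "finite {p \<in> \<Omega>. c g (snd p) (fst p) \<noteq> 0}" for g using fin by simp
      show "c (g \<otimes>\<^bsub>\<Gamma>\<^esub> h) (snd p) (fst p) = c h (snd p) (fst p) + c g (snd (leaf_map h p)) (fst (leaf_map h p))"
        if "g \<in> carrier \<Gamma>" "h \<in> carrier \<Gamma>" "p \<in> \<Omega>" for g h p
      proof -
        have "snd p \<in> topspace X" using \<Omega>01[OF that(3)] by auto
        from c[OF that(1,2) this] show ?thesis unfolding leaf_map_def .
      qed
    qed
    then obtain \<xi> where "\<forall>g\<in>carrier \<Gamma>. \<forall>p\<in>\<Omega>. c g (snd p) (fst p) = \<xi> (leaf_map g p) - \<xi> p" by blast
    then have "c n (snd ?y) (fst ?y) = \<xi> (leaf_map n ?y) - \<xi> ?y" using nC y\<Omega> by blast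
    then show ?thesis using fixed[OF n] by simp
  qed
  have "ln (lslope n (snd ?y) (fst ?y)) = 0"
  proof (rule vanish[of "\<lambda>g x t. ln (lslope g x t)"])
    fix g h x t assume gh: "g \<in> carrier \<Gamma>" "h \<in> carrier \<Gamma>" and x: "x \<in> topspace X"
    show "ln (lslope (g \<otimes>\<^bsub>\<Gamma>\<^esub> h) x t) = ln (lslope h x t) + ln (lslope g (snd (leaf_point x (G h x t))) (fst (leaf_point x (G h x t))))"
      unfolding slopes_leaf_point[OF gh(1) x] slopes_mult[OF gh x]
      using slopes_pos[OF gh(1) x, of "G h x t"] slopes_pos[OF gh(2) x, of t] by (simp add: ln_mult)
  qed
  then have "ln (lslope n x t) = 0" unfolding slopes_leaf_point[OF nC x] .
  then show "lslope n x t = 1" using slopes_pos[OF nC x, of t] by simp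
  have "ln (rslope n (snd ?y) (fst ?y)) = 0"
  proof (rule vanish[of "\<lambda>g x t. ln (rslope g x t)"])
    fix g h x t assume gh: "g \<in> carrier \<Gamma>" "h \<in> carrier \<Gamma>" and x: "x \<in> topspace X"
    show "ln (rslope (g \<otimes>\<^bsub>\<Gamma>\<^esub> h) x t) = ln (rslope h x t) + ln (rslope g (snd (leaf_point x (G h x t))) (fst (leaf_point x (G h x t))))"
      unfolding slopes_leaf_point[OF gh(1) x] slopes_mult[OF gh x]
      using slopes_pos[OF gh(1) x, of "G h x t"] slopes_pos[OF gh(2) x, of t] by (simp add: ln_mult)
  qed
  then have "ln (rslope n x t) = 0" unfolding slopes_leaf_point[OF nC x] .
  then show "rslope n x t = 1" using slopes_pos[OF nC x, of t] by simp
qed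

section \<open>Germs of the identity, their propagation and the conclusion for abstract
  actions\<close>

lemma leaf_map_fixed_generate:
  assumes T0: "T0 \<subseteq> carrier \<Gamma>" and p: "p \<in> {0..<1} \<times> topspace X"
    and fixed: "\<And>h. h \<in> T0 \<Longrightarrow> leaf_map h p = p" and n: "n \<in> generate \<Gamma> T0"
  shows "leaf_map n p = p"
proof (rule \<Gamma>.generate_minimal_on[OF n T0])
  show "leaf_map \<one>\<^bsub>\<Gamma>\<^esub> p = p" by (rule leaf_map_one[OF p])
  show "leaf_map h p = p" if "h \<in> T0" for h by (rule fixed[OF that])
  show "leaf_map (inv\<^bsub>\<Gamma>\<^esub> h) p = p" if h: "h \<in> T0" for h
  proof -
    have hC: "h \<in> carrier \<Gamma>" "inv\<^bsub>\<Gamma>\<^esub> h \<in> carrier \<Gamma>" using h T0 by auto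
    have "leaf_map (inv\<^bsub>\<Gamma>\<^esub> h \<otimes>\<^bsub>\<Gamma>\<^esub> h) p = leaf_map (inv\<^bsub>\<Gamma>\<^esub> h) (leaf_map h p)"
      by (rule leaf_map_mult[OF hC(2,1) p])
    then show ?thesis unfolding fixed[OF h] \<Gamma>.l_inv[OF hC(1)] leaf_map_one[OF p] by (rule sym)
  qed
  show "leaf_map (g \<otimes>\<^bsub>\<Gamma>\<^esub> h) p = p"
    if "g \<in> carrier \<Gamma>" "h \<in> carrier \<Gamma>" "leaf_map g p = p" "leaf_map h p = p" for g h
    unfolding leaf_map_mult[OF that(1,2) p] that(4) by (rule that(3))
qed

text \<open>The element acts as the identity on a neighbourhood of the point of the suspension: on
  all nearby leaves its lift is translation by one common period.\<close>

definition germ_fixed :: "'g \<Rightarrow> 'a \<Rightarrow> real \<Rightarrow> bool" where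
  "germ_fixed n x t \<longleftrightarrow> (\<exists>k U e. openin X U \<and> x \<in> U \<and> e > 0 \<and>
     (\<forall>y\<in>U. it k y = y \<and> (\<forall>s. \<bar>s - t\<bar> < e \<longrightarrow> G n y s = s + of_int k)))"

text \<open>Slopes 1 at a single point suffice, because the local form at that point is valid on all
  nearby leaves.\<close>

lemma germ_fixedI:
  assumes n: "n \<in> carrier \<Gamma>" and x: "x \<in> topspace X" and k: "germ_period k x"
    and v: "G n x t = t + of_int k" and sl: "lslope n x t = 1" "rslope n x t = 1"
  shows "germ_fixed n x t"
proof -
  obtain V where V: "openin X V" "x \<in> V" "\<And>y. y \<in> V \<Longrightarrow> it k y = y"
    using k unfolding germ_period_def by blast
  obtain U e where U: "openin X U" "x \<in> U" "e > 0"
    "\<And>y s. y \<in> U \<Longrightarrow> \<bar>s - t\<bar> < e \<Longrightarrow> G n y s = G n x t + (if s \<le> t then lslope n x t else rslope n x t) * (s - t)"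
    by (rule local_form[OF n x, of t]) (rule that)
  have 1: "openin X (U \<inter> V)" "x \<in> U \<inter> V" using U V by auto
  have 2: "it k y = y" if "y \<in> U \<inter> V" for y using V(3) that by blast
  have 3: "G n y s = s + of_int k" if y: "y \<in> U \<inter> V" and s: "\<bar>s - t\<bar> < e" for y s
  proof -
    have "y \<in> U" using y by blast
    from U(4)[OF this s] show ?thesis unfolding v sl by simp
  qed
  show ?thesis unfolding germ_fixed_def using 1 2 3 U(3) by blast
qed

lemma germ_fixed_fixes:
  assumes n: "n \<in> carrier \<Gamma>" and x: "x \<in> topspace X" and "germ_fixed n x t"
  shows "leaf_map n (leaf_point x t) = leaf_point x t"
proof -
  obtain k U e where k: "x \<in> U" "e > 0"
     "\<forall>y\<in>U. it k y = y \<and> (\<forall>s. \<bar>s - t\<bar> < e \<longrightarrow> G n y s = s + of_int k)"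
    using assms(3) unfolding germ_fixed_def by blast
  have "it k x = x" "G n x t = t + of_int k" using k(1,2) bspec[OF k(3,1)] by auto
  then show ?thesis using leaf_map_point[OF n x, of t] leaf_point_period[OF x, of k t] by simp
qed

lemma germ_fixed_open_base:
  assumes "finite T0"
  shows "openin X {x \<in> topspace X. \<forall>n\<in>T0. germ_fixed n x t}"
proof (subst openin_subopen, intro ballI)
  fix x assume "x \<in> {x \<in> topspace X. \<forall>n\<in>T0. germ_fixed n x t}"
  then have x: "x \<in> topspace X" "\<And>n. n \<in> T0 \<Longrightarrow> germ_fixed n x t" by auto
  have ex: "\<exists>U. openin X U \<and> x \<in> U \<and> (\<forall>y\<in>U. germ_fixed n y t)" if n: "n \<in> T0" for n
  proof -
    obtain k U e where k: "openin X U" "x \<in> U" "e > 0"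
       "\<forall>y\<in>U. it k y = y \<and> (\<forall>s. \<bar>s - t\<bar> < e \<longrightarrow> G n y s = s + of_int k)"
      using x(2)[OF n] unfolding germ_fixed_def by blast
    have "germ_fixed n y t" if "y \<in> U" for y
      unfolding germ_fixed_def using k(1,3,4) that by blast
    then show ?thesis using k(1,2) by blast
  qed
  define U where "U n = (SOME U. openin X U \<and> x \<in> U \<and> (\<forall>y\<in>U. germ_fixed n y t))" for n
  have U: "openin X (U n) \<and> x \<in> U n \<and> (\<forall>y\<in>U n. germ_fixed n y t)" if "n \<in> T0" for n
    unfolding U_def by (rule someI_ex[OF ex[OF that]])
  let ?W = "topspace X \<inter> (\<Inter>n\<in>T0. U n)"
  have "openin X ?W"
  proof (cases "T0 = {}")
    case False
    have "openin X (\<Inter>n\<in>T0. U n)" by (rule openin_INT2[OF assms False]) (use U in blast)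
    then show ?thesis by (intro openin_Int openin_topspace)
  qed simp
  moreover have "x \<in> ?W" using x(1) U by blast
  moreover have "?W \<subseteq> {x \<in> topspace X. \<forall>n\<in>T0. germ_fixed n x t}" using U by blast
  ultimately show "\<exists>T. openin X T \<and> x \<in> T \<and> T \<subseteq> {x \<in> topspace X. \<forall>n\<in>T0. germ_fixed n x t}" by blast
qed

lemma germ_fixed_open_leaf:
  assumes x: "x \<in> topspace X" and "finite T0"
  shows "open {t. \<forall>n\<in>T0. germ_fixed n x t}"
proof -
  have "open {t. germ_fixed n x t}" for n
    unfolding open_dist
  proof (intro ballI)
    fix t assume "t \<in> {t. germ_fixed n x t}"
    then obtain k U e where k: "openin X U" "x \<in> U" "e > 0"
       "\<forall>y\<in>U. it k y = y \<and> (\<forall>s. \<bar>s - t\<bar> < e \<longrightarrow> G n y s = s + of_int k)"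
      unfolding germ_fixed_def by blast
    have "germ_fixed n x t'" if t': "dist t' t < e" for t'
    proof -
      have "e - \<bar>t' - t\<bar> > 0" using t' by (simp add: dist_real_def)
      moreover have "it k y = y \<and> (\<forall>s. \<bar>s - t'\<bar> < e - \<bar>t' - t\<bar> \<longrightarrow> G n y s = s + of_int k)" if y: "y \<in> U" for y
      proof (intro conjI allI impI)
        show "it k y = y" using k(4) y by blast
        fix s assume "\<bar>s - t'\<bar> < e - \<bar>t' - t\<bar>"
        then have "\<bar>s - t\<bar> < e" by linarith
        then show "G n y s = s + of_int k" using k(4) y by blast
      qed
      ultimately show ?thesis unfolding germ_fixed_def using k(1,2) by blast
    qed
    then show "\<exists>e>0. \<forall>y. dist y t < e \<longrightarrow> y \<in> {t. germ_fixed n x t}" using k(3) by blast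
  qed
  then have "open (\<Inter>n\<in>T0. {t. germ_fixed n x t})" using assms(2) by (intro open_INT) auto
  moreover have "(\<Inter>n\<in>T0. {t. germ_fixed n x t}) = {t. \<forall>n\<in>T0. germ_fixed n x t}" by blast
  ultimately show ?thesis by simp
qed

text \<open>The set of parameters with trivial germs is open; it is shown to be closed, hence the
  whole leaf. At a limit point the generators fix the point, so a finite-index subgroup does, and
  its slopes there are 1 on both sides.\<close>

lemma germ_fixed_propagates:
  assumes T: "property_T \<Gamma>" and N: "finite_index \<Gamma> (generate \<Gamma> T0)" and T0: "finite T0" "T0 \<subseteq> carrier \<Gamma>"
    and x: "x \<in> topspace X" and start: "\<And>n. n \<in> T0 \<Longrightarrow> germ_fixed n x t0"
  shows "\<forall>n\<in>T0. germ_fixed n x t"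
proof -
  let ?A = "{t. \<forall>n\<in>T0. germ_fixed n x t}"
  have "closed ?A"
  proof (subst closure_subset_eq[symmetric], rule subsetI)
    fix t0 assume "t0 \<in> closure ?A"
    then have near: "\<forall>e>0. \<exists>t1\<in>?A. dist t1 t0 < e" unfolding closure_approachable .
    \<comment> \<open>A nearby \<open>t1\<close> with trivial germ lies on the same affine piece as
      the limit point. The piece has slope 1, so the translation valid at \<open>t1\<close> also
      gives the value at the limit point.\<close>
    have slide: "\<exists>k. germ_period k x \<and> G n x t0 = t0 + of_int k" if n: "n \<in> T0" for n
    proof -
      have nC: "n \<in> carrier \<Gamma>" using n T0 by blast
      obtain U e where U: "openin X U" "x \<in> U" "e > 0"
        "\<And>y s. y \<in> U \<Longrightarrow> \<bar>s - t0\<bar> < e \<Longrightarrow> G n y s = G n x t0 + (if s \<le> t0 then lslope n x t0 else rslope n x t0) * (s - t0)"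
        "\<And>y s. y \<in> U \<Longrightarrow> \<bar>s - t0\<bar> < e \<Longrightarrow> s < t0 \<Longrightarrow> rslope n y s = lslope n x t0"
        "\<And>y s. y \<in> U \<Longrightarrow> \<bar>s - t0\<bar> < e \<Longrightarrow> t0 < s \<Longrightarrow> rslope n y s = rslope n x t0"
        by (rule local_form[OF nC x, of t0]) (rule that)
      obtain t1 where t1: "t1 \<in> ?A" "dist t1 t0 < e" using near U(3) by blast
      have d: "\<bar>t1 - t0\<bar> < e" using t1(2) by (simp add: dist_real_def)
      have "germ_fixed n x t1" using t1(1) n by blast
      then obtain k V e' where k: "openin X V" "x \<in> V" "e' > 0"
         "\<forall>y\<in>V. it k y = y \<and> (\<forall>s. \<bar>s - t1\<bar> < e' \<longrightarrow> G n y s = s + of_int k)"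
        unfolding germ_fixed_def by blast
      have gp: "germ_period k x" unfolding germ_period_def using k(1,2,4) by blast
      have Gk: "G n x s = s + of_int k" if "\<bar>s - t1\<bar> < e'" for s using k(2,4) that by blast
      have G1: "G n x t1 = t1 + of_int k" using Gk[of t1] k(3) by simp
      have "has_slopes n x t1 1 1"
        unfolding has_slopes_def
      proof (intro conjI exI[of _ e'] allI impI k(3))
        fix s assume "\<bar>s - t1\<bar> < e'"
        from Gk[OF this] show "G n x s = G n x t1 + (if s \<le> t1 then 1 else 1) * (s - t1)" unfolding G1 by simp
      qed simp_all
      then have r1: "rslope n x t1 = 1" by (rule slopes_eqI(2))
      have "G n x t1 = G n x t0 + (t1 - t0)"
      proof (cases t1 t0 rule: linorder_cases)
        case less
        then show ?thesis using U(4)[OF U(2) d] U(5)[OF U(2) d less] r1 by simp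
      next
        case greater
        then show ?thesis using U(4)[OF U(2) d] U(6)[OF U(2) d greater] r1 by simp
      qed simp
      then show ?thesis using gp G1 by (intro exI[of _ k]) simp
    qed
    have fixT: "leaf_map n (leaf_point x t0) = leaf_point x t0" if n: "n \<in> T0" for n
    proof -
      have nC: "n \<in> carrier \<Gamma>" using n T0 by blast
      obtain k where k: "germ_period k x" "G n x t0 = t0 + of_int k" using slide[OF n] by blast
      then show ?thesis using leaf_map_point[OF nC x, of t0] leaf_point_period[OF x germ_periodD[OF k(1)], of t0] by simp
    qed
    have y01: "leaf_point x t0 \<in> {0..<1} \<times> topspace X" by (rule leaf_point_in[OF x])
    have fixN: "leaf_map n (leaf_point x t0) = leaf_point x t0" if nN: "n \<in> generate \<Gamma> T0" for n
      by (rule leaf_map_fixed_generate[OF T0(2) y01 fixT nN])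
    show "t0 \<in> ?A"
    proof (intro CollectI ballI)
      fix n assume n: "n \<in> T0"
      have nC: "n \<in> carrier \<Gamma>" using n T0 by blast
      obtain k where k: "germ_period k x" "G n x t0 = t0 + of_int k" using slide[OF n] by blast
      \<comment> \<open>The slope on the side away from the approximating points was not controlled
        so far; only the rigidity of slopes at fixed points supplies it.\<close>
      show "germ_fixed n x t0"
        by (rule germ_fixedI[OF nC x k slopes_eq_1_if_fixed[OF T N x fixN generate.incl[OF n]]])
    qed
  qed
  moreover have "open ?A" by (rule germ_fixed_open_leaf[OF x T0(1)])
  moreover have "t0 \<in> ?A" using start by blast
  ultimately have "?A = UNIV" using clopen[of ?A] by blast
  then show ?thesis by blast
qed

lemma germ_fixed_shift:
  assumes n: "n \<in> carrier \<Gamma>" and "germ_fixed n x t" and x: "x \<in> topspace X"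
  shows "germ_fixed n (it m x) (t - of_int m)"
proof -
  obtain k U e where k: "openin X U" "x \<in> U" "e > 0"
     "\<forall>y\<in>U. it k y = y \<and> (\<forall>s. \<bar>s - t\<bar> < e \<longrightarrow> G n y s = s + of_int k)"
    using assms(2) unfolding germ_fixed_def by blast
  let ?U = "{y \<in> topspace X. it (- m) y \<in> U}"
  have UX: "U \<subseteq> topspace X" using k(1) by (rule openin_subset)
  have "openin X ?U" by (rule openin_continuous_map_preimage[OF it_cont k(1)])
  moreover have "it m x \<in> ?U" using k(2) x by (simp add: it_neg it_closed)
  moreover have "it k y = y \<and> (\<forall>s. \<bar>s - (t - of_int m)\<bar> < e \<longrightarrow> G n y s = s + of_int k)" if y: "y \<in> ?U" for y
  proof -
    define z where "z = it (- m) y"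
    have z: "z \<in> U" "z \<in> topspace X" using y UX by (auto simp: z_def)
    have yz: "y = it m z" using y it_neg[of y "- m"] by (simp add: z_def)
    have "it k (it m z) = it m (it k z)" using z(2) by (simp only: it_add[symmetric] add.commute)
    then have "it k y = y" using k(4) z(1) yz by simp
    moreover have "G n y s = s + of_int k" if s: "\<bar>s - (t - of_int m)\<bar> < e" for s
    proof -
      have "G n (it m z) ((s + of_int m) - of_int m) = G n z (s + of_int m) - of_int m"
        by (rule G_shift[OF n z(2)])
      moreover have "G n z (s + of_int m) = s + of_int m + of_int k"
        using k(4) z(1) s by (simp add: algebra_simps)
      ultimately show ?thesis using yz by simp
    qed
    ultimately show ?thesis by blast
  qed
  ultimately show ?thesis unfolding germ_fixed_def using k(3) by blast
qed

lemma fixes_leaf_translation: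
  assumes g: "g \<in> carrier \<Gamma>" and x: "x \<in> topspace X"
    and fixed: "leaf_map g (leaf_point x t) = leaf_point x t"
  shows "\<exists>k. it k x = x \<and> G g x t = t + of_int k"
proof -
  define k where "k = \<lfloor>G g x t\<rfloor> - \<lfloor>t\<rfloor>"
  have eq: "leaf_point x (G g x t) = leaf_point x t" using leaf_map_point[OF g x, of t] fixed by simp
  then have fr: "frac (G g x t) = frac t" and b: "it \<lfloor>G g x t\<rfloor> x = it \<lfloor>t\<rfloor> x" by (auto simp: leaf_point_def)
  have "G g x t = t + of_int k" using fr unfolding frac_def k_def by simp
  moreover have "it k x = it (- \<lfloor>t\<rfloor>) (it \<lfloor>G g x t\<rfloor> x)"
    using it_add[OF x, of "- \<lfloor>t\<rfloor>" "\<lfloor>G g x t\<rfloor>"] by (simp add: k_def)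
  then have "it k x = x" unfolding b it_neg(1)[OF x] .
  ultimately show ?thesis by blast
qed

text \<open>Needed because the leaf found by measure theory may lie anywhere in the support: the
  argument must be repeatable on whatever part of \<open>X\<close> has not been reached.\<close>

lemma restrict_closed_invariant:
  assumes Z: "closedin X Z" and inv: "\<And>n x. x \<in> Z \<Longrightarrow> it n x \<in> Z"
  shows "PL_leaf_action (subtopology X Z) it \<Gamma> G"
proof -
  have ZX: "topspace (subtopology X Z) = Z" using closedin_subset[OF Z] by auto
  have sub: "x \<in> topspace X" if "x \<in> topspace (subtopology X Z)" for x using that by simp
  have "continuous_map (subtopology X Z) (subtopology X Z) (it n)" for n
    using inv continuous_map_from_subtopology[OF it_cont, of Z n] ZX
    by (auto simp: continuous_map_in_subtopology image_subset_iff)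
  moreover have "compact_space (subtopology X Z)"
    using closedin_compact_space[OF compact Z] compact_space_subtopology by blast
  ultimately have 1: "int_flow (subtopology X Z) it"
    by (intro int_flow.intro) (auto intro!: it_0 it_add)
  show ?thesis
  proof (intro PL_leaf_action.intro 1 \<Gamma>.group_axioms PL_leaf_action_axioms.intro)
    fix g x t assume g: "g \<in> carrier \<Gamma>" and x: "x \<in> topspace (subtopology X Z)"
    obtain U e a b where "openin X U" "x \<in> U" "e > 0" "a > 0" "b > 0"
        "\<forall>y\<in>U. \<forall>s. \<bar>s - t\<bar> < e \<longrightarrow> G g y s = G g x t + (if s \<le> t then a else b) * (s - t)"
      using G_local[OF g sub[OF x], of t] by (elim exE conjE) (rule that)
    note U = this
    have 1: "openin (subtopology X Z) (Z \<inter> U)" by (rule openin_subtopology_Int2[OF U(1)])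
    have 2: "x \<in> Z \<inter> U" using x U(2) by simp
    have 3: "\<forall>y\<in>Z \<inter> U. \<forall>s. \<bar>s - t\<bar> < e \<longrightarrow> G g y s = G g x t + (if s \<le> t then a else b) * (s - t)"
      using U(6) by (rule bspec[THEN ballI]) (rule IntD2)
    show "\<exists>U e a b. openin (subtopology X Z) U \<and> x \<in> U \<and> e > 0 \<and> a > 0 \<and> b > 0 \<and>
        (\<forall>y\<in>U. \<forall>s. \<bar>s - t\<bar> < e \<longrightarrow> G g y s = G g x t + (if s \<le> t then a else b) * (s - t))"
      by (rule exI[of _ "Z \<inter> U"], rule exI[of _ e], rule exI[of _ a], rule exI[of _ b])
        (intro conjI 1 2 3 U(3-5))
  next
    fix g h x assume gh: "g \<in> carrier \<Gamma>" "h \<in> carrier \<Gamma>" and x: "x \<in> topspace (subtopology X Z)"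
    obtain k U where "openin X U" "x \<in> U"
        "\<forall>y\<in>U. it k y = y \<and> (\<forall>t. G (g \<otimes>\<^bsub>\<Gamma>\<^esub> h) y t = G g y (G h y t) + of_int k)"
      using G_mult[OF gh sub[OF x]] by (elim exE conjE) (rule that)
    note U = this
    have 1: "openin (subtopology X Z) (Z \<inter> U)" by (rule openin_subtopology_Int2[OF U(1)])
    have 2: "x \<in> Z \<inter> U" using x U(2) by simp
    have 3: "\<forall>y\<in>Z \<inter> U. it k y = y \<and> (\<forall>t. G (g \<otimes>\<^bsub>\<Gamma>\<^esub> h) y t = G g y (G h y t) + of_int k)"
      using U(3) by (rule bspec[THEN ballI]) (rule IntD2)
    show "\<exists>k U. openin (subtopology X Z) U \<and> x \<in> U \<and>
        (\<forall>y\<in>U. it k y = y \<and> (\<forall>t. G (g \<otimes>\<^bsub>\<Gamma>\<^esub> h) y t = G g y (G h y t) + of_int k))"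
      by (rule exI[of _ k], rule exI[of _ "Z \<inter> U"]) (intro conjI 1 2 3)
  next
    fix g assume "g \<in> carrier \<Gamma>"
    from G_bounded[OF this]
    show "\<exists>K. \<forall>x\<in>topspace (subtopology X Z). \<forall>t. \<bar>G g x t - t\<bar> \<le> K" using sub by blast
  qed (use G_shift sub in blast)
qed

theorem finite_if_property_T:
  assumes T: "property_T \<Gamma>"
    and faithful: "\<And>g. g \<in> carrier \<Gamma> \<Longrightarrow>
      (\<And>x t. x \<in> topspace X \<Longrightarrow> \<exists>k. it k x = x \<and> G g x t = t + of_int k) \<Longrightarrow> g = \<one>\<^bsub>\<Gamma>\<^esub>"
  shows "finite (carrier \<Gamma>)"
proof -
  \<comment> \<open>Finite generating sets stand for the subgroups, so that triviality of germs is a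
    finite conjunction of open conditions.\<close>
  define I where "I = {T0. finite T0 \<and> T0 \<subseteq> carrier \<Gamma> \<and> finite_index \<Gamma> (generate \<Gamma> T0)}"
  \<comment> \<open>Looking at parameter 0 is enough: propagation extends the condition to the whole
    leaf, which in turn makes the set invariant.\<close>
  define V where "V T0 = {x \<in> topspace X. \<forall>n\<in>T0. germ_fixed n x 0}" for T0
  have I: "finite T0" "T0 \<subseteq> carrier \<Gamma>" "finite_index \<Gamma> (generate \<Gamma> T0)" if "T0 \<in> I" for T0
    using that by (auto simp: I_def)
  have Vopen: "openin X (V T0)" if "T0 \<in> I" for T0
    unfolding V_def by (rule germ_fixed_open_base[OF I(1)[OF that]])
  have Vall: "germ_fixed n x t" if T0: "T0 \<in> I" and x: "x \<in> V T0" and n: "n \<in> T0" for T0 x n t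
  proof -
    have "x \<in> topspace X" "\<And>n. n \<in> T0 \<Longrightarrow> germ_fixed n x 0" using x by (auto simp: V_def)
    from germ_fixed_propagates[OF T I(3)[OF T0] I(1)[OF T0] I(2)[OF T0] this] n
    show ?thesis by blast
  qed
  have Vinv: "it m x \<in> V T0" if T0: "T0 \<in> I" and x: "x \<in> V T0" for T0 x m
  proof -
    have xX: "x \<in> topspace X" using x by (simp add: V_def)
    have "germ_fixed n (it m x) 0" if n: "n \<in> T0" for n
    proof -
      have nC: "n \<in> carrier \<Gamma>" using n I(2)[OF T0] by blast
      have "germ_fixed n x (of_int m)" by (rule Vall[OF T0 x n])
      from germ_fixed_shift[OF nC this xX, of m] show ?thesis by simp
    qed
    then show ?thesis using it_closed[OF xX] by (simp add: V_def)
  qed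
  show ?thesis
  proof (cases "topspace X \<subseteq> \<Union> (V ` I)")
    case True
    have "\<exists>F. finite F \<and> F \<subseteq> V ` I \<and> topspace X \<subseteq> \<Union> F"
      using compact True Vopen unfolding compact_space_alt by (metis (no_types, lifting) imageE)
    then obtain F' where F': "finite F'" "F' \<subseteq> V ` I" "topspace X \<subseteq> \<Union> F'" by blast
    from finite_subset_image[OF F'(1,2)] obtain F where F: "F \<subseteq> I" "finite F" "F' = V ` F" by blast
    show ?thesis
    proof (rule \<Gamma>.finite_if_finite_index_Int_trivial[of F "\<lambda>T0. generate \<Gamma> T0"])
      show "finite F" by (rule F(2))
      show "finite_index \<Gamma> (generate \<Gamma> T0)" if "T0 \<in> F" for T0 using I(3) that F(1) by blast
      fix g assume g: "g \<in> carrier \<Gamma>" and gF: "\<And>T0. T0 \<in> F \<Longrightarrow> g \<in> generate \<Gamma> T0"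
      show "g = \<one>\<^bsub>\<Gamma>\<^esub>"
      proof (rule faithful[OF g])
        fix x t assume x: "x \<in> topspace X"
        then obtain T0 where T0: "T0 \<in> F" "x \<in> V T0" using F'(3) F(3) by blast
        have T0I: "T0 \<in> I" using T0(1) F(1) by blast
        have "leaf_map g (leaf_point x t) = leaf_point x t"
        proof (rule leaf_map_fixed_generate[OF I(2)[OF T0I] leaf_point_in[OF x] _ gF[OF T0(1)]])
          fix h assume h: "h \<in> T0"
          then have "h \<in> carrier \<Gamma>" using I(2)[OF T0I] by blast
          then show "leaf_map h (leaf_point x t) = leaf_point x t"
            by (rule germ_fixed_fixes[OF _ x Vall[OF T0I T0(2) h]])
        qed
        then show "\<exists>k. it k x = x \<and> G g x t = t + of_int k" by (rule fixes_leaf_translation[OF g x])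
      qed
    qed
  next
    case False
    define Z where "Z = topspace X - \<Union> (V ` I)"
    have Zcl: "closedin X Z" unfolding Z_def using Vopen by (intro closedin_diff closedin_topspace openin_Union) blast
    have Zinv: "it n x \<in> Z" if x: "x \<in> Z" for n x
    proof -
      have xX: "x \<in> topspace X" using x by (simp add: Z_def)
      have "it n x \<notin> V T0" if T0: "T0 \<in> I" for T0
      proof
        assume "it n x \<in> V T0"
        from Vinv[OF T0 this, of "- n"] have "x \<in> V T0" using xX by (simp add: it_neg)
        then show False using x T0 by (auto simp: Z_def)
      qed
      then show ?thesis using it_closed[OF xX] by (auto simp: Z_def)
    qed
    \<comment> \<open>Slopes and jumps depend on \<open>G\<close> alone, so the solution found on
      \<open>Z\<close> can be read in \<open>X\<close>; germs of periods below are taken in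
      \<open>X\<close>, as the contradiction requires a neighbourhood in \<open>X\<close>.\<close>
    interpret Z: PL_leaf_action "subtopology X Z" it \<Gamma> G by (rule restrict_closed_invariant[OF Zcl Zinv])
    have ZX: "topspace (subtopology X Z) = Z" using closedin_subset[OF Zcl] by auto
    have "topspace (subtopology X Z) \<noteq> {}" unfolding ZX using False by (auto simp: Z_def)
    from Z.leafwise_coboundary[OF T this] obtain x \<eta> where xZ: "x \<in> Z"
      and \<eta>: "\<forall>a b. finite {t \<in> {a..b}. \<eta> t \<noteq> 0}"
        "\<forall>g\<in>carrier \<Gamma>. \<forall>t. jump g x t = \<eta> (G g x t) - \<eta> t"
        "\<forall>k t. it k x = x \<longrightarrow> \<eta> (t + of_int k) = \<eta> t"
      unfolding ZX by (elim bexE exE conjE) (rule that)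
    have x: "x \<in> topspace X" using xZ by (simp add: Z_def)
    let ?N = "{g \<in> carrier \<Gamma>. \<exists>k. germ_period k x \<and> (\<forall>t. G g x t = t + of_int k)}"
    have N: "finite_index \<Gamma> ?N"
    proof (rule leaf_translations_finite_index[OF T x])
      show "finite {t \<in> {a..b}. \<eta> t \<noteq> 0}" for a b using \<eta>(1) by blast
      show "jump g x t = \<eta> (G g x t) - \<eta> t" if "g \<in> carrier \<Gamma>" for g t using \<eta>(2) that by blast
      show "\<eta> (t + of_int k) = \<eta> t" if "it k x = x" for k t using \<eta>(3) that by blast
    qed
    obtain E where E: "finite E" "E \<subseteq> carrier \<Gamma>" "generate \<Gamma> E = carrier \<Gamma>"
      using property_T_finitely_generated[OF T] by blast
    obtain T0 where T0: "finite T0" "T0 \<subseteq> ?N" "generate \<Gamma> T0 = ?N"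
      using \<Gamma>.finite_index_finitely_generated[OF E N] by blast
    have "T0 \<in> I" unfolding I_def using T0 N by auto
    moreover have "germ_fixed n x 0" if nT: "n \<in> T0" for n
    proof -
      have n: "n \<in> carrier \<Gamma>" using nT T0(2) by blast
      obtain k where k: "germ_period k x" "\<forall>t. G n x t = t + of_int k" using nT T0(2) by blast
      have "has_slopes n x 0 1 1"
        unfolding has_slopes_def k(2)[rule_format] by (intro conjI exI[of _ 1]) simp_all
      from germ_fixedI[OF n x k(1) k(2)[rule_format] slopes_eqI[OF this]] show ?thesis .
    qed
    then have "x \<in> V T0" using x by (simp add: V_def)
    ultimately show ?thesis using xZ by (auto simp: Z_def)
  qed
qed

end

section \<open>Suspension flows and isotopies\<close>

locale stone =
  fixes X :: "'a topology" and \<phi> :: "'a \<Rightarrow> 'a"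
  assumes stone: "stone_system X \<phi>"
begin

abbreviation "it \<equiv> int_iterate X \<phi>"
abbreviation "Y \<equiv> suspension X \<phi>"
abbreviation "cl \<equiv> susp_class X \<phi>"
abbreviation "P \<equiv> prod_topology X euclideanreal"

lemma compact_X: "compact_space X" and homeomorphic_phi: "homeomorphic_map X X \<phi>"
  and connectedin_singleton: "connectedin X S \<Longrightarrow> \<exists>a. S \<subseteq> {a}"
  using stone unfolding stone_system_def by blast+

lemma phi_inverse:
  "continuous_map X X \<phi>" "continuous_map X X (inv_into (topspace X) \<phi>)"
  "x \<in> topspace X \<Longrightarrow> inv_into (topspace X) \<phi> (\<phi> x) = x"
  "x \<in> topspace X \<Longrightarrow> \<phi> (inv_into (topspace X) \<phi> x) = x"
proof -
  let ?\<psi> = "inv_into (topspace X) \<phi>"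
  obtain \<psi> where \<psi>: "homeomorphic_maps X X \<phi> \<psi>" using homeomorphic_phi homeomorphic_map_maps by blast
  then have c: "continuous_map X X \<phi>" "continuous_map X X \<psi>"
    and i: "\<And>x. x \<in> topspace X \<Longrightarrow> \<psi> (\<phi> x) = x" "\<And>x. x \<in> topspace X \<Longrightarrow> \<phi> (\<psi> x) = x"
    unfolding homeomorphic_maps_def by auto
  have cl: "\<psi> x \<in> topspace X" "\<phi> x \<in> topspace X" if "x \<in> topspace X" for x
    using c that by (auto simp: continuous_map_def)
  have inj: "inj_on \<phi> (topspace X)" using i(1) by (rule inj_on_inverseI)
  have eq: "?\<psi> x = \<psi> x" if "x \<in> topspace X" for x
    using inv_into_f_eq[OF inj cl(1)[OF that] i(2)[OF that]] .
  show "continuous_map X X \<phi>" by (rule c(1))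
  show "continuous_map X X ?\<psi>" by (rule continuous_map_eq[OF c(2)]) (simp add: eq)
  show "?\<psi> (\<phi> x) = x" if "x \<in> topspace X" using eq[OF cl(2)[OF that]] i(1)[OF that] by simp
  show "\<phi> (?\<psi> x) = x" if "x \<in> topspace X" using eq[OF that] i(2)[OF that] by simp
qed

lemma continuous_map_funpow: "continuous_map X X f \<Longrightarrow> continuous_map X X (f ^^ n)"
  by (induction n) (simp_all add: continuous_map_compose)

lemma continuous_map_it: "continuous_map X X (it n)"
  unfolding int_iterate_def using phi_inverse(1,2) by (simp add: continuous_map_funpow)

lemma it_closed: "x \<in> topspace X \<Longrightarrow> it n x \<in> topspace X"
  using continuous_map_it[of n] by (auto simp: continuous_map_def)

lemma it_succ: "x \<in> topspace X \<Longrightarrow> it (n + 1) x = \<phi> (it n x)"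
proof (cases "n \<ge> 0")
  case True
  then show ?thesis by (simp add: int_iterate_def nat_add_distrib)
next
  case False
  assume x: "x \<in> topspace X"
  define k where "k = nat (- (n + 1))"
  have n: "nat (- n) = Suc k" and n1: "n + 1 = - int k" using False by (auto simp: k_def)
  let ?\<psi> = "inv_into (topspace X) \<phi>"
  have "(?\<psi> ^^ k) x \<in> topspace X"
    using continuous_map_funpow[OF phi_inverse(2), of k] x by (auto simp: continuous_map_def)
  then have "\<phi> (it n x) = (?\<psi> ^^ k) x" using False n by (simp add: int_iterate_def phi_inverse)
  moreover have "it (n + 1) x = (?\<psi> ^^ k) x" unfolding n1 by (cases "k = 0") (auto simp: int_iterate_def)
  ultimately show ?thesis by simp
qed

lemma it_pred: "x \<in> topspace X \<Longrightarrow> it (n - 1) x = inv_into (topspace X) \<phi> (it n x)"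
  using it_succ[of x "n - 1"] it_closed[of x "n - 1"] by (simp add: phi_inverse)

lemma it_add: "x \<in> topspace X \<Longrightarrow> it (m + n) x = it m (it n x)"
proof (induction m rule: int_induct[where k = 0])
  case base
  then show ?case by (simp add: int_iterate_def)
next
  case (step1 i)
  have eq: "i + 1 + n = (i + n) + 1" by simp
  have "it (i + 1 + n) x = \<phi> (it (i + n) x)" unfolding eq by (rule it_succ[OF step1(3)])
  then show ?case using step1 it_succ[of "it n x" i] it_closed[of x n] by simp
next
  case (step2 i)
  have eq: "i - 1 + n = (i + n) - 1" by simp
  have "it (i - 1 + n) x = inv_into (topspace X) \<phi> (it (i + n) x)" unfolding eq by (rule it_pred[OF step2(3)])
  then show ?case using step2 it_pred[of "it n x" i] it_closed[of x n] by simp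
qed

sublocale int_flow X it
proof
  show "it 0 x = x" for x by (simp add: int_iterate_def)
qed (auto intro: compact_X continuous_map_it it_add)

lemma topspace_Y: "topspace Y = cl ` (topspace X \<times> UNIV)" by (rule topspace_suspension)

lemma cl_in: "x \<in> topspace X \<Longrightarrow> cl (x, t) \<in> topspace Y" unfolding topspace_Y by blast

lemma Y_cases:
  assumes "y \<in> topspace Y" obtains x t where "x \<in> topspace X" "y = cl (x, t)"
  using assms unfolding topspace_Y by blast

lemma cl_shift: assumes x: "x \<in> topspace X" shows "cl (it n x, t - of_int n) = cl (x, t)"
proof -
  have "it m (it n x) = it (m + n) x" for m by (rule it_add[OF x, symmetric])
  then have "cl (it n x, t - of_int n) = range (\<lambda>m. (it (m + n) x, t - of_int (m + n)))"
    by (simp add: susp_class_def algebra_simps)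
  also have "\<dots> = (\<lambda>m. (it m x, t - of_int m)) ` range (\<lambda>m. m + n)" by (simp only: image_image)
  also have "range (\<lambda>m. m + n) = UNIV" by (rule surjI[of _ "\<lambda>m. m - n"]) simp
  finally show ?thesis by (simp add: susp_class_def)
qed

lemma cl_eqD:
  assumes "cl (x, t) = cl (x', t')" "x' \<in> topspace X"
  obtains n where "x' = it n x" "t' = t - of_int n"
proof -
  have "(x', t') \<in> cl (x', t')"
    unfolding susp_class_def prod.case using assms(2) by (intro range_eqI[of _ _ 0]) (simp add: it_0)
  then have "(x', t') \<in> cl (x, t)" using assms(1) by simp
  then show ?thesis using that unfolding susp_class_def by auto
qed

lemma cl_period: "x \<in> topspace X \<Longrightarrow> it k x = x \<Longrightarrow> cl (x, t + of_int k) = cl (x, t)"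
  using cl_shift[of x k "t + of_int k"] by simp

lemma cl_inj_on_short:
  assumes "x \<in> topspace X" "x' \<in> topspace X" "cl (x, t) = cl (x', t')" "\<bar>t - t'\<bar> < 1"
  shows "x = x' \<and> t = t'"
proof -
  obtain n where n: "x' = it n x" "t' = t - of_int n" using cl_eqD[OF assms(3,2)] .
  then have "n = 0" using assms(4) by simp
  then show ?thesis using n assms(1) by (simp add: it_0)
qed

lemma continuous_map_cl: "continuous_map P Y cl"
  by (rule quotient_imp_continuous_map[OF quotient_map_suspension])

lemma continuous_map_shift: "continuous_map P P (\<lambda>p. (it n (fst p), snd p - of_int n))"
  unfolding continuous_map_pairwise o_def fst_conv snd_conv
proof
  show "continuous_map P X (\<lambda>p. it n (fst p))"
    using continuous_map_compose[OF continuous_map_fst continuous_map_it] by (simp add: o_def)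
  show "continuous_map P euclideanreal (\<lambda>p. snd p - of_int n)"
    by (intro continuous_intros continuous_map_snd) simp
qed

lemma open_map_cl: "open_map P Y cl"
  unfolding open_map_def openin_suspension
proof (intro allI impI conjI)
  fix U assume U: "openin P U"
  then have UP: "U \<subseteq> topspace X \<times> UNIV" using openin_subset by fastforce
  then show "cl ` U \<subseteq> cl ` (topspace X \<times> UNIV)" by blast
  \<comment> \<open>The saturation of an open set is the union of its translates under the integer
    action.\<close>
  have "{p \<in> topspace X \<times> UNIV. cl p \<in> cl ` U} =
      (\<Union>n. {p \<in> topspace P. (it n (fst p), snd p - of_int n) \<in> U})" (is "?L = ?R")
  proof (rule Set.set_eqI, rule iffI)
    fix p assume "p \<in> ?L"
    then obtain q where q: "fst p \<in> topspace X" "q \<in> U" "cl (fst p, snd p) = cl (fst q, snd q)" by auto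
    have qX: "fst q \<in> topspace X" using UP q(2) by auto
    obtain n where "fst q = it n (fst p)" "snd q = snd p - of_int n" by (rule cl_eqD[OF q(3) qX])
    then have "q = (it n (fst p), snd p - of_int n)" by (simp add: prod_eq_iff)
    then have "(it n (fst p), snd p - of_int n) \<in> U" using q(2) by simp
    then show "p \<in> ?R" using q(1) by (auto simp: mem_Times_iff)
  next
    fix p assume "p \<in> ?R"
    then obtain n where n: "fst p \<in> topspace X" "(it n (fst p), snd p - of_int n) \<in> U" by auto
    then have "cl p = cl (it n (fst p), snd p - of_int n)" using cl_shift[of "fst p" n "snd p"] by simp
    then show "p \<in> ?L" using n by (auto simp: mem_Times_iff)
  qed
  moreover have "openin P ?R"
    by (intro openin_Union) (use openin_continuous_map_preimage[OF continuous_map_shift U] in blast)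
  ultimately show "openin P ?L" by simp
qed

lemma compactin_Y: "compactin Y (topspace Y)"
proof -
  have "topspace Y = cl ` (topspace X \<times> {0..1})"
  proof (intro subset_antisym subsetI)
    fix y assume "y \<in> topspace Y"
    then obtain x t where x: "x \<in> topspace X" and y: "y = cl (x, t)" by (rule Y_cases)
    have "y = cl (it \<lfloor>t\<rfloor> x, frac t)" unfolding y frac_def by (rule cl_shift[OF x, symmetric])
    moreover have "(it \<lfloor>t\<rfloor> x, frac t) \<in> topspace X \<times> {0..1}"
      using it_closed[OF x] frac_lt_1[of t] by (simp add: less_imp_le)
    ultimately show "y \<in> cl ` (topspace X \<times> {0..1})" by blast
  qed (auto simp: topspace_Y)
  moreover have "compactin P (topspace X \<times> {0..1})" using compact_X by (simp add: compactin_Times compact_space_def)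
  ultimately show ?thesis using image_compactin continuous_map_cl by metis
qed

text \<open>The projection of the suspension to the circle. Representatives of a class have second
  components differing by integers, so the choice is immaterial.\<close>

definition base :: "('a \<times> real) set \<Rightarrow> complex" where
  "base y = cis (2 * pi * snd (SOME p. p \<in> y))"

lemma cis_diff_int: "cis (2 * pi * (t - of_int n)) = cis (2 * pi * t)"
proof -
  have "cis (2 * pi * (t - of_int n)) = cis (2 * pi * t) * cis (2 * pi * of_int (- n))"
    by (simp only: cis_mult) (simp add: algebra_simps)
  also have "cis (2 * pi * of_int (- n)) = 1" by (rule cis_multiple_2pi) simp
  finally show ?thesis by simp
qed

lemma base_cl: assumes "x \<in> topspace X" shows "base (cl (x, t)) = cis (2 * pi * t)"
proof -
  have "cl (x, t) \<noteq> {}" by (simp add: susp_class_def)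
  then have "(SOME p. p \<in> cl (x, t)) \<in> cl (x, t)" by (simp add: some_in_eq)
  then obtain n where "(SOME p. p \<in> cl (x, t)) = (it n x, t - of_int n)" unfolding susp_class_def by auto
  then show ?thesis unfolding base_def using cis_diff_int[of t n] by simp
qed

lemma continuous_map_base: "continuous_map Y euclidean base"
proof (rule continuous_compose_quotient_map[OF quotient_map_suspension])
  have "continuous_map euclideanreal euclidean (\<lambda>t. cis (2 * pi * t))"
    unfolding continuous_map_iff_continuous2 by (intro continuous_intros)
  from continuous_map_compose[OF continuous_map_snd this, of X]
  show "continuous_map P euclidean (base \<circ> cl)"
    by (rule continuous_map_eq) (auto simp: base_cl)
qed

text \<open>An interval of diameter below 1 meets no nontrivial integer translate of itself, so the
  open quotient map is injective over it.\<close>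

lemma homeomorphic_map_cl_short:
  assumes J: "open J" "\<And>s t. s \<in> J \<Longrightarrow> t \<in> J \<Longrightarrow> \<bar>s - t\<bar> < 1"
  shows "homeomorphic_map (subtopology P (topspace X \<times> J)) (subtopology Y (cl ` (topspace X \<times> J))) cl"
proof (rule bijective_open_imp_homeomorphic_map)
  let ?E = "topspace X \<times> J"
  have top: "topspace (subtopology P ?E) = ?E" by auto
  have E: "openin P ?E" using J(1) by (simp add: openin_prod_Times_iff)
  have clE: "openin Y (cl ` ?E)" using open_map_cl E unfolding open_map_def by blast
  have topY: "topspace (subtopology Y (cl ` ?E)) = cl ` ?E" using openin_subset[OF clE] by auto
  show "continuous_map (subtopology P ?E) (subtopology Y (cl ` ?E)) cl"
    using continuous_map_cl by (auto simp: continuous_map_in_subtopology intro: continuous_map_from_subtopology)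
  show "cl ` topspace (subtopology P ?E) = topspace (subtopology Y (cl ` ?E))" unfolding top topY ..
  show "inj_on cl (topspace (subtopology P ?E))"
    unfolding top
  proof (rule inj_onI)
    fix p q assume pq: "p \<in> ?E" "q \<in> ?E" "cl p = cl q"
    then have "fst p = fst q \<and> snd p = snd q"
      using J(2)[of "snd p" "snd q"] by (intro cl_inj_on_short) (auto simp: mem_Times_iff)
    then show "p = q" by (simp add: prod_eq_iff)
  qed
  show "open_map (subtopology P ?E) (subtopology Y (cl ` ?E)) cl"
    unfolding open_map_def
  proof (intro allI impI)
    fix U assume "openin (subtopology P ?E) U"
    then have U: "openin P U" "U \<subseteq> ?E" using openin_open_subtopology[OF E] by auto
    then have "openin Y (cl ` U)" using open_map_cl unfolding open_map_def by blast
    then show "openin (subtopology Y (cl ` ?E)) (cl ` U)" using openin_open_subtopology[OF clE] U(2) by auto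
  qed
qed

text \<open>A path in the suspension stays in the leaf of its starting point, since a chart identifies
  short pieces of it with paths in \<open>X \<times> J\<close>, and \<open>X\<close> is totally disconnected.\<close>

lemma path_slides_along_leaf:
  fixes I :: "real set"
  assumes c: "continuous_map (top_of_set I) Y c" and I: "connected I" "s \<in> I" "s' \<in> I"
    and near: "\<And>r. r \<in> I \<Longrightarrow> dist (base (c r)) (base (c s)) < 1"
    and x: "x \<in> topspace X" and cs: "c s = cl (x, t)"
  shows "\<exists>b. \<bar>b\<bar> < 1 / 2 \<and> c s' = cl (x, t + b)"
proof -
  \<comment> \<open>An open interval of length 1 around \<open>t\<close>: it reaches every point of
    the suspension except those whose base is antipodal to that of the starting point.\<close>
  define J where "J = {t - 1/2 <..< t + 1/2}"
  let ?E = "topspace X \<times> J"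
  have hom: "homeomorphic_map (subtopology P ?E) (subtopology Y (cl ` ?E)) cl"
    by (rule homeomorphic_map_cl_short) (auto simp: J_def)
  have sub: "c ` I \<subseteq> cl ` ?E"
  proof (rule image_subsetI)
    fix r assume r: "r \<in> I"
    have "c r \<in> topspace Y" using c r by (auto simp: continuous_map_def)
    then obtain x' t' where x': "x' \<in> topspace X" "c r = cl (x', t')" by (rule Y_cases)
    define n where "n = \<lfloor>t' - t + 1/2\<rfloor>"
    define u where "u = t' - of_int n"
    have u: "t - 1/2 \<le> u" "u < t + 1/2" unfolding u_def n_def by linarith+
    have cu: "c r = cl (it n x', u)" unfolding x'(2) u_def by (rule cl_shift[OF x'(1), symmetric])
    \<comment> \<open>The missing end point is antipodal, at distance 2 in the circle, which
      \<open>near\<close> excludes.\<close>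
    have "u \<noteq> t - 1/2"
    proof
      assume u: "u = t - 1/2"
      have "base (c r) = cis (2 * pi * t - pi)" unfolding cu base_cl[OF it_closed[OF x'(1)]] u
        by (simp add: algebra_simps)
      also have "\<dots> = - cis (2 * pi * t)" by (simp add: cis_divide[symmetric])
      finally have "dist (base (c r)) (base (c s)) = norm (- 2 * cis (2 * pi * t))"
        unfolding cs base_cl[OF x] dist_norm by simp
      also have "\<dots> = 2" by (simp add: norm_mult)
      finally show False using near[OF r] by simp
    qed
    then have "(it n x', u) \<in> ?E" using u it_closed[OF x'(1)] by (simp add: J_def)
    then show "c r \<in> cl ` ?E" unfolding cu by blast
  qed
  define S where "S = {p \<in> ?E. cl p \<in> c ` I}"
  have clS: "cl ` S = c ` I"
  proof (rule equalityI; rule subsetI)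
    fix y assume y: "y \<in> c ` I"
    then have "y \<in> cl ` ?E" by (rule subsetD[OF sub])
    then obtain p where "y = cl p" "p \<in> ?E" by (rule imageE)
    with y show "y \<in> cl ` S" unfolding S_def by (intro rev_image_eqI[of p]) simp_all
  qed (auto simp: S_def)
  have "connectedin (top_of_set I) I" using I(1) by (simp add: connectedin_subtopology)
  then have "connectedin Y (c ` I)" by (rule connectedin_continuous_map_image[OF c])
  then have "connectedin (subtopology Y (cl ` ?E)) (cl ` S)" using sub by (simp add: clS connectedin_subtopology)
  moreover have "S \<subseteq> topspace (subtopology P ?E)" by (auto simp: S_def)
  ultimately have "connectedin (subtopology P ?E) S" using homeomorphic_map_connectedness[OF hom] by blast
  then have "connectedin P S" by (simp add: connectedin_subtopology)
  then have "connectedin X (fst ` S)" by (rule connectedin_continuous_map_image[OF continuous_map_fst])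
  then obtain a where a: "fst ` S \<subseteq> {a}" using connectedin_singleton by blast
  have "cl (x, t) \<in> c ` I" unfolding cs[symmetric] using I(2) by (rule imageI)
  then have "(x, t) \<in> S" using x by (simp add: S_def J_def)
  then have "x \<in> fst ` S" by (rule rev_image_eqI) simp
  then have ax: "a = x" using a by blast
  have "c s' \<in> cl ` S" unfolding clS using I(3) by (rule imageI)
  then obtain p where p: "c s' = cl p" "p \<in> S" by (rule imageE)
  have "fst p \<in> {a}" by (rule subsetD[OF a imageI[OF p(2)]])
  then have "p = (x, t + (snd p - t))" unfolding ax by (simp add: prod_eq_iff)
  then have "c s' = cl (x, t + (snd p - t))" using p(1) by simp
  moreover have "snd p \<in> J" using p(2) by (auto simp: S_def)
  then have "t - 1/2 < snd p" "snd p < t + 1/2" unfolding J_def by auto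
  then have "\<bar>snd p - t\<bar> < 1 / 2" by linarith
  ultimately show ?thesis by blast
qed

text \<open>The maps at two times are related by a continuous flow time. This is an equivalence
  relation, and it holds for close times because a short displacement along a leaf is recovered
  continuously from the angle in the circle. Connectedness of the time interval links 0 with
  1.\<close>

lemma isotopic_to_id_along_flow:
  assumes "homotopic_with Q Y Y id g"
  shows "\<exists>\<delta>. continuous_map Y euclideanreal \<delta> \<and>
    (\<forall>x\<in>topspace X. \<forall>t. g (cl (x, t)) = cl (x, t + \<delta> (cl (x, t))))"
proof -
  let ?I = "{0..1::real}"
  obtain h where h: "continuous_map (prod_topology (top_of_set ?I) Y) Y h"
    and h01: "\<And>y. h (0, y) = y" "\<And>y. h (1, y) = g y"
    using assms unfolding homotopic_with_def by (auto simp: id_def)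
  have hY: "h (s, y) \<in> topspace Y" if "s \<in> ?I" "y \<in> topspace Y" for s y
    using h that by (auto simp: continuous_map_def)
  have h_slice: "continuous_map Y Y (\<lambda>y. h (s, y))" if "s \<in> ?I" for s
    using continuous_map_compose[OF _ h, of Y "\<lambda>y. (s, y)"] that by (simp add: o_def continuous_map_pairwise)
  have h_path: "continuous_map (top_of_set ?I) Y (\<lambda>s. h (s, y))" if "y \<in> topspace Y" for y
    using continuous_map_compose[OF _ h, of "top_of_set ?I" "\<lambda>s. (s, y)"] that
    by (simp add: o_def continuous_map_pairwise)
  \<comment> \<open>Quantifying over all representatives avoids choosing them; the displacement
    depends on the point \<open>y\<close> alone.\<close>
  define R where "R s s' \<longleftrightarrow> (\<exists>\<delta>. continuous_map Y euclideanreal \<delta> \<and> (\<forall>y\<in>topspace Y. \<forall>x\<in>topspace X. \<forall>t.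
      h (s, y) = cl (x, t) \<longrightarrow> h (s', y) = cl (x, t + \<delta> y)))" for s s'
  have "R 0 1"
  proof (rule connected_equivalence_relation[of ?I 0 1 R])
    show "R s' s" if R: "R s s'" and s: "s \<in> ?I" "s' \<in> ?I" for s s'
    proof -
      obtain \<delta> where \<delta>: "continuous_map Y euclideanreal \<delta>"
        "\<And>y x t. y \<in> topspace Y \<Longrightarrow> x \<in> topspace X \<Longrightarrow> h (s, y) = cl (x, t) \<Longrightarrow> h (s', y) = cl (x, t + \<delta> y)"
        using R unfolding R_def by blast
      have "h (s, y) = cl (x, t + - \<delta> y)" if y: "y \<in> topspace Y" and x: "x \<in> topspace X" and e: "h (s', y) = cl (x, t)" for y x t
      proof -
        obtain x1 t1 where x1: "x1 \<in> topspace X" "h (s, y) = cl (x1, t1)" using hY[OF s(1) y] by (rule Y_cases)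
        have "cl (x1, t1 + \<delta> y) = cl (x, t)" using \<delta>(2)[OF y x1] e by simp
        then obtain n where n: "x = it n x1" "t = t1 + \<delta> y - of_int n" using x by (rule cl_eqD)
        have "cl (x, t + - \<delta> y) = cl (it n x1, t1 - of_int n)" unfolding n by simp
        then show ?thesis unfolding x1(2) by (simp add: cl_shift[OF x1(1)])
      qed
      moreover have "continuous_map Y euclideanreal (\<lambda>y. - \<delta> y)" using \<delta>(1) by (rule continuous_map_minus)
      ultimately show ?thesis unfolding R_def by blast
    qed
    show "R r u" if R: "R r s" "R s u" and "r \<in> ?I" "s \<in> ?I" "u \<in> ?I" for r s u
    proof -
      obtain \<delta> where \<delta>: "continuous_map Y euclideanreal \<delta>"
        "\<And>y x t. y \<in> topspace Y \<Longrightarrow> x \<in> topspace X \<Longrightarrow> h (r, y) = cl (x, t) \<Longrightarrow> h (s, y) = cl (x, t + \<delta> y)"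
        using R(1) unfolding R_def by blast
      obtain \<epsilon> where \<epsilon>: "continuous_map Y euclideanreal \<epsilon>"
        "\<And>y x t. y \<in> topspace Y \<Longrightarrow> x \<in> topspace X \<Longrightarrow> h (s, y) = cl (x, t) \<Longrightarrow> h (u, y) = cl (x, t + \<epsilon> y)"
        using R(2) unfolding R_def by blast
      have "h (u, y) = cl (x, t + (\<delta> y + \<epsilon> y))" if "y \<in> topspace Y" "x \<in> topspace X" "h (r, y) = cl (x, t)" for y x t
        using \<epsilon>(2)[OF that(1,2) \<delta>(2)[OF that]] by (simp add: add.assoc)
      moreover have "continuous_map Y euclideanreal (\<lambda>y. \<delta> y + \<epsilon> y)" using \<delta>(1) \<epsilon>(1) by (rule continuous_map_add)
      ultimately show ?thesis unfolding R_def by blast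
    qed
    fix s assume s: "s \<in> ?I"
    \<comment> \<open>Displacement is measured in the circle. It vanishes at time \<open>s\<close>,
      so the tube lemma over the compact suspension gives a time interval on which it is below 1 for
      all points simultaneously.\<close>
    define D where "D p = dist (base (h p)) (base (h (s, snd p)))" for p
    have "continuous_map (prod_topology (top_of_set ?I) Y) euclidean (\<lambda>p. (base (h p), base (h (s, snd p))))"
      unfolding prod_topology_euclidean[symmetric] continuous_map_pairwise o_def fst_conv snd_conv
      using continuous_map_compose[OF h continuous_map_base]
        continuous_map_compose[OF continuous_map_snd continuous_map_compose[OF h_slice[OF s] continuous_map_base], of "top_of_set ?I"]
      by (simp add: o_def)
    from continuous_map_compose[OF this, of euclideanreal "\<lambda>w. dist (fst w) (snd w)"]
    have cD: "continuous_map (prod_topology (top_of_set ?I) Y) euclideanreal D"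
      unfolding D_def o_def by (simp add: continuous_on_dist continuous_on_fst continuous_on_snd continuous_on_id)
    define W where "W = {p \<in> topspace (prod_topology (top_of_set ?I) Y). D p \<in> {..<1}}"
    have W: "openin (prod_topology (top_of_set ?I) Y) W"
      unfolding W_def by (rule openin_continuous_map_preimage[OF cD]) simp
    have "{s} \<times> topspace Y \<subseteq> W" using s by (auto simp: W_def D_def)
    then obtain U V where UV: "openin (top_of_set ?I) U" "s \<in> U" "topspace Y \<subseteq> V" "U \<times> V \<subseteq> W"
      using tube_lemma_right[OF W compactin_Y, of s] s by auto
    obtain e where e: "e > 0" "ball s e \<inter> ?I \<subseteq> U" using UV(1,2) unfolding openin_contains_ball by blast
    let ?T = "ball s e \<inter> ?I"
    have near: "dist (base (h (r, y))) (base (h (s, y))) < 1" if "r \<in> ?T" "y \<in> topspace Y" for r y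
    proof -
      have "(r, y) \<in> W" using that e(2) UV(3,4) by blast
      then show ?thesis by (simp add: W_def D_def)
    qed
    have conT: "connected ?T" by (intro convex_connected convex_Int) auto
    have sT: "s \<in> ?T" using s e(1) by simp
    have "R s s'" if s': "s' \<in> ?T" for s'
    proof -
      have s'I: "s' \<in> ?I" using s' by blast
      define z where "z y = (base (h (s', y)), base (h (s, y)))" for y
      \<comment> \<open>Pairs whose quotient avoids the branch cut of \<open>Arg\<close>. A
        displacement below 1/2 stays in this set, where dividing the argument by
        \<open>2 * pi\<close> returns it continuously.\<close>
      define A where "A = {w :: complex \<times> complex. fst w * cnj (snd w) \<notin> \<real>\<^sub>\<le>\<^sub>0}"
      define \<delta> where "\<delta> y = Arg (fst (z y) * cnj (snd (z y))) / (2 * pi)" for y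
      have slide: "z y \<in> A \<and> h (s', y) = cl (x, t + \<delta> y)"
        if y: "y \<in> topspace Y" and x: "x \<in> topspace X" and e: "h (s, y) = cl (x, t)" for y x t
      proof -
        have "continuous_map (top_of_set ?T) Y (\<lambda>r. h (r, y))"
          by (rule continuous_map_from_subtopology_mono[OF h_path[OF y]]) blast
        then have "\<exists>b. \<bar>b\<bar> < 1 / 2 \<and> h (s', y) = cl (x, t + b)"
          by (rule path_slides_along_leaf[where c = "\<lambda>r. h (r, y)", OF _ conT sT s' _ x e]) (rule near[OF _ y])
        then obtain b where b: "\<bar>b\<bar> < 1 / 2" "h (s', y) = cl (x, t + b)" by blast
        have "fst (z y) * cnj (snd (z y)) = cis (2 * pi * b)"
          unfolding z_def fst_conv snd_conv b(2) e base_cl[OF x] by (simp add: cis_cnj cis_mult algebra_simps)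
        moreover have "2 * b < 1" "- 1 < 2 * b" using b(1) by linarith+
        from mult_strict_left_mono[OF this(1) pi_gt_zero] mult_strict_left_mono[OF this(2) pi_gt_zero]
        have "2 * pi * b \<in> {-pi<..<pi}" by (simp add: mult.commute mult.left_commute)
        then have Ab: "Arg (cis (2 * pi * b)) = 2 * pi * b" by (intro Arg_cis) auto
        moreover have "cis (2 * pi * b) \<notin> \<real>\<^sub>\<le>\<^sub>0"
        proof
          assume "cis (2 * pi * b) \<in> \<real>\<^sub>\<le>\<^sub>0"
          then have "Im (cis (2 * pi * b)) = 0" "Re (cis (2 * pi * b)) \<le> 0" by (auto simp: complex_nonpos_Reals_iff)
          then have sc: "sin (2 * pi * b) = 0" "cos (2 * pi * b) \<le> 0" by simp_all
          then have "(cos (2 * pi * b))\<^sup>2 = 1" using sin_cos_squared_add[of "2 * pi * b"] by simp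
          then have "cos (2 * pi * b) = - 1" using sc(2) by (auto simp: power2_eq_1_iff)
          then have "cis (2 * pi * b) = - 1" using sc(1) by (simp add: complex_eq_iff)
          then have "2 * pi * b = pi" using Ab Arg_cis[of pi] by simp
          then show False using b(1) by simp
        qed
        ultimately have "z y \<in> A" "\<delta> y = b" unfolding A_def \<delta>_def by auto
        then show ?thesis using b(2) by simp
      qed
      have "z y \<in> A" if y: "y \<in> topspace Y" for y
      proof -
        obtain x t where "x \<in> topspace X" "h (s, y) = cl (x, t)" using hY[OF s y] by (rule Y_cases)
        then show ?thesis using slide[OF y] by blast
      qed
      moreover have "continuous_map Y euclidean z"
        unfolding prod_topology_euclidean[symmetric] continuous_map_pairwise o_def z_def fst_conv snd_conv
        using continuous_map_compose[OF h_slice[OF s'I] continuous_map_base] continuous_map_compose[OF h_slice[OF s] continuous_map_base]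
        by (simp add: o_def)
      ultimately have cz: "continuous_map Y (top_of_set A) z" by (auto simp: continuous_map_in_subtopology)
      have "continuous_on A (\<lambda>w. Arg (fst w * cnj (snd w)) / (2 * pi))"
        by (intro continuous_intros) (auto simp: A_def)
      then have "continuous_map (top_of_set A) euclideanreal (\<lambda>w. Arg (fst w * cnj (snd w)) / (2 * pi))" by simp
      from continuous_map_compose[OF cz this] have "continuous_map Y euclideanreal \<delta>"
        by (rule continuous_map_eq) (simp add: \<delta>_def)
      then show ?thesis unfolding R_def using slide by blast
    qed
    moreover have "openin (top_of_set ?I) ?T" by (subst Int_commute) (rule openin_open_Int[OF open_ball])
    ultimately show "\<exists>T. openin (top_of_set ?I) T \<and> s \<in> T \<and> (\<forall>x\<in>T. R s x)" using sT by blast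
  qed auto
  then obtain \<delta> where \<delta>: "continuous_map Y euclideanreal \<delta>"
    "\<And>y x t. y \<in> topspace Y \<Longrightarrow> x \<in> topspace X \<Longrightarrow> h (0, y) = cl (x, t) \<Longrightarrow> h (1, y) = cl (x, t + \<delta> y)"
    unfolding R_def by blast
  have "g (cl (x, t)) = cl (x, t + \<delta> (cl (x, t)))" if "x \<in> topspace X" for x t
    using \<delta>(2)[OF cl_in[OF that] that h01(1)] unfolding h01(2) .
  then show ?thesis using \<delta>(1) by blast
qed

end

section \<open>Lifts to the leaves\<close>

text \<open>A short interval on either side of \<open>t\<close> avoids the other breakpoints and
  lies in one component, where \<open>f\<close> is affine; continuity extends the formula to
  \<open>t\<close> itself.\<close>

lemma PL_homeo_one_sided_affine:
  assumes PL: "PL_homeo J f" and J: "open J" and t: "t \<in> J"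
  shows "\<exists>e a b. e > 0 \<and> (\<forall>s. \<bar>s - t\<bar> < e \<longrightarrow> s \<in> J \<and> f s = f t + (if s \<le> t then a else b) * (s - t))"
proof -
  obtain f' where "homeomorphism J (f ` J) f f'" using PL unfolding PL_homeo_def by blast
  then have cont: "continuous_on J f" unfolding homeomorphism_def by blast
  obtain B where B: "finite B" "\<And>K. K \<in> components (J - B) \<Longrightarrow> \<exists>m b. \<forall>x\<in>K. f x = m * x + b"
    using PL unfolding PL_homeo_def by blast
  obtain d where d: "d > 0" "\<And>x. x \<in> B \<Longrightarrow> x \<noteq> t \<Longrightarrow> d \<le> dist t x"
    using finite_set_avoid[OF B(1), of t] by blast
  obtain e0 where e0: "e0 > 0" "ball t e0 \<subseteq> J" using J t open_contains_ball by blast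
  \<comment> \<open>The half makes even the closed interval of this radius lie in \<open>J\<close>
    and miss every other breakpoint.\<close>
  define e where "e = min d e0 / 2"
  have e: "e > 0" using d(1) e0(1) by (simp add: e_def)
  have inJ: "s \<in> J" if "\<bar>s - t\<bar> \<le> e" for s
  proof -
    have "\<bar>s - t\<bar> < e0" using that d(1) e0(1) by (auto simp: e_def)
    then have "s \<in> ball t e0" by (simp add: dist_real_def abs_minus_commute)
    then show ?thesis using e0(2) by blast
  qed
  have inJB: "s \<in> J - B" if "\<bar>s - t\<bar> < e" "s \<noteq> t" for s
  proof -
    have "s \<notin> B"
    proof
      assume "s \<in> B"
      then have "d \<le> \<bar>s - t\<bar>" using d(2)[of s] that(2) by (simp add: dist_real_def abs_minus_commute)
      then show False using that(1) d(1) by (auto simp: e_def min_def split: if_splits)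
    qed
    then show ?thesis using inJ[of s] that(1) by simp
  qed
  have side: "\<exists>m. \<forall>s\<in>closure {u<..<v}. f s = f t + m * (s - t)"
    if uv: "u < v" "t - e \<le> u" "v \<le> t + e" "t \<notin> {u<..<v}" "t \<in> {u..v}" for u v
  proof -
    have sub: "{u<..<v} \<subseteq> J - B"
    proof
      fix s assume s: "s \<in> {u<..<v}"
      then have "\<bar>s - t\<bar> < e" using uv(2,3) by auto
      moreover have "s \<noteq> t" using s uv(4) by blast
      ultimately show "s \<in> J - B" by (rule inJB)
    qed
    have "(u + v) / 2 \<in> {u<..<v}" using uv(1) by simp
    then have "J - B \<noteq> {}" using sub by blast
    then obtain K where K: "K \<in> components (J - B)" "{u<..<v} \<subseteq> K"
      using exists_component_superset[OF sub, of] by auto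
    obtain m b where mb: "\<forall>x\<in>K. f x = m * x + b" using B(2)[OF K(1)] by blast
    have clo: "closure {u<..<v} = {u..v}" using uv(1) by simp
    have "{u..v} \<subseteq> J" using inJ uv(2,3) by auto
    then have c: "continuous_on (closure {u<..<v}) (\<lambda>x. f x - m * x)"
      unfolding clo by (intro continuous_intros continuous_on_subset[OF cont])
    have fb: "f x - m * x = b" if "x \<in> closure {u<..<v}" for x
      by (rule continuous_constant_on_closure[OF c _ that]) (use mb K(2) in auto)
    have "t \<in> closure {u<..<v}" unfolding clo by (rule uv(5))
    from fb[OF this] have "b = f t - m * t" by simp
    then have "f s = f t + m * (s - t)" if "s \<in> closure {u<..<v}" for s
      using fb[OF that] by (simp add: algebra_simps)
    then show ?thesis by blast
  qed
  have "\<exists>m. \<forall>s\<in>closure {t - e<..<t}. f s = f t + m * (s - t)" by (rule side) (use e in simp_all)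
  then obtain a where a: "\<forall>s\<in>closure {t - e<..<t}. f s = f t + a * (s - t)" by blast
  have "\<exists>m. \<forall>s\<in>closure {t<..<t + e}. f s = f t + m * (s - t)" by (rule side) (use e in simp_all)
  then obtain b where b: "\<forall>s\<in>closure {t<..<t + e}. f s = f t + b * (s - t)" by blast
  have "s \<in> J \<and> f s = f t + (if s \<le> t then a else b) * (s - t)" if s: "\<bar>s - t\<bar> < e" for s
  proof (cases "s \<le> t")
    case True
    then have "s \<in> closure {t - e<..<t}" using s e by auto
    from bspec[OF a this] show ?thesis using True inJ[of s] s by simp
  next
    case False
    then have "s \<in> closure {t<..<t + e}" using s e by auto
    from bspec[OF b this] show ?thesis using False inJ[of s] s by simp
  qed
  then show ?thesis using e by blast
qed

text \<open>A continuous injection is monotone, and bounded displacement rules out a decreasing one: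
  beyond \<open>x + 2 * K\<close> all values exceed \<open>f x\<close>.\<close>

lemma strict_mono_if_bounded_displacement:
  fixes f :: "real \<Rightarrow> real"
  assumes cont: "continuous_on UNIV f" and inj: "inj f" and K: "\<And>t. \<bar>f t - t\<bar> \<le> K"
  shows "strict_mono f"
proof (rule strict_monoI)
  fix x y :: real assume xy: "x < y"
  define z where "z = max y (x + 2 * K) + 1"
  have z: "y < z" "x + 2 * K < z" by (auto simp: z_def)
  have "f x < f z" using K[of x] K[of z] z(2) by linarith
  moreover have "(f x < f y \<and> f y < f z) \<or> (f z < f y \<and> f y < f x)"
    by (rule continuous_inj_imp_mono[OF xy z(1)])
      (use cont inj in \<open>auto intro: continuous_on_subset inj_on_subset\<close>)
  ultimately show "f x < f y" by linarith
qed

context stone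
begin

lemma cl_eq_translation:
  assumes "x \<in> topspace X" "cl (x, a) = cl (x, b)"
  shows "\<exists>n. it n x = x \<and> a - b = of_int n"
proof -
  obtain n where "x = it n x" "b = a - of_int n" using cl_eqD[OF assms(2,1)] .
  then show ?thesis by (intro exI[of _ n]) simp
qed

text \<open>An integer-valued continuous function of the leaf parameter is locally constant in both
  variables, so its values are periods of all nearby leaves.\<close>

lemma locally_constant_period:
  assumes W: "openin P W" "(x, t) \<in> W"
    and F: "continuous_map (subtopology P W) euclideanreal F"
    and per: "\<And>y s. (y, s) \<in> W \<Longrightarrow> \<exists>n. it n y = y \<and> F (y, s) = of_int n"
  shows "\<exists>n U e. openin X U \<and> x \<in> U \<and> e > 0 \<and>
    (\<forall>y\<in>U. \<forall>s. \<bar>s - t\<bar> < e \<longrightarrow> (y, s) \<in> W \<and> it n y = y \<and> F (y, s) = of_int n)"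
proof -
  obtain n where n: "F (x, t) = of_int n" using per[OF W(2)] by blast
  define V where "V = {p \<in> topspace (subtopology P W). F p \<in> ball (of_int n) 1}"
  have "openin (subtopology P W) V" unfolding V_def by (rule openin_continuous_map_preimage[OF F]) simp
  then have V: "openin P V" "V \<subseteq> W" using openin_open_subtopology[OF W(1)] by auto
  have "(x, t) \<in> topspace P" using openin_subset[OF W(1)] W(2) by blast
  then have "(x, t) \<in> V" using W(2) n by (simp add: V_def)
  then obtain U A where UA: "openin X U" "openin euclideanreal A" "x \<in> U" "t \<in> A" "U \<times> A \<subseteq> V"
    using V(1) unfolding openin_prod_topology_alt by metis
  have "open A" using UA(2) by simp
  then obtain e where e: "e > 0" "ball t e \<subseteq> A" using UA(4) by (rule openE)
  have "(y, s) \<in> W \<and> it n y = y \<and> F (y, s) = of_int n" if y: "y \<in> U" and s: "\<bar>s - t\<bar> < e" for y s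
  proof -
    have "s \<in> ball t e" using s by (simp add: dist_real_def abs_minus_commute)
    then have ysV: "(y, s) \<in> V" using UA(5) e(2) y by blast
    then have ys: "(y, s) \<in> W" using V(2) by blast
    obtain m where m: "it m y = y" "F (y, s) = of_int m" using per[OF ys] by blast
    have "\<bar>real_of_int n - of_int m\<bar> < 1" using ysV m(2) by (simp add: V_def dist_real_def)
    then have "m = n" by linarith
    then show ?thesis using ys m by simp
  qed
  then show ?thesis using UA(1,3) e(1) by blast
qed

text \<open>A continuous displacement fixed once and for all. It is not unique when leaves have
  periods, so lifts of products agree only up to periods.\<close>

definition flow_time :: "(('a \<times> real) set \<Rightarrow> ('a \<times> real) set) \<Rightarrow> ('a \<times> real) set \<Rightarrow> real" where
  "flow_time g = (SOME \<delta>. continuous_map Y euclideanreal \<delta> \<and>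
    (\<forall>x\<in>topspace X. \<forall>t. g (cl (x, t)) = cl (x, t + \<delta> (cl (x, t)))))"

definition lift :: "(('a \<times> real) set \<Rightarrow> ('a \<times> real) set) \<Rightarrow> 'a \<Rightarrow> real \<Rightarrow> real" where
  "lift g x t = t + flow_time g (cl (x, t))"

lemma
  assumes "g \<in> H0 X \<phi>"
  shows flow_time_continuous: "continuous_map Y euclideanreal (flow_time g)"
    and cl_lift: "x \<in> topspace X \<Longrightarrow> g (cl (x, t)) = cl (x, lift g x t)"
proof -
  have "homotopic_with (homeomorphic_map Y Y) Y Y id g" using assms by (simp add: H0_def)
  then have "\<exists>\<delta>. continuous_map Y euclideanreal \<delta> \<and>
    (\<forall>x\<in>topspace X. \<forall>t. g (cl (x, t)) = cl (x, t + \<delta> (cl (x, t))))" by (rule isotopic_to_id_along_flow)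
  from someI_ex[OF this, folded flow_time_def]
  show "continuous_map Y euclideanreal (flow_time g)" "x \<in> topspace X \<Longrightarrow> g (cl (x, t)) = cl (x, lift g x t)"
    unfolding lift_def by blast+
qed

lemma lift_shift:
  assumes x: "x \<in> topspace X"
  shows "lift g (it n x) (t - of_int n) = lift g x t - of_int n"
  unfolding lift_def cl_shift[OF x] by simp

lemma lift_continuous_map:
  assumes g: "g \<in> H0 X \<phi>"
  shows "continuous_map P euclideanreal (\<lambda>p. lift g (fst p) (snd p))"
proof -
  have "continuous_map P euclideanreal (\<lambda>p. snd p + (flow_time g \<circ> cl) p)"
    by (rule continuous_map_add[OF continuous_map_snd continuous_map_compose[OF continuous_map_cl flow_time_continuous[OF g]]])
  then show ?thesis by (simp add: lift_def)
qed

lemma lift_bounded: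
  assumes g: "g \<in> H0 X \<phi>"
  shows "\<exists>K. \<forall>x\<in>topspace X. \<forall>t. \<bar>lift g x t - t\<bar> \<le> K"
proof -
  have "compact (flow_time g ` topspace Y)" using image_compactin[OF compactin_Y flow_time_continuous[OF g]] by simp
  then obtain K where K: "\<And>r. r \<in> flow_time g ` topspace Y \<Longrightarrow> norm r \<le> K" using compact_imp_bounded bounded_iff by metis
  have "\<bar>lift g x t - t\<bar> \<le> K" if "x \<in> topspace X" for x t
    using K[OF imageI[OF cl_in[OF that]], of t] by (simp add: lift_def)
  then show ?thesis by blast
qed

lemma lift_continuous_leaf:
  assumes g: "g \<in> H0 X \<phi>" and x: "x \<in> topspace X"
  shows "continuous_on UNIV (lift g x)"
proof -
  have "continuous_map euclideanreal P (\<lambda>t. (x, t))" using x by (simp add: continuous_map_pairwise o_def)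
  from continuous_map_compose[OF this lift_continuous_map[OF g]] show ?thesis by (simp add: o_def)
qed

lemma lift_strict_mono:
  assumes g: "g \<in> H0 X \<phi>" and x: "x \<in> topspace X"
  shows "strict_mono (lift g x)"
proof -
  obtain K where K: "\<And>t. \<bar>lift g x t - t\<bar> \<le> K" using lift_bounded[OF g] x by blast
  have gi: "inj_on g (topspace Y)" using g by (simp add: H0_def Bij_def bij_betw_def)
  have "inj (lift g x)"
  proof (rule injI)
    fix s t assume st: "lift g x s = lift g x t"
    then have "g (cl (x, s)) = g (cl (x, t))" using cl_lift[OF g x] by simp
    then have "cl (x, s) = cl (x, t)" using inj_onD[OF gi] cl_in[OF x] by blast
    then show "s = t" using st by (simp add: lift_def)
  qed
  then show ?thesis using strict_mono_if_bounded_displacement[OF lift_continuous_leaf[OF g x] _ K] by blast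
qed

text \<open>The two lifts of the product differ by a continuous function whose values are integral
  periods. Its value \<open>n\<close> at parameter 0 is common to all nearby leaves, and on each of
  these it is constant in the parameter; hence one integer serves for all parameters at
  once.\<close>

lemma lift_mult:
  assumes g: "g \<in> H0 X \<phi>" and h: "h \<in> H0 X \<phi>" and k: "k \<in> H0 X \<phi>"
    and k_eq: "\<And>y. y \<in> topspace Y \<Longrightarrow> k y = g (h y)" and x: "x \<in> topspace X"
  shows "\<exists>n U. openin X U \<and> x \<in> U \<and>
    (\<forall>y\<in>U. it n y = y \<and> (\<forall>t. lift k y t = lift g y (lift h y t) + of_int n))"
proof -
  define F where "F p = lift k (fst p) (snd p) - lift g (fst p) (lift h (fst p) (snd p))" for p
  have "continuous_map P P (\<lambda>p. (fst p, lift h (fst p) (snd p)))"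
    using lift_continuous_map[OF h] continuous_map_fst[of X euclideanreal] by (simp add: continuous_map_pairwise o_def)
  from continuous_map_compose[OF this lift_continuous_map[OF g]]
  have "continuous_map P euclideanreal (\<lambda>p. lift g (fst p) (lift h (fst p) (snd p)))" by (simp add: o_def)
  from continuous_map_diff[OF lift_continuous_map[OF k] this]
  have F: "continuous_map (subtopology P (topspace P)) euclideanreal F"
    unfolding F_def by (rule continuous_map_from_subtopology)
  have W: "openin P (topspace P)" by (rule openin_topspace)
  have per: "\<exists>n. it n y = y \<and> F (y, s) = of_int n" if "(y, s) \<in> topspace P" for y s
  proof -
    have y: "y \<in> topspace X" using that by simp
    have "cl (y, lift k y s) = k (cl (y, s))" by (rule cl_lift[OF k y, symmetric])
    also have "\<dots> = cl (y, lift g y (lift h y s))"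
      unfolding k_eq[OF cl_in[OF y]] cl_lift[OF h y] cl_lift[OF g y] ..
    finally show ?thesis unfolding F_def fst_conv snd_conv by (rule cl_eq_translation[OF y])
  qed
  have loc: "\<exists>n U e. openin X U \<and> y \<in> U \<and> e > 0 \<and>
    (\<forall>z\<in>U. \<forall>s. \<bar>s - t\<bar> < e \<longrightarrow> (z, s) \<in> topspace P \<and> it n z = z \<and> F (z, s) = of_int n)"
    if "y \<in> topspace X" for y t
    by (rule locally_constant_period[OF W _ F]) (use that in simp, rule per)
  obtain n U e where U: "openin X U" "x \<in> U" "e > 0"
    "\<forall>z\<in>U. \<forall>s. \<bar>s - 0\<bar> < e \<longrightarrow> (z, s) \<in> topspace P \<and> it n z = z \<and> F (z, s) = of_int n"
    using loc[OF x, of 0] by (elim exE conjE) (rule that)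
  have "it n y = y \<and> (\<forall>t. lift k y t = lift g y (lift h y t) + of_int n)" if y: "y \<in> U" for y
  proof -
    have n0: "it n y = y" "F (y, 0) = of_int n" using U(4)[rule_format, OF y, of 0] U(3) by auto
    have yX: "y \<in> topspace X" using openin_subset[OF U(1)] y by blast
    have "F (y, t) = F (y, 0)" for t
    proof (rule locally_constant_real[where f = "\<lambda>t. F (y, t)"])
      fix t :: real
      obtain m U' e' where U': "openin X U'" "y \<in> U'" "e' > 0"
        "\<forall>z\<in>U'. \<forall>s. \<bar>s - t\<bar> < e' \<longrightarrow> (z, s) \<in> topspace P \<and> it m z = z \<and> F (z, s) = of_int m"
        using loc[OF yX, of t] by (elim exE conjE) (rule that)
      have "F (y, s) = of_int m" if "\<bar>s - t\<bar> < e'" for s using U'(2,4) that by blast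
      moreover from this[of t] have "F (y, t) = of_int m" using U'(3) by simp
      ultimately show "\<exists>e>0. \<forall>s. \<bar>s - t\<bar> < e \<longrightarrow> F (y, s) = F (y, t)"
        using U'(3) by (intro exI[of _ e']) simp
    qed
    then have "F (y, t) = of_int n" for t using n0(2) by simp
    then have "lift k y t = lift g y (lift h y t) + of_int n" for t
      unfolding F_def fst_conv snd_conv by (simp add: algebra_simps)
    then show ?thesis using n0(1) by blast
  qed
  then show ?thesis using U(1,2) by blast
qed

text \<open>In a chart the element acts by \<open>f\<close> on the parameter, so the lift differs
  from \<open>f\<close> by a locally constant integer. Slopes come from \<open>f\<close>, and they
  are positive because the lift is strictly increasing.\<close>

lemma lift_local:
  assumes g: "g \<in> H0 X \<phi>" and loc: "locally_of_form PL_homeo X \<phi> g" and x: "x \<in> topspace X"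
  shows "\<exists>U e a b. openin X U \<and> x \<in> U \<and> e > 0 \<and> a > 0 \<and> b > 0 \<and>
    (\<forall>y\<in>U. \<forall>s. \<bar>s - t\<bar> < e \<longrightarrow> lift g y s = lift g x t + (if s \<le> t then a else b) * (s - t))"
proof -
  obtain C J f where C: "is_chart X \<phi> C J" "cl (x, t) \<in> chart_domain X \<phi> C J" "PL_homeo J f"
    and gC: "g ` chart_domain X \<phi> C J = chart_domain X \<phi> C (f ` J)"
      "\<forall>x\<in>C. \<forall>t\<in>J. inv_into (C \<times> f ` J) (chart X \<phi> C (f ` J)) (g (chart X \<phi> C J (x, t))) = (x, f t)"
    using loc cl_in[OF x, of t] unfolding locally_of_form_def by metis
  have Cop: "openin X C" and Jop: "open J" using C(1) unfolding is_chart_def clopenin_def by auto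
  have CX: "C \<subseteq> topspace X" by (rule openin_subset[OF Cop])
  obtain x0 t0 where xt0: "x0 \<in> C" "t0 \<in> J" "cl (x, t) = cl (x0, t0)"
    using C(2) unfolding chart_domain_def chart_def by auto
  have x0: "x0 \<in> topspace X" using xt0(1) CX by blast
  obtain k where k: "x0 = it k x" "t0 = t - of_int k" using cl_eqD[OF xt0(3) x0] .
  have gf: "g (cl (y, s)) = cl (y, f s)" if y: "y \<in> C" and s: "s \<in> J" for y s
  proof -
    let ?c = "chart X \<phi> C (f ` J)"
    have eq: "chart X \<phi> C J (y, s) = cl (y, s)" "?c (y, f s) = cl (y, f s)" using y s by (auto simp: chart_def)
    have "chart X \<phi> C J (y, s) \<in> chart_domain X \<phi> C J" unfolding chart_domain_def using y s by (intro imageI) simp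
    then have "g (cl (y, s)) \<in> ?c ` (C \<times> f ` J)" using gC(1) unfolding eq chart_domain_def by blast
    then have "?c (inv_into (C \<times> f ` J) ?c (g (cl (y, s)))) = g (cl (y, s))" by (rule f_inv_into_f)
    moreover have "inv_into (C \<times> f ` J) ?c (g (cl (y, s))) = (y, f s)" using gC(2) y s eq(1) by metis
    ultimately show ?thesis using eq(2) by simp
  qed
  obtain e0 a b where ab: "e0 > 0" "\<And>s. \<bar>s - t0\<bar> < e0 \<Longrightarrow> s \<in> J \<and> f s = f t0 + (if s \<le> t0 then a else b) * (s - t0)"
    using PL_homeo_one_sided_affine[OF C(3) Jop xt0(2)] by blast
  let ?W = "C \<times> J"
  define F where "F p = lift g (fst p) (snd p) - f (snd p)" for p
  have W: "openin P ?W" "(x0, t0) \<in> ?W" using Cop Jop xt0 by (auto simp: openin_prod_Times_iff)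
  have "continuous_on J f" using C(3) unfolding PL_homeo_def homeomorphism_def by blast
  then have fc: "continuous_map (top_of_set J) euclideanreal f" by simp
  have "continuous_map (subtopology P ?W) (top_of_set J) snd"
    using continuous_map_from_subtopology[OF continuous_map_snd] by (auto simp: continuous_map_in_subtopology)
  from continuous_map_compose[OF this fc]
  have "continuous_map (subtopology P ?W) euclideanreal (\<lambda>p. f (snd p))" by (simp add: o_def)
  from continuous_map_diff[OF continuous_map_from_subtopology[OF lift_continuous_map[OF g]] this]
  have F: "continuous_map (subtopology P ?W) euclideanreal F" unfolding F_def .
  have per: "\<exists>n. it n y = y \<and> F (y, s) = of_int n" if "(y, s) \<in> ?W" for y s
  proof -
    have ys: "y \<in> C" "s \<in> J" using that by auto
    have y: "y \<in> topspace X" using ys(1) CX by blast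
    have "cl (y, lift g y s) = cl (y, f s)" using gf[OF ys] cl_lift[OF g y] by simp
    then show ?thesis unfolding F_def fst_conv snd_conv by (rule cl_eq_translation[OF y])
  qed
  have "\<exists>n U e1. openin X U \<and> x0 \<in> U \<and> e1 > 0 \<and>
    (\<forall>y\<in>U. \<forall>s. \<bar>s - t0\<bar> < e1 \<longrightarrow> (y, s) \<in> ?W \<and> it n y = y \<and> F (y, s) = of_int n)"
    by (rule locally_constant_period[OF W F]) (rule per)
  then obtain n U e1 where U: "openin X U" "x0 \<in> U" "e1 > 0"
    "\<forall>y\<in>U. \<forall>s. \<bar>s - t0\<bar> < e1 \<longrightarrow> (y, s) \<in> ?W \<and> it n y = y \<and> F (y, s) = of_int n"
    by (elim exE conjE) (rule that)
  define e where "e = min e0 e1"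
  have e: "e > 0" using ab(1) U(3) by (simp add: e_def)
  have lf: "lift g y s = f t0 + of_int n + (if s \<le> t0 then a else b) * (s - t0)" if y: "y \<in> U" and s: "\<bar>s - t0\<bar> < e" for y s
  proof -
    have "F (y, s) = of_int n" using U(4) y s by (simp add: e_def)
    then have "lift g y s = f s + of_int n" unfolding F_def fst_conv snd_conv by (simp add: algebra_simps)
    moreover have "f s = f t0 + (if s \<le> t0 then a else b) * (s - t0)" using ab(2)[of s] s by (simp add: e_def)
    ultimately show ?thesis by simp
  qed
  have l0: "lift g x0 t0 = f t0 + of_int n" using lf[OF U(2), of t0] e by simp
  have mono: "strict_mono (lift g x0)" by (rule lift_strict_mono[OF g x0])
  have "a > 0"
  proof -
    have "lift g x0 (t0 - e / 2) < lift g x0 t0" using e by (intro strict_monoD[OF mono]) simp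
    then show ?thesis unfolding l0 using lf[OF U(2), of "t0 - e / 2"] e by (simp add: zero_less_mult_iff)
  qed
  moreover have "b > 0"
  proof -
    have "lift g x0 t0 < lift g x0 (t0 + e / 2)" using e by (intro strict_monoD[OF mono]) simp
    then show ?thesis unfolding l0 using lf[OF U(2), of "t0 + e / 2"] e by (simp add: zero_less_mult_iff)
  qed
  \<comment> \<open>The chart sees the given point as \<open>(it k x, t - k)\<close>, so the
    neighbourhood found there is pulled back along \<open>it k\<close>.\<close>
  moreover have "openin X {y \<in> topspace X. it k y \<in> U}" (is "openin X ?U")
    by (rule openin_continuous_map_preimage[OF continuous_map_it U(1)])
  moreover have "x \<in> ?U" using x U(2) k(1) by simp
  moreover have "lift g y s = lift g x t + (if s \<le> t then a else b) * (s - t)" if y: "y \<in> ?U" and s: "\<bar>s - t\<bar> < e" for y s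
  proof -
    have yX: "y \<in> topspace X" and ky: "it k y \<in> U" using y by auto
    have "\<bar>(s - of_int k) - t0\<bar> < e" using s k(2) by simp
    from lf[OF ky this] have "lift g y s - of_int k = f t0 + of_int n + (if s \<le> t then a else b) * (s - t)"
      unfolding lift_shift[OF yX] k(2) by simp
    moreover have "lift g x0 t0 = lift g x t - of_int k" unfolding k by (rule lift_shift[OF x])
    ultimately show ?thesis using l0 by simp
  qed
  ultimately show ?thesis using e by blast
qed

text \<open>The lifts form a leafwise piecewise linear action. It is faithful in the sense required,
  since translating every leaf by one of its periods fixes all points of the suspension, and
  elements are extensional.\<close>

lemma property_T_subgroup_finite:
  assumes sub: "\<Gamma> \<subseteq> carrier (PL_group X \<phi>)" and T: "property_T ((BijGroup (topspace Y))\<lparr>carrier := \<Gamma>\<rparr>)"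
    (is "property_T ?\<Gamma>")
  shows "finite \<Gamma>"
proof -
  have H: "g \<in> H0 X \<phi>" "locally_of_form PL_homeo X \<phi> g" if "g \<in> \<Gamma>" for g
    using sub that by (auto simp: PL_group_def)
  have Bij: "g \<in> Bij (topspace Y)" if "g \<in> \<Gamma>" for g using H(1)[OF that] by (simp add: H0_def)
  have grp: "group ?\<Gamma>" using T by (simp add: property_T_def)
  have mult: "(g \<otimes>\<^bsub>?\<Gamma>\<^esub> h) y = g (h y)" if "g \<in> \<Gamma>" "h \<in> \<Gamma>" "y \<in> topspace Y" for g h y
    using that Bij by (simp add: BijGroup_def compose_def)
  interpret PL_leaf_action X it ?\<Gamma> lift
  proof (intro PL_leaf_action.intro PL_leaf_action_axioms.intro)
    show "int_flow X it" by unfold_locales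
    show "group ?\<Gamma>" by (rule grp)
    fix g assume "g \<in> carrier ?\<Gamma>"
    then have g: "g \<in> \<Gamma>" by simp
    show "\<exists>K. \<forall>x\<in>topspace X. \<forall>t. \<bar>lift g x t - t\<bar> \<le> K" by (rule lift_bounded[OF H(1)[OF g]])
    fix x assume x: "x \<in> topspace X"
    show "lift g (it n x) (t - of_int n) = lift g x t - of_int n" for n t by (rule lift_shift[OF x])
    show "\<exists>U e a b. openin X U \<and> x \<in> U \<and> e > 0 \<and> a > 0 \<and> b > 0 \<and>
        (\<forall>y\<in>U. \<forall>s. \<bar>s - t\<bar> < e \<longrightarrow> lift g y s = lift g x t + (if s \<le> t then a else b) * (s - t))" for t
      by (rule lift_local[OF H[OF g] x])
    fix h assume "h \<in> carrier ?\<Gamma>"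
    then have h: "h \<in> \<Gamma>" by simp
    have gh: "g \<otimes>\<^bsub>?\<Gamma>\<^esub> h \<in> \<Gamma>" using monoid.m_closed[OF group.is_monoid[OF grp], of g h] g h by simp
    show "\<exists>k U. openin X U \<and> x \<in> U \<and>
        (\<forall>y\<in>U. it k y = y \<and> (\<forall>t. lift (g \<otimes>\<^bsub>?\<Gamma>\<^esub> h) y t = lift g y (lift h y t) + of_int k))"
      by (rule lift_mult[OF H(1)[OF g] H(1)[OF h] H(1)[OF gh] mult[OF g h] x])
  qed
  have "finite (carrier ?\<Gamma>)"
  proof (rule finite_if_property_T[OF T])
    fix g assume "g \<in> carrier ?\<Gamma>"
      and trans: "\<And>x t. x \<in> topspace X \<Longrightarrow> \<exists>k. it k x = x \<and> lift g x t = t + of_int k"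
    then have g: "g \<in> \<Gamma>" by simp
    have "g y = y" if y: "y \<in> topspace Y" for y
    proof -
      obtain x t where x: "x \<in> topspace X" "y = cl (x, t)" using y by (rule Y_cases)
      obtain k where k: "it k x = x" "lift g x t = t + of_int k" using trans[OF x(1)] by blast
      show ?thesis unfolding x(2) cl_lift[OF H(1)[OF g] x(1)] k(2) by (rule cl_period[OF x(1) k(1)])
    qed
    moreover have "g \<in> extensional (topspace Y)" using Bij[OF g] by (simp add: Bij_def)
    ultimately have "g = (\<lambda>y\<in>topspace Y. y)" by (intro extensionalityI[of g "topspace Y"]) auto
    then show "g = \<one>\<^bsub>?\<Gamma>\<^esub>" by (simp add: BijGroup_def)
  qed
  then show ?thesis by simp
qed

end

theorem theorem6:
  fixes X :: "'a topology" and \<phi> :: "'a \<Rightarrow> 'a"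
  assumes "stone_system X \<phi>"
  shows "(\<nexists>\<Gamma>. subgroup \<Gamma> (T_group X \<phi>) \<and> infinite \<Gamma> \<and>
              property_T ((T_group X \<phi>)\<lparr>carrier := \<Gamma>\<rparr>)) \<and>
         (\<nexists>\<Gamma>. subgroup \<Gamma> (PL_group X \<phi>) \<and> infinite \<Gamma> \<and>
              property_T ((PL_group X \<phi>)\<lparr>carrier := \<Gamma>\<rparr>))"
proof -
  interpret stone X \<phi> by (rule stone.intro[OF assms])
  let ?B = "\<lambda>\<Gamma>. (BijGroup (topspace (suspension X \<phi>)))\<lparr>carrier := \<Gamma>\<rparr>"
  have "(T_group X \<phi>)\<lparr>carrier := \<Gamma>\<rparr> = ?B \<Gamma>" "(PL_group X \<phi>)\<lparr>carrier := \<Gamma>\<rparr> = ?B \<Gamma>" for \<Gamma>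
    by (simp_all add: T_group_def PL_group_def)
  then have fin: "finite \<Gamma>"
    if "\<Gamma> \<subseteq> carrier (PL_group X \<phi>)"
      "property_T ((T_group X \<phi>)\<lparr>carrier := \<Gamma>\<rparr>) \<or> property_T ((PL_group X \<phi>)\<lparr>carrier := \<Gamma>\<rparr>)" for \<Gamma>
    using property_T_subgroup_finite[OF that(1)] that(2) by simp
  show ?thesis
  proof (intro conjI notI; elim exE conjE)
    fix \<Gamma> assume "subgroup \<Gamma> (T_group X \<phi>)" "infinite \<Gamma>" "property_T ((T_group X \<phi>)\<lparr>carrier := \<Gamma>\<rparr>)"
    then show False using fin[of \<Gamma>] subgroup.subset T_group_subset_PL_group[of X \<phi>] by blast
  next
    fix \<Gamma> assume "subgroup \<Gamma> (PL_group X \<phi>)" "infinite \<Gamma>" "property_T ((PL_group X \<phi>)\<lparr>carrier := \<Gamma>\<rparr>)"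
    then show False using fin[of \<Gamma>] subgroup.subset by blast
  qed
qed

end
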